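(* Let $k$ be an algebraically closed field of characteristic $2$, let $m,n\in\mathbb{Z}_{\ge0}$, $d\in\mathbb{Z}_{>0}$, and $X=m+nP\in\mathrm{Ver}_4^+$. Then $X$ is relatively $d$-discerning if and only if: - when $d=1$: $m\ge1$ or $n\ge1$; - when $d=2$: $m+n\ge2$ and $m\ge1$; - when $d=3$: $m\ge3$, or ($n\ge1$ and $m\ge1$); - when $d\ge4$: $m\ge\lfloor d/2\rfloor$ and $n\ge\lfloor d/4\rfloor$.
   Context: $\mathrm{Ver}_4^+$ is the symmetric tensor category of finite-dimensional modules over the Hopf algebra $k[\delta]/\delta^2$ ($\delta$ primitive) with braiding $c(v\otimes w)=w\otimes v+\delta w\otimes\delta v$. Its unique simple object is $\mathbf{1}$, with projective cover $P=k[\delta]/\delta^2$, and every object is of the form $m+nP:=m\mathbf{1}\oplus nP$. For $X\in\mathrm{Ver}_4^+$, $S_d$ acts on $X^{\otimes d}$ via the braiding. $\mathbf{B}^d_X\subset\mathrm{Rep}_kS_d$ is the full subcategory of direct sums of direct summands of the underlying $S_d$-representation of $X^{\otimes d}$, and $\mathbf{B}^d[\mathrm{Ver}_4^+]$ is the full subcategory of finite direct sums of objects in the $\mathbf{B}^d_Y$, $Y\in\mathrm{Ver}_4^+$. $X$ is relatively $d$-discerning (with respect to $\mathrm{Ver}_4^+$) if $\mathbf{B}^d_X=\mathbf{B}^d[\mathrm{Ver}_4^+]$. Equivalently, no nonzero $k$-linear functor $F:\mathbf{B}^d[\mathrm{Ver}_4^+]\to\mathrm{Vec}$ (polynomial functor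 of degree $d$) satisfies $F(X^{\otimes d})=0$. *)

theory Defs
  imports
    "Jordan_Normal_Form.Matrix"
    "HOL-Algebra.Sym_Groups"
    "HOL-Computational_Algebra.Computational_Algebra"
begin

section \<open>Representations of the symmetric group\<close>

text \<open>
  A finite-dimensional representation of \<open>S_d\<close> is given in coordinates: a dimension \<open>n\<close>
  together with a homomorphism from \<open>S_d\<close>, the permutations of \<open>{1..d}\<close>, to \<open>GL_n(k)\<close>.
  Matrices act on column vectors.  Values outside the carrier of \<open>S_d\<close> play no role.
  Full subcategories of \<open>Rep S_d\<close> are given by their sets of objects, always closed under
  isomorphism, so that they are equal precisely if these sets are.
\<close>

type_synonym 'k perm_rep = "nat \<times> ((nat \<Rightarrow> nat) \<Rightarrow> 'k mat)"

definition GL :: "nat \<Rightarrow> 'k::field mat monoid" where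
  "GL n = units_of (ring_mat TYPE('k) n ())"

definition Rep :: "nat \<Rightarrow> 'k::field perm_rep set" where
  "Rep d = {(n, \<rho>). \<rho> \<in> hom (sym_group d) (GL n)}"

definition rep_iso :: "nat \<Rightarrow> 'k::field perm_rep \<Rightarrow> 'k perm_rep \<Rightarrow> bool" where
  "rep_iso d M N \<longleftrightarrow> fst M = fst N \<and>
     (\<exists>Q \<in> carrier (GL (fst M)). \<forall>\<sigma> \<in> carrier (sym_group d). Q * snd M \<sigma> = snd N \<sigma> * Q)"

definition rep_direct_sum :: "'k::field perm_rep list \<Rightarrow> 'k perm_rep" where
  "rep_direct_sum Ms = (sum_list (map fst Ms), \<lambda>\<sigma>. diag_block_mat (map (\<lambda>M. snd M \<sigma>) Ms))"

definition direct_summand :: "nat \<Rightarrow> 'k::field perm_rep \<Rightarrow> 'k perm_rep \<Rightarrow> bool" where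
  "direct_summand d M N \<longleftrightarrow> M \<in> Rep d \<and> (\<exists>M' \<in> Rep d. rep_iso d N (rep_direct_sum [M, M']))"

definition sums_of :: "nat \<Rightarrow> 'k::field perm_rep set \<Rightarrow> 'k perm_rep set" where
  "sums_of d C = {M \<in> Rep d. \<exists>Ms. set Ms \<subseteq> C \<and> rep_iso d M (rep_direct_sum Ms)}"


section \<open>The category \<open>Ver\<^sub>4\<^sup>+\<close>\<close>

text \<open>
  A finite-dimensional module over \<open>k[\<delta>]/\<delta>\<^sup>2\<close> with a chosen basis is the square matrix of
  the action of \<open>\<delta>\<close>, which squares to zero.
\<close>

definition Ver4p :: "'k::field mat set" where
  "Ver4p = {D. square_mat D \<and> D * D = 0\<^sub>m (dim_row D) (dim_row D)}"

definition unit_obj :: "'k::field mat" where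
  "unit_obj = 0\<^sub>m 1 1"

text \<open>The regular module, in the basis \<open>1, \<delta>\<close>.\<close>

definition P_obj :: "'k::field mat" where
  "P_obj = mat_of_rows_list 2 [[0, 0], [1, 0]]"

definition mn_obj :: "nat \<Rightarrow> nat \<Rightarrow> 'k::field mat" where
  "mn_obj m n = diag_block_mat (replicate m unit_obj @ replicate n P_obj)"

text \<open>
  Tensor products have the basis \<open>e\<^sub>a \<otimes> e\<^sub>b\<close> in lexicographic order: \<open>e\<^sub>a \<otimes> e\<^sub>b\<close> has
  index \<open>a * N + b\<close>, where \<open>N\<close> is the dimension of the second factor (and all indices start at
  0).  Then the tensor product of linear maps is the Kronecker product of matrices.
\<close>

definition kron :: "'k::field mat \<Rightarrow> 'k mat \<Rightarrow> 'k mat" where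
  "kron A B = mat (dim_row A * dim_row B) (dim_col A * dim_col B)
     (\<lambda>(i, j). A $$ (i div dim_row B, j div dim_col B) * B $$ (i mod dim_row B, j mod dim_col B))"

text \<open>The flip \<open>v \<otimes> w \<mapsto> w \<otimes> v\<close> of the tensor square of an \<open>N\<close>-dimensional space.\<close>

definition flip_mat :: "nat \<Rightarrow> 'k::field mat" where
  "flip_mat N = mat (N * N) (N * N) (\<lambda>(i, j). if i = (j mod N) * N + j div N then 1 else 0)"

text \<open>The braiding \<open>v \<otimes> w \<mapsto> w \<otimes> v + \<delta> w \<otimes> \<delta> v\<close> on the tensor square of \<open>D\<close>.\<close>

definition braiding :: "'k::field mat \<Rightarrow> 'k mat" where
  "braiding D = flip_mat (dim_row D) + kron D D * flip_mat (dim_row D)"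

text \<open>The braiding of the factors \<open>i\<close> and \<open>i + 1\<close> of the \<open>d\<close>-th tensor power, \<open>1 \<le> i < d\<close>.\<close>

definition braiding_at :: "nat \<Rightarrow> 'k::field mat \<Rightarrow> nat \<Rightarrow> 'k mat" where
  "braiding_at d D i =
     kron (1\<^sub>m (dim_row D ^ (i - 1))) (kron (braiding D) (1\<^sub>m (dim_row D ^ (d - i - 1))))"

text \<open>
  The \<open>S_d\<close>-representation underlying the \<open>d\<close>-th tensor power of \<open>D\<close>.  As the category is
  symmetric (in characteristic 2), there is exactly one homomorphism on \<open>S_d\<close> that sends the
  adjacent transpositions, which generate \<open>S_d\<close>, to the braidings of adjacent factors.
\<close>

definition tensor_power :: "nat \<Rightarrow> 'k::field mat \<Rightarrow> 'k perm_rep" where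
  "tensor_power d D = (dim_row D ^ d,
     SOME \<rho>. \<rho> \<in> hom (sym_group d) (GL (dim_row D ^ d)) \<and>
             (\<forall>i \<in> {1..<d}. \<rho> (transpose i (Suc i)) = braiding_at d D i))"

definition B_obj :: "nat \<Rightarrow> 'k::field mat \<Rightarrow> 'k perm_rep set" where
  "B_obj d X = sums_of d {M. direct_summand d M (tensor_power d X)}"

definition B_Ver4p :: "nat \<Rightarrow> 'k::field perm_rep set" where
  "B_Ver4p d = sums_of d (\<Union>Y \<in> Ver4p. B_obj d Y)"

definition relatively_discerning :: "nat \<Rightarrow> 'k::field mat \<Rightarrow> bool" where
  "relatively_discerning d X \<longleftrightarrow> B_obj d X = B_Ver4p d"

end

(* Choosing bases, X^d becomes a space of functions on words over the letters One i (from m) and V j, W j (from nP),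
 and X is relatively discerning iff the identity of every other tensor power factors through sums of X^d.
 Sufficiency is a relative trace argument along Young subgroups; for necessity, a pairing of positions into
 blocks of size 2 or 4 gives operators in the group algebra that detect d div 2 distinct letters One
 and d div 4 distinct copies of P. *)
theory Submission
 imports Defs "Jordan_Normal_Form.Determinant" "HOL-Library.Function_Algebras"
begin

text \<open>The bounds come from the small tensor powers of P. A copy of P that occurs an odd number
  of times, or exactly twice, can be traded for letters One that occur once: an odd index is
  invertible in characteristic 2, and the tensor square of P is free over S_2. Only even
  multiplicities of at least 4 keep their copy of P, whence d div 4; a letter One of multiplicity at
  least 2 is kept as well, whence d div 2. The positions of the letters that occur once carry a
  regular representation, to be found in words over the letters left over. Distinct letters do this
  up to their number; beyond it one uses that the norms of S_3 and S_4 do not vanish on the third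
  and fourth power of P, so that a copy of P makes room for one or two more positions. For
  necessity, the obstruction is a homology ker/im of a square-zero element of the group algebra of a
  block: 1 + s for size 2, and for size 4 an element of the Klein four-group with a primitive cube
  root of unity among its coefficients. If a representation has too few letters, the sum over the
  permutations of the blocks kills the part that this homology sees.\<close>

no_notation fps_nth (infixl "$" 75)

section \<open>Linear algebra over a field: factorizations of matrices and relations between
  powers\<close>

lemma mult_mat_assoc: "dim_col A = dim_row B ==> dim_col B = dim_row C ==>
  A * B * C = A * (B * C)" for A :: "'a::semiring_0 mat"
 by (rule assoc_mult_mat[of A "dim_row A" "dim_col A" B "dim_col B" C "dim_col C"]) auto

lemma mult_mat_add_left: "dim_row A = dim_row B ==> dim_col A = dim_col B ==>
  dim_col A = dim_row C ==> (A + B) * C = A * C + B * C" for A :: "'a::semiring_0 mat"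
 by (rule add_mult_distrib_mat[of A "dim_row A" "dim_col A" B C "dim_col C"]) auto

lemma mult_mat_add_right: "dim_row A = dim_row B ==> dim_col A = dim_col B ==>
  dim_col C = dim_row A ==> C * (A + B) = C * A + C * B" for A :: "'a::semiring_0 mat"
 by (rule mult_add_distrib_mat[of C "dim_row C" "dim_col C" A "dim_col A" B]) auto

lemma mult_mat_one: "dim_row A = n ==> 1\<^sub>m n * A = A" "dim_col A = n ==> A * 1\<^sub>m n = A"
 for A :: "'a::semiring_1 mat"
 by (rule left_mult_one_mat', simp) (rule right_mult_one_mat', simp)

lemma mult_mat_zero: "dim_row A = n ==> 0\<^sub>m m n * A = 0\<^sub>m m (dim_col A)"
 "dim_col A = n ==> A * 0\<^sub>m n m = 0\<^sub>m (dim_row A) m" for A :: "'a::semiring_0 mat"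
 by auto

lemma add_mat_zero: "dim_row A = n ==> dim_col A = m ==> 0\<^sub>m n m + A = A"
 "dim_row A = n ==> dim_col A = m ==> A + 0\<^sub>m n m = A" for A :: "'a::monoid_add mat"
 by auto

lemmas mat_dim_simps = mult_mat_assoc mult_mat_add_left mult_mat_add_right mult_mat_one
 mult_mat_zero add_mat_zero

lemma add_mat_assoc: "dim_row A = dim_row B ==> dim_col A = dim_col B ==>
  dim_row B = dim_row C ==> dim_col B = dim_col C ==> A + B + C = A + (B + C)"
 for A :: "'a::semigroup_add mat"
 by (intro eq_matI) (auto simp: add.assoc)

text \<open>If q < p, padding A with zero columns and B with zero rows to size p keeps the product
  1. For square matrices the product in the other order is then 1 too, but its row q is
  zero.\<close>

lemma left_inverse_dim_le:
 fixes A B :: "'a::field mat"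
 assumes "dim_row A = p" "dim_col A = q" "dim_row B = q" "dim_col B = p" "A * B = 1\<^sub>m p"
 shows "p \<le> q"
proof (rule ccontr)
 assume "\<not> p \<le> q"
 hence qp: "q < p" by simp
 define A' where "A' = mat p p (%(i, j). if j < q then A $$ (i, j) else 0)"
 define B' where "B' = mat p p (%(i, j). if i < q then B $$ (i, j) else 0)"
 have cA: "A' \<in> carrier_mat p p" and cB: "B' \<in> carrier_mat p p" by (auto simp: A'_def B'_def)
 have "A' * B' = A * B"
 proof (rule eq_matI)
  fix i j assume ij: "i < dim_row (A * B)" "j < dim_col (A * B)"
  hence ij': "i < p" "j < p" using assms by auto
  have "(A' * B') $$ (i, j) = (\<Sum>k = 0..<p. if k < q then A $$ (i, k) * B $$ (k, j) else 0)"
  using ij' by (auto simp: A'_def B'_def scalar_prod_def intro!: sum.cong)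
  also have "... = (\<Sum>k = 0..<q. A $$ (i, k) * B $$ (k, j))"
  using qp by (intro sum.mono_neutral_cong_right) auto
  also have "... = (A * B) $$ (i, j)" using ij' assms(1-4) by (auto simp: scalar_prod_def)
  finally show "(A' * B') $$ (i, j) = (A * B) $$ (i, j)" .
 qed (use assms in \<open>auto simp: A'_def B'_def\<close>)
 hence "B' * A' = 1\<^sub>m p" using mat_mult_left_right_inverse[OF cA cB] assms by simp
 hence "1 = (B' * A') $$ (q, q)" using qp by simp
 also have "... = 0" using qp by (auto simp: A'_def B'_def scalar_prod_def intro!: sum.neutral)
 finally show False by simp
qed

text \<open>A kernel vector v with nonzero entry at p expresses column p through the other columns.
  So L is c without column p, and R restores that column with the coefficients - v_k / v_p.\<close>

lemma singular_factorization:
 fixes c :: "'a::field mat"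
 assumes c: "c \<in> carrier_mat (Suc r) (Suc r)" and "det c = 0"
 shows "EX L R. L \<in> carrier_mat (Suc r) r & R \<in> carrier_mat r (Suc r) & c = L * R"
proof -
 from assms obtain v where v: "v \<in> carrier_vec (Suc r)" "v ~= 0\<^sub>v (Suc r)" "c *\<^sub>v v = 0\<^sub>v (Suc r)"
  using det_0_iff_vec_prod_zero_field[OF c] by auto
 obtain p where p: "p < Suc r" "v $ p ~= 0" using v by (metis carrier_vecD eq_vecI index_zero_vec)
 define s where "s k = (if k < p then k else Suc k)" for k
 have s: "s k < Suc r & s k ~= p" if "k < r" for k using that p by (auto simp: s_def)
 have inj: "inj_on s {0..<r}" by (auto simp: s_def inj_on_def split: if_splits)
 have "card (s ` {0..<r}) = card ({0..<Suc r} - {p})" using inj p by (simp add: card_image)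
 moreover have "s ` {0..<r} \<subseteq> {0..<Suc r} - {p}"
  by (rule image_subsetI) (use s in simp)
 ultimately have im: "s ` {0..<r} = {0..<Suc r} - {p}" by (intro card_subset_eq) simp_all
 define L where "L = mat (Suc r) r (%(i, k). c $$ (i, s k))"
 define R where "R = mat r (Suc r) (%(k, j). (if s k = j then 1 else 0) - (if j = p then v $ (s k) / v $ p else 0))"
 have "c = L * R"
 proof (rule eq_matI)
  fix i j assume "i < dim_row (L * R)" "j < dim_col (L * R)"
  hence ij: "i < Suc r" "j < Suc r" by (auto simp: L_def R_def)
  have z: "(\<Sum>k = 0..<Suc r. c $$ (i, k) * v $ k) = 0"
  using arg_cong[OF v(3), of "%x. vec_index x i"] ij c v(1)
  by (auto simp: scalar_prod_def intro!: sum.cong simp del: sum.op_ivl_Suc)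
  hence z': "(\<Sum>k \<in> {0..<Suc r} - {p}. c $$ (i, k) * v $ k) = - (c $$ (i, p) * v $ p)"
  using p by (subst (asm) sum.remove[of _ p]) (auto simp: eq_neg_iff_add_eq_0 add.commute simp del: sum.op_ivl_Suc)
  have "(L * R) $$ (i, j) = (\<Sum>k = 0..<r. c $$ (i, s k) *
   ((if s k = j then 1 else 0) - (if j = p then v $ (s k) / v $ p else 0)))"
  using ij by (auto simp: L_def R_def scalar_prod_def)
  also have "... = (\<Sum>k \<in> s ` {0..<r}. c $$ (i, k) *
   ((if k = j then 1 else 0) - (if j = p then v $ k / v $ p else 0)))"
  using inj by (simp add: sum.reindex)
  also have "... = c $$ (i, j)"
  proof (cases "j = p")
  case False
  have "(\<Sum>k \<in> {0..<Suc r} - {p}. c $$ (i, k) * (if k = j then 1 else 0)) =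
    (\<Sum>k \<in> {0..<Suc r} - {p}. if k = j then c $$ (i, k) else 0)"
   by (intro sum.cong) auto
  also have "... = c $$ (i, j)" using False ij by (subst sum.delta) auto
  finally show ?thesis using False by (simp add: im)
  next
  case True
  have "(\<Sum>k \<in> {0..<Suc r} - {p}. c $$ (i, k) * ((if k = p then 1 else 0) - v $ k / v $ p)) =
    (\<Sum>k \<in> {0..<Suc r} - {p}. - (1 / v $ p) * (c $$ (i, k) * v $ k))"
   by (intro sum.cong) auto
  also have "... = - (1 / v $ p) * (- (c $$ (i, p) * v $ p))"
   by (simp only: sum_distrib_left[symmetric] z')
  finally show ?thesis using True p by (simp add: im)
  qed
  finally show "c $$ (i, j) = (L * R) $$ (i, j)" by simp
 qed (use c in \<open>auto simp: L_def R_def\<close>)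
 thus ?thesis by (intro exI[of _ L] exI[of _ R]) (auto simp: L_def R_def)
qed

text \<open>Among all factorizations e = B A take one of least inner dimension r. Then c = A B is
  invertible: a singular c would factor through dimension r - 1, and with it e = B c A. Finally e e
  = e gives c^3 = c^2, hence c = 1.\<close>

lemma idempotent_split:
 fixes e :: "'a::field mat"
 assumes e: "dim_row e = n" "dim_col e = n" "e * e = e"
 shows "EX r A B. dim_row A = r & dim_col A = n & dim_row B = n & dim_col B = r &
  B * A = e & A * B = 1\<^sub>m r"
proof -
 define P where "P r \<longleftrightarrow> (EX A B. dim_row A = r & dim_col A = n & dim_row B = n & dim_col B = r &
  B * A = e)" for r
 have "P n" unfolding P_def using e by (intro exI[of _ e] exI[of _ "1\<^sub>m n"]) (simp add: mat_dim_simps)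
 define r where "r = (LEAST r. P r)"
 have "P r" unfolding r_def using \<open>P n\<close> by (rule LeastI)
 then obtain A B where AB: "dim_row A = r" "dim_col A = n" "dim_row B = n" "dim_col B = r" "B * A = e"
  unfolding P_def by blast
 define c where "c = A * B"
 have c: "c \<in> carrier_mat r r" using AB by (auto simp: c_def)
 have "B * (A * (B * A)) = (B * A) * (B * A)" using AB(1-4) by (simp add: mult_mat_assoc)
 hence e1: "B * (A * (B * A)) = e" using e(3) AB(5) by simp
 have "det c ~= 0"
 proof
  assume d0: "det c = 0"
  have "r ~= 0" using d0 c det_dim_zero[of c] by auto
  then obtain r' where r': "r = Suc r'" by (cases r) auto
  from singular_factorization[OF c[unfolded r'] d0] obtain L R where LR:
  "L \<in> carrier_mat (Suc r') r'" "R \<in> carrier_mat r' (Suc r')" "c = L * R" by blast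
  have "(B * L) * (R * A) = B * (c * A)" using LR AB r'
  by (simp add: mult_mat_assoc)
  also have "... = e" using AB e1 by (simp add: c_def mult_mat_assoc)
  finally have "P r'" unfolding P_def using LR AB
  by (intro exI[of _ "R * A"] exI[of _ "B * L"]) auto
  hence "r \<le> r'" unfolding r_def by (rule Least_le)
  thus False using r' by simp
 qed
 then obtain ci where ci: "ci \<in> carrier_mat r r" "ci * c = 1\<^sub>m r" "c * ci = 1\<^sub>m r"
  using det_non_zero_imp_unit[OF c, where ?b = "()"] unfolding Units_def by (auto simp: ring_mat_def)
 have "c * (c * c) = A * (B * (A * (B * A)) * B)" using AB(1-4) by (simp add: c_def mult_mat_assoc)
 also have "... = A * (B * A * B)" using e1 AB(5) by simp
 also have "... = c * c" using AB(1-4) by (simp add: c_def mult_mat_assoc)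
 finally have ccc: "c * (c * c) = c * c" .
 have cancel: "ci * (c * x) = x" if "dim_row x = r" for x
  using ci c that mult_mat_assoc[of ci c x] by (simp add: mult_mat_one)
 have "c = ci * (ci * (c * (c * c)))" using c by (simp add: cancel)
 also have "... = 1\<^sub>m r" unfolding ccc using ci c by (simp add: cancel)
 finally have "A * B = 1\<^sub>m r" by (simp add: c_def)
 thus ?thesis using AB by (intro exI[of _ r] exI[of _ A] exI[of _ B]) simp
qed

text \<open>The n^2 + 1 powers with exponents up to n^2 lie in a space of dimension n^2. The
  relation is a kernel vector of the square matrix whose columns are the flattened powers, completed
  by one zero row.\<close>

lemma linear_dependence_of_powers:
 fixes f :: "'a::field mat"
 assumes f: "dim_row f = n" "dim_col f = n"
 shows "EX v K. (\<exists>j \<le> K. v j ~= 0) &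
  (\<forall>a < n. \<forall>b < n. (\<Sum>j \<le> K. v j * (f ^\<^sub>m j) $$ (a, b)) = 0)"
proof -
 define m where "m = n * n"
 define Z where "Z = mat (Suc m) (Suc m) (%(i, j). if i < m then (f ^\<^sub>m j) $$ (i div n, i mod n) else 0)"
 have Z: "Z \<in> carrier_mat (Suc m) (Suc m)" by (simp add: Z_def)
 have "det (transpose_mat Z) = 0"
 proof (subst det_0_iff_vec_prod_zero_field[of _ "Suc m"])
  show "EX v. v \<in> carrier_vec (Suc m) & v ~= 0\<^sub>v (Suc m) & transpose_mat Z *\<^sub>v v = 0\<^sub>v (Suc m)"
  proof (intro exI[of _ "unit_vec (Suc m) m"] conjI)
  show "unit_vec (Suc m) m ~= (0\<^sub>v (Suc m) :: 'a vec)"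
   by (metis index_unit_vec(2) index_zero_vec(1) lessI one_neq_zero)
  show "transpose_mat Z *\<^sub>v unit_vec (Suc m) m = 0\<^sub>v (Suc m)"
   using Z by (intro eq_vecI) (auto simp: Z_def scalar_prod_def intro!: sum.neutral)
  qed auto
 qed (use Z in auto)
 hence "det Z = 0" using Z by (simp add: det_transpose)
 then obtain v where v: "v \<in> carrier_vec (Suc m)" "v ~= 0\<^sub>v (Suc m)" "Z *\<^sub>v v = 0\<^sub>v (Suc m)"
  using det_0_iff_vec_prod_zero_field[OF Z] by auto
 obtain p where p: "p < Suc m" "v $ p ~= 0" using v by (metis carrier_vecD eq_vecI index_zero_vec)
 have "(\<Sum>j \<le> m. v $ j * (f ^\<^sub>m j) $$ (a, b)) = 0" if ab: "a < n" "b < n" for a b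
 proof -
  have "a * n + b < Suc a * n" using ab by simp
  also have "... \<le> n * n" using ab by (intro mult_le_mono) auto
  finally have im: "a * n + b < m" by (simp add: m_def)
  have "(Z *\<^sub>v v) $ (a * n + b) = (\<Sum>j = 0..<Suc m. (f ^\<^sub>m j) $$ (a, b) * v $ j)"
  using im ab v(1) by (auto simp: Z_def scalar_prod_def intro!: sum.cong simp del: sum.op_ivl_Suc)
  thus ?thesis using v im by (simp add: atLeast0LessThan lessThan_Suc_atMost mult.commute del: sum.op_ivl_Suc)
 qed
 thus ?thesis using p by (intro exI[of _ "%j. v $ j"] exI[of _ m]) (auto simp: less_Suc_eq_le)
qed

text \<open>With \<open>c\<^sub>a\<close> the lowest nonzero coefficient of a linear relation between the powers of \<open>f\<close>,
 the relation reads \<open>f\<^sup>a = f\<^bsup>a+1\<^esup> g\<close>, where \<open>g\<close> is a polynomial in \<open>f\<close>.\<close>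

lemma strongly_pi_regular:
 fixes f :: "'a::field mat"
 assumes f: "f \<in> carrier_mat n n"
  and S0: "0\<^sub>m n n \<in> S" and S1: "1\<^sub>m n \<in> S"
  and Sadd: "!!x y. x \<in> S ==> y \<in> S ==> x + y \<in> S"
  and Ssmult: "!!c x. x \<in> S ==> c \<cdot>\<^sub>m x \<in> S"
  and Smult: "!!x. x \<in> S ==> x * f \<in> S" and SC: "S \<subseteq> carrier_mat n n"
 shows "EX a. \<exists>g \<in> S. f ^\<^sub>m a = f ^\<^sub>m (Suc a) * g"
proof -
 obtain v K where v: "\<exists>j \<le> K. v j ~= 0"
  "!!a b. a < n ==> b < n ==> (\<Sum>j \<le> K. v j * (f ^\<^sub>m j) $$ (a, b)) = 0"
  using linear_dependence_of_powers[of f n] f by auto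
 define a where "a = (LEAST j. v j ~= 0)"
 have va: "v a ~= 0" unfolding a_def using v(1) by (metis (mono_tags, lifting) LeastI)
 have aK: "a \<le> K" unfolding a_def using v(1) by (metis (mono_tags, lifting) Least_le le_trans)
 have vl: "v j = 0" if "j < a" for j using that unfolding a_def using not_less_Least by blast
 have pc: "f ^\<^sub>m j \<in> carrier_mat n n" for j using f by auto
 have pS: "f ^\<^sub>m j \<in> S" for j using S1 Smult f by (induction j) auto
 \<comment> \<open>\<open>h k\<close> is the sum over j < k of - v (a + 1 + j) / v a times the j-th
   power of \<open>f\<close>. The recursion makes membership in \<open>S\<close> a consequence of
   the closure hypotheses.\<close>
 define h where "h = rec_nat (0\<^sub>m n n) (%k g. g + (- v (Suc (a + k)) / v a) \<cdot>\<^sub>m (f ^\<^sub>m k))"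
 have hS: "h k \<in> S" for k by (induction k) (auto simp: h_def intro!: S0 Sadd Ssmult pS)
 have hc: "h k \<in> carrier_mat n n" for k using hS SC by auto
 have pd: "dim_row (f ^\<^sub>m j) = n" "dim_col (f ^\<^sub>m j) = n" for j using pc[of j] by auto
 have hd: "dim_row (h k) = n" "dim_col (h k) = n" for k using hc[of k] by auto
 have fpow: "f ^\<^sub>m i * f ^\<^sub>m j = f ^\<^sub>m (i + j)" for i j
 proof (induction j)
  case 0
  show ?case using f right_mult_one_mat[OF pc[of i]] by simp
 next
  case (Suc j)
  show ?case using Suc assoc_mult_mat[OF pc[of i] pc[of j] f] by simp
 qed
 have hent: "(f ^\<^sub>m (Suc a) * h k) $$ (x, y) =
  (\<Sum>j < k. (- v (Suc (a + j)) / v a) * (f ^\<^sub>m (Suc (a + j))) $$ (x, y))"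
  if xy: "x < n" "y < n" for k x y
 proof (induction k)
  case 0
  show ?case using xy pc[of "Suc a"] by (simp add: h_def right_mult_zero_mat)
 next
  case (Suc k)
  let ?c = "- v (Suc (a + k)) / v a"
  have "f ^\<^sub>m (Suc a) * h (Suc k) = f ^\<^sub>m (Suc a) * h k + f ^\<^sub>m (Suc a) * (?c \<cdot>\<^sub>m (f ^\<^sub>m k))"
  unfolding h_def using pc[of "Suc a"] hc[of k, unfolded h_def] pc[of k]
  by (simp only: nat.rec) (intro mult_mat_add_right, auto)
  also have "f ^\<^sub>m (Suc a) * (?c \<cdot>\<^sub>m (f ^\<^sub>m k)) = ?c \<cdot>\<^sub>m (f ^\<^sub>m (Suc (a + k)))"
  using fpow[of "Suc a" k] mult_smult_distrib[OF pc[of "Suc a"] pc[of k]] by (metis add_Suc)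
  finally show ?case using Suc xy hd f[THEN carrier_matD(1)] f[THEN carrier_matD(2)]
  by (simp del: pow_mat.simps)
 qed
 have "f ^\<^sub>m a = f ^\<^sub>m (Suc a) * h (K - a)"
 proof (rule eq_matI)
  fix x y assume "x < dim_row (f ^\<^sub>m (Suc a) * h (K - a))" "y < dim_col (f ^\<^sub>m (Suc a) * h (K - a))"
  hence xy: "x < n" "y < n" using pd hd
  by (auto simp del: pow_mat.simps)
  have "0 = (\<Sum>j \<in> {a..K}. v j * (f ^\<^sub>m j) $$ (x, y))"
  using v(2)[OF xy] vl aK by (subst sum.mono_neutral_left[of "{..K}"]) auto
  also have "... = v a * (f ^\<^sub>m a) $$ (x, y) + (\<Sum>j \<in> {Suc a..K}. v j * (f ^\<^sub>m j) $$ (x, y))"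
  using aK by (subst sum.atLeast_Suc_atMost) auto
  also have "(\<Sum>j \<in> {Suc a..K}. v j * (f ^\<^sub>m j) $$ (x, y)) =
   (\<Sum>j < K - a. v (Suc (a + j)) * (f ^\<^sub>m (Suc (a + j))) $$ (x, y))"
  by (rule sum.reindex_bij_witness[of _ "%j. Suc (a + j)" "%j. j - Suc a"])
   (use aK in \<open>auto simp del: pow_mat.simps simp: Suc_diff_Suc\<close>)
  finally have "v a * (f ^\<^sub>m a) $$ (x, y) = - (\<Sum>j < K - a. v (Suc (a + j)) * (f ^\<^sub>m (Suc (a + j))) $$ (x, y))"
  by (simp add: eq_neg_iff_add_eq_0 del: pow_mat.simps)
  hence "(f ^\<^sub>m a) $$ (x, y) = - (\<Sum>j < K - a. v (Suc (a + j)) * (f ^\<^sub>m (Suc (a + j))) $$ (x, y)) / v a"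
  using va by (simp add: field_simps del: pow_mat.simps)
  also have "... = (f ^\<^sub>m (Suc a) * h (K - a)) $$ (x, y)"
  unfolding hent[OF xy] by (simp add: sum_negf sum_divide_distrib del: pow_mat.simps)
  finally show "(f ^\<^sub>m a) $$ (x, y) = (f ^\<^sub>m (Suc a) * h (K - a)) $$ (x, y)" .
 qed (use pd hd in \<open>auto simp del: pow_mat.simps\<close>)
 thus ?thesis using hS by blast
qed

section \<open>Morphisms that factor through sums of a given representation\<close>

lemma carrier_GL: "A \<in> carrier (GL n) \<longleftrightarrow> dim_row A = n & dim_col A = n &
  (EX B. dim_row B = n & dim_col B = n & A * B = 1\<^sub>m n & B * A = 1\<^sub>m n)"
 unfolding GL_def units_of_carrier Units_def by (auto simp: ring_mat_def)

lemma GL_mult: "x \<otimes>\<^bsub>GL n\<^esub> y = x * y"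
 by (simp add: GL_def units_of_mult ring_mat_def)

lemma GL_one: "\<one>\<^bsub>GL n\<^esub> = 1\<^sub>m n"
 by (simp add: GL_def units_of_one ring_mat_def)

lemma group_GL: "group (GL n :: 'a::field mat monoid)"
proof -
 interpret ring "ring_mat TYPE('a) n ()" by (rule ring_mat)
 show ?thesis unfolding GL_def by (rule units_group)
qed

lemma RepD:
 assumes "M \<in> Rep d" "sz permutes {1..d}"
 shows "dim_row (snd M sz) = fst M" "dim_col (snd M sz) = fst M"
  "tz permutes {1..d} ==> snd M (sz o tz) = snd M sz * snd M tz"
  "snd M id = 1\<^sub>m (fst M)"
proof -
 obtain n rh where M: "M = (n, rh)" "rh \<in> hom (sym_group d) (GL n)" using assms(1) by (auto simp: Rep_def)
 have "rh sz \<in> carrier (GL n)" using M assms by (auto simp: hom_def sym_group_def)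
 thus "dim_row (snd M sz) = fst M" "dim_col (snd M sz) = fst M" using M by (auto simp: carrier_GL)
 show "snd M (sz o tz) = snd M sz * snd M tz" if "tz permutes {1..d}"
  using M assms that by (auto simp: hom_def sym_group_def GL_mult)
 have "group_hom (sym_group d) (GL n) rh"
  using M by (intro group_hom.intro group_hom_axioms.intro sym_group_is_group group_GL)
 from group_hom.hom_one[OF this] show "snd M id = 1\<^sub>m (fst M)"
  using M by (simp add: sym_group_def GL_one)
qed

text \<open>Invertibility is automatic: the inverse of \<open>rh sz\<close> is \<open>rh\<close> at
  the inverse permutation.\<close>

lemma RepI:
 assumes "!!sz. sz permutes {1..d} ==> dim_row (rh sz) = n" "!!sz. sz permutes {1..d} ==> dim_col (rh sz) = n"
  and mult: "!!sz tz. sz permutes {1..d} ==> tz permutes {1..d} ==> rh (sz o tz) = rh sz * rh tz"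
  and one: "rh id = 1\<^sub>m n"
 shows "(n, rh) \<in> Rep d"
proof -
 have "rh sz \<in> carrier (GL n)" if s: "sz permutes {1..d}" for sz
 proof -
  have "rh sz * rh (inv' sz) = 1\<^sub>m n" "rh (inv' sz) * rh sz = 1\<^sub>m n"
  using mult[OF s permutes_inv[OF s]] mult[OF permutes_inv[OF s] s] one
  by (simp_all add: permutes_inv_o[OF s])
  thus ?thesis unfolding carrier_GL using assms(1,2) s permutes_inv[OF s] by blast
 qed
 thus ?thesis using mult by (auto simp: Rep_def hom_def sym_group_def GL_mult)
qed

definition intertwiner :: "nat => 'k::field perm_rep => 'k perm_rep => 'k mat => bool" where
 "intertwiner d M N A \<longleftrightarrow> dim_row A = fst N & dim_col A = fst M &
  (ALL sz. sz permutes {1..d} --> A * snd M sz = snd N sz * A)"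

lemma intertwinerD:
 assumes "intertwiner d M N A"
 shows "dim_row A = fst N" "dim_col A = fst M" "sz permutes {1..d} ==> A * snd M sz = snd N sz * A"
 using assms by (auto simp: intertwiner_def)

lemma intertwiner_one: "M \<in> Rep d ==> intertwiner d M M (1\<^sub>m (fst M))"
 by (auto simp: intertwiner_def RepD mat_dim_simps)

lemma intertwiner_zero: "M \<in> Rep d ==> N \<in> Rep d ==> intertwiner d M N (0\<^sub>m (fst N) (fst M))"
 by (auto simp: intertwiner_def RepD mat_dim_simps)

lemma intertwiner_comp:
 assumes "M \<in> Rep d" "N \<in> Rep d" "L \<in> Rep d" and A: "intertwiner d M N A" and B: "intertwiner d N L B"
 shows "intertwiner d M L (B * A)"
 unfolding intertwiner_def
proof (intro conjI allI impI)
 fix sz assume s: "sz permutes {1..d}"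
 note d = assms(1-3)[THEN RepD(1), OF s] assms(1-3)[THEN RepD(2), OF s] intertwinerD(1,2)[OF A] intertwinerD(1,2)[OF B]
 have "B * A * snd M sz = B * (A * snd M sz)" using d by (simp add: mult_mat_assoc)
 also have "... = B * snd N sz * A" using intertwinerD(3)[OF A s] d by (simp add: mult_mat_assoc)
 also have "... = snd L sz * (B * A)" using intertwinerD(3)[OF B s] d by (simp add: mult_mat_assoc)
 finally show "B * A * snd M sz = snd L sz * (B * A)" .
qed (use A B in \<open>auto dest: intertwinerD\<close>)

lemma intertwiner_add:
 assumes "M \<in> Rep d" "N \<in> Rep d" and A: "intertwiner d M N A" and B: "intertwiner d M N B"
 shows "intertwiner d M N (A + B)"
 using assms intertwinerD[OF A] intertwinerD[OF B]
 by (auto simp: intertwiner_def RepD mat_dim_simps)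

lemma intertwiner_smult:
 assumes "M \<in> Rep d" "N \<in> Rep d" and A: "intertwiner d M N A"
 shows "intertwiner d M N (c \<cdot>\<^sub>m A)"
 unfolding intertwiner_def
proof (intro conjI allI impI)
 fix sz assume s: "sz permutes {1..d}"
 have c: "A \<in> carrier_mat (fst N) (fst M)" "snd M sz \<in> carrier_mat (fst M) (fst M)"
  "snd N sz \<in> carrier_mat (fst N) (fst N)" using RepD[OF assms(1) s] RepD[OF assms(2) s] intertwinerD[OF A] by auto
 show "c \<cdot>\<^sub>m A * snd M sz = snd N sz * (c \<cdot>\<^sub>m A)"
  using mult_smult_assoc_mat[OF c(1,2)] mult_smult_distrib[OF c(3,1)] intertwinerD(3)[OF A s] by simp
qed (use intertwinerD[OF A] in auto)

text \<open>The morphisms from M to M' that factor through a finite direct sum of copies of N. They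
  are generated as sums of composites through N itself, so that no power of N has to be
  formed.\<close>

inductive thru :: "nat => 'k::field perm_rep => 'k perm_rep => 'k perm_rep => 'k mat => bool"
 for d N M M' where
 zero: "thru d N M M' (0\<^sub>m (fst M') (fst M))"
| step: "thru d N M M' C ==> intertwiner d M N A ==> intertwiner d N M' B ==> thru d N M M' (C + B * A)"

text \<open>This expresses that M is a direct summand of a finite direct sum of copies of N, in a
  form that composes and that does not mention complements.\<close>

definition fac :: "nat => 'k::field perm_rep => 'k perm_rep => bool" where
 "fac d M N \<longleftrightarrow> thru d N M M (1\<^sub>m (fst M))"

lemma thru_dim: "thru d N M M' C ==> dim_row C = fst M' & dim_col C = fst M"
 by (induction rule: thru.induct) (auto dest: intertwinerD)

lemma thru_intertwiner: "thru d N M M' C ==> M \<in> Rep d ==> N \<in> Rep d ==> M' \<in> Rep d ==> intertwiner d M M' C"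
 by (induction rule: thru.induct) (auto intro: intertwiner_zero intertwiner_add intertwiner_comp)

lemma thru_single:
 assumes "intertwiner d M N A" "intertwiner d N M' B"
 shows "thru d N M M' (B * A)"
 using thru.step[OF thru.zero assms] intertwinerD(1,2)[OF assms(1)] intertwinerD(1,2)[OF assms(2)]
 by (simp add: mat_dim_simps)

lemma thru_add: "thru d N M M' D ==> thru d N M M' C ==> thru d N M M' (C + D)"
proof (induction rule: thru.induct)
 case zero
 then show ?case by (simp add: mat_dim_simps thru_dim)
next
 case (step D A B)
 have "C + (D + B * A) = C + D + B * A" using thru_dim[OF step(1)] thru_dim[OF step(5)]
  intertwinerD(1,2)[OF step(2)] intertwinerD(1,2)[OF step(3)] by (simp add: add_mat_assoc)
 then show ?case using thru.step[OF step(4)[OF step(5)] step(2,3)] by simp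
qed

lemma thru_comp_left:
 assumes "N \<in> Rep d" "M' \<in> Rep d" "M'' \<in> Rep d" "intertwiner d M' M'' E"
 shows "thru d N M M' C ==> thru d N M M'' (E * C)"
proof (induction rule: thru.induct)
 case zero
 then show ?case using thru.zero[of d N M M''] intertwinerD[OF assms(4)] by (simp add: mat_dim_simps)
next
 case (step C A B)
 have "E * (C + B * A) = E * C + (E * B) * A" using thru_dim[OF step(1)] intertwinerD(1,2)[OF assms(4)]
  intertwinerD(1,2)[OF step(2)] intertwinerD(1,2)[OF step(3)] by (simp add: mat_dim_simps)
 then show ?case using thru.step[OF step(4,2) intertwiner_comp[OF assms(1-3) step(3) assms(4)]] by simp
qed

lemma thru_comp_right:
 assumes "N \<in> Rep d" "M \<in> Rep d" "M'' \<in> Rep d" "intertwiner d M'' M E"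
 shows "thru d N M M' C ==> thru d N M'' M' (C * E)"
proof (induction rule: thru.induct)
 case zero
 then show ?case using thru.zero[of d N M'' M'] intertwinerD[OF assms(4)] by (simp add: mat_dim_simps)
next
 case (step C A B)
 have "(C + B * A) * E = C * E + B * (A * E)" using thru_dim[OF step(1)] intertwinerD(1,2)[OF assms(4)]
  intertwinerD(1,2)[OF step(2)] intertwinerD(1,2)[OF step(3)] by (simp add: mat_dim_simps)
 then show ?case using thru.step[OF step(4) intertwiner_comp[OF assms(3,2,1,4) step(2)] step(3)] by simp
qed

text \<open>A composite through N does not change if the identity of N is inserted in the middle,
  and that identity is a sum of composites through P.\<close>

lemma thru_trans:
 assumes "M \<in> Rep d" "M' \<in> Rep d" "N \<in> Rep d" "P \<in> Rep d" "fac d N P"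
 shows "thru d N M M' C ==> thru d P M M' C"
proof (induction rule: thru.induct)
 case zero
 then show ?case by (rule thru.zero)
next
 case (step C A B)
 have "thru d P M M' (B * (1\<^sub>m (fst N) * A))"
  using thru_comp_left[OF assms(4,3,2) step(3) thru_comp_right[OF assms(4,3,1) step(2)]] assms(5)
  by (simp add: fac_def)
 then show ?case using thru_add[OF _ step(4)] step(2) by (simp add: mat_dim_simps intertwinerD)
qed

lemma fac_trans: "M \<in> Rep d ==> N \<in> Rep d ==> P \<in> Rep d ==> fac d M N ==> fac d N P ==> fac d M P"
 unfolding fac_def[of d M] by (rule thru_trans) 

lemma fac_retract:
 assumes "intertwiner d M N A" "intertwiner d N M B" "B * A = 1\<^sub>m (fst M)"
 shows "fac d M N"
 using thru_single[OF assms(1,2)] assms(3) by (simp add: fac_def)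

lemma fac_refl: "M \<in> Rep d ==> fac d M M"
 using fac_retract[OF intertwiner_one intertwiner_one] by (simp add: mat_dim_simps)

section \<open>Direct sums and the Krull--Schmidt property\<close>

definition biproduct :: "nat => 'k::field perm_rep => 'k perm_rep => 'k perm_rep =>
  'k mat => 'k mat => 'k mat => 'k mat => bool" where
 "biproduct d S M N i p j q \<longleftrightarrow> intertwiner d M S i & intertwiner d S M p &
  intertwiner d N S j & intertwiner d S N q &
  p * i = 1\<^sub>m (fst M) & q * j = 1\<^sub>m (fst N) & i * p + j * q = 1\<^sub>m (fst S) &
  p * j = 0\<^sub>m (fst M) (fst N) & q * i = 0\<^sub>m (fst N) (fst M)"

text \<open>\<open>rep_iso\<close> has equality of dimensions built in; for two mutually inverse
  intertwiners this follows by comparing dimensions in both directions.\<close>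

lemma rep_iso_iff:
 assumes "M \<in> Rep d" "N \<in> Rep d"
 shows "rep_iso d M N \<longleftrightarrow> (EX Q R. intertwiner d M N Q & intertwiner d N M R &
  Q * R = 1\<^sub>m (fst N) & R * Q = 1\<^sub>m (fst M))"
proof
 assume "rep_iso d M N"
 then obtain Q where Q: "fst M = fst N" "Q \<in> carrier (GL (fst M))"
  "!!sz. sz permutes {1..d} ==> Q * snd M sz = snd N sz * Q"
  by (auto simp: rep_iso_def sym_group_def)
 then obtain R where R: "dim_row R = fst M" "dim_col R = fst M" "Q * R = 1\<^sub>m (fst M)" "R * Q = 1\<^sub>m (fst M)"
  and dQ: "dim_row Q = fst M" "dim_col Q = fst M"
  by (auto simp: carrier_GL)
 have "R * snd N sz = snd M sz * R" if s: "sz permutes {1..d}" for sz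
 proof -
  note dd = RepD(1,2)[OF assms(1) s] RepD(1,2)[OF assms(2) s] R(1,2) dQ Q(1)[symmetric]
  have "R * snd N sz = R * (snd N sz * (Q * R))" using R(3) dd by (simp add: mult_mat_one)
  also have "... = R * ((Q * snd M sz) * R)" using Q(3)[OF s] dd by (simp add: mult_mat_assoc)
  also have "... = (R * Q) * snd M sz * R" using dd by (simp add: mult_mat_assoc)
  finally show ?thesis using R(4) dd by (simp add: mult_mat_one)
 qed
 thus "EX Q R. intertwiner d M N Q & intertwiner d N M R & Q * R = 1\<^sub>m (fst N) & R * Q = 1\<^sub>m (fst M)"
  using Q R dQ by (intro exI[of _ Q] exI[of _ R]) (auto simp: intertwiner_def)
next
 assume "EX Q R. intertwiner d M N Q & intertwiner d N M R & Q * R = 1\<^sub>m (fst N) & R * Q = 1\<^sub>m (fst M)"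
 then obtain Q R where QR: "intertwiner d M N Q" "intertwiner d N M R" "Q * R = 1\<^sub>m (fst N)" "R * Q = 1\<^sub>m (fst M)"
  by blast
 note dd = intertwinerD(1,2)[OF QR(1)] intertwinerD(1,2)[OF QR(2)]
 have "fst M = fst N" using left_inverse_dim_le[OF dd QR(3)] left_inverse_dim_le[OF dd(3,4,1,2) QR(4)] by simp
 thus "rep_iso d M N" unfolding rep_iso_def
  using QR dd by (auto simp: carrier_GL sym_group_def intro!: bexI[of _ Q] intertwinerD(3) exI[of _ R])
qed

lemma rep_direct_sum_Nil: "rep_direct_sum [] = (0, %sz. 1\<^sub>m 0)"
 by (auto simp: rep_direct_sum_def fun_eq_iff)

text \<open>The structure maps are the obvious 0-1 matrices. With them, later arguments about direct
  sums become calculations with identities between maps instead of block matrices.\<close>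

lemma rep_direct_sum_Cons:
 assumes M: "M \<in> Rep d" and S: "rep_direct_sum Ms \<in> Rep d"
 shows "rep_direct_sum (M # Ms) \<in> Rep d & (EX i p j q. biproduct d (rep_direct_sum (M # Ms)) M (rep_direct_sum Ms) i p j q)"
proof -
 define S where "S = rep_direct_sum Ms"
 define a b where "a = fst M" and "b = fst S"
 have SR: "S \<in> Rep d" using assms by (simp add: S_def)
 define T where "T = rep_direct_sum (M # Ms)"
 have fT: "fst T = a + b" by (simp add: T_def a_def b_def S_def rep_direct_sum_def)
 have T: "snd T sz = four_block_mat (snd M sz) (0\<^sub>m a b) (0\<^sub>m b a) (snd S sz)" if s: "sz permutes {1..d}" for sz
  using RepD(1,2)[OF M s] RepD(1,2)[OF SR s]
  by (auto simp: T_def S_def a_def b_def rep_direct_sum_def Let_def)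
 have TR: "T \<in> Rep d"
 proof -
  have "(fst T, snd T) \<in> Rep d"
  proof (rule RepI)
  fix sz assume s: "sz permutes {1..d}"
  show "dim_row (snd T sz) = fst T" "dim_col (snd T sz) = fst T"
   using RepD(1,2)[OF M s] RepD(1,2)[OF SR s] by (simp_all add: T[OF s] fT a_def b_def)
  fix tz assume t: "tz permutes {1..d}"
  have c: "snd M sz \<in> carrier_mat a a" "snd M tz \<in> carrier_mat a a" "snd S sz \<in> carrier_mat b b" "snd S tz \<in> carrier_mat b b"
   using RepD(1,2)[OF M s] RepD(1,2)[OF SR s] RepD(1,2)[OF M t] RepD(1,2)[OF SR t] by (auto simp: a_def b_def)
  show "snd T (sz o tz) = snd T sz * snd T tz"
   unfolding T[OF s] T[OF t] T[OF permutes_compose[OF t s]] RepD(3)[OF M s t] RepD(3)[OF SR s t]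
   using c by (subst mult_four_block_mat[OF c(1) zero_carrier_mat zero_carrier_mat c(3) c(2) zero_carrier_mat zero_carrier_mat c(4)])
    (simp add: mat_dim_simps)
  next
  show "snd T id = 1\<^sub>m (fst T)"
   unfolding T[OF permutes_id] RepD(4)[OF M permutes_id] RepD(4)[OF SR permutes_id] fT a_def b_def
   by (intro eq_matI) (auto simp: four_block_mat_def Let_def)
  qed
  thus ?thesis by simp
 qed
 define i where "i = mat (a + b) a (%(x, y). if x = y then 1 else 0 :: 'a)"
 define p where "p = mat a (a + b) (%(x, y). if x = y then 1 else 0 :: 'a)"
 define j where "j = mat (a + b) b (%(x, y). if x = a + y then 1 else 0 :: 'a)"
 define q where "q = mat b (a + b) (%(x, y). if a + x = y then 1 else 0 :: 'a)"
 have sp1: "(\<Sum>k = 0..<n. (if P k then (1::'a) else 0) * f k) = (\<Sum>k \<in> {k. k < n & P k}. f k)" for n :: nat and P f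
  by (rule sum.mono_neutral_cong_right) auto
 have sp2: "(\<Sum>k = 0..<n. f k * (if P k then (1::'a) else 0)) = (\<Sum>k \<in> {k. k < n & P k}. f k)" for n :: nat and P f
  by (rule sum.mono_neutral_cong_right) auto
 have sg: "{k. k < n & x = k} = (if x < n then {x} else {})" "{k. k < n & k = x} = (if x < n then {x} else {})"
  "{k. k < n & x = a + k} = (if a \<le> x & x - a < n then {x - a} else {})"
  "{k. k < n & a + k = x} = (if a \<le> x & x - a < n then {x - a} else {})"
  "{k. k < n & a + x = k} = (if a + x < n then {a + x} else {})" 
  "{k. k < n & k = a + x} = (if a + x < n then {a + x} else {})" for n x :: nat
  by auto
 note mm = i_def p_def j_def q_def scalar_prod_def sp1 sp2 sg
 have "biproduct d T M S i p j q"
  unfolding biproduct_def intertwiner_def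
 proof (intro conjI allI impI)
  fix sz assume s: "sz permutes {1..d}"
  note dd = RepD(1,2)[OF M s, folded a_def] RepD(1,2)[OF SR s, folded b_def]
  show "i * snd M sz = snd T sz * i" "p * snd T sz = snd M sz * p" "j * snd S sz = snd T sz * j"
  "q * snd T sz = snd S sz * q"
  unfolding T[OF s]
  by (rule eq_matI; use dd in \<open>auto simp: mm four_block_mat_def Let_def\<close>)+
 next
  show "p * i = 1\<^sub>m (fst M)" "q * j = 1\<^sub>m (fst S)" "p * j = 0\<^sub>m (fst M) (fst S)" "q * i = 0\<^sub>m (fst S) (fst M)"
  unfolding a_def[symmetric] b_def[symmetric] by (rule eq_matI; auto simp: mm)+
  show "i * p + j * q = 1\<^sub>m (fst T)" unfolding fT
  by (rule eq_matI) (auto simp: mm)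
 qed (auto simp: fT i_def p_def j_def q_def a_def b_def)
 thus ?thesis using TR unfolding T_def S_def by blast
qed

lemma rep_direct_sum_Rep: "set Ms \<subseteq> Rep d ==> rep_direct_sum Ms \<in> Rep d"
proof (induction Ms)
 case Nil
 show ?case unfolding rep_direct_sum_Nil by (rule RepI) auto
next
 case (Cons M Ms)
 then show ?case using rep_direct_sum_Cons[of M d Ms] by simp
qed

lemma fac_rep_direct_sum:
 assumes "N \<in> Rep d"
 shows "set Ms \<subseteq> Rep d ==> (\<forall>M \<in> set Ms. fac d M N) ==> fac d (rep_direct_sum Ms) N"
proof (induction Ms)
 case Nil
 have z: "0\<^sub>m 0 0 = (1\<^sub>m 0 :: 'a mat)" by (intro eq_matI) auto
 show ?case using thru.zero[of d N "rep_direct_sum []" "rep_direct_sum []"]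
  by (simp add: fac_def rep_direct_sum_Nil z)
next
 case (Cons M Ms)
 let ?S = "rep_direct_sum (M # Ms)" and ?S' = "rep_direct_sum Ms"
 have R: "M \<in> Rep d" "?S' \<in> Rep d" "?S \<in> Rep d" using Cons.prems rep_direct_sum_Rep[of Ms d] rep_direct_sum_Rep[of "M # Ms" d] by auto
 obtain i p j q where b: "biproduct d ?S M ?S' i p j q" using rep_direct_sum_Cons[OF R(1,2)] by blast
 have "thru d N ?S ?S (i * (1\<^sub>m (fst M) * p))"
  using b R assms Cons by (intro thru_comp_left[where M' = M] thru_comp_right[where M = M]) (auto simp: biproduct_def fac_def)
 moreover have "thru d N ?S ?S (j * (1\<^sub>m (fst ?S') * q))"
  using b R assms Cons by (intro thru_comp_left[where M' = ?S'] thru_comp_right[where M = ?S']) (auto simp: biproduct_def fac_def)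
 ultimately have "thru d N ?S ?S (i * (1\<^sub>m (fst M) * p) + j * (1\<^sub>m (fst ?S') * q))" by (intro thru_add)
 moreover have "dim_row p = fst M" "dim_row q = fst ?S'" using b by (auto simp: biproduct_def intertwiner_def)
 ultimately show ?case using b by (simp add: fac_def mat_dim_simps biproduct_def)
qed

lemma fac_rep_iso: "M \<in> Rep d ==> N \<in> Rep d ==> rep_iso d M N ==> fac d M N"
 unfolding rep_iso_iff by (blast intro: fac_retract)

lemma fac_sums_of:
 assumes "M \<in> sums_of d C" "N \<in> Rep d" "C \<subseteq> Rep d" "!!L. L \<in> C ==> fac d L N"
 shows "fac d M N"
proof -
 obtain Ms where Ms: "M \<in> Rep d" "set Ms \<subseteq> C" "rep_iso d M (rep_direct_sum Ms)"
  using assms by (auto simp: sums_of_def)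
 hence "rep_direct_sum Ms \<in> Rep d" "fac d (rep_direct_sum Ms) N"
  using assms by (auto intro!: rep_direct_sum_Rep fac_rep_direct_sum)
 thus ?thesis using fac_trans[OF Ms(1) _ assms(2) fac_rep_iso[OF Ms(1) _ Ms(3)]] by blast
qed

lemma fac_direct_summand:
 assumes "direct_summand d M N" "N \<in> Rep d"
 shows "fac d M N"
proof -
 obtain M' where M': "M \<in> Rep d" "M' \<in> Rep d" "rep_iso d N (rep_direct_sum [M, M'])"
  using assms by (auto simp: direct_summand_def)
 let ?S = "rep_direct_sum [M, M']"
 have R: "?S \<in> Rep d" "rep_direct_sum [M'] \<in> Rep d" using M' by (auto intro!: rep_direct_sum_Rep)
 obtain i p j q where b: "biproduct d ?S M (rep_direct_sum [M']) i p j q"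
  using rep_direct_sum_Cons[OF M'(1) R(2)] by blast
 have "fac d M ?S" using b unfolding biproduct_def by (blast intro: fac_retract)
 moreover have "rep_iso d ?S N" using M'(3) rep_iso_iff[OF assms(2) R(1)] rep_iso_iff[OF R(1) assms(2)] by blast
 ultimately show ?thesis using fac_trans[OF M'(1) R(1) assms(2)] fac_rep_iso[OF R(1) assms(2)] by blast
qed

text \<open>A splitting \<open>1 = B\<^sub>1 A\<^sub>1 + B\<^sub>2 A\<^sub>2\<close> identifies \<open>M\<close> with the direct sum of the two retracts.\<close>

lemma rep_iso_direct_sum_Cons:
 assumes R: "M \<in> Rep d" "M1 \<in> Rep d" "M2 \<in> Rep d" "set Ms \<subseteq> Rep d" and iso: "rep_iso d M2 (rep_direct_sum Ms)"
  and b: "biproduct d M M1 M2 B1 A1 B2 A2"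
 shows "rep_iso d M (rep_direct_sum (M1 # Ms))"
proof -
 let ?T = "rep_direct_sum Ms" and ?S = "rep_direct_sum (M1 # Ms)"
 have RS: "?T \<in> Rep d" "?S \<in> Rep d" using R rep_direct_sum_Rep[of Ms d] rep_direct_sum_Rep[of "M1 # Ms" d] by auto
 obtain i p j q where c: "biproduct d ?S M1 ?T i p j q" using rep_direct_sum_Cons[OF R(2) RS(1)] by blast
 obtain Q Q' where Q: "intertwiner d M2 ?T Q" "intertwiner d ?T M2 Q'" "Q * Q' = 1\<^sub>m (fst ?T)" "Q' * Q = 1\<^sub>m (fst M2)"
  using iso rep_iso_iff[OF R(3) RS(1)] by auto
 have bs: "intertwiner d M1 M B1" "intertwiner d M M1 A1" "intertwiner d M2 M B2" "intertwiner d M M2 A2"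
  and be: "A1 * B1 = 1\<^sub>m (fst M1)" "A2 * B2 = 1\<^sub>m (fst M2)" "B1 * A1 + B2 * A2 = 1\<^sub>m (fst M)"
  "A1 * B2 = 0\<^sub>m (fst M1) (fst M2)" "A2 * B1 = 0\<^sub>m (fst M2) (fst M1)" using b by (auto simp: biproduct_def)
 have cs: "intertwiner d M1 ?S i" "intertwiner d ?S M1 p" "intertwiner d ?T ?S j" "intertwiner d ?S ?T q"
  and ce: "p * i = 1\<^sub>m (fst M1)" "q * j = 1\<^sub>m (fst ?T)" "i * p + j * q = 1\<^sub>m (fst ?S)"
  "p * j = 0\<^sub>m (fst M1) (fst ?T)" "q * i = 0\<^sub>m (fst ?T) (fst M1)" using c by (auto simp: biproduct_def)
 note d = bs[THEN intertwinerD(1)] bs[THEN intertwinerD(2)] cs[THEN intertwinerD(1)] cs[THEN intertwinerD(2)]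
  Q(1,2)[THEN intertwinerD(1)] Q(1,2)[THEN intertwinerD(2)]
 have ext: "x * y = z ==> dim_col x = dim_row y ==> dim_col y = dim_row t ==> x * (y * t) = z * t"
  for x y z t :: "'a mat" using mult_mat_assoc[of x y t] by simp
 note ee = be(1,2,4,5)[THEN ext] ce(1,2,4,5)[THEN ext] Q(3,4)[THEN ext]
 let ?X = "i * A1 + j * (Q * A2)" and ?Y = "B1 * p + B2 * (Q' * q)"
 have "intertwiner d M ?S ?X" "intertwiner d ?S M ?Y"
  using R RS bs cs Q by (blast intro: intertwiner_add intertwiner_comp)+
 moreover have "?X * ?Y = 1\<^sub>m (fst ?S)"
  using d by (simp add: mat_dim_simps ee ce be Q add_mat_zero del: assoc_mult_mat)
 moreover have "?Y * ?X = 1\<^sub>m (fst M)"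
  using d by (simp add: mat_dim_simps ee ce be Q add_mat_zero del: assoc_mult_mat)
 ultimately show ?thesis using rep_iso_iff[OF R(1) RS(2)] by blast
qed

text \<open>Split the matrix e as B A with A B = 1 and let a permutation act on the smaller space by
  A rho B. This is multiplicative because e commutes with the action. The same for 1 - e gives the
  complement.\<close>

lemma split_idempotent_intertwiner:
 assumes M: "M \<in> Rep d" and e: "intertwiner d M M e" "e * e = e"
 shows "EX M1 M2 B1 A1 B2 A2. M1 \<in> Rep d & M2 \<in> Rep d & biproduct d M M1 M2 B1 A1 B2 A2 & B1 * A1 = e"
proof -
 let ?n = "fst M"
 have retract: "EX M1 B A. M1 \<in> Rep d & intertwiner d M1 M B & intertwiner d M M1 A & A * B = 1\<^sub>m (fst M1) & B * A = e"
  if e: "intertwiner d M M e" "e * e = e" for e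
 proof -
  note de = intertwinerD(1,2)[OF e(1)]
  obtain r A B where AB: "dim_row A = r" "dim_col A = ?n" "dim_row B = ?n" "dim_col B = r" "B * A = e" "A * B = 1\<^sub>m r"
  using idempotent_split[OF de e(2)] by blast
  have ext: "x * y = z ==> dim_col x = dim_row y ==> dim_col y = dim_row t ==> x * (y * t) = z * t"
  for x y z t :: "'a mat" using mult_mat_assoc[of x y t] by simp
  define M1 where "M1 = (r, %sz. A * (snd M sz * B))"
  have AeA: "A * e = A" using AB(1-4,6) by (simp add: AB(5)[symmetric] ext[OF AB(6)] mult_mat_one)
  have eB: "e * B = B" using AB(1-4,6) by (simp add: AB(5)[symmetric] mat_dim_simps)
  have Ae: "A * (snd M sz * e) = A * snd M sz" "e * (snd M sz * B) = snd M sz * B" if s: "sz permutes {1..d}" for sz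
  proof -
  note dd = RepD(1,2)[OF M s] AB(1-4) de
  have "A * (snd M sz * e) = (A * e) * snd M sz" using intertwinerD(3)[OF e(1) s] dd by (simp add: mult_mat_assoc)
  thus "A * (snd M sz * e) = A * snd M sz" by (simp add: AeA)
  have "e * (snd M sz * B) = e * snd M sz * B" using dd by (simp add: mult_mat_assoc)
  also have "... = snd M sz * (e * B)" unfolding intertwinerD(3)[OF e(1) s] using dd by (simp add: mult_mat_assoc)
  finally show "e * (snd M sz * B) = snd M sz * B" by (simp add: eB)
  qed
  have MA: "A * snd M sz = snd M1 sz * A" "B * snd M1 sz = snd M sz * B" if s: "sz permutes {1..d}" for sz
  proof -
  note dd = RepD(1,2)[OF M s] AB(1-4) de
  have "snd M1 sz * A = A * (snd M sz * e)" using dd by (simp add: M1_def mult_mat_assoc AB(5))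
  thus "A * snd M sz = snd M1 sz * A" by (simp add: Ae[OF s])
  have "B * snd M1 sz = (B * A) * (snd M sz * B)" using dd by (simp add: M1_def mult_mat_assoc)
  thus "B * snd M1 sz = snd M sz * B" using Ae[OF s] AB(5) by simp
  qed
  have "M1 \<in> Rep d"
  proof -
  have "(fst M1, snd M1) \<in> Rep d"
  proof (rule RepI)
   fix sz tz assume s: "sz permutes {1..d}" and t: "tz permutes {1..d}"
   note dd = RepD(1,2)[OF M s] RepD(1,2)[OF M t] AB(1-4)
   have "snd M1 sz * snd M1 tz = A * (snd M sz * (B * snd M1 tz))"
    using dd by (simp add: M1_def mult_mat_assoc)
   also have "... = snd M1 (sz o tz)"
    using dd by (simp add: MA(2)[OF t]) (simp add: M1_def RepD(3)[OF M s t] mult_mat_assoc)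
   finally show "snd M1 (sz o tz) = snd M1 sz * snd M1 tz" by simp
  next
   show "snd M1 id = 1\<^sub>m (fst M1)" using AB RepD(4)[OF M permutes_id] by (simp add: M1_def mult_mat_one)
  qed (use AB RepD(1,2)[OF M] in \<open>auto simp: M1_def\<close>)
  thus ?thesis by simp
  qed
  thus ?thesis using MA AB by (intro exI[of _ M1] exI[of _ B] exI[of _ A]) (auto simp: intertwiner_def M1_def)
 qed
 note de = intertwinerD(1,2)[OF e(1)]
 define e' where "e' = 1\<^sub>m ?n + (-1) \<cdot>\<^sub>m e"
 have de': "dim_row e' = ?n" "dim_col e' = ?n" using de by (auto simp: e'_def)
 have i': "intertwiner d M M e'" unfolding e'_def
  by (intro intertwiner_add intertwiner_one intertwiner_smult e M)
 have sm: "((-1) \<cdot>\<^sub>m x) * y = (-1) \<cdot>\<^sub>m (x * y)" "x * ((-1) \<cdot>\<^sub>m y) = (-1) \<cdot>\<^sub>m (x * y)"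
  if "dim_col x = dim_row y" for x y :: "'a mat"
  using that by (auto simp: mult_smult_assoc_mat[of x "dim_row x" "dim_col x"] mult_smult_distrib[of x "dim_row x" "dim_col x"])
 have ee': "e * e' = 0\<^sub>m ?n ?n" "e' * e = 0\<^sub>m ?n ?n"
  using de e(2) by (auto simp: e'_def mat_dim_simps sm intro!: eq_matI)
 have "e' * e' = e' + (-1) \<cdot>\<^sub>m (e * e')"
  using de de' by (subst e'_def) (simp add: mat_dim_simps sm)
 hence e'2: "e' * e' = e'" using de' by (auto simp: ee')
 obtain M1 B1 A1 where 1: "M1 \<in> Rep d" "intertwiner d M1 M B1" "intertwiner d M M1 A1" "A1 * B1 = 1\<^sub>m (fst M1)" "B1 * A1 = e"
  using retract[OF e] by blast
 obtain M2 B2 A2 where 2: "M2 \<in> Rep d" "intertwiner d M2 M B2" "intertwiner d M M2 A2" "A2 * B2 = 1\<^sub>m (fst M2)" "B2 * A2 = e'"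
  using retract[OF i' e'2] by blast
 note d = 1(2,3)[THEN intertwinerD(1)] 1(2,3)[THEN intertwinerD(2)] 2(2,3)[THEN intertwinerD(1)] 2(2,3)[THEN intertwinerD(2)]
 \<comment> \<open>Orthogonality of the idempotents passes to their splittings: A B' = (A B) (A B')
   (A' B') = A (B A) (B' A') B' = 0.\<close>
 have cross: "A * B' = 0\<^sub>m r r'" if "A * B = 1\<^sub>m r" "A' * B' = 1\<^sub>m r'" "(B * A) * (B' * A') = 0\<^sub>m ?n ?n"
  "dim_row A = r" "dim_col A = ?n" "dim_row B = ?n" "dim_col B = r"
  "dim_row A' = r'" "dim_col A' = ?n" "dim_row B' = ?n" "dim_col B' = r'" for A B A' B' :: "'a mat" and r r'
 proof -
  have "A * B' = (A * B) * (A * B') * (A' * B')" using that by (simp add: mult_mat_one)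
  also have "... = A * ((B * A) * (B' * A')) * B'" using that(4-) by (simp add: mult_mat_assoc)
  finally show ?thesis unfolding that(3) using that(4-) by (simp add: mat_dim_simps)
 qed
 have "biproduct d M M1 M2 B1 A1 B2 A2"
  unfolding biproduct_def
 proof (intro conjI)
  show "B1 * A1 + B2 * A2 = 1\<^sub>m (fst M)" using 1 2 de by (auto simp: e'_def intro!: eq_matI)
  show "A1 * B2 = 0\<^sub>m (fst M1) (fst M2)" using cross[OF 1(4) 2(4)] ee' 1 2 d by simp
  show "A2 * B1 = 0\<^sub>m (fst M2) (fst M1)" using cross[OF 2(4) 1(4)] ee' 1 2 d by simp
 qed (use 1 2 in simp_all)
 thus ?thesis using 1 2 by blast
qed

lemma rep_direct_sum_singleton: "rep_direct_sum [M] = M"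
 by (simp add: rep_direct_sum_def prod_eq_iff del: diag_block_mat.simps)

lemma rep_iso_refl: "M \<in> Rep d ==> rep_iso d M M"
 using intertwiner_one[of M d] by (auto simp: rep_iso_iff mat_dim_simps intro!: exI[of _ "1\<^sub>m (fst M)"])

lemma biproduct_iso:
 assumes "M \<in> Rep d" "M1 \<in> Rep d" "M2 \<in> Rep d" "biproduct d M M1 M2 B1 A1 B2 A2"
 shows "rep_iso d M (rep_direct_sum [M1, M2])"
 using rep_iso_direct_sum_Cons[OF assms(1-3) _ _ assms(4), of "[M2]"] assms
 by (simp add: rep_direct_sum_singleton rep_iso_refl)

lemma biproduct_dim:
 assumes "M \<in> Rep d" "M1 \<in> Rep d" "M2 \<in> Rep d" "biproduct d M M1 M2 B1 A1 B2 A2"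
 shows "fst M = fst M1 + fst M2"
 using biproduct_iso[OF assms] by (simp add: rep_iso_def rep_direct_sum_def)

text \<open>The idempotent B A is split once more; of the two summands obtained, the image is
  exchanged for L itself and the complement is kept.\<close>

lemma retract_complement:
 assumes R: "M \<in> Rep d" "L \<in> Rep d" and B: "intertwiner d L M B" and A: "intertwiner d M L A" and AB: "A * B = 1\<^sub>m (fst L)"
 shows "EX M2 B2 A2. M2 \<in> Rep d & biproduct d M L M2 B A B2 A2"
proof -
 have ext: "x * y = z ==> dim_col x = dim_row y ==> dim_col y = dim_row t ==> x * (y * t) = z * t"
  for x y z t :: "'a mat" using mult_mat_assoc[of x y t] by simp
 note d = intertwinerD(1,2)[OF A] intertwinerD(1,2)[OF B]
 have "intertwiner d M M (B * A)" "(B * A) * (B * A) = B * A"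
  using intertwiner_comp[OF R(1,2,1) A B] d by (simp_all add: mat_dim_simps ext[OF AB])
 from split_idempotent_intertwiner[OF R(1) this] obtain M1 M2 B1 A1 B2 A2 where
  s: "M1 \<in> Rep d" "M2 \<in> Rep d" "biproduct d M M1 M2 B1 A1 B2 A2" "B1 * A1 = B * A" by blast
 have i: "intertwiner d M1 M B1" "intertwiner d M M1 A1" "intertwiner d M2 M B2" "intertwiner d M M2 A2"
  and be: "A2 * B2 = 1\<^sub>m (fst M2)" "B1 * A1 + B2 * A2 = 1\<^sub>m (fst M)"
  "A1 * B2 = 0\<^sub>m (fst M1) (fst M2)" "A2 * B1 = 0\<^sub>m (fst M2) (fst M1)" using s by (auto simp: biproduct_def)
 note dd = d i[THEN intertwinerD(1)] i[THEN intertwinerD(2)]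
 have "A * B2 = A * ((B * A) * B2)" using dd by (simp add: mult_mat_assoc ext[OF AB] mult_mat_one)
 also have "... = 0\<^sub>m (fst L) (fst M2)" unfolding s(4)[symmetric] using dd by (simp add: mult_mat_assoc be mult_mat_zero)
 finally have 1: "A * B2 = 0\<^sub>m (fst L) (fst M2)" .
 have "A2 * B = A2 * ((B * A) * B)" using dd AB by (simp add: mult_mat_assoc mult_mat_one)
 also have "... = 0\<^sub>m (fst M2) (fst L)" unfolding s(4)[symmetric] using dd by (simp add: mult_mat_assoc ext[OF be(4)] mult_mat_zero)
 finally have 2: "A2 * B = 0\<^sub>m (fst M2) (fst L)" .
 show ?thesis using s 1 2 A B AB i be by (intro exI[of _ M2] exI[of _ B2] exI[of _ A2]) (auto simp: biproduct_def)
qed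

lemma retract_direct_summand:
 assumes "M \<in> Rep d" "L \<in> Rep d" "intertwiner d L M B" "intertwiner d M L A" "A * B = 1\<^sub>m (fst L)"
 shows "direct_summand d L M"
 using retract_complement[OF assms] biproduct_iso[OF assms(1,2)] assms(2) unfolding direct_summand_def by blast

lemma pow_mat_intertwiner:
 assumes "L \<in> Rep d" "intertwiner d L L f"
 shows "intertwiner d L L (f ^\<^sub>m k)"
proof (induction k)
 case 0
 show ?case using intertwiner_one[OF assms(1)] intertwinerD(1)[OF assms(2)] by simp
next
 case (Suc k)
 show ?case using intertwiner_comp[OF assms(1,1,1,2) Suc] by simp
qed

text \<open>Fitting's lemma.\<close>

lemma fitting:
 assumes L: "L \<in> Rep d" and f: "intertwiner d L L f"
  and indec: "!!e. intertwiner d L L e ==> e * e = e ==> e = 0\<^sub>m (fst L) (fst L) \<or> e = 1\<^sub>m (fst L)"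
 shows "(EX a. f ^\<^sub>m a = 0\<^sub>m (fst L) (fst L)) \<or> (EX g. intertwiner d L L g & g * f = 1\<^sub>m (fst L))"
proof -
 define n where "n = fst L"
 have ext: "x * y = z ==> dim_col x = dim_row y ==> dim_col y = dim_row t ==> x * (y * t) = z * t"
  for x y z t :: "'a mat" using mult_mat_assoc[of x y t] by simp
 note df = intertwinerD(1,2)[OF f, folded n_def]
 have fc: "f \<in> carrier_mat n n" using df by auto
 \<comment> \<open>Restricting to endomorphisms that commute with \<open>f\<close> ensures that the
   \<open>g\<close> obtained from the power relation commutes with \<open>f\<close> as well.\<close>
 define S where "S = {x. intertwiner d L L x & x * f = f * x}"
 have dS: "dim_row x = n & dim_col x = n" if "x \<in> S" for x using that by (auto simp: S_def n_def dest: intertwinerD)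
 have "EX a. \<exists>g \<in> S. f ^\<^sub>m a = f ^\<^sub>m (Suc a) * g"
 proof (rule strongly_pi_regular)
  show "f \<in> carrier_mat n n" by (rule fc)
  show "0\<^sub>m n n \<in> S" using intertwiner_zero[OF L L] df by (simp add: S_def n_def mult_mat_zero)
  show "1\<^sub>m n \<in> S" using intertwiner_one[OF L] df by (simp add: S_def n_def mult_mat_one)
  show "x + y \<in> S" if "x \<in> S" "y \<in> S" for x y
  using that intertwiner_add[OF L L] df dS[OF that(1)] dS[OF that(2)] by (simp add: S_def mat_dim_simps)
  show "c \<cdot>\<^sub>m x \<in> S" if "x \<in> S" for x c
  proof -
  have x: "x \<in> carrier_mat n n" using dS[OF that] by auto
  show ?thesis using that intertwiner_smult[OF L L] mult_smult_assoc_mat[OF x fc] mult_smult_distrib[OF fc x] by (simp add: S_def)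
  qed
  show "x * f \<in> S" if x: "x \<in> S" for x
  proof -
  have xf: "intertwiner d L L x" "x * f = f * x" using x by (auto simp: S_def)
  have "x * f * f = f * x * f" by (simp only: xf)
  also have "... = f * (x * f)" using df dS[OF x] by (simp add: mult_mat_assoc)
  finally show ?thesis using intertwiner_comp[OF L L L f xf(1)] by (simp only: S_def mem_Collect_eq)
  qed
  show "S \<subseteq> carrier_mat n n" using dS by auto
 qed
 then obtain a g where ag: "g \<in> S" "f ^\<^sub>m a = f ^\<^sub>m (Suc a) * g" by blast
 have gi: "intertwiner d L L g" and gf: "g * f = f * g" using ag by (auto simp: S_def)
 have dg: "dim_row g = n" "dim_col g = n" using dS[OF ag(1)] by auto
 have dp: "dim_row (h ^\<^sub>m k) = n" "dim_col (h ^\<^sub>m k) = n" if "dim_row h = n" "dim_col h = n" for h :: "'a mat" and k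
  using that pow_carrier_mat[of h n k] by auto
 have comm: "y * x ^\<^sub>m k = x ^\<^sub>m k * y" if "y * x = x * y" "dim_row x = n" "dim_col x = n" "dim_row y = n" "dim_col y = n"
  for x y :: "'a mat" and k
 proof (induction k)
  case 0
  show ?case using that by (simp add: mult_mat_one)
 next
  case (Suc k)
  have "y * x ^\<^sub>m Suc k = (y * x ^\<^sub>m k) * x" using that dp by (simp add: mult_mat_assoc)
  also have "... = x ^\<^sub>m k * (y * x)" using that dp by (simp add: mult_mat_assoc Suc)
  also have "... = x ^\<^sub>m Suc k * y" using that dp by (simp add: mult_mat_assoc)
  finally show ?case .
 qed
 define F where "F = f ^\<^sub>m a"
 have dF: "dim_row F = n" "dim_col F = n" using dp[OF df] by (auto simp: F_def)
 have Fg: "g * F = F * g" unfolding F_def using comm[OF gf df dg] .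
 \<comment> \<open>From f^a = f^(a+1) g the exponent can be raised at will. For k = a this reads F =
   F F G, so F G is idempotent, hence 0 or 1; these are the nilpotent and the invertible
   case.\<close>
 have FF: "F = f ^\<^sub>m k * F * g ^\<^sub>m k" for k
 proof (induction k)
  case 0
  show ?case using df dg dF by (simp add: mult_mat_one)
 next
  case (Suc k)
  have fF: "f * F = F * f" unfolding F_def by (rule comm) (use df in auto)
  have F1: "F = f * F * g" using ag(2) fF by (simp add: F_def)
  have "f ^\<^sub>m Suc k * F * g ^\<^sub>m Suc k = f ^\<^sub>m k * (f * (F * g ^\<^sub>m k)) * g" using df dg dF dp by (simp add: mult_mat_assoc)
  also have "F * g ^\<^sub>m k = g ^\<^sub>m k * F" by (rule comm) (use Fg dg dF in auto)
  also have "f * (g ^\<^sub>m k * F) = g ^\<^sub>m k * (f * F)"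
  using comm[OF gf[symmetric] dg df, of k] df dg dF dp mult_mat_assoc[of f "g ^\<^sub>m k" F] by (simp add: mult_mat_assoc)
  also have "f ^\<^sub>m k * (g ^\<^sub>m k * (f * F)) * g = f ^\<^sub>m k * (g ^\<^sub>m k * (f * F * g))" using df dg dF dp by (simp add: mult_mat_assoc)
  also have "... = f ^\<^sub>m k * (g ^\<^sub>m k * F)" using F1 by simp
  also have "g ^\<^sub>m k * F = F * g ^\<^sub>m k" by (rule comm[symmetric]) (use Fg dg dF in auto)
  also have "f ^\<^sub>m k * (F * g ^\<^sub>m k) = F" using Suc df dg dF dp by (simp add: mult_mat_assoc)
  finally show ?case by simp
 qed
 define G where "G = g ^\<^sub>m a"
 have dG: "dim_row G = n" "dim_col G = n" using dp[OF dg] by (auto simp: G_def)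
 have GF: "G * F = F * G" unfolding G_def by (rule comm[symmetric]) (use Fg dg dF in auto)
 have FFG: "F * (F * G) = F" using FF[of a] dF dG by (simp add: F_def[symmetric] G_def[symmetric] mult_mat_assoc)
 have "(F * G) * (F * G) = (F * (G * F)) * G" using dF dG by (simp add: mult_mat_assoc)
 also have "... = F * G" unfolding GF FFG ..
 finally have ee: "(F * G) * (F * G) = F * G" .
 have Fi: "intertwiner d L L F" and Gi: "intertwiner d L L G"
  unfolding F_def G_def by (intro pow_mat_intertwiner L f gi)+
 from indec[OF intertwiner_comp[OF L L L Gi Fi] ee] show ?thesis
 proof
  assume "F * G = 0\<^sub>m (fst L) (fst L)"
  hence "F = 0\<^sub>m n n" using FFG dF by (simp add: n_def mult_mat_zero)
  thus ?thesis unfolding F_def n_def by blast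
 next
  assume FG: "F * G = 1\<^sub>m (fst L)"
  show ?thesis
  proof (cases a)
  case 0
  have "F = 1\<^sub>m n" using df 0 by (simp add: F_def)
  hence "1\<^sub>m n = g * f" using ag(2) df 0 gf by (simp add: mult_mat_one)
  thus ?thesis using gi by (auto simp: n_def)
  next
  case (Suc b)
  have "(G * f ^\<^sub>m b) * f = G * F" using Suc dG df dp by (simp add: F_def mult_mat_assoc)
  hence "(G * f ^\<^sub>m b) * f = 1\<^sub>m (fst L)" using GF FG by simp
  thus ?thesis using intertwiner_comp[OF L L L pow_mat_intertwiner[OF L f] Gi] by blast
  qed
 qed
qed

text \<open>If neither f nor g had a left inverse, both would be nilpotent by Fitting's lemma. The
  last nonzero power X of f satisfies X f = 0, so X = X (f + g) = X g = X g^b = 0 for large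
  b.\<close>

lemma indecomposable_local:
 assumes L: "L \<in> Rep d" and pos: "fst L > 0"
  and indec: "!!e. intertwiner d L L e ==> e * e = e ==> e = 0\<^sub>m (fst L) (fst L) \<or> e = 1\<^sub>m (fst L)"
  and f: "intertwiner d L L f" and g: "intertwiner d L L g" and fg: "f + g = 1\<^sub>m (fst L)"
 shows "(EX h. intertwiner d L L h & h * f = 1\<^sub>m (fst L)) \<or> (EX h. intertwiner d L L h & h * g = 1\<^sub>m (fst L))"
proof (rule ccontr)
 assume neg: "\<not> ?thesis"
 define n where "n = fst L"
 have np: "n > 0" using pos by (simp add: n_def)
 note df = intertwinerD(1,2)[OF f, folded n_def] and dg = intertwinerD(1,2)[OF g, folded n_def]
 obtain a0 where "f ^\<^sub>m a0 = 0\<^sub>m n n" using fitting[OF L f indec] neg by (auto simp: n_def)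
 obtain b where b: "g ^\<^sub>m b = 0\<^sub>m n n" using fitting[OF L g indec] neg by (auto simp: n_def)
 have dp: "dim_row (h ^\<^sub>m k) = n" "dim_col (h ^\<^sub>m k) = n" if "dim_row h = n" "dim_col h = n" for h :: "'a mat" and k
  using that pow_carrier_mat[of h n k] by auto
 define a where "a = (LEAST a. f ^\<^sub>m a = 0\<^sub>m n n)"
 have a: "f ^\<^sub>m a = 0\<^sub>m n n" unfolding a_def using \<open>f ^\<^sub>m a0 = 0\<^sub>m n n\<close> by (rule LeastI)
 have "(1\<^sub>m n :: 'a mat) $$ (0, 0) ~= 0\<^sub>m n n $$ (0, 0)" using np by simp
 hence "a ~= 0" using a df by (metis pow_mat.simps(1))
 then obtain a' where a': "a = Suc a'" by (cases a) auto
 define X where "X = f ^\<^sub>m a'"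
 have X0: "X ~= 0\<^sub>m n n" unfolding X_def using not_less_Least[of a' "%a. f ^\<^sub>m a = 0\<^sub>m n n"] a' by (simp add: a_def)
 have dX: "dim_row X = n" "dim_col X = n" using dp[OF df] by (auto simp: X_def)
 have Xf: "X * f = 0\<^sub>m n n" using a a' by (simp add: X_def)
 have "X = X * (f + g)" using fg dX by (simp add: n_def mult_mat_one)
 also have "... = X * g" using Xf dX df dg by (simp add: mat_dim_simps)
 finally have Xg: "X * g = X" by simp
 have "X * g ^\<^sub>m k = X" for k
 proof (induction k)
  case 0
  show ?case using dX dg by (simp add: mult_mat_one)
 next
  case (Suc k)
  have "X * g ^\<^sub>m Suc k = (X * g ^\<^sub>m k) * g" using dX dg dp by (simp add: mult_mat_assoc)
  thus ?case using Suc Xg by simp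
 qed
 from this[of b] b dX have "X = 0\<^sub>m n n" by (simp add: mult_mat_zero)
 thus False using X0 by simp
qed

text \<open>In a local ring, a sum with a left inverse has a summand with a left inverse. The
  multiplier u absorbs the inverses met on the way, so the induction strips off one composite at a
  time until one of them is the retraction.\<close>

lemma thru_local_retract:
 assumes L: "L \<in> Rep d" and N: "N \<in> Rep d" and pos: "fst L > 0"
  and indec: "!!e. intertwiner d L L e ==> e * e = e ==> e = 0\<^sub>m (fst L) (fst L) \<or> e = 1\<^sub>m (fst L)"
 shows "thru d N L L C ==> intertwiner d L L u ==> u * C = 1\<^sub>m (fst L) ==>
  EX A B. intertwiner d L N A & intertwiner d N L B & B * A = 1\<^sub>m (fst L)"
proof (induction arbitrary: u rule: thru.induct)
 case zero
 note du = intertwinerD(1,2)[OF zero(1)]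
 have "(0\<^sub>m (fst L) (fst L) :: 'a mat) $$ (0, 0) = 1\<^sub>m (fst L) $$ (0, 0)"
  using zero(2) du by (simp add: mult_mat_zero)
 thus ?case using pos by simp
next
 case (step C A B)
 note dims = intertwinerD(1,2)[OF step(2)] intertwinerD(1,2)[OF step(3)] intertwinerD(1,2)[OF step(5)] thru_dim[OF step(1)]
 have "u * C + (u * B) * A = 1\<^sub>m (fst L)" using step(6) dims by (simp add: mat_dim_simps)
 moreover have "intertwiner d L L (u * C)" using intertwiner_comp[OF L L L thru_intertwiner[OF step(1) L N L] step(5)] .
 moreover have uB: "intertwiner d N L (u * B)" using intertwiner_comp[OF N L L step(3,5)] .
 moreover have "intertwiner d L L ((u * B) * A)" using intertwiner_comp[OF L N L step(2) uB] .
 ultimately consider h where "intertwiner d L L h" "h * (u * C) = 1\<^sub>m (fst L)"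
  | h where "intertwiner d L L h" "h * ((u * B) * A) = 1\<^sub>m (fst L)"
  using indecomposable_local[OF L pos indec] by blast
 thus ?case
 proof cases
  case 1
  show ?thesis using step(4)[OF intertwiner_comp[OF L L L step(5) 1(1)]] 1 dims intertwinerD(1,2)[OF 1(1)]
  by (simp add: mult_mat_assoc)
 next
  case 2
  show ?thesis using 2 step(2) dims intertwinerD(1,2)[OF 2(1)] intertwiner_comp[OF N L L uB 2(1)]
  by (intro exI[of _ A] exI[of _ "h * (u * B)"]) (simp add: mult_mat_assoc)
 qed
qed

text \<open>A nonzero retract L of M of least dimension has no idempotent endomorphisms besides 0
  and 1. Its endomorphism ring is therefore local, and being a summand of copies of N it is a
  summand of N itself. Split off L and continue with the complement, which has smaller
  dimension.\<close>

lemma krull_schmidt: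
 assumes N: "N \<in> Rep d"
 shows "M \<in> Rep d ==> fac d M N ==> EX Ms. set Ms \<subseteq> {L. direct_summand d L N} & rep_iso d M (rep_direct_sum Ms)"
proof (induction "fst M" arbitrary: M rule: less_induct)
 case less
 note M = less(2)
 show ?case
 proof (cases "fst M = 0")
  case True
  have "rep_iso d M (rep_direct_sum [])" unfolding rep_iso_def rep_direct_sum_Nil
  using True RepD(1,2)[OF M]
  by (auto simp: carrier_GL sym_group_def mat_dim_simps intro!: bexI[of _ "1\<^sub>m 0"] exI[of _ "1\<^sub>m 0"])
  thus ?thesis by (intro exI[of _ "[]"]) simp
 next
  case False
  define P where "P L \<longleftrightarrow> L \<in> Rep d & fst L > 0 &
  (EX B A. intertwiner d L M B & intertwiner d M L A & A * B = 1\<^sub>m (fst L))" for L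
  have "P M" unfolding P_def using False M intertwiner_one[OF M] by (auto simp: mat_dim_simps intro!: exI[of _ "1\<^sub>m (fst M)"])
  hence "EX L. P L & (ALL L'. P L' --> fst L \<le> fst L')" by (rule ex_has_least_nat)
  then obtain L where L: "P L" and min: "!!L'. P L' ==> fst L \<le> fst L'" by blast
  then obtain B A where BA: "L \<in> Rep d" "fst L > 0" "intertwiner d L M B" "intertwiner d M L A" "A * B = 1\<^sub>m (fst L)"
  unfolding P_def by blast
  note dd = intertwinerD(1,2)[OF BA(3)] intertwinerD(1,2)[OF BA(4)]
  have ext: "x * y = z ==> dim_col x = dim_row y ==> dim_col y = dim_row t ==> x * (y * t) = z * t"
  for x y z t :: "'a mat" using mult_mat_assoc[of x y t] by simp
  have indec: "e = 0\<^sub>m (fst L) (fst L) \<or> e = 1\<^sub>m (fst L)" if e: "intertwiner d L L e" "e * e = e" for e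
  proof -
  obtain L1 L2 B1 A1 B2 A2 where s: "L1 \<in> Rep d" "L2 \<in> Rep d" "biproduct d L L1 L2 B1 A1 B2 A2" "B1 * A1 = e"
   using split_idempotent_intertwiner[OF BA(1) e] by blast
  have dim: "fst L = fst L1 + fst L2" using biproduct_dim[OF BA(1) s(1-3)] .
  have i: "intertwiner d L1 L B1" "intertwiner d L L1 A1" "intertwiner d L2 L B2" "intertwiner d L L2 A2"
   and be: "A1 * B1 = 1\<^sub>m (fst L1)" "B1 * A1 + B2 * A2 = 1\<^sub>m (fst L)"
   using s by (auto simp: biproduct_def)
  note di = i[THEN intertwinerD(1)] i[THEN intertwinerD(2)]
  have "P L1" if "fst L1 > 0" unfolding P_def
  proof (intro conjI exI)
   show "intertwiner d L1 M (B * B1)" using intertwiner_comp[OF s(1) BA(1) M i(1) BA(3)] .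
   show "intertwiner d M L1 (A1 * A)" using intertwiner_comp[OF M BA(1) s(1) BA(4) i(2)] .
   show "(A1 * A) * (B * B1) = 1\<^sub>m (fst L1)" using dd di be by (simp add: mult_mat_assoc ext[OF BA(5)] mult_mat_one)
  qed (use that s in auto)
  hence "fst L1 = 0 \<or> fst L2 = 0" using min[of L1] dim by fastforce
  thus ?thesis
  proof
   assume "fst L1 = 0"
   hence "B1 * A1 = 0\<^sub>m (fst L) (fst L)" using di by (intro eq_matI) (auto simp: scalar_prod_def)
   thus ?thesis using s(4) by simp
  next
   assume "fst L2 = 0"
   hence "B2 * A2 = 0\<^sub>m (fst L) (fst L)" using di by (intro eq_matI) (auto simp: scalar_prod_def)
   thus ?thesis using s(4) be(2) intertwinerD(1,2)[OF e(1)] by (simp add: add_mat_zero)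
  qed
  qed
  have "fac d L M" using fac_retract[OF BA(3,4,5)] .
  hence "fac d L N" using fac_trans[OF BA(1) M N _ less(3)] by simp
  hence th: "thru d N L L (1\<^sub>m (fst L))" by (simp add: fac_def)
  have "EX A B. intertwiner d L N A & intertwiner d N L B & B * A = 1\<^sub>m (fst L)"
  by (rule thru_local_retract[OF BA(1) N BA(2) indec th intertwiner_one[OF BA(1)]]) (simp_all add: mult_mat_one)
  then obtain A' B' where AB': "intertwiner d L N A'" "intertwiner d N L B'" "B' * A' = 1\<^sub>m (fst L)" by blast
  hence LN: "direct_summand d L N" by (intro retract_direct_summand[OF N BA(1)])
  obtain M2 B2 A2 where M2: "M2 \<in> Rep d" "biproduct d M L M2 B A B2 A2"
  using retract_complement[OF M BA(1,3,4,5)] by blast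
  have "fst M2 < fst M" using biproduct_dim[OF M BA(1) M2] BA(2) by simp
  moreover have "fac d M2 N"
  proof -
  have "fac d M2 M" using M2(2) unfolding biproduct_def by (blast intro: fac_retract)
  thus ?thesis using fac_trans[OF M2(1) M N _ less(3)] by simp
  qed
  ultimately obtain Ms where Ms: "set Ms \<subseteq> {L. direct_summand d L N}" "rep_iso d M2 (rep_direct_sum Ms)"
  using less(1)[OF _ M2(1)] by blast
  have "set Ms \<subseteq> Rep d" using Ms(1) by (auto simp: direct_summand_def)
  from rep_iso_direct_sum_Cons[OF M BA(1) M2(1) this Ms(2) M2(2)] Ms(1) LN
  show ?thesis by (intro exI[of _ "L # Ms"]) auto
 qed
qed

text \<open>\<open>B_obj\<close> speaks of sums of summands of N, while \<open>fac\<close> speaks of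
  summands of sums of N. That the latter are no more general is the content of
  \<open>krull_schmidt\<close>.\<close>

lemma sums_of_direct_summands_iff:
 assumes N: "N \<in> Rep d"
 shows "M \<in> sums_of d {L. direct_summand d L N} \<longleftrightarrow> M \<in> Rep d & fac d M N"
proof
 assume M: "M \<in> sums_of d {L. direct_summand d L N}"
 have "fac d M N" using fac_sums_of[OF M N] fac_direct_summand[OF _ N] by (auto simp: direct_summand_def)
 thus "M \<in> Rep d & fac d M N" using M by (auto simp: sums_of_def)
next
 assume "M \<in> Rep d & fac d M N"
 thus "M \<in> sums_of d {L. direct_summand d L N}" using krull_schmidt[OF N, of M] by (auto simp: sums_of_def)
qed

lemma relatively_discerning_iff_fac:
 fixes X :: "'k::field mat"
 assumes R: "!!Y. (Y :: 'k mat) \<in> Ver4p ==> tensor_power d Y \<in> Rep d" and X: "X \<in> Ver4p"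
 shows "relatively_discerning d X \<longleftrightarrow> (\<forall>Y \<in> Ver4p. fac d (tensor_power d Y) (tensor_power d X))"
proof -
 let ?C = "\<Union>Y \<in> (Ver4p :: 'k mat set). B_obj d Y"
 have B: "M \<in> B_obj d Y \<longleftrightarrow> M \<in> Rep d & fac d M (tensor_power d Y)" if "Y \<in> Ver4p" for M and Y :: "'k mat"
  unfolding B_obj_def by (rule sums_of_direct_summands_iff[OF R[OF that]])
 have sing: "M \<in> B_Ver4p d" if "M \<in> ?C" "M \<in> Rep d" for M
  unfolding B_Ver4p_def sums_of_def using that
  by (auto simp: rep_direct_sum_singleton rep_iso_refl intro!: exI[of _ "[M]"])
 show ?thesis
 proof
  assume d: "relatively_discerning d X"
  show "\<forall>Y \<in> Ver4p. fac d (tensor_power d Y) (tensor_power d X)"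
  proof
  fix Y :: "'k mat" assume Y: "Y \<in> Ver4p"
  have "tensor_power d Y \<in> B_obj d Y" using B[OF Y] R[OF Y] fac_refl by blast
  hence "tensor_power d Y \<in> B_Ver4p d" using sing R[OF Y] Y by blast
  hence "tensor_power d Y \<in> B_obj d X" using d by (simp add: relatively_discerning_def)
  thus "fac d (tensor_power d Y) (tensor_power d X)" using B[OF X] by blast
  qed
 next
  assume f: "\<forall>Y \<in> Ver4p. fac d (tensor_power d Y) (tensor_power d X)"
  have "B_Ver4p d \<subseteq> B_obj d X"
  proof
  fix M :: "'k perm_rep" assume M: "M \<in> B_Ver4p d"
  have "fac d M (tensor_power d X)"
  proof (rule fac_sums_of[OF M[unfolded B_Ver4p_def] R[OF X]])
   show "?C \<subseteq> Rep d"
   proof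
    fix L :: "'k perm_rep" assume "L \<in> ?C"
    then obtain Y :: "'k mat" where "Y \<in> Ver4p" "L \<in> B_obj d Y" by blast
    thus "L \<in> Rep d" using B[of Y L] by blast
   qed
   fix L :: "'k perm_rep" assume "L \<in> ?C"
   then obtain Y :: "'k mat" where "Y \<in> Ver4p" "L \<in> B_obj d Y" by blast
   hence "Y \<in> Ver4p" "L \<in> Rep d" "fac d L (tensor_power d Y)" using B[of Y L] by auto
   thus "fac d L (tensor_power d X)" using fac_trans[OF _ R R[OF X]] f by blast
  qed
  thus "M \<in> B_obj d X" using B[OF X] M by (auto simp: B_Ver4p_def sums_of_def)
  qed
  moreover have "B_obj d X \<subseteq> B_Ver4p d"
  proof
  fix M :: "'k perm_rep" assume "M \<in> B_obj d X"
  thus "M \<in> B_Ver4p d" using sing[of M] B[OF X, of M] X by blast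
  qed
  ultimately show "relatively_discerning d X" by (auto simp: relatively_discerning_def)
 qed
qed

section \<open>Kronecker products\<close>

lemma dim_kron [simp]: "dim_row (kron A B) = dim_row A * dim_row B" "dim_col (kron A B) = dim_col A * dim_col B"
 by (simp_all add: kron_def)

lemma sum_div_mod:
 "(\<Sum>k = 0..<a * b. f (k div b) (k mod b)) = (\<Sum>x = 0..<a. \<Sum>y = 0..<(b::nat). f x y)"
proof -
 have "(\<Sum>k < a * b. f (k div b) (k mod b)) = (\<Sum>x < a. \<Sum>k \<in> {x * b..<x * b + b}. f (k div b) (k mod b))"
  by (rule sum.nat_group[symmetric])
 also have "... = (\<Sum>x < a. \<Sum>y = 0..<b. f x y)"
 proof (rule sum.cong[OF refl])
  fix x
  have "(\<Sum>k \<in> {0 + x * b..<b + x * b}. f (k div b) (k mod b)) = (\<Sum>y = 0..<b. f ((y + x * b) div b) ((y + x * b) mod b))"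
  by (rule sum.shift_bounds_nat_ivl)
  also have "... = (\<Sum>y = 0..<b. f x y)" by (rule sum.cong) auto
  finally show "(\<Sum>k \<in> {x * b..<x * b + b}. f (k div b) (k mod b)) = (\<Sum>y = 0..<b. f x y)"
  by (simp add: add.commute)
 qed
 finally show ?thesis by (simp add: atLeast0LessThan)
qed

lemma index_kron:
 "i < dim_row A * dim_row B ==> j < dim_col A * dim_col B ==>
  kron A B $$ (i, j) = A $$ (i div dim_row B, j div dim_col B) * B $$ (i mod dim_row B, j mod dim_col B)"
 by (simp add: kron_def)

lemma div_mod_less: "i < a * (b::nat) ==> i div b < a" "i < a * b ==> i mod b < b"
 by (auto simp: less_mult_imp_div_less) (metis less_nat_zero_code mod_less_divisor mult_0_right neq0_conv)

lemma kron_mult: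
 assumes "dim_col A = dim_row C" "dim_col B = dim_row D"
 shows "kron A B * kron C D = kron (A * C) (B * D)"
proof (rule eq_matI)
 fix i j assume "i < dim_row (kron (A * C) (B * D))" "j < dim_col (kron (A * C) (B * D))"
 hence ij: "i < dim_row A * dim_row B" "j < dim_col C * dim_col D" by auto
 note l = div_mod_less[OF ij(1)] div_mod_less[OF ij(2)]
 let ?i = "i div dim_row B" and ?i' = "i mod dim_row B" and ?j = "j div dim_col D" and ?j' = "j mod dim_col D"
 have "(kron A B * kron C D) $$ (i, j) = (\<Sum>k = 0..<dim_row C * dim_row D.
  (A $$ (?i, k div dim_row D) * C $$ (k div dim_row D, ?j)) * (B $$ (?i', k mod dim_row D) * D $$ (k mod dim_row D, ?j')))"
  using ij assms by (auto simp: scalar_prod_def index_kron mult_ac intro!: sum.cong)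
 also have "... = (\<Sum>x = 0..<dim_row C. \<Sum>y = 0..<dim_row D.
  (A $$ (?i, x) * C $$ (x, ?j)) * (B $$ (?i', y) * D $$ (y, ?j')))"
  by (rule sum_div_mod)
 also have "... = (A * C) $$ (?i, ?j) * (B * D) $$ (?i', ?j')"
  using l assms by (simp add: scalar_prod_def sum_product)
 finally show "(kron A B * kron C D) $$ (i, j) = kron (A * C) (B * D) $$ (i, j)"
  using ij by (simp add: index_kron del: index_mult_mat(1))
qed auto

lemma kron_assoc: "kron A (kron B C) = kron (kron A B) C"
proof (rule eq_matI)
 fix i j assume "i < dim_row (kron (kron A B) C)" "j < dim_col (kron (kron A B) C)"
 hence ij: "i < dim_row A * dim_row B * dim_row C" "j < dim_col A * dim_col B * dim_col C" by auto
 have dm: "x div (b * c) = (x div c) div b" "(x mod (b * c)) div c = (x div c) mod b" "(x mod (b * c)) mod c = x mod c"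
  for x b c :: nat
  by (simp_all add: div_mult2_eq mult.commute[of b c] mod_mult2_eq) (cases "c = 0", auto simp: mod_mult2_eq)
 note l = div_mod_less[OF ij(1)] div_mod_less[OF ij(2)]
 have "i mod (dim_row B * dim_row C) < dim_row B * dim_row C" "j mod (dim_col B * dim_col C) < dim_col B * dim_col C"
  using ij by (auto intro!: mod_less_divisor Nat.gr0I)
 then show "kron A (kron B C) $$ (i, j) = kron (kron A B) C $$ (i, j)"
  using ij l by (simp add: index_kron mult.assoc dm)
qed (auto simp: mult.assoc)

lemma kron_one: "kron (1\<^sub>m a) (1\<^sub>m b) = 1\<^sub>m (a * b)"
proof (rule eq_matI)
 fix i j assume "i < dim_row (1\<^sub>m (a * b) :: 'a mat)" "j < dim_col (1\<^sub>m (a * b) :: 'a mat)"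
 hence ij: "i < a * b" "j < a * b" by auto
 have "i = j" if "i div b = j div b" "i mod b = j mod b" using that by (metis div_mult_mod_eq)
 thus "kron (1\<^sub>m a) (1\<^sub>m b) $$ (i, j) = (1\<^sub>m (a * b) :: 'a mat) $$ (i, j)"
  using ij div_mod_less[OF ij(1)] div_mod_less[OF ij(2)] by (auto simp: index_kron)
qed auto

lemma dim_flip_mat [simp]: "dim_row (flip_mat N) = N * N" "dim_col (flip_mat N) = N * N"
 by (simp_all add: flip_mat_def)

lemma flip_kron:
 assumes A: "dim_row A = N" "dim_col A = N"
 shows "flip_mat N * kron A A = kron A A * flip_mat N"
proof -
 \<comment> \<open>The exchange (a, b) to (b, a) of index pairs, an involution whose permutation
   matrix is \<open>flip_mat\<close>.\<close>
 define s where "s j = (j mod N) * N + j div N" for j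
 have s: "s j < N * N" "s j div N = j mod N" "s j mod N = j div N" "s (s j) = j" if "j < N * N" for j
 proof -
  have l: "j div N < N" "j mod N < N" using div_mod_less[OF that] by auto
  show d: "s j div N = j mod N" "s j mod N = j div N" using l by (auto simp: s_def)
  have "s j < Suc (j mod N) * N" using l by (simp add: s_def)
  also have "... \<le> N * N" using l by (intro mult_le_mono) (simp_all add: Suc_le_eq)
  finally show "s j < N * N" .
  show "s (s j) = j" using d by (simp add: s_def[of "s j"])
 qed
 have fl: "flip_mat N $$ (i, j) = (if i = s j then 1 else 0 :: 'a)" if "i < N * N" "j < N * N" for i j
  using that by (simp add: flip_mat_def s_def)
 show ?thesis
 proof (rule eq_matI)
  fix i j assume "i < dim_row (kron A A * flip_mat N)" "j < dim_col (kron A A * flip_mat N)"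
  hence ij: "i < N * N" "j < N * N" using A by auto
  have eq: "i = s k \<longleftrightarrow> k = s i" if "k < N * N" for k using s[OF that] s[OF ij(1)] by metis
  have "(flip_mat N * kron A A) $$ (i, j) = (\<Sum>k = 0..<N * N. flip_mat N $$ (i, k) * kron A A $$ (k, j))"
  using ij A by (simp add: scalar_prod_def)
  also have "... = (\<Sum>k = 0..<N * N. (if k = s i then kron A A $$ (k, j) else 0))"
  using ij eq by (intro sum.cong) (auto simp: fl)
  also have "... = kron A A $$ (s i, j)" using s(1)[OF ij(1)] by simp
  also have "... = kron A A $$ (i, s j)" using ij A s by (simp add: index_kron mult.commute)
  also have "... = (\<Sum>k = 0..<N * N. (if k = s j then kron A A $$ (i, k) else 0))" using s(1)[OF ij(2)] by simp
  also have "... = (\<Sum>k = 0..<N * N. kron A A $$ (i, k) * flip_mat N $$ (k, j))"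
  using ij by (intro sum.cong) (auto simp: fl)
  also have "... = (kron A A * flip_mat N) $$ (i, j)" using ij A by (simp add: scalar_prod_def)
  finally show "(flip_mat N * kron A A) $$ (i, j) = (kron A A * flip_mat N) $$ (i, j)" .
 qed (use A in auto)
qed

text \<open>Naturality of the braiding in module homomorphisms: the flip commutes with the tensor
  square of Q, and Y Q = Q D moves both copies of delta past it.\<close>

lemma braiding_intertwine:
 assumes Q: "dim_row Q = N" "dim_col Q = N" and D: "dim_row D = N" "dim_col D = N"
  and Y: "dim_row Y = N" "dim_col Y = N" and YQ: "Y * Q = Q * D"
 shows "braiding Y * kron Q Q = kron Q Q * braiding D"
proof -
 have "braiding Y * kron Q Q = flip_mat N * kron Q Q + kron Y Y * (flip_mat N * kron Q Q)"
  using assms by (simp add: braiding_def mat_dim_simps)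
 also have "... = kron Q Q * flip_mat N + kron Y Y * kron Q Q * flip_mat N"
  using assms flip_kron[OF Q] by (simp add: mult_mat_assoc)
 also have "kron Y Y * kron Q Q = kron Q Q * kron D D" using assms by (simp add: kron_mult)
 finally show ?thesis using assms by (simp add: braiding_def mat_dim_simps)
qed

fun kpow :: "nat => 'k::field mat => 'k mat" where
 "kpow 0 Q = 1\<^sub>m 1"
| "kpow (Suc d) Q = kron Q (kpow d Q)"

lemma dim_kpow [simp]: "dim_row (kpow d Q) = dim_row Q ^ d" "dim_col (kpow d Q) = dim_col Q ^ d"
 by (induction d) auto

lemma kron_one_left: "kron (1\<^sub>m 1) A = A"
 by (rule eq_matI) (auto simp: index_kron)

lemma kpow_add: "kpow (a + b) Q = kron (kpow a Q) (kpow b Q)"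
 by (induction a) (auto simp: kron_one_left[simplified] kron_assoc)

lemma kpow_mult: "dim_col A = dim_row B ==> kpow d A * kpow d B = kpow d (A * B)"
 by (induction d) (auto simp: kron_mult mult_mat_one)

lemma kpow_one: "kpow d (1\<^sub>m N) = 1\<^sub>m (N ^ d)"
 by (induction d) (auto simp: kron_one)

lemma braiding_at_intertwine:
 assumes Q: "dim_row Q = N" "dim_col Q = N" and D: "dim_row D = N" "dim_col D = N"
  and Y: "dim_row Y = N" "dim_col Y = N" and YQ: "Y * Q = Q * D" and i: "1 \<le> i" "i < d"
 shows "braiding_at d Y i * kpow d Q = kpow d Q * braiding_at d D i"
proof -
 have db: "dim_row (braiding Z) = N * N" "dim_col (braiding Z) = N * N" if "dim_row Z = N" for Z :: "'a mat"
  using that by (auto simp: braiding_def)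
 have "d = (i - 1) + (2 + (d - i - 1))" using i by simp
 hence "kpow d Q = kron (kpow (i - 1) Q) (kpow (2 + (d - i - 1)) Q)" by (metis kpow_add)
 also have "kpow (2 + (d - i - 1)) Q = kron (kron Q Q) (kpow (d - i - 1) Q)"
  by (simp add: numeral_2_eq_2 kron_assoc)
 finally have k: "kpow d Q = kron (kpow (i - 1) Q) (kron (kron Q Q) (kpow (d - i - 1) Q))" .
 have "braiding_at d Y i * kpow d Q = kron (kpow (i - 1) Q) (kron (braiding Y * kron Q Q) (kpow (d - i - 1) Q))"
  unfolding k using assms db by (simp add: braiding_at_def kron_mult mult_mat_one)
 also have "... = kpow d Q * braiding_at d D i"
  unfolding k braiding_intertwine[OF Q D Y YQ] using assms db by (simp add: braiding_at_def kron_mult mult_mat_one)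
 finally show ?thesis .
qed

section \<open>Square-zero matrices\<close>

lemma mn_obj_Suc: "mn_obj m (Suc n) = four_block_mat (mn_obj m n) (0\<^sub>m (dim_row (mn_obj m n :: 'k::field mat)) 2)
  (0\<^sub>m 2 (dim_col (mn_obj m n :: 'k mat))) (P_obj :: 'k mat)"
proof -
 have "replicate m unit_obj @ replicate (Suc n) (P_obj :: 'k mat) = (replicate m unit_obj @ replicate n P_obj) @ [P_obj]"
  by (simp add: replicate_append_same)
 moreover have "dim_row (P_obj :: 'k mat) = 2" "dim_col (P_obj :: 'k mat) = 2" by (simp_all add: P_obj_def mat_of_rows_list_def)
 ultimately show ?thesis unfolding mn_obj_def by (simp only: diag_block_mat_last Let_def)
qed

lemma mn_obj_0: "mn_obj m 0 = 0\<^sub>m m m"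
proof (induction m)
 case 0
 show ?case by (auto simp: mn_obj_def)
next
 case (Suc m)
 then show ?case by (auto simp: mn_obj_def unit_obj_def Let_def four_block_mat_def intro!: eq_matI)
qed

lemma dim_mn_obj [simp]: "dim_row (mn_obj m n) = m + 2 * n" "dim_col (mn_obj m n) = m + 2 * n"
 by (induction n) (auto simp: mn_obj_0 mn_obj_Suc P_obj_def mat_of_rows_list_def)

text \<open>A vector \<open>v\<close> with \<open>D v ~= 0\<close> spans with \<open>D v\<close> a copy of \<open>P\<close>, which is split off by means of
 a functional \<open>qf\<close> with \<open>qf v = 0\<close> and \<open>qf (D v) = 1\<close>: the projection is \<open>(qf D, qf)\<close>.\<close>

lemma split_off_P:
 fixes D :: "'k::field mat"
 assumes D: "D \<in> carrier_mat N N" "D * D = 0\<^sub>m N N" and ne: "D ~= 0\<^sub>m N N"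
 shows "EX A B. A \<in> carrier_mat 2 N & B \<in> carrier_mat N 2 & A * B = 1\<^sub>m 2 & D * B = B * P_obj & A * D = P_obj * A"
proof -
 obtain p q where pq: "p < N" "q < N" "D $$ (p, q) ~= 0"
  using ne D(1) by (metis carrier_matD eq_matI index_zero_mat)
 define c where "c = D $$ (p, q)"
 \<comment> \<open>Here v is the basis vector \<open>q\<close>, and c is the nonzero coordinate
   \<open>p\<close> of D v. The functional is that coordinate divided by c. If p = q it must be
   corrected in order to vanish on v; the correction is a multiple of row p of D and vanishes on the
   image of D because D D = 0.\<close>
 define f where "f k = (if k = p then 1 / c else 0) - (if p = q then 1 / c else 0) * (D $$ (p, k) / c)" for k
 define A where "A = mat 2 N (%(i, k). if i = 0 then D $$ (p, k) / c else f k)"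
 define B where "B = mat N 2 (%(k, j). if j = 0 then (if k = q then 1 else 0) else D $$ (k, q))"
 have DD: "(\<Sum>k = 0..<N. D $$ (x, k) * D $$ (k, y)) = 0" if "x < N" "y < N" for x y
 proof -
  have "(D * D) $$ (x, y) = 0" using that D(2) by simp
  thus ?thesis using that D(1) by (simp add: scalar_prod_def)
 qed
 have fs: "(\<Sum>k = 0..<N. f k * g k) = g p / c - (if p = q then 1 / c else 0) * (\<Sum>k = 0..<N. D $$ (p, k) * g k) / c" for g
 proof -
  have "(\<Sum>k = 0..<N. f k * g k) = (\<Sum>k = 0..<N. (if k = p then g k / c else 0)) -
   (\<Sum>k = 0..<N. (if p = q then 1 / c else 0) * (D $$ (p, k) * g k) / c)"
  unfolding sum_subtractf[symmetric] by (intro sum.cong) (auto simp: f_def algebra_simps)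
  also have "(\<Sum>k = 0..<N. (if k = p then g k / c else 0)) = g p / c" using pq by simp
  also have "(\<Sum>k = 0..<N. (if p = q then 1 / c else 0) * (D $$ (p, k) * g k) / c) =
   (if p = q then 1 / c else 0) * (\<Sum>k = 0..<N. D $$ (p, k) * g k) / c"
  by (simp add: sum_distrib_left sum_divide_distrib)
  finally show ?thesis .
 qed
 have P: "P_obj $$ (0, 0) = (0::'k)" "P_obj $$ (0, 1) = (0::'k)" "P_obj $$ (1, 0) = (1::'k)" "P_obj $$ (1, 1) = (0::'k)"
  "P_obj $$ (Suc 0, 0) = (1::'k)" "P_obj $$ (0, Suc 0) = (0::'k)" "P_obj $$ (Suc 0, Suc 0) = (0::'k)"
  "dim_row (P_obj :: 'k mat) = 2" "dim_col (P_obj :: 'k mat) = 2"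
  by (simp_all add: P_obj_def mat_of_rows_list_def)
 have two: "i = 0 \<or> i = Suc 0" if "i < 2" for i :: nat using that by auto
 have s2: "(\<Sum>k = 0..<2. g k) = g 0 + g (Suc 0)" for g :: "nat => 'k" by (simp add: numeral_2_eq_2)
 have ifm: "(\<Sum>k = 0..<N. g k * (if k = q then 1 else 0)) = g q" for g :: "nat => 'k"
  using pq by (simp add: if_distrib[of "%x. g _ * x"] cong: if_cong)
 have c0: "c ~= 0" using pq by (simp add: c_def)
 have sd: "(\<Sum>k = 0..<N. D $$ (p, k) * g k / c) = (\<Sum>k = 0..<N. D $$ (p, k) * g k) / c" for g
  by (simp add: sum_divide_distrib)
 have Dc: "D $$ (p, q) = c" by (simp add: c_def)
 have fq: "f q = 0" using c0 by (auto simp: f_def Dc)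
 have "A * B = 1\<^sub>m 2"
  by (rule eq_matI)
  (use pq(1,2) c0 in \<open>auto simp: A_def B_def scalar_prod_def sd fs ifm DD fq Dc dest!: two\<close>)
 moreover have "D * B = B * P_obj"
  by (rule eq_matI)
  (use pq D(1) in \<open>auto simp: B_def scalar_prod_def ifm DD P s2 dest!: two\<close>)
 moreover have "A * D = P_obj * A"
  by (rule eq_matI)
  (use pq(1,2) D(1) in \<open>auto simp: A_def scalar_prod_def sd fs DD P s2 dest!: two\<close>)
 ultimately show ?thesis by (intro exI[of _ A] exI[of _ B]) (auto simp: A_def B_def)
qed

text \<open>The base change is the row (B1 B2) and its inverse the column (A1, A2), both written as
  four-block matrices with empty blocks. That a + b = N follows by comparing dimensions.\<close>

lemma four_block_similar:
 fixes D :: "'k::field mat"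
 assumes D: "D \<in> carrier_mat N N" and c: "A1 \<in> carrier_mat a N" "B1 \<in> carrier_mat N a" "A2 \<in> carrier_mat b N" "B2 \<in> carrier_mat N b"
  and S: "S \<in> carrier_mat a a" "T \<in> carrier_mat b b"
  and one: "B1 * A1 + B2 * A2 = 1\<^sub>m N" "A1 * B1 = 1\<^sub>m a" "A2 * B2 = 1\<^sub>m b" "A1 * B2 = 0\<^sub>m a b" "A2 * B1 = 0\<^sub>m b a"
  and DB: "D * B1 = B1 * S" "D * B2 = B2 * T"
 shows "similar_mat D (four_block_mat S (0\<^sub>m a b) (0\<^sub>m b a) T)"
proof -
 let ?F = "four_block_mat S (0\<^sub>m a b) (0\<^sub>m b a) T"
 define P where "P = four_block_mat B1 B2 (0\<^sub>m 0 a) (0\<^sub>m 0 b)"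
 define Q where "Q = four_block_mat A1 (0\<^sub>m a 0) A2 (0\<^sub>m b 0)"
 have cP: "P \<in> carrier_mat N (a + b)" and cQ: "Q \<in> carrier_mat (a + b) N"
  unfolding P_def Q_def
  using four_block_carrier_mat[OF c(2) zero_carrier_mat[of 0 b]] four_block_carrier_mat[OF c(1) zero_carrier_mat[of b 0]] by simp_all
 have z: "0\<^sub>m 0 x \<in> carrier_mat 0 x" "0\<^sub>m x 0 \<in> carrier_mat x 0" for x by auto
 have fb: "four_block_mat X Y Z V = X" if "X \<in> carrier_mat x y" "Y \<in> carrier_mat x 0" "Z \<in> carrier_mat 0 y" "V \<in> carrier_mat 0 0"
  for X Y Z V :: "'k mat" and x y using that by (intro eq_matI) auto
 note dd = carrier_matD[OF D] carrier_matD[OF c(1)] carrier_matD[OF c(2)] carrier_matD[OF c(3)] carrier_matD[OF c(4)]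
  carrier_matD[OF S(1)] carrier_matD[OF S(2)]
 have "P * Q = four_block_mat (B1 * A1 + B2 * A2) (B1 * 0\<^sub>m a 0 + B2 * 0\<^sub>m b 0)
  (0\<^sub>m 0 a * A1 + 0\<^sub>m 0 b * A2) (0\<^sub>m 0 a * 0\<^sub>m a 0 + 0\<^sub>m 0 b * 0\<^sub>m b 0)"
  unfolding P_def Q_def by (rule mult_four_block_mat[OF c(2,4) z(1) z(1) c(1) z(2) c(3) z(2)])
 also have "... = B1 * A1 + B2 * A2"
  by (rule fb[of _ N N]; rule carrier_matI; simp add: dd)
 finally have PQ: "P * Q = 1\<^sub>m N" unfolding one .
 have "Q * P = four_block_mat (A1 * B1 + 0\<^sub>m a 0 * 0\<^sub>m 0 a) (A1 * B2 + 0\<^sub>m a 0 * 0\<^sub>m 0 b)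
  (A2 * B1 + 0\<^sub>m b 0 * 0\<^sub>m 0 a) (A2 * B2 + 0\<^sub>m b 0 * 0\<^sub>m 0 b)"
  unfolding P_def Q_def by (rule mult_four_block_mat[OF c(1) z(2) c(3) z(2) c(2,4) z(1) z(1)])
 also have "... = four_block_mat (1\<^sub>m a) (0\<^sub>m a b) (0\<^sub>m b a) (1\<^sub>m b)"
  unfolding one by (simp add: mult_mat_zero add_mat_zero)
 also have "... = 1\<^sub>m (a + b)" by (rule eq_matI) auto
 finally have QP: "Q * P = 1\<^sub>m (a + b)" .
 have "N \<le> a + b" "a + b \<le> N"
  by (rule left_inverse_dim_le[OF carrier_matD[OF cP] carrier_matD[OF cQ] PQ])
  (rule left_inverse_dim_le[OF carrier_matD[OF cQ] carrier_matD[OF cP] QP])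
 hence dims: "a + b = N" by (rule le_antisym[rotated])
 have "P * ?F = four_block_mat (B1 * S + B2 * 0\<^sub>m b a) (B1 * 0\<^sub>m a b + B2 * T)
  (0\<^sub>m 0 a * S + 0\<^sub>m 0 b * 0\<^sub>m b a) (0\<^sub>m 0 a * 0\<^sub>m a b + 0\<^sub>m 0 b * T)"
  unfolding P_def by (rule mult_four_block_mat[OF c(2,4) z(1) z(1) S(1) zero_carrier_mat zero_carrier_mat S(2)])
 also have "... = four_block_mat (D * B1) (D * B2) (0\<^sub>m 0 a) (0\<^sub>m 0 b)"
  unfolding DB using dd by (simp add: mult_mat_zero add_mat_zero)
 also have "... = four_block_mat (D * B1 + 0\<^sub>m N 0 * 0\<^sub>m 0 a) (D * B2 + 0\<^sub>m N 0 * 0\<^sub>m 0 b)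
  (0\<^sub>m 0 N * B1 + 0\<^sub>m 0 0 * 0\<^sub>m 0 a) (0\<^sub>m 0 N * B2 + 0\<^sub>m 0 0 * 0\<^sub>m 0 b)"
  using dd by (simp add: mult_mat_zero add_mat_zero)
 also have "... = four_block_mat D (0\<^sub>m N 0) (0\<^sub>m 0 N) (0\<^sub>m 0 0) * P"
  unfolding P_def by (rule mult_four_block_mat[symmetric, OF D z(2) z(1) z(1) c(2,4) z(1) z(1)])
 finally have "P * ?F = D * P" unfolding fb[OF D z(2) z(1) z(1)] .
 hence "P * ?F * Q = D * P * Q" by (simp only:)
 also have "... = D * (P * Q)" by (rule mult_mat_assoc) (use cP cQ D in auto)
 also have "... = D" unfolding PQ by (rule mult_mat_one) (use D in auto)
 finally have DF: "D = P * ?F * Q" by (simp only:)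
 have cF: "?F \<in> carrier_mat N N" unfolding dims[symmetric] by (rule four_block_carrier_mat[OF S])
 have "{D, ?F, P, Q} \<subseteq> carrier_mat N N"
  using D cF cP[unfolded dims] cQ[unfolded dims] by (simp only: insert_subset empty_subsetI)
 from similar_matI[OF this PQ QP[unfolded dims] DF] show ?thesis .
qed

text \<open>Copies of P are split off until D vanishes. As \<open>mn_obj\<close> lists the copies of
  P after the unit objects, the new copy is placed behind the complement.\<close>

lemma square_zero_similar:
 fixes D :: "'k::field mat"
 shows "D \<in> carrier_mat N N ==> D * D = 0\<^sub>m N N ==> EX m n. similar_mat D (mn_obj m n)"
proof (induction N arbitrary: D rule: less_induct)
 case (less N)
 show ?case
 proof (cases "D = 0\<^sub>m N N")
  case True
  thus ?thesis by (intro exI[of _ N] exI[of _ 0]) (simp add: mn_obj_0 similar_mat_refl[of _ N])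
 next
  case False
  then obtain A B where AB: "A \<in> carrier_mat 2 N" "B \<in> carrier_mat N 2" "A * B = 1\<^sub>m 2" "D * B = B * P_obj" "A * D = P_obj * A"
  using split_off_P[OF less(2,3)] by blast
  \<comment> \<open>Vector spaces are viewed as representations of the trivial group S_0, so that
    \<open>retract_complement\<close> provides the complement of the copy of P.\<close>
  define M where "M = (N, %sz :: nat => nat. 1\<^sub>m N :: 'k mat)"
  define L where "L = (2 :: nat, %sz :: nat => nat. 1\<^sub>m 2 :: 'k mat)"
  have R: "M \<in> Rep 0" "L \<in> Rep 0" unfolding M_def L_def by (rule RepI; simp)+
  have triv: "intertwiner 0 M' N' X \<longleftrightarrow> X \<in> carrier_mat (fst N') (fst M')" if "M' \<in> Rep 0" "N' \<in> Rep 0" for M' N' X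
  using RepD(4)[OF that(1) permutes_id] RepD(4)[OF that(2) permutes_id] by (auto simp: intertwiner_def mat_dim_simps)
  have fM: "fst M = N" "fst L = 2" by (simp_all add: M_def L_def)
  have "intertwiner 0 L M B" "intertwiner 0 M L A" "A * B = 1\<^sub>m (fst L)"
  using AB(1-3) fM by (simp_all only: triv[OF R] triv[OF R(2,1)])
  from retract_complement[OF R this] obtain M2 B2 A2 where s: "M2 \<in> Rep 0" "biproduct 0 M L M2 B A B2 A2"
  by blast
  define b where "b = fst M2"
  have N: "N = 2 + b" using biproduct_dim[OF R s] by (simp add: fM b_def)
  have c: "A2 \<in> carrier_mat b N" "B2 \<in> carrier_mat N b" and one: "B * A + B2 * A2 = 1\<^sub>m N" "A2 * B2 = 1\<^sub>m b"
   "A * B2 = 0\<^sub>m 2 b" "A2 * B = 0\<^sub>m b 2"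
  using s(2) unfolding biproduct_def triv[OF R(1) s(1)] triv[OF s(1) R(1)] fM b_def by simp_all
  define D2 where "D2 = A2 * D * B2"
  have cD2: "D2 \<in> carrier_mat b b" using c less(2) by (auto simp: D2_def)
  have dP: "dim_row (P_obj :: 'k mat) = 2" "dim_col (P_obj :: 'k mat) = 2" by (simp_all add: P_obj_def mat_of_rows_list_def)
  note dd = carrier_matD[OF AB(1)] carrier_matD[OF AB(2)] carrier_matD[OF c(1)] carrier_matD[OF c(2)] carrier_matD[OF less(2)] dP
  have ext: "x * y = z ==> dim_col x = dim_row y ==> dim_col y = dim_row t ==> x * (y * t) = z * t"
  for x y z t :: "'k mat" using mult_mat_assoc[of x y t] by simp
  \<comment> \<open>The complement is the kernel of \<open>A\<close>; it is stable under D because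
    \<open>A\<close> intertwines D with the action of delta on P.\<close>
  have "D * B2 = (B * A + B2 * A2) * (D * B2)" unfolding one using dd by (simp add: mult_mat_one)
  also have "... = B * (A * (D * B2)) + B2 * D2" using dd by (simp add: mat_dim_simps D2_def)
  also have "A * (D * B2) = 0\<^sub>m 2 b" using dd by (simp add: ext[OF AB(5)] one mult_mat_assoc mult_mat_zero)
  finally have DB2: "D * B2 = B2 * D2" using dd cD2 by (simp add: mult_mat_zero add_mat_zero)
  have "D2 * D2 = A2 * (D * (B2 * D2))" using dd cD2 by (simp add: D2_def mult_mat_assoc)
  also have "... = A2 * ((D * D) * B2)" using dd by (simp add: DB2[symmetric] mult_mat_assoc)
  finally have "D2 * D2 = 0\<^sub>m b b" unfolding less(3) using dd by (simp add: mult_mat_zero)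
  from less(1)[OF _ cD2 this] obtain m n where mn: "similar_mat D2 (mn_obj m n)" using N by auto
  obtain k P Q where "{D2, mn_obj m n :: 'k mat, P, Q} \<subseteq> carrier_mat k k" using similar_matD[OF mn] by blast
  hence "D2 \<in> carrier_mat k k" "(mn_obj m n :: 'k mat) \<in> carrier_mat k k" by auto
  from this[THEN carrier_matD(1)] have dmn: "m + 2 * n = b" using carrier_matD(1)[OF cD2] by simp
  have s1: "similar_mat D (four_block_mat D2 (0\<^sub>m b 2) (0\<^sub>m 2 b) P_obj)"
  proof (rule four_block_similar[OF less(2) c AB(1,2) cD2 _ _ one(2) AB(3) one(4,3) DB2 AB(4)])
  show "B2 * A2 + B * A = 1\<^sub>m N" unfolding one(1)[symmetric]
   by (rule comm_add_mat[of _ N N]) (rule carrier_matI; simp add: dd)+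
  show "(P_obj :: 'k mat) \<in> carrier_mat 2 2" by (rule carrier_matI; simp add: dP)
  qed
  have s2: "similar_mat (four_block_mat D2 (0\<^sub>m b 2) (0\<^sub>m 2 b) P_obj) (four_block_mat (mn_obj m n) (0\<^sub>m b 2) (0\<^sub>m 2 b) (P_obj :: 'k mat))"
  by (rule similar_mat_four_block_0_0[OF mn similar_mat_refl[of _ 2] cD2]) (use dP in auto)
  have s3: "four_block_mat (mn_obj m n) (0\<^sub>m b 2) (0\<^sub>m 2 b) (P_obj :: 'k mat) = mn_obj m (Suc n)"
  unfolding mn_obj_Suc using dmn by simp
  show ?thesis using similar_mat_trans[OF s1 s2] unfolding s3 by blast
 qed
qed

section \<open>The action of the symmetric group on words\<close>

text \<open>A basis of m + nP: \<open>One i\<close> spans the i-th unit object, and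
  \<open>V j\<close>, \<open>W j\<close> are the basis 1, delta of the j-th copy of P. Thus delta
  takes \<open>V j\<close> to \<open>W j\<close> and kills the other letters. The colour of a letter
  records the indecomposable summand to which it belongs.\<close>

datatype letter = One nat | V nat | W nat

fun colour :: "letter => letter" where
 "colour (One i) = One i" | "colour (V j) = V j" | "colour (W j) = V j"

type_synonym word = "nat => letter"

text \<open>A function on words is the coordinate vector of a tensor, and this is delta on the i-th
  tensor factor: the coefficient at a word with \<open>W j\<close> in position i comes from the word
  with \<open>V j\<close> there.\<close>

definition der :: "nat => (word => 'k) => word => 'k::field" where
 "der i f u = (case u i of W j => f (u(i := V j)) | _ => 0)"

text \<open>For X = {i, j} this is 1 + delta_i delta_j, the factor by which the braiding differs
  from the flip. \<open>Min\<close> and \<open>Max\<close> serve to index it by an unordered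
  pair.\<close>

definition hop :: "nat set => (word => 'k) => word => 'k::field" where
 "hop X f = f + der (Min X) (der (Max X) f)"

definition hops :: "nat set set => (word => 'k) => word => 'k::field" where
 "hops S f = Finite_Set.fold hop f S"

definition pm :: "(nat => nat) => (word => 'k) => word => 'k::field" where
 "pm sz f u = f (u o sz)"

definition Inv :: "(nat => nat) => nat set set" where
 "Inv sz = {{i, j} | i j. i < j & sz j < sz i}"

text \<open>A permutation crosses exactly the pairs in its inversion set, each once, and every
  crossing contributes one factor 1 + delta_i delta_j besides the exchange of positions. As these
  factors commute, the braided action has this closed form, independent of any reduced word.\<close>

definition act :: "(nat => nat) => (word => 'k) => word => 'k::field" where
 "act sz f = pm sz (hops (Inv sz) f)"

definition lin :: "((word => 'k) => word => 'k::field) => bool" where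
 "lin al \<longleftrightarrow> (ALL f g. al (f + g) = al f + al g) & (ALL c f. al (%u. c * f u) = (%u. c * al f u))"

lemma linD: "lin al ==> al (f + g) = al f + al g" "lin al ==> al (%u. c * f u) = (%u. c * al f u)"
 by (auto simp: lin_def)

lemma lin_zero: "lin al ==> al 0 = 0"
 using linD(1)[of al 0 0] by simp

lemma lin_sum: "lin al ==> al (sum f A) = (\<Sum>x \<in> A. al (f x))"
 by (induction A rule: infinite_finite_induct) (auto simp: lin_zero linD)

lemma sum_fun_apply: "(sum f A) u = (\<Sum>x \<in> A. f x u)"
 by (induction A rule: infinite_finite_induct) auto

lemma lin_comp: "lin al ==> lin bt ==> lin (%f. al (bt f))"
 by (auto simp: lin_def)

lemma lin_add: "lin al ==> lin bt ==> lin (%f. al f + bt f)"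
 by (auto simp: lin_def fun_eq_iff algebra_simps)

lemma lin_sumI: "(!!x. x \<in> A ==> lin (al x)) ==> lin (%f. \<Sum>x \<in> A. al x f)"
 by (induction A rule: infinite_finite_induct) (auto simp: lin_def fun_eq_iff algebra_simps)

lemma lin_id: "lin (%f. f)" by (simp add: lin_def)

lemma lin_der: "lin (der i)"
 by (auto simp: lin_def der_def fun_eq_iff split: letter.splits)

lemma lin_pm: "lin (pm sz)"
 by (auto simp: lin_def pm_def fun_eq_iff)

lemma lin_mult: "lin (%f. ch * f)"
 by (auto simp: lin_def fun_eq_iff algebra_simps)

lemma lin_hop: "lin (hop X)"
 unfolding hop_def by (intro lin_add lin_id lin_comp[OF lin_der] lin_der)

lemma der_commute: "der i (der j f) = der j (der i f)"
 by (cases "i = j") (auto simp: der_def fun_eq_iff fun_upd_twist split: letter.splits)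

lemma der_der: "der i (der i f) = 0"
 by (auto simp: der_def fun_eq_iff split: letter.splits)

lemma der_zero [simp]: "der i 0 = 0" by (simp add: lin_zero[OF lin_der])

lemma hop_doubleton: "hop {i, j} f = f + der i (der j f)"
 by (cases "i \<le> j") (auto simp: hop_def min_def max_def der_commute)

lemma hop_commute: "hop X (hop Y f) = hop Y (hop X f)"
 unfolding hop_def by (simp add: linD(1)[OF lin_der] add_ac)
  (metis (no_types, lifting) der_commute)

interpretation hop: comp_fun_commute hop
 by standard (auto simp: fun_eq_iff hop_commute comp_def)

lemma hops_empty [simp]: "hops {} f = f"
 by (simp add: hops_def)

lemma hops_insert: "finite S ==> X ~: S ==> hops (insert X S) f = hop X (hops S f)"
 by (simp add: hops_def)

lemma lin_hops: "finite S ==> lin (hops S :: (word => 'k) => word => 'k::field)"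
proof (induction S rule: finite_induct)
 case empty
 show ?case by (simp add: lin_def)
next
 case (insert X S)
 have "hops (insert X S) = (%f :: word => 'k. hop X (hops S f))" using insert by (auto simp: hops_insert)
 then show ?case using lin_comp[OF lin_hop[of X] insert(3)] by simp
qed

lemma hops_hop: "finite S ==> hops S (hop X f) = hop X (hops S f)"
 by (induction S rule: finite_induct) (auto simp: hops_insert hop_commute)

lemma hops_union: "finite S ==> finite T ==> S \<inter> T = {} ==> hops (S \<union> T) f = hops S (hops T f)"
 by (induction S rule: finite_induct) (auto simp: hops_insert)

lemma pm_der: "inj sz ==> pm sz (der i f) = der (sz i) (pm sz f)"
proof
 fix u :: word assume s: "inj sz"
 have "(u o sz)(i := x) = u(sz i := x) o sz" for x using s by (auto simp: fun_eq_iff inj_eq)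
 thus "pm sz (der i f) u = der (sz i) (pm sz f) u" by (simp add: pm_def der_def split: letter.splits)
qed

lemma pm_hops:
 assumes "inj sz"
 shows "finite S ==> (!!X. X \<in> S ==> EX i j. X = {i, j}) ==> pm sz (hops S f) = hops ((`) sz ` S) (pm sz f)"
proof (induction S rule: finite_induct)
 case (insert X S)
 obtain i j where X: "X = {i, j}" using insert(4) by blast
 have ni: "sz ` X ~: (`) sz ` S" using insert(2) assms by (auto simp: inj_image_eq_iff)
 have "pm sz (hop X g) = hop (sz ` X) (pm sz g)" for g :: "word => 'a"
  by (simp add: X hop_doubleton linD(1)[OF lin_pm] pm_der[OF assms])
 with insert ni show ?case by (simp add: hops_insert)
qed auto

lemma Inv_doubleton: "{i, j} \<in> Inv sz \<longleftrightarrow> (i < j & sz j < sz i) \<or> (j < i & sz i < sz j)"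
 by (auto simp: Inv_def doubleton_eq_iff)

lemma Inv_bound:
 assumes s: "sz permutes {a..b::nat}" and "i < j" "sz j < sz i"
 shows "a \<le> i" "j \<le> b"
proof -
 have r: "sz x \<in> {a..b} \<longleftrightarrow> x \<in> {a..b}" for x using permutes_in_image[OF s] .
 have f: "x ~: {a..b} ==> sz x = x" for x using s by (simp add: permutes_def)
 show "a \<le> i" using r[of i] r[of j] f[of i] f[of j] assms(2,3) by (cases "a \<le> i") auto
 show "j \<le> b" using r[of i] r[of j] f[of i] f[of j] assms(2,3) by (cases "j \<le> b") auto
qed

lemma Inv_subset:
 assumes "sz permutes {a..b}" "X \<in> Inv sz"
 shows "X \<subseteq> {a..b}"
proof -
 obtain i j where "X = {i, j}" "i < j" "sz j < sz i" using assms(2) unfolding Inv_def by blast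
 thus ?thesis using Inv_bound[OF assms(1), of i j] by auto
qed

lemma finite_Inv: "sz permutes {a..b::nat} ==> finite (Inv sz)"
 by (rule finite_subset[of _ "Pow {a..b}"]) (blast dest: Inv_subset, simp)

text \<open>Reversing a pair twice restores its order, so inversion sets add modulo 2, up to moving
  the pairs of the outer factor by \<open>tz\<close>. This fits with \<open>hop X\<close> being an
  involution in characteristic 2.\<close>

lemma Inv_comp:
 assumes s: "bij sz" and t: "bij tz"
 shows "Inv (sz o tz) = ({X. tz ` X \<in> Inv sz} - Inv tz) \<union> (Inv tz - {X. tz ` X \<in> Inv sz})"
proof -
 have two: "EX i j. i < j & X = {i, j}" if "X \<in> Inv (sz o tz) \<or> X \<in> Inv tz \<or> tz ` X \<in> Inv sz" for X
 proof (cases "tz ` X \<in> Inv sz")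
  case True
  then obtain a b where ab: "tz ` X = {a, b}" "a < b" by (auto simp: Inv_def)
  have "X = inv' tz ` {a, b}" using ab t by (metis bij_is_inj image_inv_f_f)
  hence X: "X = {inv' tz a, inv' tz b}" by simp
  moreover have "inv' tz a ~= inv' tz b" using ab t by (metis bij_is_surj nat_neq_iff surj_f_inv_f)
  ultimately show ?thesis by (metis insert_commute nat_neq_iff)
 qed (use that in \<open>auto simp: Inv_def\<close>)
 have ne: "tz i ~= tz j" if "i < j" for i j using t that by (metis bij_is_inj inj_eq nat_neq_iff)
 have "X \<in> Inv (sz o tz) \<longleftrightarrow> (tz ` X \<in> Inv sz) ~= (X \<in> Inv tz)" for X
 proof (cases "EX i j. i < j & X = {i, j}")
  case True
  then obtain i j where ij: "i < j" "X = {i, j}" by blast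
  have "sz (tz i) ~= sz (tz j)" using ne[OF ij(1)] s by (metis bij_is_inj inj_eq)
  thus ?thesis using ij ne[OF ij(1)] Inv_doubleton[of i j sz]
  by (auto simp: Inv_doubleton)
 next
  case False
  thus ?thesis using two by blast
 qed
 thus ?thesis by blast
qed

lemma finite_Inv_bij: "sz permutes {1..d::nat} ==> tz permutes {1..d} ==> finite {X. tz ` X \<in> Inv sz}"
proof -
 assume s: "sz permutes {1..d}" and t: "tz permutes {1..d}"
 have "{X. tz ` X \<in> Inv sz} \<subseteq> (`) (inv' tz) ` Inv sz"
 proof
  fix X assume "X \<in> {X. tz ` X \<in> Inv sz}"
  moreover have "X = inv' tz ` (tz ` X)" using permutes_inj[OF t] by (simp add: image_inv_f_f)
  ultimately show "X \<in> (`) (inv' tz) ` Inv sz" by blast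
 qed
 thus ?thesis using finite_Inv[OF s] by (rule finite_subset[OF _ finite_imageI])
qed

locale char2 =
 fixes K :: "'k::field itself"
 assumes two: "(1::'k) + 1 = 0"
begin

lemma add_self [simp]: "x + x = (0::'k)"
 using two by (metis distrib_left mult.right_neutral mult_zero_right)

lemma two_zero [simp]: "(2::'k) = 0"
 using two by (simp only: one_add_one)

lemma uminus_self [simp]: "- x = (x::'k)"
 by (metis add_self add.inverse_unique)

lemma add_self_left [simp]: "x + (x + y) = (y::'k)"
 by (simp add: add.assoc[symmetric])

lemma add_self_fun [simp]: "f + f = (0 :: word => 'k)"
 by (simp add: fun_eq_iff)

lemma add_self_left_fun [simp]: "f + (f + g) = (g :: word => 'k)"
 by (simp add: fun_eq_iff)

lemma hop_hop: "hop X (hop X f) = (f :: word => 'k)"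
proof -
 have "der (Min X) (der (Max X) (der (Min X) (der (Max X) f))) = 0"
  by (simp add: der_commute[of "Max X" "Min X"] der_der)
 thus ?thesis by (simp add: hop_def linD(1)[OF lin_der] add_ac)
qed

lemma hops_hops: "finite S ==> hops S (hops S f) = (f :: word => 'k)"
proof (induction S rule: finite_induct)
 case (insert X S)
 show ?case using insert by (simp add: hops_insert hops_hop hop_hop)
qed auto

text \<open>The factors for the common pairs of A and B occur twice and cancel.\<close>

lemma hops_symdiff:
 assumes "finite A" "finite B"
 shows "hops ((A - B) \<union> (B - A)) f = hops A (hops B f :: word => 'k)"
proof -
 have "hops A (hops B f) = hops ((A - B) \<union> (A \<inter> B)) (hops ((A \<inter> B) \<union> (B - A)) f)"
  by (simp add: Int_commute Un_Diff_Int Diff_Diff_Int Un_commute)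
  (metis Int_Diff_Un Int_commute Un_Diff_Int)
 also have "... = hops (A - B) (hops (A \<inter> B) (hops (A \<inter> B) (hops (B - A) f)))"
  using assms by (subst hops_union, simp, simp, blast)+ simp
 also have "... = hops ((A - B) \<union> (B - A)) f"
  using assms by (subst hops_union, auto simp: hops_hops)
 finally show ?thesis by simp
qed

text \<open>The factors of the outer permutation are pulled through the inner one, which moves their
  pairs; what is left is the symmetric difference of inversion sets, translated by
  \<open>hops_symdiff\<close>.\<close>

lemma act_comp:
 assumes s: "sz permutes {1..d::nat}" and t: "tz permutes {1..d}"
 shows "act (sz o tz) f = act sz (act tz f :: word => 'k)"
proof -
 let ?S = "{X. tz ` X \<in> Inv sz}"
 have fin: "finite ?S" by (rule finite_Inv_bij[OF s t])
 have im: "(`) tz ` ?S = Inv sz"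
 proof
  show "Inv sz \<subseteq> (`) tz ` ?S"
  proof
  fix X assume "X \<in> Inv sz"
  moreover have "X = tz ` (inv' tz ` X)" using permutes_surj[OF t] by (simp add: image_f_inv_f)
  ultimately show "X \<in> (`) tz ` ?S" by auto
  qed
 qed auto
 have dbl: "EX i j. X = {i, j}" if XS: "X \<in> ?S" for X
 proof -
  have "X = inv' tz ` (tz ` X)" using permutes_inj[OF t] by (simp add: image_inv_f_f)
  moreover obtain a b where "tz ` X = {a, b}" using XS unfolding Inv_def by blast
  ultimately show ?thesis by auto
 qed
 have ph: "pm tz (hops ?S g) = hops (Inv sz) (pm tz g)" for g :: "word => 'k"
  using pm_hops[OF permutes_inj[OF t] fin dbl, where f = g] by (simp only: im)
 have "act sz (act tz f) = pm sz (hops (Inv sz) (pm tz (hops (Inv tz) f)))" by (simp add: act_def)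
 also have "hops (Inv sz) (pm tz (hops (Inv tz) f)) = pm tz (hops ?S (hops (Inv tz) f))"
  by (rule ph[symmetric])
 also have "hops ?S (hops (Inv tz) f) = hops (Inv (sz o tz)) f"
  unfolding Inv_comp[OF permutes_bij[OF s] permutes_bij[OF t]] by (rule hops_symdiff[symmetric, OF fin finite_Inv[OF t]])
 also have "pm sz (pm tz g) = pm (sz o tz) g" for g :: "word => 'k" by (simp add: pm_def fun_eq_iff comp_assoc)
 finally show ?thesis by (simp add: act_def)
qed

end

lemma act_id [simp]: "act id f = f"
proof -
 have "Inv id = {}" by (auto simp: Inv_def)
 thus ?thesis by (simp add: act_def pm_def fun_eq_iff)
qed

lemma lin_act: "sz permutes {1..d::nat} ==> lin (act sz)"
 unfolding act_def[abs_def] by (intro lin_comp[OF lin_pm] lin_hops finite_Inv)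

text \<open>To be compatible with the braided action it suffices to be compatible with delta at the
  positions that are crossed, and with the bare permutation of positions. The second operator
  \<open>T'\<close> is there because a permutation may move the data on which \<open>T\<close>
  depends.\<close>

lemma act_transfer:
 assumes s: "sz permutes {1..d::nat}" and add: "!!f g. T (f + g) = T f + T g"
  and der: "!!i X f. X \<in> Inv sz ==> i \<in> X ==> T (der i f) = der i (T f)"
  and pm: "!!f. T' (pm sz f) = pm sz (T f)"
 shows "T' (act sz f) = act sz (T f)"
proof -
 have "T (hops S f) = hops S (T f)" if "finite S" "S \<subseteq> Inv sz" for S
  using that
 proof (induction S rule: finite_induct)
  case (insert X S)
  obtain i j where X: "X = {i, j}" using insert by (auto simp: Inv_def)
  have "T (hop X g) = hop X (T g)" for g using der[of X] insert(4) by (simp add: X hop_doubleton add)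
  thus ?case using insert by (simp add: hops_insert)
 qed auto
 thus ?thesis using finite_Inv[OF s] by (simp add: act_def pm)
qed

definition colour_dep :: "(word => 'k) => bool" where
 "colour_dep ch \<longleftrightarrow> (ALL u v. colour o u = colour o v --> ch u = ch v)"

lemma colour_depD:
 assumes "colour_dep ch" "u i = W j"
 shows "ch (u(i := V j)) = ch u"
proof -
 have "colour o u(i := V j) = colour o u" using assms(2) by (auto simp: fun_eq_iff)
 thus ?thesis using assms(1) unfolding colour_dep_def by blast
qed

lemma der_mult:
 assumes "!!j u. u i = W j ==> ch (u(i := V j)) = ch u"
 shows "der i (ch * f) = ch * der i f"
 using assms by (auto simp: der_def fun_eq_iff split: letter.splits)

lemma act_mult:
 assumes "sz permutes {1..d::nat}" "!!i j u X. X \<in> Inv sz ==> i \<in> X ==> u i = W j ==> ch (u(i := V j)) = ch u"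
 shows "act sz (ch * f) = (ch o (%u. u o sz)) * act sz f"
proof (rule act_transfer[OF assms(1), where T = "%f. ch * f" and T' = "%f. (ch o (%u. u o sz)) * f", symmetric])
 show "ch * der i f = der i (ch * f)" if "X \<in> Inv sz" "i \<in> X" for i X and f :: "word => 'a"
  using der_mult[of i ch f] assms(2)[OF that] by simp
qed (auto simp: algebra_simps pm_def fun_eq_iff)

text \<open>Since delta never changes the colour of a position, a multiplier that depends on colours
  alone is just carried along by the permutation.\<close>

lemma act_mult_colour: "sz permutes {1..d::nat} ==> colour_dep ch ==>
  act sz (ch * f) = (ch o (%u. u o sz)) * act sz f"
 by (rule act_mult) (auto simp: colour_depD)

definition on :: "word set => (word => 'k::field) => bool" where
 "on A f \<longleftrightarrow> (ALL u. u ~: A --> f u = 0)"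

text \<open>The sets of words whose functions form a subrepresentation given by colour
  patterns.\<close>

definition stable :: "nat => word set => bool" where
 "stable d A \<longleftrightarrow> (ALL u v. u \<in> A --> colour o u = colour o v --> v \<in> A) &
  (ALL sz u. sz permutes {1..d} --> u \<in> A --> u o sz \<in> A)"

lemma stable_perm: "stable d A ==> sz permutes {1..d} ==> u o sz \<in> A \<longleftrightarrow> u \<in> A"
proof
 assume s: "stable d A" "sz permutes {1..d}" and u: "u o sz \<in> A"
 have "(u o sz) o inv' sz \<in> A" using s(1) u permutes_inv[OF s(2)] unfolding stable_def by blast
 thus "u \<in> A" using permutes_inv_o(1)[OF s(2)] by (simp add: comp_assoc)
qed (auto simp: stable_def)

lemma stable_colour: "stable d A ==> colour o u = colour o v ==> u \<in> A \<longleftrightarrow> v \<in> A"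
 unfolding stable_def by metis

lemma on_mult: "on A f ==> (%u. if u \<in> A then 1 else 0) * f = f"
 by (auto simp: on_def fun_eq_iff)

lemma on_iff_mult: "on A f \<longleftrightarrow> (%u. if u \<in> A then 1 else 0) * f = f"
proof
 assume h: "(%u. if u \<in> A then 1 else 0) * f = f"
 show "on A f" unfolding on_def
 proof (intro allI impI)
  fix u assume "u ~: A"
  thus "f u = 0" using fun_cong[OF h, of u] by simp
 qed
qed (simp add: on_mult)

lemma on_act:
 assumes A: "stable d A" and s: "sz permutes {1..d}" and f: "on A f"
 shows "on A (act sz f)"
proof -
 have c: "colour_dep (%u. if u \<in> A then 1 else 0 :: 'a)"
  unfolding colour_dep_def
 proof (intro allI impI)
  fix u v :: word assume "colour o u = colour o v"
  thus "(if u \<in> A then 1 else 0 :: 'a) = (if v \<in> A then 1 else 0)" using stable_colour[OF A, of u v] by simp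
 qed
 have "act sz f = act sz ((%u. if u \<in> A then 1 else 0) * f)" using f by (simp add: on_mult)
 also have "... = (%u. if u \<in> A then 1 else 0) * act sz f"
  unfolding act_mult_colour[OF s c] by (simp add: fun_eq_iff stable_perm[OF A s])
 finally show ?thesis unfolding on_iff_mult by simp
qed

lemma on_add: "on A f ==> on A g ==> on A (f + g)"
 and on_zero: "on A 0"
 and on_scale: "on A f ==> on A (%u. c * f u)"
 by (auto simp: on_def)

lemma on_sum: "(!!x. x \<in> I ==> on A (f x)) ==> on A (sum f I)"
 by (auto simp: on_def sum_fun_apply)

section \<open>Representations on words\<close>

definition unitw :: "word => word => 'k::field" where
 "unitw w u = (if u = w then 1 else 0)"

text \<open>Operators are defined on all functions on words, but equivariance is asked only on
  functions supported in A. This avoids a separate type for every subrepresentation.\<close>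

definition ghom :: "nat => word set => word set => ((word => 'k::field) => word => 'k) => bool" where
 "ghom d A B al \<longleftrightarrow> lin al & (ALL f. on A f --> on B (al f)) &
  (ALL sz f. sz permutes {1..d} --> on A f --> al (act sz f) = act sz (al f))"

text \<open>The counterpart of \<open>fac\<close> without coordinates; \<open>fac_wrep_iff\<close>
  is the translation.\<close>

definition dominated :: "'k::field itself => nat => word set => word set => bool" where
 "dominated K d A B \<longleftrightarrow> (\<exists>ps :: (((word => 'k) => word => 'k) \<times> ((word => 'k) => word => 'k)) list.
  (\<forall>(al, bt) \<in> set ps. ghom d A B al & ghom d B A bt) &
  (ALL f. on A f --> (\<Sum>(al, bt)\<leftarrow>ps. bt (al f)) = f))"

definition mx :: "(nat => word) => nat => (nat => word) => nat =>
  ((word => 'k) => word => 'k::field) => 'k mat" where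
 "mx e n e' n' T = mat n' n (%(i, j). T (unitw (e j)) (e' i))"

definition crd :: "(nat => word) => nat => (word => 'k::field) => 'k vec" where
 "crd e n f = vec n (%j. f (e j))"

definition opm :: "(nat => word) => nat => (nat => word) => nat => 'k mat =>
  (word => 'k) => word => 'k::field" where
 "opm e n e' n' X f u = (\<Sum>i<n'. if u = e' i then (\<Sum>j<n. X $$ (i, j) * f (e j)) else 0)"

definition wrep :: "(nat => word) => nat => 'k::field perm_rep" where
 "wrep e n = (n, %sz. mx e n e n (act sz))"

lemma dim_mx [simp]: "dim_row (mx e n e' n' T) = n'" "dim_col (mx e n e' n' T) = n"
 by (simp_all add: mx_def)

lemma crd_carrier [simp]: "crd e n f \<in> carrier_vec n" "dim_vec (crd e n f) = n"
 by (simp_all add: crd_def)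

lemma on_unitw: "w \<in> A ==> on A (unitw w)"
 by (auto simp: on_def unitw_def)

lemma crd_add: "crd e n (f + g) = crd e n f + crd e n g"
 by (rule eq_vecI) (simp_all add: crd_def)

lemma crd_eqI:
 assumes "bij_betw e {..<n} A" "on A f" "on A g" "crd e n f = crd e n g"
 shows "f = g"
proof
 fix u
 show "f u = g u"
 proof (cases "u \<in> A")
  case True
  then obtain j where "j < n" "u = e j" using bij_betw_imp_surj_on[OF assms(1)] by auto
  thus ?thesis using arg_cong[OF assms(4), of "%v. vec_index v j"] by (simp add: crd_def)
 qed (use assms(2,3) in \<open>simp add: on_def\<close>)
qed

lemma on_expand:
 assumes e: "bij_betw e {..<n::nat} A" and f: "on A f"
 shows "f = (\<Sum>j<n. (%u. f (e j) * unitw (e j) u))"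
proof
 fix u
 show "f u = (\<Sum>j<n. (%u. f (e j) * unitw (e j) u)) u"
 proof (cases "u \<in> A")
  case True
  then obtain k where k: "k < n" "u = e k" using bij_betw_imp_surj_on[OF e] by auto
  have "(\<Sum>j<n. (%u. f (e j) * unitw (e j) u)) u = (\<Sum>j<n. if j = k then f (e j) else 0)"
  unfolding sum_fun_apply using k bij_betw_imp_inj_on[OF e]
  by (intro sum.cong) (auto simp: unitw_def inj_on_eq_iff)
  thus ?thesis using k by simp
 next
  case False
  have "e j ~= u" if "j < n" for j using False that bij_betw_imp_surj_on[OF e] by auto
  thus ?thesis using False f by (auto simp: sum_fun_apply unitw_def on_def intro!: sum.neutral)
 qed
qed

lemma crd_lin:
 assumes e: "bij_betw e {..<n} A" and f: "on A f" and T: "lin T"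
 shows "crd e' n' (T f) = mx e n e' n' T *\<^sub>v crd e n f"
proof (rule eq_vecI)
 fix i assume "i < dim_vec (mx e n e' n' T *\<^sub>v crd e n f)"
 hence i: "i < n'" by simp
 have "T f = T (\<Sum>j<n. (%u. f (e j) * unitw (e j) u))" using on_expand[OF e f] by simp
 also have "... = (\<Sum>j<n. (%u. f (e j) * T (unitw (e j)) u))"
  by (simp add: lin_sum[OF T] linD(2)[OF T])
 finally show "crd e' n' (T f) $ i = (mx e n e' n' T *\<^sub>v crd e n f) $ i"
  using i by (simp add: crd_def mx_def scalar_prod_def sum_fun_apply mult.commute atLeast0LessThan)
qed simp

lemma mx_comp:
 assumes e': "bij_betw e' {..<n'} B" and S: "lin S" and T: "!!j. j < n ==> on B (T (unitw (e j)))"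
 shows "mx e n e'' n'' (%f. S (T f)) = mx e' n' e'' n'' S * mx e n e' n' T"
proof (rule eq_matI)
 fix i j assume "i < dim_row (mx e' n' e'' n'' S * mx e n e' n' T)" "j < dim_col (mx e' n' e'' n'' S * mx e n e' n' T)"
 hence ij: "i < n''" "j < n" by auto
 have "S (T (unitw (e j))) (e'' i) = crd e'' n'' (S (T (unitw (e j)))) $ i" using ij by (simp add: crd_def)
 also have "... = (mx e' n' e'' n'' S *\<^sub>v crd e' n' (T (unitw (e j)))) $ i"
  using crd_lin[OF e' T[OF ij(2)] S] by simp
 finally show "mx e n e'' n'' (%f. S (T f)) $$ (i, j) = (mx e' n' e'' n'' S * mx e n e' n' T) $$ (i, j)"
  using ij by (simp add: mx_def crd_def scalar_prod_def)
qed auto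

lemma lin_opm: "lin (opm e n e' n' X)"
 unfolding lin_def opm_def
 by (auto simp: fun_eq_iff distrib_left sum.distrib[symmetric] sum_distrib_left mult_ac intro!: sum.cong)

lemma on_opm:
 assumes "bij_betw e' {..<n'} B"
 shows "on B (opm e n e' n' X f)"
 unfolding on_def
proof (intro allI impI)
 fix u assume "u ~: B"
 hence "u ~= e' i" if "i < n'" for i using that bij_betw_imp_surj_on[OF assms] by auto
 thus "opm e n e' n' X f u = 0" by (simp add: opm_def)
qed

lemma crd_opm:
 assumes e': "bij_betw e' {..<n'} B" and X: "dim_row X = n'" "dim_col X = n"
 shows "crd e' n' (opm e n e' n' X f) = X *\<^sub>v crd e n f"
proof (rule eq_vecI)
 fix i assume "i < dim_vec (X *\<^sub>v crd e n f)"
 hence i: "i < n'" using X by simp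
 have "opm e n e' n' X f (e' i) = (\<Sum>i'<n'. if i' = i then (\<Sum>j<n. X $$ (i', j) * f (e j)) else 0)"
  unfolding opm_def using i bij_betw_imp_inj_on[OF e'] by (intro sum.cong) (auto simp: inj_on_eq_iff)
 thus "crd e' n' (opm e n e' n' X f) $ i = (X *\<^sub>v crd e n f) $ i"
  using i X by (simp add: crd_def scalar_prod_def atLeast0LessThan)
qed (use X in simp)

context char2
begin

lemma wrep_Rep:
 assumes e: "bij_betw e {..<n} A" and A: "stable d A"
 shows "(wrep e n :: 'k perm_rep) \<in> Rep d"
 unfolding wrep_def
proof (rule RepI)
 fix sz tz :: "nat => nat" assume s: "sz permutes {1..d}" and t: "tz permutes {1..d}"
 have "on A (act tz (unitw (e j) :: word => 'k))" if "j < n" for j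
  using on_act[OF A t on_unitw] bij_betw_apply[OF e] that by blast
 note u = this
 have "mx e n e n (%f :: word => 'k. act sz (act tz f)) = mx e n e n (act sz) * mx e n e n (act tz)"
  by (rule mx_comp[where T = "act tz" and S = "act sz", OF e lin_act[OF s] u])
 thus "mx e n e n (act (sz o tz)) = mx e n e n (act sz) * (mx e n e n (act tz) :: 'k mat)"
  unfolding mx_def[of _ _ _ _ "act (sz o tz)"] act_comp[OF s t] unfolding mx_def[of _ _ _ _ "%f. act sz (act tz f)"] .
next
 show "mx e n e n (act id) = (1\<^sub>m n :: 'k mat)"
  using bij_betw_imp_inj_on[OF e] by (auto simp: mx_def unitw_def inj_on_eq_iff intro!: eq_matI)
qed auto

lemma mx_intertwiner:
 assumes e: "bij_betw e {..<n} A" and A: "stable d A" and e': "bij_betw e' {..<n'} B" and B: "stable d B"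
  and g: "ghom d A B al"
 shows "intertwiner d (wrep e n) (wrep e' n') (mx e n e' n' al :: 'k mat)"
 unfolding intertwiner_def
proof (intro conjI allI impI)
 fix sz assume s: "sz permutes {1..d}"
 have l: "lin al" using g by (simp add: ghom_def)
 have u: "on A (unitw (e j) :: word => 'k)" if "j < n" for j
  using on_unitw bij_betw_apply[OF e] that by blast
 have "mx e n e' n' al * mx e n e n (act sz) = mx e n e' n' (%f. al (act sz f))"
  by (rule mx_comp[OF e l, symmetric]) (rule on_act[OF A s u])
 also have "... = mx e n e' n' (%f. act sz (al f))"
  using g u s by (auto simp: mx_def ghom_def intro!: eq_matI)
 also have "... = mx e' n' e' n' (act sz) * mx e n e' n' al"
  by (rule mx_comp[OF e' lin_act[OF s]]) (use g u in \<open>auto simp: ghom_def\<close>)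
 finally show "mx e n e' n' al * snd (wrep e n) sz = snd (wrep e' n') sz * mx e n e' n' al"
  by (simp add: wrep_def)
qed (auto simp: wrep_def)

lemma opm_ghom:
 assumes e: "bij_betw e {..<n} A" and A: "stable d A" and e': "bij_betw e' {..<n'} B" and B: "stable d B"
  and X: "intertwiner d (wrep e n) (wrep e' n') (X :: 'k mat)"
 shows "ghom d A B (opm e n e' n' X)"
 unfolding ghom_def
proof (intro conjI allI impI)
 fix sz :: "nat => nat" and f :: "word => 'k" assume s: "sz permutes {1..d}" and f: "on A f"
 have dX: "dim_row X = n'" "dim_col X = n" using intertwinerD[OF X] by (simp_all add: wrep_def)
 have cX: "X \<in> carrier_mat n' n" using dX by auto
 have m: "mx e n e n (act sz) \<in> carrier_mat n n" "mx e' n' e' n' (act sz) \<in> carrier_mat n' n'" by auto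
 show "opm e n e' n' X (act sz f) = act sz (opm e n e' n' X f)"
 proof (rule crd_eqI[OF e' on_opm[OF e'] on_act[OF B s on_opm[OF e']]])
  have "crd e' n' (opm e n e' n' X (act sz f)) = X *\<^sub>v (mx e n e n (act sz) *\<^sub>v crd e n f)"
  by (simp add: crd_opm[OF e' dX] crd_lin[OF e f lin_act[OF s]])
  also have "... = (X * mx e n e n (act sz)) *\<^sub>v crd e n f"
  by (rule assoc_mult_mat_vec[OF cX m(1) crd_carrier(1), symmetric])
  also have "X * mx e n e n (act sz) = mx e' n' e' n' (act sz) * X"
  using intertwinerD(3)[OF X s] by (simp add: wrep_def)
  also have "... *\<^sub>v crd e n f = mx e' n' e' n' (act sz) *\<^sub>v (X *\<^sub>v crd e n f)"
  by (rule assoc_mult_mat_vec[OF m(2) cX crd_carrier(1)])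
  also have "... = crd e' n' (act sz (opm e n e' n' X f))"
  by (simp add: crd_opm[OF e' dX] crd_lin[OF e' on_opm[OF e'] lin_act[OF s]])
  finally show "crd e' n' (opm e n e' n' X (act sz f)) = crd e' n' (act sz (opm e n e' n' X f))" .
 qed
qed (auto intro: lin_opm on_opm[OF e'])

text \<open>Supported functions correspond to coordinate vectors, and intertwining matrices to
  equivariant operators by way of \<open>mx\<close> and \<open>opm\<close>; each step of
  \<open>thru\<close> contributes one pair to the list, and conversely.\<close>

lemma fac_wrep_iff:
 assumes e: "bij_betw e {..<n} A" and A: "stable d A" and e': "bij_betw e' {..<n'} B" and B: "stable d B"
 shows "fac d (wrep e n) (wrep e' n' :: 'k perm_rep) \<longleftrightarrow> dominated TYPE('k) d A B"
proof
 let ?M = "wrep e n :: 'k perm_rep" and ?N = "wrep e' n' :: 'k perm_rep"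
 assume "fac d ?M ?N"
 hence "thru d ?N ?M ?M (1\<^sub>m n)" by (simp add: fac_def wrep_def)
 moreover have "EX ps. (\<forall>(al, bt) \<in> set ps. ghom d A B al & ghom d B A bt) &
  (ALL f. on A f --> (\<Sum>(al, bt)\<leftarrow>ps. bt (al f)) = opm e n e n C f)" if "thru d ?N ?M ?M C" for C
  using that
 proof (induction rule: thru.induct)
  case zero
  have "opm e n e n (0\<^sub>m (fst ?M) (fst ?M)) f = 0" for f :: "word => 'k"
  by (auto simp: opm_def wrep_def fun_eq_iff intro!: sum.neutral)
  then show ?case by (intro exI[of _ "[]"]) (simp add: zero_fun_def)
 next
  case (step C X Y)
  then obtain ps where ps: "\<forall>(al, bt) \<in> set ps. ghom d A B al & ghom d B A bt"
  "!!f. on A f ==> (\<Sum>(al, bt)\<leftarrow>ps. bt (al f)) = opm e n e n C f" by auto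
  have d: "dim_row X = n'" "dim_col X = n" "dim_row Y = n" "dim_col Y = n'" "dim_row C = n" "dim_col C = n"
  using intertwinerD[OF step(2)] intertwinerD[OF step(3)] thru_dim[OF step(1)] by (auto simp: wrep_def)
  have c: "Y \<in> carrier_mat n n'" "X \<in> carrier_mat n' n" "C \<in> carrier_mat n n" "Y * X \<in> carrier_mat n n" using d by auto
  have "opm e' n' e n Y (opm e n e' n' X f) + opm e n e n C f = opm e n e n (C + Y * X) f" for f
  proof (rule crd_eqI[OF e on_add[OF on_opm[OF e] on_opm[OF e]] on_opm[OF e]])
  have "crd e n (opm e' n' e n Y (opm e n e' n' X f) + opm e n e n C f) =
    Y *\<^sub>v (X *\<^sub>v crd e n f) + C *\<^sub>v crd e n f"
   by (simp only: crd_add crd_opm[OF e d(3,4)] crd_opm[OF e' d(1,2)] crd_opm[OF e d(5,6)])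
  also have "... = (Y * X) *\<^sub>v crd e n f + C *\<^sub>v crd e n f"
   by (simp only: assoc_mult_mat_vec[OF c(1,2) crd_carrier(1)])
  also have "... = (C + Y * X) *\<^sub>v crd e n f"
   using add_mult_distrib_mat_vec[OF c(3,4) crd_carrier(1), of e f] comm_add_vec[of "C *\<^sub>v crd e n f" n "(Y * X) *\<^sub>v crd e n f"] c
    mult_mat_vec_carrier[OF c(3) crd_carrier(1)] mult_mat_vec_carrier[OF c(4) crd_carrier(1)] by simp
  also have "... = crd e n (opm e n e n (C + Y * X) f)"
   by (rule crd_opm[OF e, symmetric]) (use d in auto)
  finally show "crd e n (opm e' n' e n Y (opm e n e' n' X f) + opm e n e n C f) = crd e n (opm e n e n (C + Y * X) f)" .
  qed
  then show ?case using ps opm_ghom[OF e A e' B step(2)] opm_ghom[OF e' B e A step(3)]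
  by (intro exI[of _ "(opm e n e' n' X, opm e' n' e n Y) # ps"]) auto
 qed
 ultimately have "EX ps. (\<forall>(al, bt) \<in> set ps. ghom d A B al & ghom d B A bt) &
  (ALL f. on A f --> (\<Sum>(al, bt)\<leftarrow>ps. bt (al f)) = opm e n e n (1\<^sub>m n :: 'k mat) f)" by blast
 moreover have "opm e n e n (1\<^sub>m n) f = f" if "on A f" for f :: "word => 'k"
  by (rule crd_eqI[OF e on_opm[OF e] that]) (simp add: crd_opm[OF e])
 ultimately show "dominated TYPE('k) d A B" unfolding dominated_def by simp
next
 let ?M = "wrep e n :: 'k perm_rep" and ?N = "wrep e' n' :: 'k perm_rep"
 assume "dominated TYPE('k) d A B"
 then obtain ps where ps: "!!al bt. (al, bt) \<in> set ps ==> ghom d A B al & ghom d B A bt"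
  and id: "!!f :: word => 'k. on A f ==> (\<Sum>(al, bt)\<leftarrow>ps. bt (al f)) = f" unfolding dominated_def by blast
 define S :: "(((word => 'k) => word => 'k) \<times> ((word => 'k) => word => 'k)) list => 'k mat"
  where "S qs = mx e n e n (%f. \<Sum>(al, bt)\<leftarrow>qs. bt (al f))" for qs
 have "set qs \<subseteq> set ps ==> thru d ?N ?M ?M (S qs)" for qs
 proof (induction qs)
  case Nil
  have "S [] = 0\<^sub>m (fst ?M) (fst ?M)" by (auto simp: S_def mx_def wrep_def intro!: eq_matI)
  then show ?case by (simp only: thru.zero)
 next
  case (Cons p qs)
  obtain al bt where p: "p = (al, bt)" by force
  have g: "ghom d A B al" "ghom d B A bt" using ps[of al bt] Cons(2) p by auto
  have u: "on B (al (unitw (e j)))" if "j < n" for j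
  using g on_unitw[of "e j" A] bij_betw_apply[OF e] that by (auto simp: ghom_def)
  have l: "lin bt" using g by (simp add: ghom_def)
  have m: "mx e n e n (%f. bt (al f)) = mx e' n' e n bt * mx e n e' n' al"
  by (rule mx_comp[where T = al, OF e' l u])
  have "S (p # qs) = S qs + mx e' n' e n bt * mx e n e' n' al"
  unfolding m[symmetric] by (auto simp: S_def p mx_def add.commute intro!: eq_matI)
  then show ?case
  using thru.step[OF _ mx_intertwiner[OF e A e' B g(1)] mx_intertwiner[OF e' B e A g(2)]] Cons by simp
 qed
 from this[of ps] have th: "thru d ?N ?M ?M (S ps)" by simp
 have "S ps = 1\<^sub>m n"
 proof (rule eq_matI)
  fix i j assume "i < dim_row (1\<^sub>m n :: 'k mat)" "j < dim_col (1\<^sub>m n :: 'k mat)"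
  hence ij: "i < n" "j < n" by auto
  have "on A (unitw (e j) :: word => 'k)" using on_unitw bij_betw_apply[OF e] ij by blast
  from id[OF this] show "S ps $$ (i, j) = (1\<^sub>m n :: 'k mat) $$ (i, j)"
  using ij bij_betw_imp_inj_on[OF e] by (simp add: S_def mx_def unitw_def inj_on_eq_iff)
 qed (auto simp: S_def)
 with th show "fac d ?M ?N" by (simp add: fac_def wrep_def)
qed

end

section \<open>The tensor powers as representations on words\<close>

definition letters :: "nat set => nat set => letter set" where
 "letters O1 P1 = One ` O1 \<union> V ` P1 \<union> W ` P1"

text \<open>Positions outside \<open>{1..d}\<close> carry the letter \<open>One 0\<close>, whether
  or not it belongs to L. Words remain total functions on which permutations act by composition, and
  each is determined by its letters in \<open>{1..d}\<close>.\<close>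

definition words :: "nat => letter set => word set" where
 "words d L = {u. ALL i. (i \<in> {1..d} --> u i \<in> L) & (i ~: {1..d} --> u i = One 0)}"

lemma colour_eq_One: "colour l = One a \<longleftrightarrow> l = One a" by (cases l) auto

lemma colour_letters: "colour l = colour l' ==> l \<in> letters O1 P1 \<longleftrightarrow> l' \<in> letters O1 P1"
 by (cases l; cases l') (auto simp: letters_def)

lemma colour_comp: "colour o u = colour o v ==> colour (u i) = colour (v i)"
 by (metis comp_apply)

lemma stable_words: "stable d (words d (letters O1 P1))"
 unfolding stable_def
proof (intro conjI allI impI)
 fix u v :: word assume u: "u \<in> words d (letters O1 P1)" and c: "colour o u = colour o v"
 show "v \<in> words d (letters O1 P1)"
  unfolding words_def
 proof (intro CollectI allI conjI impI)
  fix i assume "i \<in> {1..d}"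
  hence "u i \<in> letters O1 P1" using u unfolding words_def by blast
  thus "v i \<in> letters O1 P1" using colour_letters[OF colour_comp[OF c, of i]] by blast
 next
  fix i assume "i ~: {1..d}"
  hence "u i = One 0" using u unfolding words_def by blast
  hence "colour (v i) = One 0" using colour_comp[OF c, of i] by simp
  thus "v i = One 0" by (simp only: colour_eq_One)
 qed
next
 fix sz :: "nat => nat" and u :: word
 assume s: "sz permutes {1..d}" and u: "u \<in> words d (letters O1 P1)"
 show "u o sz \<in> words d (letters O1 P1)"
  unfolding words_def
 proof (intro CollectI allI conjI impI)
  fix i assume "i \<in> {1..d}"
  hence "sz i \<in> {1..d}" using permutes_in_image[OF s] by blast
  hence "u (sz i) \<in> letters O1 P1" using u unfolding words_def by blast
  thus "(u o sz) i \<in> letters O1 P1" by simp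
 next
  fix i assume i: "i ~: {1..d}"
  hence "sz i = i" using s by (simp add: permutes_def)
  moreover have "u i = One 0" using i u unfolding words_def by blast
  ultimately show "(u o sz) i = One 0" by simp
 qed
qed

lemma card_words:
 assumes "finite L"
 shows "card (words d L) = card L ^ d" "finite (words d L)"
proof -
 define h where "h g = (%k. if k \<in> {1..d} then g k else One 0)" for g :: word
 have im: "words d L = h ` ({1..d} \<rightarrow>\<^sub>E L)"
 proof
  show "words d L \<subseteq> h ` ({1..d} \<rightarrow>\<^sub>E L)"
  proof
  fix u assume u: "u \<in> words d L"
  hence "u = h (restrict u {1..d})" by (auto simp: h_def words_def fun_eq_iff)
  moreover have "restrict u {1..d} \<in> {1..d} \<rightarrow>\<^sub>E L" using u by (auto simp: words_def)
  ultimately show "u \<in> h ` ({1..d} \<rightarrow>\<^sub>E L)" by blast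
  qed
 qed (auto simp: h_def words_def)
 have inj: "inj_on h ({1..d} \<rightarrow>\<^sub>E L)"
 proof (rule inj_onI)
  fix f g assume fg: "f \<in> {1..d} \<rightarrow>\<^sub>E L" "g \<in> {1..d} \<rightarrow>\<^sub>E L" "h f = h g"
  show "f = g"
  proof (rule PiE_ext[OF fg(1,2)])
  fix k assume "k \<in> {1..d}"
  thus "f k = g k" using fun_cong[OF fg(3), of k] by (simp add: h_def)
  qed
 qed
 show "card (words d L) = card L ^ d" unfolding im card_image[OF inj] by (simp add: card_PiE)
 show "finite (words d L)" unfolding im using assms by (intro finite_imageI finite_PiE) auto
qed

text \<open>The letters in the order in which \<open>mn_obj\<close> lists its basis: the unit
  objects, then the pairs \<open>V j\<close>, \<open>W j\<close>.\<close>

definition enc :: "nat => nat => letter" where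
 "enc m a = (if a < m then One a else if even (a - m) then V ((a - m) div 2) else W ((a - m) div 2))"

text \<open>The letters are the digits of J in base N with position 1 the most significant, in
  agreement with the lexicographic order on tensor products.\<close>

definition wd :: "nat => nat => nat => nat => word" where
 "wd m N d J = (%k. if k \<in> {1..d} then enc m (J div N ^ (d - k) mod N) else One 0)"

lemma enc_simps: "enc m (m + 2 * j) = V j" "enc m (m + (2 * j + 1)) = W j" "i < m ==> enc m i = One i"
 by (simp_all add: enc_def)

lemma enc_cases:
 obtains "a < m" "enc m a = One a" | j where "a = m + 2 * j" "enc m a = V j" | j where "a = m + (2 * j + 1)" "enc m a = W j"
proof (cases "a < m")
 case False
 hence a: "a = m + (a - m)" by simp
 show ?thesis
 proof (cases "even (a - m)")
  case True
  then obtain j where "a - m = 2 * j" by (rule evenE)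
  thus ?thesis using that(2)[of j] a enc_simps(1)[of m j] by simp
 next
  case False
  then obtain j where "a - m = 2 * j + 1" by (rule oddE)
  thus ?thesis using that(3)[of j] a enc_simps(2)[of m j] by simp
 qed
qed (use that(1) enc_simps(3) in blast)

lemma bij_enc: "bij_betw (enc m) {..<m + 2 * n} (letters {..<m} {..<n})"
proof -
 have "inj_on (enc m) {..<m + 2 * n}"
 proof (rule inj_onI)
  fix a b assume "enc m a = enc m b"
  thus "a = b" by (cases rule: enc_cases[where a = a and m = m]; cases rule: enc_cases[where a = b and m = m]) simp_all
 qed
 moreover have "enc m ` {..<m + 2 * n} = letters {..<m} {..<n}"
 proof
  show "enc m ` {..<m + 2 * n} \<subseteq> letters {..<m} {..<n}"
  proof
  fix l assume "l \<in> enc m ` {..<m + 2 * n}"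
  then obtain a where a: "a < m + 2 * n" "l = enc m a" by auto
  show "l \<in> letters {..<m} {..<n}" using a by (cases rule: enc_cases[where a = a and m = m]) (simp_all add: letters_def)
  qed
  show "letters {..<m} {..<n} \<subseteq> enc m ` {..<m + 2 * n}"
  proof
  fix l assume "l \<in> letters {..<m} {..<n}"
  then consider (1) i where "i < m" "l = One i" | (2) j where "j < n" "l = V j" | (3) j where "j < n" "l = W j"
   unfolding letters_def by blast
  thus "l \<in> enc m ` {..<m + 2 * n}"
  proof cases
   case (1 i)
   thus ?thesis by (intro image_eqI[of _ _ i]) (simp_all add: enc_simps)
  next
   case (2 j)
   thus ?thesis by (intro image_eqI[of _ _ "m + 2 * j"]) (simp_all only: enc_simps, simp)
  next
   case (3 j)
   thus ?thesis by (intro image_eqI[of _ _ "m + (2 * j + 1)"]) (simp_all only: enc_simps, simp)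
  qed
  qed
 qed
 ultimately show ?thesis by (simp add: bij_betw_def)
qed

lemma digits_inj:
 fixes I J N :: nat
 shows "I < N ^ e ==> J < N ^ e ==> (!!k. k < e ==> I div N ^ k mod N = J div N ^ k mod N) ==> I = J"
proof (induction e arbitrary: I J)
 case (Suc e)
 have "I div N < N ^ e" "J div N < N ^ e" using Suc(2,3) by (auto simp: less_mult_imp_div_less mult.commute)
 moreover have "I div N div N ^ k mod N = J div N div N ^ k mod N" if "k < e" for k
  using Suc(4)[of "Suc k"] that by (simp add: div_mult2_eq)
 ultimately have "I div N = J div N" by (rule Suc(1))
 moreover have "I mod N = J mod N" using Suc(4)[of 0] by simp
 ultimately show ?case by (metis div_mult_mod_eq)
qed auto

lemma bij_wd:
 assumes "N = m + 2 * n"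
 shows "bij_betw (wd m N d) {..<N ^ d} (words d (letters {..<m} {..<n}))"
proof -
 have e: "bij_betw (enc m) {..<N} (letters {..<m} {..<n})" using bij_enc assms by simp
 have inj: "inj_on (wd m N d) {..<N ^ d}"
 proof (rule inj_onI)
  fix I J assume IJ: "I \<in> {..<N ^ d}" "J \<in> {..<N ^ d}" "wd m N d I = wd m N d J"
  show "I = J"
  proof (cases "d = 0")
  case False
  show ?thesis
  proof (rule digits_inj)
   show "I < N ^ d" "J < N ^ d" using IJ by auto
   hence "N > 0" using False by (cases "N = 0") (auto simp: power_0_left split: if_splits)
   fix k assume "k < d"
   hence "enc m (I div N ^ k mod N) = enc m (J div N ^ k mod N)"
    using fun_cong[OF IJ(3), of "d - k"] by (simp add: wd_def Suc_le_eq)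
   thus "I div N ^ k mod N = J div N ^ k mod N"
    using inj_onD[OF bij_betw_imp_inj_on[OF e]] \<open>N > 0\<close> by simp
  qed
  qed (use IJ in simp)
 qed
 have sub: "wd m N d ` {..<N ^ d} \<subseteq> words d (letters {..<m} {..<n})"
 proof (intro image_subsetI)
  fix J assume J: "J \<in> {..<N ^ d}"
  show "wd m N d J \<in> words d (letters {..<m} {..<n})"
  proof (cases "d = 0")
  case False
  have "J < N ^ d" using J by simp
  hence "N > 0" using False by (cases "N = 0") (auto simp: power_0_left split: if_splits)
  thus ?thesis using bij_betw_apply[OF e] by (simp add: words_def wd_def)
  qed (simp add: words_def wd_def)
 qed
 have "card (letters {..<m} {..<n}) = N" "finite (letters {..<m} {..<n})"
  using bij_betw_same_card[OF e] bij_betw_finite[OF e] by simp_all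
 hence "card (words d (letters {..<m} {..<n})) = card (wd m N d ` {..<N ^ d})" "finite (words d (letters {..<m} {..<n}))"
  using card_words inj by (simp_all add: card_image)
 hence "wd m N d ` {..<N ^ d} = words d (letters {..<m} {..<n})" using sub by (metis card_subset_eq)
 thus ?thesis using inj by (simp add: bij_betw_def)
qed

text \<open>The matrix of delta indexed by letters, with a the row and b the column.\<close>

definition dlt :: "letter => letter => 'k::field" where
 "dlt a b = (if EX j. a = W j & b = V j then 1 else 0)"

lemma index_mn_obj: "a < m + 2 * n ==> b < m + 2 * n ==> mn_obj m n $$ (a, b) = (dlt (enc m a) (enc m b) :: 'k::field)"
proof (induction n)
 case 0
 thus ?case by (simp add: mn_obj_0 dlt_def enc_def)
next
 case (Suc n)
 have P: "P_obj $$ (0, 0) = (0::'k)" "P_obj $$ (0, 1) = (0::'k)" "P_obj $$ (1, 0) = (1::'k)" "P_obj $$ (1, 1) = (0::'k)"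
  "dim_row (P_obj :: 'k mat) = 2" "dim_col (P_obj :: 'k mat) = 2"
  by (simp_all add: P_obj_def mat_of_rows_list_def)
 have lt: "enc m c ~= V n" "enc m c ~= W n" if "c < m + 2 * n" for c
  using that by (cases rule: enc_cases[where a = c and m = m]; simp)+
 have cs: "c < m + 2 * n \<or> c = m + 2 * n \<or> c = m + 2 * n + 1" if "c < m + 2 * Suc n" for c using that by auto
 have e: "enc m (m + 2 * n) = V n" "enc m (m + 2 * n + 1) = W n" using enc_simps(1,2)[of m n] by (simp_all add: add.assoc)
 have sub: "m + 2 * n + 1 - (m + 2 * n) = 1" by simp
 show ?case
  using cs[OF Suc(2)] cs[OF Suc(3)] Suc(1) lt[of a] lt[of b]
  by (elim disjE) (simp_all add: mn_obj_Suc P e dlt_def sub del: One_nat_def add_Suc_right)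
qed

lemma Inv_adjacent: "Inv (transpose i (Suc i)) = {{i, Suc i}}"
proof
 show "Inv (transpose i (Suc i)) \<subseteq> {{i, Suc i}}"
 proof
  fix X assume "X \<in> Inv (transpose i (Suc i))"
  then obtain a b where ab: "X = {a, b}" "a < b" "transpose i (Suc i) b < transpose i (Suc i) a"
  unfolding Inv_def by blast
  hence "a = i & b = Suc i" unfolding transpose_def by (auto split: if_splits)
  thus "X \<in> {{i, Suc i}}" using ab by simp
 qed
qed (auto simp: Inv_doubleton)

lemma act_adjacent: "act (transpose i (Suc i)) f = pm (transpose i (Suc i)) (f + der i (der (Suc i) f))"
 by (simp add: act_def Inv_adjacent hops_insert hop_doubleton)

lemma act_adjacent_unitw:
 "act (transpose i (Suc i)) (unitw w) u = (if ALL k. k ~= i --> k ~= Suc i --> u k = w k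
  then (if u i = w (Suc i) & u (Suc i) = w i then 1 else 0) + dlt (u i) (w (Suc i)) * dlt (u (Suc i)) (w i) else (0::'k::field))"
proof -
 let ?s = "transpose i (Suc i)"
 have eq: "u o ?s = w \<longleftrightarrow> (ALL k. k ~= i --> k ~= Suc i --> u k = w k) & u i = w (Suc i) & u (Suc i) = w i" for u :: word
 proof
  assume h: "u o ?s = w"
  have "w k = u (?s k)" for k using fun_cong[OF h, of k] by simp
  thus "(ALL k. k ~= i --> k ~= Suc i --> u k = w k) & u i = w (Suc i) & u (Suc i) = w i" by simp
 next
  assume "(ALL k. k ~= i --> k ~= Suc i --> u k = w k) & u i = w (Suc i) & u (Suc i) = w i"
  thus "u o ?s = w" by (auto simp: fun_eq_iff transpose_def)
 qed
 have upd: "(u o ?s)(i := x, Suc i := y) = (u(i := y, Suc i := x)) o ?s" for x y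
  by (auto simp: fun_eq_iff transpose_def)
 have "der i (der (Suc i) (unitw w)) (u o ?s) = (if ALL k. k ~= i --> k ~= Suc i --> u k = w k
  then dlt (u i) (w (Suc i)) * dlt (u (Suc i)) (w i) else (0::'k))"
  unfolding der_def unitw_def dlt_def
  by (cases "u i"; cases "u (Suc i)") (auto simp: fun_upd_twist[of i "Suc i", symmetric] upd eq)
 note h1 = this
 define P where "P \<longleftrightarrow> (ALL k. k ~= i --> k ~= Suc i --> u k = w k)"
 have h2: "unitw w (u o ?s) = (if P & u i = w (Suc i) & u (Suc i) = w i then 1 else (0::'k))"
  unfolding unitw_def eq P_def ..
 show ?thesis unfolding act_adjacent pm_def plus_fun_apply h1 h2 P_def[symmetric] by (cases P) simp_all
qed

text \<open>An index is cut into prefix, digits i and i + 1, and suffix, as the nested Kronecker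
  product in \<open>braiding_at\<close> does; r is the number of suffixes.\<close>

lemma digit_facts:
 fixes N d i :: nat
 assumes i: "1 \<le> i" "i < d" and I: "I < N ^ d"
 defines "r \<equiv> N ^ (d - i - 1)"
 shows "(I mod (N * N * r)) div r div N = I div N ^ (d - i) mod N"
  "(I mod (N * N * r)) div r mod N = I div N ^ (d - Suc i) mod N"
  "(I mod (N * N * r)) mod r = I mod r" "(I mod (N * N * r)) div r < N * N" "r > 0" "N > 0"
  "I div (N * N * r) < N ^ (i - 1)" "N * N * r = N ^ (d - i + 1)"
proof -
 show N: "N > 0" using assms by (cases "N = 0") (auto simp: power_0_left split: if_splits)
 thus r: "r > 0" by (simp add: r_def)
 have x: "(I mod (N * N * r)) div r = (I div r) mod (N * N)"
  using r by (simp add: mult.commute[of "N * N"] mod_mult2_eq)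
 have Nr: "N * r = N ^ (d - i)" using i by (simp add: r_def power_Suc[symmetric] Suc_diff_Suc del: power_Suc)
 show "(I mod (N * N * r)) div r div N = I div N ^ (d - i) mod N"
 proof -
  have "y mod (N * N) div N = y div N mod N" for y using N by (simp add: mod_mult2_eq)
  moreover have "I div r div N = I div (N * r)" by (simp add: div_mult2_eq[symmetric] mult.commute)
  ultimately show ?thesis unfolding x Nr[symmetric] by simp
 qed
 show "(I mod (N * N * r)) div r mod N = I div N ^ (d - Suc i) mod N"
  unfolding x by (simp add: mod_mod_cancel r_def)
 show "(I mod (N * N * r)) mod r = I mod r" by (simp add: mod_mod_cancel)
 show "(I mod (N * N * r)) div r < N * N" unfolding x using N by simp
 show NNr: "N * N * r = N ^ (d - i + 1)" using Nr by simp
 have "(i - 1) + (d - i + 1) = d" using i by simp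
 hence "N ^ d = N ^ (i - 1) * N ^ (d - i + 1)" using power_add[of N "i - 1" "d - i + 1"] by (simp only:)
 thus "I div (N * N * r) < N ^ (i - 1)" unfolding NNr using I by (metis less_mult_imp_div_less)
qed

text \<open>The two identity factors in \<open>braiding_at\<close> test for equal prefix and equal
  suffix. For words this means that all letters other than those in positions i and i + 1
  agree.\<close>

lemma off_digits:
 fixes N d i :: nat
 assumes i: "1 \<le> i" "i < d" and I: "I < N ^ d" and J: "J < N ^ d" and N: "N = m + 2 * n"
 defines "r \<equiv> N ^ (d - i - 1)"
 shows "(ALL k. k ~= i --> k ~= Suc i --> wd m N d I k = wd m N d J k) \<longleftrightarrow>
  I div (N * N * r) = J div (N * N * r) & I mod r = J mod r"
proof -
 note f = digit_facts[OF i I, folded r_def] and g = digit_facts[OF i J, folded r_def]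
 have e: "enc m (x mod N) = enc m (y mod N) \<longleftrightarrow> x mod N = y mod N" for x y
  by (rule inj_on_eq_iff[OF bij_betw_imp_inj_on[OF bij_enc[of m n]]]) (use f(6) N[symmetric] in simp_all)
 have w: "wd m N d I k = wd m N d J k \<longleftrightarrow> k \<in> {1..d} --> I div N ^ (d - k) mod N = J div N ^ (d - k) mod N" for k
  by (auto simp: wd_def e)
 have lo: "(X mod r) div N ^ k mod N = X div N ^ k mod N" if "k < d - i - 1" for X k
 proof -
  have "k + (d - i - 1 - k) = d - i - 1" using that by simp
  hence "r = N ^ k * N ^ (d - i - 1 - k)" using power_add[of N k "d - i - 1 - k"] by (simp only: r_def)
  hence "(X mod r) div N ^ k = X div N ^ k mod N ^ (d - i - 1 - k)" using f(6) by (simp add: mod_mult2_eq)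
  moreover have "0 < d - i - 1 - k" using that by linarith
  hence "N dvd N ^ (d - i - 1 - k)" by (intro dvd_power disjI1)
  ultimately show ?thesis by (simp add: mod_mod_cancel)
 qed
 have hi: "(X div (N * N * r)) div N ^ k = X div N ^ (d - i + 1 + k)" for X k
  by (simp only: f(8) power_add[of N "d - i + 1" k] div_mult2_eq)
 show ?thesis
 proof
  assume h: "ALL k. k ~= i --> k ~= Suc i --> wd m N d I k = wd m N d J k"
  have "I div (N * N * r) = J div (N * N * r)"
  proof (rule digits_inj[OF f(7) g(7)])
  fix k assume k: "k < i - 1"
  have e: "d - (i - 1 - k) = d - i + 1 + k" using k i by simp
  have kk: "i - 1 - k ~= i" "i - 1 - k ~= Suc i" "i - 1 - k \<in> {1..d}" using k i by auto
  show "I div (N * N * r) div N ^ k mod N = J div (N * N * r) div N ^ k mod N"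
   using h[rule_format, OF kk(1,2)] kk(3) unfolding w e hi by blast
  qed
  moreover have "I mod r = J mod r"
  proof (rule digits_inj)
  show "I mod r < N ^ (d - i - 1)" "J mod r < N ^ (d - i - 1)" using f(5) by (simp_all add: r_def)
  fix k assume k: "k < d - i - 1"
  have e: "d - (d - k) = k" using k by simp
  have kk: "d - k ~= i" "d - k ~= Suc i" "d - k \<in> {1..d}" using k i by auto
  show "I mod r div N ^ k mod N = J mod r div N ^ k mod N"
   using h[rule_format, OF kk(1,2)] kk(3) unfolding w e lo[OF k] by blast
  qed
  ultimately show "I div (N * N * r) = J div (N * N * r) & I mod r = J mod r" ..
 next
  assume h: "I div (N * N * r) = J div (N * N * r) & I mod r = J mod r"
  show "ALL k. k ~= i --> k ~= Suc i --> wd m N d I k = wd m N d J k"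
  proof (intro allI impI)
  fix k assume k: "k ~= i" "k ~= Suc i"
  show "wd m N d I k = wd m N d J k" unfolding w
  proof
   assume kd: "k \<in> {1..d}"
   show "I div N ^ (d - k) mod N = J div N ^ (d - k) mod N"
   proof (cases "k < i")
    case True
    hence e: "d - i + 1 + (i - 1 - k) = d - k" using i by simp
    show ?thesis using h hi[of I "i - 1 - k"] hi[of J "i - 1 - k"] unfolding e by simp
   next
    case False
    hence "d - k < d - i - 1" using k kd i by auto
    thus ?thesis using lo[of "d - k" I] lo[of "d - k" J] h by simp
   qed
  qed
  qed
 qed
qed

lemma index_braiding:
 assumes D: "dim_row D = N" "dim_col D = N" and x: "x < N * N" and y: "y < N * N"
 shows "braiding D $$ (x, y) = (if x div N = y mod N & x mod N = y div N then 1 else 0) +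
  D $$ (x div N, y mod N) * D $$ (x mod N, y div N)"
proof -
 define s where "s = (y mod N) * N + y div N"
 have l: "y div N < N" "y mod N < N" "x div N < N" "x mod N < N" using div_mod_less[OF x] div_mod_less[OF y] by auto
 have s: "s div N = y mod N" "s mod N = y div N" using l by (auto simp: s_def)
 have "s < Suc (y mod N) * N" using l by (simp add: s_def)
 also have "... \<le> N * N" using l by (intro mult_le_mono) (simp_all add: Suc_le_eq)
 finally have sN: "s < N * N" .
 have xs: "x = s \<longleftrightarrow> x div N = y mod N & x mod N = y div N" using s by (metis div_mult_mod_eq)
 have fl: "flip_mat N $$ (i, y) = (if i = s then 1 else 0)" if "i < N * N" for i
  using that y by (simp add: flip_mat_def s_def)
 have "(kron D D * flip_mat N) $$ (x, y) = (\<Sum>k = 0..<N * N. kron D D $$ (x, k) * flip_mat N $$ (k, y))"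
  using x y D by (simp add: scalar_prod_def)
 also have "... = (\<Sum>k = 0..<N * N. if k = s then kron D D $$ (x, k) else 0)"
  by (intro sum.cong) (auto simp: fl)
 also have "... = kron D D $$ (x, s)" using sN by simp
 also have "... = D $$ (x div N, y mod N) * D $$ (x mod N, y div N)" using x sN D s by (simp add: index_kron)
 finally show ?thesis using x y D fl[OF x] by (simp add: braiding_def xs[symmetric] del: index_mult_mat(1))
qed

lemma power_split: "1 \<le> i ==> i < d ==> N ^ (i - 1) * (N * N * N ^ (d - i - 1)) = (N :: nat) ^ d"
proof -
 assume "1 \<le> i" "i < d"
 hence e: "(i - 1) + (2 + (d - i - 1)) = d" by simp
 have "N ^ (i - 1) * (N * N * N ^ (d - i - 1)) = N ^ ((i - 1) + (2 + (d - i - 1)))"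
  by (simp only: power_add power2_eq_square)
 thus ?thesis unfolding e .
qed

text \<open>This ties the closed formula \<open>act\<close> to the braiding of the definitions.
  After the index has been cut into digits, both sides are the same product of three tests on
  prefix, two letters, and suffix.\<close>

lemma braiding_at_word:
 fixes N d i :: nat
 assumes i: "1 \<le> i" "i < d" and N: "N = m + 2 * n"
 shows "mx (wd m N d) (N ^ d) (wd m N d) (N ^ d) (act (transpose i (Suc i))) = (braiding_at d (mn_obj m n) i :: 'k::field mat)"
proof (rule eq_matI)
 define D where "D = (mn_obj m n :: 'k mat)"
 have dD: "dim_row D = N" "dim_col D = N" by (simp_all add: D_def N)
 have db: "dim_row (braiding D) = N * N" "dim_col (braiding D) = N * N" using dD by (auto simp: braiding_def)
 note dim = power_split[OF i, of N]
 show "dim_row (mx (wd m N d) (N ^ d) (wd m N d) (N ^ d) (act (transpose i (Suc i)))) = dim_row (braiding_at d (mn_obj m n) i :: 'k mat)"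
  "dim_col (mx (wd m N d) (N ^ d) (wd m N d) (N ^ d) (act (transpose i (Suc i)))) = dim_col (braiding_at d (mn_obj m n) i :: 'k mat)"
  unfolding D_def[symmetric] using dim db dD by (simp_all add: braiding_at_def)
 fix I J assume "I < dim_row (braiding_at d (mn_obj m n) i :: 'k mat)" "J < dim_col (braiding_at d (mn_obj m n) i :: 'k mat)"
 hence IJ: "I < N ^ d" "J < N ^ d" unfolding D_def[symmetric] using dim db dD by (simp_all add: braiding_at_def)
 define r where "r = N ^ (d - i - 1)"
 note f = digit_facts[OF i IJ(1), folded r_def] and g = digit_facts[OF i IJ(2), folded r_def]
 define a b a' b' where "a = I div N ^ (d - i) mod N" and "b = I div N ^ (d - Suc i) mod N"
  and "a' = J div N ^ (d - i) mod N" and "b' = J div N ^ (d - Suc i) mod N"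
 have l: "a < N" "b < N" "a' < N" "b' < N" using f(6) by (simp_all add: a_def b_def a'_def b'_def)
 have dim': "I < N ^ (i - 1) * (N * N * r)" "J < N ^ (i - 1) * (N * N * r)" using IJ dim by (simp_all add: r_def)
 have mm: "I mod (N * N * r) < N * N * r" "J mod (N * N * r) < N * N * r" using f(5,6) by simp_all
 have e: "enc m x = enc m y \<longleftrightarrow> x = y" if "x < N" "y < N" for x y
  by (rule inj_on_eq_iff[OF bij_betw_imp_inj_on[OF bij_enc[of m n]]]) (use that N[symmetric] in simp_all)
 have w: "wd m N d I i = enc m a" "wd m N d I (Suc i) = enc m b" "wd m N d J i = enc m a'" "wd m N d J (Suc i) = enc m b'"
  using i by (simp_all add: wd_def a_def b_def a'_def b'_def)
 have "braiding_at d D i $$ (I, J) = (if I div (N * N * r) = J div (N * N * r) then 1 else 0) *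
  (braiding D $$ (I mod (N * N * r) div r, J mod (N * N * r) div r) * (if I mod r = J mod r then 1 else 0))"
  using dim' mm f(3,5,7) g(3,5,7) unfolding braiding_at_def dD r_def[symmetric] by (simp add: index_kron db)
 also have "braiding D $$ (I mod (N * N * r) div r, J mod (N * N * r) div r) =
  (if a = b' & b = a' then 1 else 0) + D $$ (a, b') * D $$ (b, a')"
  unfolding index_braiding[OF dD f(4) g(4)] f(1,2) g(1,2) by (simp add: a_def b_def a'_def b'_def)
 finally have bd: "braiding_at d D i $$ (I, J) = (if I div (N * N * r) = J div (N * N * r) then 1 else 0) *
  (((if a = b' & b = a' then 1 else 0) + D $$ (a, b') * D $$ (b, a')) * (if I mod r = J mod r then 1 else 0))" .
 have Dab: "D $$ (a, b') = dlt (enc m a) (enc m b')" "D $$ (b, a') = dlt (enc m b) (enc m a')"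
  unfolding D_def by (rule index_mn_obj; use l N in simp)+
 have "braiding_at d D i $$ (I, J) = act (transpose i (Suc i)) (unitw (wd m N d J)) (wd m N d I)"
  unfolding bd Dab act_adjacent_unitw off_digits[OF i IJ N, folded r_def] w using e[OF l(1,4)] e[OF l(2,3)] by simp
 thus "mx (wd m N d) (N ^ d) (wd m N d) (N ^ d) (act (transpose i (Suc i))) $$ (I, J) = (braiding_at d (mn_obj m n) i :: 'k mat) $$ (I, J)"
  using IJ by (simp add: mx_def D_def)
qed

text \<open>A transposition of two positions at distance l + 1 is conjugate under an adjacent one to
  a transposition at distance l. So the step for adjacent transpositions yields the step for all of
  them.\<close>

lemma adjacent_transpositions_induct [consumes 1, case_names id step]:
 assumes s: "sz permutes {1..d::nat}" and id: "P id"
  and step: "!!i tz. 1 \<le> i ==> i < d ==> tz permutes {1..d} ==> P tz ==> P (transpose i (Suc i) o tz)"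
 shows "P sz"
proof -
 have tp: "transpose a b permutes {1..d}" if "a \<in> {1..d}" "b \<in> {1..d}" for a b
  using that by (rule permutes_swap_id)
 have lt: "P (transpose a (a + Suc k) o tz)" if "tz permutes {1..d}" "P tz" "1 \<le> a" "a + Suc k \<le> d" for a k tz
  using that
 proof (induction k arbitrary: tz)
  case 0
  have "a < d" using 0 by simp
  moreover have "a + Suc 0 = Suc a" by simp
  ultimately show ?case using step[OF 0(3) _ 0(1,2)] by (simp only:)
 next
  case (Suc k)
  let ?s = "transpose (a + Suc k) (Suc (a + Suc k))"
  have sp: "?s permutes {1..d}" using Suc.prems by (intro tp) auto
  have tpp: "transpose a (a + Suc k) permutes {1..d}" using Suc.prems by (intro tp) auto
  have p1: "?s o tz permutes {1..d}" by (rule permutes_compose[OF Suc.prems(1) sp])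
  have P1: "P (?s o tz)" by (rule step[OF _ _ Suc.prems(1,2)]) (use Suc.prems in auto)
  have P2: "P (transpose a (a + Suc k) o (?s o tz))" by (rule Suc.IH[OF p1 P1]) (use Suc.prems in auto)
  have P3: "P (?s o (transpose a (a + Suc k) o (?s o tz)))"
  by (rule step[OF _ _ permutes_compose[OF p1 tpp] P2]) (use Suc.prems in auto)
  have e: "?s o (transpose a (a + Suc k) o (?s o tz)) = transpose a (a + Suc (Suc k)) o tz"
  by (auto simp: fun_eq_iff transpose_def)
  show ?case using P3 unfolding e .
 qed
 show ?thesis using s finite_atLeastAtMost[of 1 d]
 proof (induction rule: permutes_induct)
  case (swap a b p)
  show ?case
  proof (cases "a < b")
  case True
  hence e: "a + Suc (b - a - 1) = b" by simp
  have "P (transpose a (a + Suc (b - a - 1)) o p)" by (rule lt) (use swap True in auto)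
  thus ?thesis unfolding e .
  next
  case False
  hence e: "b + Suc (a - b - 1) = a" using swap by simp
  have "P (transpose b (b + Suc (a - b - 1)) o p)" by (rule lt) (use swap False in auto)
  thus ?thesis unfolding e transpose_commute[of b a] .
  qed
 qed (rule id)
qed

context char2
begin

text \<open>The homomorphism demanded behind \<open>SOME\<close> exists: conjugating the word
  representation by the d-th Kronecker power of the base change gives one. It is unique on S_d, as
  its values on adjacent transpositions are prescribed. Hence the chosen representation is
  isomorphic to the one on words.\<close>

lemma tensor_power_word:
 fixes Y :: "'k mat" and d :: nat
 assumes Y: "similar_mat Y (mn_obj m n)"
 defines "R \<equiv> wrep (wd m (m + 2 * n) d) ((m + 2 * n) ^ d) :: 'k perm_rep"
 shows "tensor_power d Y \<in> Rep d & fac d (tensor_power d Y) R & fac d R (tensor_power d Y)"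
proof -
 define N where "N = m + 2 * n"
 define D where "D = (mn_obj m n :: 'k mat)"
 have dD: "dim_row D = N" "dim_col D = N" by (simp_all add: D_def N_def)
 obtain k P Q where PQ: "{Y, D, P, Q} \<subseteq> carrier_mat k k" "P * Q = 1\<^sub>m k" "Q * P = 1\<^sub>m k" "Y = P * D * Q"
  using similar_matD[OF Y, folded D_def] by blast
 have k: "k = N" using PQ(1) dD by auto
 have dd: "dim_row Y = N" "dim_col Y = N" "dim_row P = N" "dim_col P = N" "dim_row Q = N" "dim_col Q = N" using PQ(1) k by auto
 have "Y * P = P * D * (Q * P)" unfolding PQ(4) using dd dD by (simp add: mult_mat_assoc)
 hence YP: "Y * P = P * D" unfolding PQ(3) using dd dD k by (simp add: mult_mat_one)
 have R: "R \<in> Rep d" unfolding R_def by (rule wrep_Rep[OF bij_wd stable_words]) simp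
 have fR: "fst R = N ^ d" by (simp add: R_def wrep_def N_def)
 have gR: "snd R (transpose i (Suc i)) = braiding_at d D i" if "1 \<le> i" "i < d" for i
  unfolding R_def wrep_def D_def using braiding_at_word[OF that refl, of m n] by simp
 define A B where "A = kpow d P" and "B = kpow d Q"
 have dA: "dim_row A = N ^ d" "dim_col A = N ^ d" "dim_row B = N ^ d" "dim_col B = N ^ d" using dd by (simp_all add: A_def B_def)
 have AB: "A * B = 1\<^sub>m (N ^ d)" "B * A = 1\<^sub>m (N ^ d)"
  unfolding A_def B_def using dd PQ(2,3) k by (simp_all add: kpow_mult kpow_one)
 have ext: "x * y = z ==> dim_col x = dim_row y ==> dim_col y = dim_row t ==> x * (y * t) = z * t"
  for x y z t :: "'k mat" using mult_mat_assoc[of x y t] by simp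
 define rh where "rh sz = A * (snd R sz * B)" for sz
 define M where "M = (N ^ d, rh)"
 have M: "M \<in> Rep d"
  unfolding M_def
 proof (rule RepI)
  fix sz tz :: "nat => nat" assume s: "sz permutes {1..d}" and t: "tz permutes {1..d}"
  note dR = RepD(1,2)[OF R s, unfolded fR] RepD(1,2)[OF R t, unfolded fR]
  show "rh (sz o tz) = rh sz * rh tz"
  unfolding rh_def RepD(3)[OF R s t] using dA dR by (simp add: mult_mat_assoc ext[OF AB(2)] mult_mat_one)
  show "dim_row (rh sz) = N ^ d" "dim_col (rh sz) = N ^ d" using dA by (simp_all add: rh_def)
 next
  show "rh id = 1\<^sub>m (N ^ d)" unfolding rh_def RepD(4)[OF R permutes_id] fR using dA AB by (simp add: mult_mat_one)
 qed
 have gen: "rh (transpose i (Suc i)) = braiding_at d Y i" if i: "1 \<le> i" "i < d" for i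
 proof -
  have tp: "transpose i (Suc i) permutes {1..d}" using i by (intro permutes_swap_id) auto
  note dR = RepD(1,2)[OF R tp, unfolded fR]
  have eq: "braiding_at d Y i * A = A * snd R (transpose i (Suc i))"
  unfolding A_def gR[OF i] by (rule braiding_at_intertwine[OF dd(3,4) dD dd(1,2) YP i])
  note dim = power_split[OF i, of N]
  have db: "dim_col (braiding_at d Y i) = N ^ d" using dd dim by (simp add: braiding_at_def braiding_def)
  have "rh (transpose i (Suc i)) = A * snd R (transpose i (Suc i)) * B" unfolding rh_def using dA dR by (simp add: mult_mat_assoc)
  also have "... = braiding_at d Y i * (A * B)" unfolding eq[symmetric] using dA db by (simp add: mult_mat_assoc)
  finally show ?thesis unfolding AB using db by (simp add: mult_mat_one)
 qed
 define Q' where "Q' rh' \<longleftrightarrow> rh' \<in> hom (sym_group d) (GL (N ^ d)) & (\<forall>i \<in> {1..<d}. rh' (transpose i (Suc i)) = braiding_at d Y i)" for rh'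
 have "Q' rh" unfolding Q'_def using M gen by (auto simp: M_def Rep_def)
 hence S: "Q' (SOME rh'. Q' rh')" by (rule someI[of Q'])
 define T where "T = tensor_power d Y"
 have T: "T = (N ^ d, SOME rh'. Q' rh')" unfolding T_def tensor_power_def Q'_def dd ..
 have TR: "T \<in> Rep d" using S unfolding T Q'_def Rep_def by simp
 have sM: "snd M = rh" by (simp add: M_def)
 have agree: "snd T sz = rh sz" if "sz permutes {1..d}" for sz
  using that
 proof (induction rule: adjacent_transpositions_induct)
  case id
  have "snd T id = snd M id" unfolding RepD(4)[OF TR permutes_id] RepD(4)[OF M permutes_id] by (simp add: T M_def)
  thus ?case by (simp only: sM)
 next
  case (step i tz)
  have tp: "transpose i (Suc i) permutes {1..d}" using step by (intro permutes_swap_id) auto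
  have "snd T (transpose i (Suc i)) = rh (transpose i (Suc i))"
  using S gen[OF step(1,2)] step(1,2) unfolding T Q'_def by simp
  thus ?case using RepD(3)[OF TR tp step(3)] RepD(3)[OF M tp step(3)] step(4) unfolding sM by (simp only:)
 qed
 have fT: "fst T = N ^ d" by (simp add: T)
 have iA: "intertwiner d R T A" unfolding intertwiner_def fT fR
 proof (intro conjI allI impI)
  fix sz assume s: "sz permutes {1..d}"
  show "A * snd R sz = snd T sz * A" unfolding agree[OF s] rh_def
  using dA RepD(1,2)[OF R s, unfolded fR] AB by (simp add: mult_mat_assoc mult_mat_one)
 qed (use dA in auto)
 have iB: "intertwiner d T R B" unfolding intertwiner_def fT fR
 proof (intro conjI allI impI)
  fix sz assume s: "sz permutes {1..d}"
  show "B * snd T sz = snd R sz * B" unfolding agree[OF s] rh_def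
  using dA RepD(1,2)[OF R s, unfolded fR] by (simp add: ext[OF AB(2)] mult_mat_one)
 qed (use dA in auto)
 have "fac d T R" by (rule fac_retract[OF iB iA]) (simp add: AB fT)
 moreover have "fac d R T" by (rule fac_retract[OF iA iB]) (simp add: AB fR)
 ultimately show ?thesis using TR unfolding T_def by blast
qed

text \<open>By \<open>square_zero_similar\<close> every object has the form m' + n'P up to
  isomorphism, so only these objects have to be tested.\<close>

lemma relatively_discerning_iff_dominated:
 "relatively_discerning d (mn_obj m n :: 'k mat) \<longleftrightarrow>
  (ALL m' n'. dominated TYPE('k) d (words d (letters {..<m'} {..<n'})) (words d (letters {..<m} {..<n})))"
proof -
 have sq: "(mn_obj a b :: 'k mat) * mn_obj a b = 0\<^sub>m (a + 2 * b) (a + 2 * b)" for a b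
 proof (rule eq_matI)
  fix i j assume "i < dim_row (0\<^sub>m (a + 2 * b) (a + 2 * b) :: 'k mat)" "j < dim_col (0\<^sub>m (a + 2 * b) (a + 2 * b) :: 'k mat)"
  hence ij: "i < a + 2 * b" "j < a + 2 * b" by auto
  have "((mn_obj a b :: 'k mat) * mn_obj a b) $$ (i, j) = (\<Sum>k = 0..<a + 2 * b. dlt (enc a i) (enc a k) * dlt (enc a k) (enc a j))"
  using ij by (simp add: scalar_prod_def index_mn_obj)
  also have "... = 0" by (rule sum.neutral) (auto simp: dlt_def)
  finally show "((mn_obj a b :: 'k mat) * mn_obj a b) $$ (i, j) = 0\<^sub>m (a + 2 * b) (a + 2 * b) $$ (i, j)" using ij by simp
 qed auto
 have V4: "(mn_obj a b :: 'k mat) \<in> Ver4p" for a b using sq[of a b] by (simp add: Ver4p_def)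
 have sim: "EX a b. similar_mat Y (mn_obj a b)" if "Y \<in> Ver4p" for Y :: "'k mat"
 proof (rule square_zero_similar)
  show "Y \<in> carrier_mat (dim_row Y) (dim_row Y)" by (rule carrier_matI) (use that in \<open>simp_all add: Ver4p_def\<close>)
  show "Y * Y = 0\<^sub>m (dim_row Y) (dim_row Y)" using that by (simp add: Ver4p_def)
 qed
 have T: "tensor_power d Y \<in> Rep d" if "Y \<in> Ver4p" for Y :: "'k mat" using sim[OF that] tensor_power_word by blast
 have refl: "similar_mat (mn_obj a b) (mn_obj a b :: 'k mat)" for a b
  by (rule similar_mat_refl[of _ "a + 2 * b"]) (rule carrier_matI; simp)
 define R where "R a b = (wrep (wd a (a + 2 * b) d) ((a + 2 * b) ^ d) :: 'k perm_rep)" for a b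
 have RR: "R a b \<in> Rep d" for a b unfolding R_def by (rule wrep_Rep[OF bij_wd stable_words]) simp
 have iff: "fac d (R a b) (R m n) \<longleftrightarrow> dominated TYPE('k) d (words d (letters {..<a} {..<b})) (words d (letters {..<m} {..<n}))" for a b
  unfolding R_def by (rule fac_wrep_iff[OF bij_wd stable_words bij_wd stable_words]) simp_all
 have X: "fac d (tensor_power d (mn_obj m n)) (R m n)" "fac d (R m n) (tensor_power d (mn_obj m n))"
  using tensor_power_word[OF refl[of m n], of d] by (simp_all add: R_def)
 have "(\<forall>Y \<in> Ver4p. fac d (tensor_power d Y) (tensor_power d (mn_obj m n :: 'k mat))) \<longleftrightarrow> (ALL a b. fac d (R a b) (R m n))"
 proof (intro iffI allI ballI)
  fix a b assume "\<forall>Y \<in> Ver4p. fac d (tensor_power d Y) (tensor_power d (mn_obj m n :: 'k mat))"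
  hence "fac d (tensor_power d (mn_obj a b)) (tensor_power d (mn_obj m n :: 'k mat))" using V4 by blast
  moreover have "fac d (R a b) (tensor_power d (mn_obj a b))"
  using tensor_power_word[OF refl[of a b], of d] by (simp add: R_def)
  ultimately show "fac d (R a b) (R m n)"
  using X(1) fac_trans[OF RR T[OF V4] T[OF V4]] fac_trans[OF RR T[OF V4] RR] by blast
 next
  fix Y :: "'k mat" assume h: "ALL a b. fac d (R a b) (R m n)" and Y: "Y \<in> Ver4p"
  obtain a b where ab: "similar_mat Y (mn_obj a b)" using sim[OF Y] by blast
  have "fac d (tensor_power d Y) (R a b)" using tensor_power_word[OF ab, of d] by (simp add: R_def)
  hence "fac d (tensor_power d Y) (R m n)" using fac_trans[OF T[OF Y] RR RR] h by blast
  thus "fac d (tensor_power d Y) (tensor_power d (mn_obj m n))" using fac_trans[OF T[OF Y] RR T[OF V4]] X(2) by blast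
 qed
 thus ?thesis unfolding iff using relatively_discerning_iff_fac[OF T V4[of m n]] by (simp only:)
qed

end

section \<open>Relative traces\<close>

lemma lin_sum_list: "lin al ==> al (\<Sum>x\<leftarrow>xs. f x) = (\<Sum>x\<leftarrow>xs. al (f x))"
 by (induction xs) (auto simp: lin_zero linD)

lemma ghom_comp: "ghom d A B al ==> ghom d B C bt ==> ghom d A C (%f. bt (al f))"
 unfolding ghom_def by (auto intro: lin_comp)

lemma dominated_trans:
 assumes "dominated TYPE('k::field) d A B" "dominated TYPE('k) d B C"
 shows "dominated TYPE('k) d A C"
proof -
 obtain ps :: "(((word => 'k) => word => 'k) \<times> ((word => 'k) => word => 'k)) list" where
  ps: "!!al bt. (al, bt) \<in> set ps ==> ghom d A B al & ghom d B A bt"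
  and idA: "!!f. on A f ==> (\<Sum>(al, bt)\<leftarrow>ps. bt (al f)) = f" using assms(1) unfolding dominated_def by blast
 obtain qs :: "(((word => 'k) => word => 'k) \<times> ((word => 'k) => word => 'k)) list" where
  qs: "!!al bt. (al, bt) \<in> set qs ==> ghom d B C al & ghom d C B bt"
  and idB: "!!f. on B f ==> (\<Sum>(al, bt)\<leftarrow>qs. bt (al f)) = f" using assms(2) unfolding dominated_def by blast
 define cp :: "((word => 'k) => word => 'k) \<times> ((word => 'k) => word => 'k) => ((word => 'k) => word => 'k) \<times> ((word => 'k) => word => 'k) => _"
  where "cp p q = ((%f. fst q (fst p f)), (%f. snd p (snd q f)))" for p q
 define rs where "rs = concat (map (%p. map (cp p) qs) ps)"
 have g: "ghom d A C (fst r) & ghom d C A (snd r)" if r: "r \<in> set rs" for r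
 proof -
  obtain p q where pq: "p \<in> set ps" "q \<in> set qs" "r = cp p q" using r unfolding rs_def by auto
  show ?thesis using ps[of "fst p" "snd p"] qs[of "fst q" "snd q"] pq
  ghom_comp[of d A B "fst p" C "fst q"] ghom_comp[of d C B "snd q" A "snd p"] by (simp add: cp_def)
 qed
 have s: "(\<Sum>r\<leftarrow>concat (map (%p. map (cp p) qs) xs). snd r (fst r f)) = (\<Sum>p\<leftarrow>xs. snd p (fst p f))"
  if "set xs \<subseteq> set ps" "on A f" for xs f
  using that
 proof (induction xs)
  case (Cons p xs)
  have p: "ghom d A B (fst p)" "ghom d B A (snd p)" using ps[of "fst p" "snd p"] Cons(2) by auto
  have "(\<Sum>q\<leftarrow>qs. snd (cp p q) (fst (cp p q) f)) = snd p (\<Sum>q\<leftarrow>qs. snd q (fst q (fst p f)))"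
  using p(2) by (simp add: cp_def lin_sum_list ghom_def)
  also have "(\<Sum>q\<leftarrow>qs. snd q (fst q (fst p f))) = fst p f"
  using idB[of "fst p f"] p(1) Cons(3) by (simp add: ghom_def case_prod_unfold)
  finally show ?case using Cons by (simp add: comp_def)
 qed simp
 show ?thesis unfolding dominated_def
 proof (intro exI[of _ rs] conjI allI impI)
  show "\<forall>(al, bt) \<in> set rs. ghom d A C al & ghom d C A bt" using g by (simp add: case_prod_unfold)
  fix f :: "word => 'k" assume f: "on A f"
  show "(\<Sum>(al, bt)\<leftarrow>rs. bt (al f)) = f"
  using s[OF order_refl f] idA[OF f] by (simp add: rs_def case_prod_unfold)
 qed
qed

lemma act_indicator:
 assumes "stable d A" "sz permutes {1..d}"
 shows "act sz ((%u. if u \<in> A then 1 else 0) * f) = (%u. if u \<in> A then 1 else (0::'k::field)) * act sz f"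
proof -
 have c: "colour_dep (%u. if u \<in> A then 1 else 0 :: 'k)" unfolding colour_dep_def
 proof (intro allI impI)
  fix u v :: word assume "colour o u = colour o v"
  thus "(if u \<in> A then 1 else 0 :: 'k) = (if v \<in> A then 1 else 0)" using stable_colour[OF assms(1), of u v] by simp
 qed
 show ?thesis unfolding act_mult_colour[OF assms(2) c] by (simp add: fun_eq_iff stable_perm[OF assms])
qed

text \<open>The functions supported in A and those supported in B are complementary. Multiplication
  by the indicator of A is equivariant as A is stable, and extends maps defined on A to the
  union.\<close>

lemma dominated_union:
 assumes "dominated TYPE('k::field) d A C" "dominated TYPE('k) d B C" "A \<inter> B = {}" "stable d A" "stable d B"
 shows "dominated TYPE('k) d (A \<union> B) C"
proof -
 define pr :: "word set => (word => 'k) => word => 'k" where "pr D f = (%u. if u \<in> D then 1 else 0) * f" for D f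
 have on_pr: "on D (pr D f)" for D f by (simp add: pr_def on_def)
 have lift: "\<exists>qs :: (((word => 'k) => word => 'k) \<times> ((word => 'k) => word => 'k)) list.
  (\<forall>(al, bt) \<in> set qs. ghom d (A \<union> B) C al & ghom d C (A \<union> B) bt) & (ALL f. (\<Sum>(al, bt)\<leftarrow>qs. bt (al f)) = pr D f)"
  if D: "D = A \<or> D = B" and dom: "dominated TYPE('k) d D C" for D
 proof -
  obtain ps :: "(((word => 'k) => word => 'k) \<times> ((word => 'k) => word => 'k)) list" where
  ps: "!!al bt. (al, bt) \<in> set ps ==> ghom d D C al & ghom d C D bt"
  and idA: "!!f. on D f ==> (\<Sum>(al, bt)\<leftarrow>ps. bt (al f)) = f" using dom unfolding dominated_def by blast
  have sD: "stable d D" using D assms by auto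
  define qs where "qs = map (%(al, bt). ((%f. al (pr D f)), bt)) ps"
  have "ghom d (A \<union> B) C al & ghom d C (A \<union> B) bt" if q: "(al, bt) \<in> set qs" for al bt
  proof -
  obtain al' where a: "al = (%f. al' (pr D f))" "(al', bt) \<in> set ps" using q by (auto simp: qs_def)
  have g: "ghom d D C al'" "ghom d C D bt" using ps[OF a(2)] by auto
  have "lin al" unfolding a(1) pr_def by (rule lin_comp[OF _ lin_mult]) (use g(1) in \<open>simp add: ghom_def\<close>)
  moreover have "al (act sz f) = act sz (al f)" if s: "sz permutes {1..d}" for sz f
  proof -
   have "pr D (act sz f) = act sz (pr D f)" unfolding pr_def by (rule act_indicator[OF sD s, symmetric])
   thus ?thesis using g(1) on_pr[of D f] s unfolding a(1) ghom_def by simp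
  qed
  moreover have "on C (al f)" for f using g(1) on_pr[of D f] unfolding a(1) ghom_def by blast
  moreover have "on (A \<union> B) (bt f)" if "on C f" for f
   using g(2) that D unfolding ghom_def on_def by blast
  ultimately show ?thesis using g(2) unfolding ghom_def by blast
  qed
  moreover have "(\<Sum>(al, bt)\<leftarrow>qs. bt (al f)) = pr D f" for f
  using idA[OF on_pr[of D f]] by (simp add: qs_def comp_def case_prod_unfold)
  ultimately show ?thesis by blast
 qed
 obtain p1 :: "(((word => 'k) => word => 'k) \<times> ((word => 'k) => word => 'k)) list" where
  p1: "\<forall>(al, bt) \<in> set p1. ghom d (A \<union> B) C al & ghom d C (A \<union> B) bt" "!!f. (\<Sum>(al, bt)\<leftarrow>p1. bt (al f)) = pr A f"
  using lift[of A] assms(1) by blast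
 obtain p2 :: "(((word => 'k) => word => 'k) \<times> ((word => 'k) => word => 'k)) list" where
  p2: "\<forall>(al, bt) \<in> set p2. ghom d (A \<union> B) C al & ghom d C (A \<union> B) bt" "!!f. (\<Sum>(al, bt)\<leftarrow>p2. bt (al f)) = pr B f"
  using lift[of B] assms(2) by blast
 have sum: "pr A f + pr B f = f" if "on (A \<union> B) f" for f
  using that assms(3) by (auto simp: pr_def on_def fun_eq_iff)
 show ?thesis unfolding dominated_def
 proof (intro exI[of _ "p1 @ p2"] conjI allI impI)
  show "\<forall>(al, bt) \<in> set (p1 @ p2). ghom d (A \<union> B) C al & ghom d C (A \<union> B) bt" using p1(1) p2(1) by (simp add: ball_Un)
  fix f :: "word => 'k" assume f: "on (A \<union> B) f"
  show "(\<Sum>(al, bt)\<leftarrow>p1 @ p2. bt (al f)) = f" by (simp only: map_append sum_list_append p1(2) p2(2) sum[OF f])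
 qed
qed

lemma dominated_empty: "dominated K d {} C"
 unfolding dominated_def
proof (intro exI[of _ "[]"] conjI allI impI)
 fix f :: "word => 'a" assume "on {} f"
 hence "f = 0" by (simp add: on_def fun_eq_iff)
 thus "(\<Sum>(al, bt)\<leftarrow>[]. bt (al f)) = f" by simp
qed simp

text \<open>The cosets g H of the pointwise stabilizer H of \<open>{1..t}\<close> are the sets of
  permutations with prescribed values on \<open>{1..t}\<close>; R has one element in each.\<close>

lemma transversal_exists:
 fixes d t :: nat
 obtains R where "finite R" "!!r. r \<in> R ==> r permutes {1..d}"
  "!!g. g permutes {1..d} ==> \<exists>!r. r \<in> R & (\<forall>i \<in> {1..t}. r i = g i)"
proof -
 define P where "P h g \<longleftrightarrow> g permutes {1..d} & (\<forall>i \<in> {1..t}. g i = h i)" for h g :: "nat => nat"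
 \<comment> \<open>\<open>Eps (P h)\<close> depends only on the predicate \<open>P h\<close>, hence
   only on the values of \<open>h\<close> on \<open>{1..t}\<close>: this selects one element per
   coset.\<close>
 define R where "R = {Eps (P h) | h. h permutes {1..d}}"
 have E: "P h (Eps (P h))" if "h permutes {1..d}" for h
  by (rule someI[of "P h" h]) (use that in \<open>simp add: P_def\<close>)
 have "R = (%h. Eps (P h)) ` {h. h permutes {1..d}}" by (auto simp: R_def)
 hence "finite R" using finite_permutations[of "{1..d}"] by simp
 moreover have "r permutes {1..d}" if "r \<in> R" for r using that E by (auto simp: R_def P_def)
 moreover have "\<exists>!r. r \<in> R & (\<forall>i \<in> {1..t}. r i = g i)" if g: "g permutes {1..d}" for g
 proof (rule ex1I[of _ "Eps (P g)"])
  show "Eps (P g) \<in> R & (\<forall>i \<in> {1..t}. Eps (P g) i = g i)" using E[OF g] g unfolding R_def P_def by blast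
  fix r assume r: "r \<in> R & (\<forall>i \<in> {1..t}. r i = g i)"
  then obtain h where h: "h permutes {1..d}" "r = Eps (P h)" by (auto simp: R_def)
  have "P h = P g" using E[OF h(1)] r h(2) by (auto simp: P_def fun_eq_iff)
  thus "r = Eps (P g)" using h(2) by simp
 qed
 ultimately show ?thesis using that by blast
qed

context char2
begin

lemma act_inv: "sz permutes {1..d} ==> act sz (act (inv' sz) f) = (f :: word => 'k)"
 "sz permutes {1..d} ==> act (inv' sz) (act sz f) = (f :: word => 'k)"
 using act_comp[of sz d "inv' sz" f] act_comp[of "inv' sz" d sz f] permutes_inv[of sz "{1..d}"]
 by (simp_all add: permutes_inv_o)

text \<open>The maps \<open>nu\<close> and \<open>%\<close> are equivariant only for the pointwise stabilizer of \<open>{1..t}\<close>; their relative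
 traces are equivariant, and the hypothesis \<open>zero\<close> makes the trace multiplicative.\<close>

lemma dominated_by_trace:
 fixes nu mu :: "'i => (word => 'k) => word => 'k"
 assumes A: "stable d A" and B: "stable d B" and I: "finite I"
  and R: "finite R" "!!r. r \<in> R ==> r permutes {1..d}"
  "!!g. g permutes {1..d} ==> \<exists>!r. r \<in> R & (\<forall>i \<in> {1..t}. r i = g i)"
  and lin: "!!x. x \<in> I ==> lin (nu x)" "!!x. x \<in> I ==> lin (mu x)"
  and on: "!!x f. x \<in> I ==> on A f ==> on B (nu x f)" "!!x f. x \<in> I ==> on B f ==> on A (mu x f)"
  and eqv: "!!x f k. x \<in> I ==> k permutes {1..d} ==> (\<forall>i \<in> {1..t}. k i = i) ==> nu x (act k f) = act k (nu x f)"
  "!!x f k. x \<in> I ==> k permutes {1..d} ==> (\<forall>i \<in> {1..t}. k i = i) ==> mu x (act k f) = act k (mu x f)"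
  and zero: "!!f g. on A f ==> g permutes {1..d} ==> \<not> (\<forall>i \<in> {1..t}. g i = i) ==> (\<Sum>x \<in> I. mu x (act g (nu x f))) = 0"
  and id: "!!f. on A f ==> (\<Sum>r \<in> R. act r (\<Sum>x \<in> I. mu x (nu x (act (inv' r) f)))) = f"
 shows "dominated TYPE('k) d A B"
proof -
 \<comment> \<open>The relative trace from the pointwise stabilizer of \<open>{1..t}\<close> to
   S_d.\<close>
 define tr where "tr T f = (\<Sum>r \<in> R. act r (T (act (inv' r) f)))" for T :: "(word => 'k) => word => 'k" and f
 have gh: "ghom d C D (tr T)"
  if C: "stable d C" and D: "stable d D" and l: "lin T" and o: "!!f. on C f ==> on D (T f)"
  and e: "!!f k. k permutes {1..d} ==> (\<forall>i \<in> {1..t}. k i = i) ==> T (act k f) = act k (T f)" for C D T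
  unfolding ghom_def
 proof (intro conjI allI impI)
  show "lin (tr T)" unfolding tr_def
  by (rule lin_sumI, rule lin_comp[OF lin_comp[OF lin_act[OF R(2)] l] lin_act[OF permutes_inv[OF R(2)]]])
  show "on D (tr T f)" if "on C f" for f unfolding tr_def
  by (rule on_sum, rule on_act[OF D R(2) o[OF on_act[OF C permutes_inv[OF R(2)] that]]])
  fix g :: "nat => nat" and f assume g: "g permutes {1..d}"
  \<comment> \<open>Left multiplication by \<open>g\<close> permutes the cosets. \<open>qf r\<close>
    represents the coset of \<open>g o r\<close>, and the remaining factor \<open>k\<close> fixes
    \<open>{1..t}\<close> pointwise, so the equivariance of \<open>T\<close> absorbs it.\<close>
  define qf where "qf r = (THE r'. r' \<in> R & (\<forall>i \<in> {1..t}. r' i = (g o r) i))" for r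
  have qf: "qf r \<in> R & (\<forall>i \<in> {1..t}. qf r i = (g o r) i)" if "r \<in> R" for r
  unfolding qf_def by (rule theI'[OF R(3)]) (rule permutes_compose[OF R(2)[OF that] g])
  have inj: "inj_on qf R"
  proof (rule inj_onI)
  fix r r' assume rr: "r \<in> R" "r' \<in> R" "qf r = qf r'"
  have "\<forall>i \<in> {1..t}. r i = r' i"
   using qf[OF rr(1)] qf[OF rr(2)] rr(3) permutes_inj[OF g] by (auto simp: inj_eq)
  thus "r = r'" using R(3)[OF R(2)[OF rr(1)]] rr(1,2) by metis
  qed
  have im: "qf ` R = R" by (rule card_subset_eq[OF R(1)]) (use qf inj in \<open>auto simp: card_image\<close>)
  have "act g (tr T f) = (\<Sum>r \<in> R. act g (act r (T (act (inv' r) f))))"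
  unfolding tr_def by (rule lin_sum[OF lin_act[OF g]])
  also have "... = (\<Sum>r \<in> R. act (qf r) (T (act (inv' (qf r)) (act g f))))"
  proof (rule sum.cong[OF refl])
  fix r assume r: "r \<in> R"
  note pr = R(2)[OF r] and pr' = R(2)[OF conjunct1[OF qf[OF r]]]
  define k where "k = inv' (qf r) o (g o r)"
  have k: "k permutes {1..d}" unfolding k_def
   by (intro permutes_compose permutes_inv g pr pr')
  have kf: "\<forall>i \<in> {1..t}. k i = i"
  proof
   fix i assume "i \<in> {1..t}"
   hence "(g o r) i = qf r i" using qf[OF r] by simp
   thus "k i = i" unfolding k_def comp_apply[of "inv' (qf r)"] by (simp only: permutes_inverses(2)[OF pr'])
  qed
  have gr: "g o r = qf r o k" unfolding k_def comp_assoc[symmetric] permutes_inv_o(1)[OF pr'] by simp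
  have kr: "k o inv' r = inv' (qf r) o g" unfolding k_def comp_assoc permutes_inv_o(1)[OF pr] by simp
  have "act g (act r (T (act (inv' r) f))) = act (qf r) (act k (T (act (inv' r) f)))"
   unfolding act_comp[OF g pr, symmetric] act_comp[OF pr' k, symmetric] gr ..
  also have "act k (T (act (inv' r) f)) = T (act (inv' (qf r)) (act g f))"
   unfolding e[OF k kf, symmetric] act_comp[OF k permutes_inv[OF pr], symmetric] kr
    act_comp[OF permutes_inv[OF pr'] g] ..
  finally show "act g (act r (T (act (inv' r) f))) = act (qf r) (T (act (inv' (qf r)) (act g f)))" .
  qed
  also have "... = (\<Sum>r \<in> qf ` R. act r (T (act (inv' r) (act g f))))" by (subst sum.reindex[OF inj]) (simp only: o_def)
  finally show "tr T (act g f) = act g (tr T f)" unfolding im by (simp only: tr_def)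
 qed
 have comp: "(\<Sum>x \<in> I. tr (mu x) (tr (nu x) f)) = f" if f: "on A f" for f
 proof -
  have "(\<Sum>x \<in> I. tr (mu x) (tr (nu x) f)) =
   (\<Sum>x \<in> I. \<Sum>r \<in> R. \<Sum>r' \<in> R. act r (mu x (act (inv' r o r') (nu x (act (inv' r') f)))))"
  proof (intro sum.cong refl)
  fix x assume x: "x \<in> I"
  show "tr (mu x) (tr (nu x) f) = (\<Sum>r \<in> R. \<Sum>r' \<in> R. act r (mu x (act (inv' r o r') (nu x (act (inv' r') f)))))"
   unfolding tr_def[of "mu x"]
  proof (intro sum.cong refl)
   fix r assume r: "r \<in> R"
   have "act r (mu x (act (inv' r) (tr (nu x) f))) = (\<Sum>r' \<in> R. act r (mu x (act (inv' r) (act r' (nu x (act (inv' r') f))))))"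
    unfolding tr_def lin_sum[OF lin_act[OF permutes_inv[OF R(2)[OF r]]]] lin_sum[OF lin(2)[OF x]] lin_sum[OF lin_act[OF R(2)[OF r]]] ..
   also have "... = (\<Sum>r' \<in> R. act r (mu x (act (inv' r o r') (nu x (act (inv' r') f)))))"
    by (intro sum.cong refl) (simp only: act_comp[OF permutes_inv[OF R(2)[OF r]] R(2)])
   finally show "act r (mu x (act (inv' r) (tr (nu x) f))) = (\<Sum>r' \<in> R. act r (mu x (act (inv' r o r') (nu x (act (inv' r') f)))))" .
  qed
  qed
  also have "... = (\<Sum>r \<in> R. \<Sum>r' \<in> R. \<Sum>x \<in> I. act r (mu x (act (inv' r o r') (nu x (act (inv' r') f)))))"
  by (subst sum.swap, intro sum.cong refl, rule sum.swap)
  \<comment> \<open>For distinct representatives \<open>inv' r o r'\<close> moves some point of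
    \<open>{1..t}\<close>, and \<open>zero\<close> removes the term. Only the diagonal of the double
    sum survives.\<close>
  also have "... = (\<Sum>r \<in> R. \<Sum>r' \<in> R. if r' = r then act r (\<Sum>x \<in> I. mu x (nu x (act (inv' r) f))) else 0)"
  proof (intro sum.cong refl)
  fix r r' assume r: "r \<in> R" "r' \<in> R"
  note p = R(2)[OF r(1)] R(2)[OF r(2)]
  note o = on_act[OF A permutes_inv[OF p(2)] f]
  have "(\<Sum>x \<in> I. act r (mu x (act (inv' r o r') (nu x (act (inv' r') f))))) =
    act r (\<Sum>x \<in> I. mu x (act (inv' r o r') (nu x (act (inv' r') f))))"
   by (rule lin_sum[OF lin_act[OF p(1)], symmetric])
  also have "... = (if r' = r then act r (\<Sum>x \<in> I. mu x (nu x (act (inv' r) f))) else 0)"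
  proof (cases "r' = r")
   case True
   thus ?thesis by (simp only: permutes_inv_o(2)[OF p(1)] act_id if_True simp_thms)
  next
   case False
   have "\<not> (\<forall>i \<in> {1..t}. (inv' r o r') i = i)"
   proof
    assume h: "\<forall>i \<in> {1..t}. (inv' r o r') i = i"
    have "\<forall>i \<in> {1..t}. r' i = r i"
    proof
    fix i assume "i \<in> {1..t}"
    hence "inv' r (r' i) = i" using h by simp
    thus "r' i = r i" using permutes_inverses(1)[OF p(1), of "r' i"] by simp
    qed
    thus False using R(3)[OF p(1)] r False by metis
   qed
   from zero[OF o permutes_compose[OF p(2) permutes_inv[OF p(1)]] this]
   show ?thesis using False lin_zero[OF lin_act[OF p(1)]] by (simp only: if_False)
  qed
  finally show "(\<Sum>x \<in> I. act r (mu x (act (inv' r o r') (nu x (act (inv' r') f))))) =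
    (if r' = r then act r (\<Sum>x \<in> I. mu x (nu x (act (inv' r) f))) else 0)" .
  qed
  also have "... = (\<Sum>r \<in> R. act r (\<Sum>x \<in> I. mu x (nu x (act (inv' r) f))))"
  by (intro sum.cong refl) (simp only: sum.delta[OF R(1)] if_True)
  also have "... = f" by (rule id[OF f])
  finally show ?thesis .
 qed
 obtain xs where xs: "set xs = I" "distinct xs" using finite_distinct_list[OF I] by blast
 show ?thesis unfolding dominated_def
 proof (intro exI[of _ "map (%x. (tr (nu x), tr (mu x))) xs"] conjI allI impI)
  have "ghom d A B (tr (nu x)) & ghom d B A (tr (mu x))" if "x \<in> I" for x
  using gh[OF A B lin(1)[OF that] on(1)[OF that] eqv(1)[OF that]] gh[OF B A lin(2)[OF that] on(2)[OF that] eqv(2)[OF that]] by blast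
  thus "\<forall>(al, bt) \<in> set (map (%x. (tr (nu x), tr (mu x))) xs). ghom d A B al & ghom d B A bt" using xs(1) by auto
  fix f :: "word => 'k" assume f: "on A f"
  show "(\<Sum>(al, bt)\<leftarrow>map (%x. (tr (nu x), tr (mu x))) xs. bt (al f)) = f"
  using comp[OF f] xs by (simp add: comp_def sum_list_distinct_conv_sum_set)
 qed
qed

end

text \<open>A permutation that fixes \<open>{1..t}\<close> pointwise inverts only pairs of positions
  beyond t, so commuting with delta is needed only there.\<close>

lemma act_local:
 assumes k: "k permutes {1..d::nat}" "\<forall>i \<in> {1..t}. k i = i" and add: "!!f g. T (f + g) = T f + T g"
  and der: "!!i f. i > t ==> T (der i f) = der i (T f)"
  and pm: "!!f. T (pm k f) = pm k (T f)"
 shows "T (act k f) = act k (T f)"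
proof (rule act_transfer[OF k(1) add _ pm])
 fix i X and f :: "word => 'a" assume X: "X \<in> Inv k" "i \<in> X"
 have "k permutes {Suc t..d}" by (rule permutes_superset[OF k(1)]) (use k(2) in auto)
 hence "i \<in> {Suc t..d}" using Inv_subset[OF _ X(1)] X(2) by blast
 thus "T (der i f) = der i (T f)" using der[of i f] by simp
qed

definition rp :: "nat => word => word => word" where
 "rp t u v = (%i. if i \<in> {1..t} then v i else u i)"

definition tr :: "nat => word => word" where
 "tr t u = (%i. if i \<in> {1..t} then u i else One 0)"

text \<open>The tensor product of n, living on the first t positions, with F, living on the others.
  Each factor is evaluated at the word whose remaining positions are reset to
  \<open>One 0\<close>.\<close>

definition tens :: "nat => (word => 'k) => (word => 'k) => word => 'k::field" where
 "tens t n F u = n (tr t u) * F (rp t u (%i. One 0))"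

lemma fixes_notin:
 assumes k: "k permutes {1..d::nat}" "\<forall>i \<in> {1..t}. k i = i" and i: "i ~: {1..t}"
 shows "k i ~: {1..t}"
proof
 assume h: "k i \<in> {1..t}"
 hence "k (k i) = k i" using k(2) by blast
 hence "k i = i" using permutes_inj[OF k(1)] by (simp add: inj_eq)
 thus False using h i by simp
qed

lemma rp_upd: "i ~: {1..t} ==> rp t (u(i := x)) v = (rp t u v)(i := x)"
 by (auto simp: rp_def fun_eq_iff)

lemma rp_comp:
 assumes "k permutes {1..d::nat}" "\<forall>i \<in> {1..t}. k i = i"
 shows "rp t (u o k) v = rp t u v o k"
proof
 fix i show "rp t (u o k) v i = (rp t u v o k) i"
  using fixes_notin[OF assms, of i] assms(2) by (auto simp: rp_def)
qed

lemma tr_rp [simp]: "tr t (rp t u v) = tr t v"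
 by (auto simp: rp_def tr_def fun_eq_iff)

lemma rp_rp [simp]: "rp t (rp t u v) w = rp t u w"
 by (auto simp: rp_def fun_eq_iff)

lemma rp_tr [simp]: "rp t u (tr t u) = u"
 by (auto simp: rp_def tr_def fun_eq_iff)

lemma tr_upd: "i ~: {1..t} ==> tr t (u(i := x)) = tr t u"
 by (auto simp: tr_def fun_eq_iff)

lemma tr_comp:
 assumes "\<forall>i \<in> {1..t}. k i = i"
 shows "tr t (u o k) = tr t u"
 using assms by (auto simp: tr_def fun_eq_iff)

lemma tens_act_left:
 assumes t: "tz permutes {1..t::nat}"
 shows "tens t (act tz n) F = act tz (tens t n F)"
proof (rule act_transfer[OF t, where T = "%n. tens t n F" and T' = "%n. tens t n F"])
 show "tens t (f + g) F = tens t f F + tens t g F" for f g :: "word => 'a" by (simp add: tens_def fun_eq_iff algebra_simps)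
 fix i X and f :: "word => 'a" assume "X \<in> Inv tz" "i \<in> X"
 hence i: "i \<in> {1..t}" using Inv_subset[OF t] by blast
 show "tens t (der i f) F = der i (tens t f F)"
 proof
  fix u :: word
  have "tr t (u(i := x)) = (tr t u)(i := x)" "rp t (u(i := x)) v = rp t u v" "tr t u i = u i" for x v
  using i by (auto simp: tr_def rp_def fun_eq_iff)
  thus "tens t (der i f) F u = der i (tens t f F) u" by (simp add: tens_def der_def split: letter.split)
 qed
next
 fix f :: "word => 'a"
 have m: "tz i \<in> {1..t} \<longleftrightarrow> i \<in> {1..t}" for i by (rule permutes_in_image[OF t])
 have f: "i ~: {1..t} ==> tz i = i" for i using t by (simp add: permutes_def)
 have e: "tr t (u o tz) = tr t u o tz" "rp t (u o tz) v = rp t u v" for u v using m f unfolding tr_def rp_def fun_eq_iff by auto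
 show "tens t (pm tz f) F = pm tz (tens t f F)" unfolding tens_def pm_def e ..
qed

lemma tens_act_right:
 assumes k: "k permutes {1..d::nat}" "\<forall>i \<in> {1..t}. k i = i"
 shows "tens t n (act k F) = act k (tens t n F)"
proof (rule act_local[OF k, where T = "%F. tens t n F"])
 show "tens t n (f + g) = tens t n f + tens t n g" for f g :: "word => 'a" by (simp add: tens_def fun_eq_iff algebra_simps)
 fix i and f :: "word => 'a" assume "i > t"
 hence i: "i ~: {1..t}" by auto
 hence "rp t u v i = u i" for u v by (auto simp: rp_def)
 thus "tens t n (der i f) = der i (tens t n f)"
  using i by (auto simp: tens_def der_def fun_eq_iff tr_upd rp_upd split: letter.split)
next
 fix f :: "word => 'a"
 show "tens t n (pm k f) = pm k (tens t n f)"
  by (simp only: tens_def pm_def fun_eq_iff tr_comp[OF k(2)] rp_comp[OF k] simp_thms)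
qed

text \<open>f equals its product with the indicator of Q, and a multiplier depending only on colours
  is permuted by the action.\<close>

lemma act_supp:
 assumes s: "sz permutes {1..d::nat}" and Q: "!!u v. colour o u = colour o v ==> Q u \<longleftrightarrow> Q v"
  and f: "!!u. f u ~= 0 ==> Q u" and nz: "act sz f u ~= (0::'k::field)"
 shows "Q (u o sz)"
proof (rule ccontr)
 assume nq: "\<not> Q (u o sz)"
 have c: "colour_dep (%u. if Q u then 1 else 0 :: 'k)" using Q unfolding colour_dep_def by metis
 have "f = (%u. if Q u then 1 else 0) * f" using f by (auto simp: fun_eq_iff)
 hence "act sz f u = (((%u. if Q u then 1 else 0) o (%u. u o sz)) * act sz f) u"
  using act_mult_colour[OF s c, of f] by simp
 thus False using nq nz by simp
qed

lemma colour_iff: "colour l = V j \<longleftrightarrow> l \<in> letters {} {j}"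
 by (cases l) (auto simp: letters_def)

context char2
begin

text \<open>E lives where the first t positions have the colour of the j-th copy of P, and its
  relative trace is 1. The map \<open>nu l\<close> extracts the part in which these positions spell
  l and writes the letters \<open>One (e i)\<close> there; \<open>mu l\<close> puts l back, and the
  composites add up to E. In a word of B each \<open>One (e i)\<close> occurs at most once. Hence a
  permutation that moves a point of \<open>{1..t}\<close> carries the image of \<open>nu l\<close>
  off the words that \<open>mu l\<close> reads, which is the vanishing needed for the trace.\<close>

lemma dominated_fresh:
 fixes E :: "(word => 'k) => word => 'k"
 assumes A: "stable d A" and B: "stable d B" and t: "t \<le> d"
  and R: "finite R" "!!r. r \<in> R ==> r permutes {1..d}"
  "!!g. g permutes {1..d} ==> \<exists>!r. r \<in> R & (\<forall>i \<in> {1..t}. r i = g i)"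
  and lin: "lin E" and onE: "!!f. on A f ==> on A (E f)"
  and der: "!!i f. i > t ==> E (der i f) = der i (E f)"
  and pm: "!!k f. k permutes {1..d} ==> (\<forall>i \<in> {1..t}. k i = i) ==> E (pm k f) = pm k (E f)"
  and supp: "!!f u. E f u ~= 0 ==> \<forall>i \<in> {1..t}. colour (u i) = V j"
  and AB: "!!u. (\<forall>i \<in> {1..t}. colour (u i) = V j) ==> u \<in> A \<longleftrightarrow> rp t u (One o e) \<in> B"
  and uniq: "!!u p q i. u \<in> B ==> i \<in> {1..t} ==> p \<in> {1..d} ==> q \<in> {1..d} ==> u p = One (e i) ==> u q = One (e i) ==> p = q"
  and sumE: "!!f. on A f ==> (\<Sum>r \<in> R. act r (E (act (inv' r) f))) = f"
 shows "dominated TYPE('k) d A B"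
proof -
 define I where "I = words t (letters {} {j})"
 have I: "finite I" unfolding I_def by (rule card_words(2)) (simp add: letters_def)
 define nu where "nu l f u = (if \<forall>i \<in> {1..t}. u i = One (e i) then E f (rp t u l) else 0)" for l f u
 define mu where "mu l f u = (if tr t u = l then f (rp t u (One o e)) else 0)" for l u and f :: "word => 'k"
 have rpi: "rp t u v i = u i" if "i > t" for u v i using that by (auto simp: rp_def)
 have Icol: "colour (l i) = V j" if "l \<in> I" "i \<in> {1..t}" for l i
  using that unfolding I_def words_def colour_iff by blast
 have onnu: "on B (nu l f)" if "l \<in> I" "on A f" for l f
  unfolding on_def
 proof (intro allI impI)
  fix u assume u: "u ~: B"
  show "nu l f u = 0"
  proof (cases "\<forall>i \<in> {1..t}. u i = One (e i)")
  case True
  have "rp t (rp t u l) (One o e) = u" using True by (auto simp: rp_def fun_eq_iff)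
  moreover have "\<forall>i \<in> {1..t}. colour (rp t u l i) = V j" using Icol[OF that(1)] by (simp add: rp_def)
  ultimately have "rp t u l ~: A" using AB[of "rp t u l"] u by simp
  thus ?thesis using onE[OF that(2)] by (simp add: nu_def on_def)
  qed (auto simp: nu_def)
 qed
 have nle: "i ~: {1..t}" if "i > t" for i using that by auto
 show ?thesis
 proof (rule dominated_by_trace[OF A B I R, where nu = nu and mu = mu])
  fix l assume l: "l \<in> I"
  show "lin (nu l)" using lin unfolding lin_def nu_def by (auto simp: fun_eq_iff)
  show "lin (mu l)" unfolding lin_def mu_def by (auto simp: fun_eq_iff)
 next
  fix l and f :: "word => 'k" assume l: "l \<in> I" and f: "on A f"
  show "on B (nu l f)" by (rule onnu[OF l f])
 next
  fix l and f :: "word => 'k" assume l: "l \<in> I" and f: "on B f"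
  show "on A (mu l f)" unfolding on_def
  proof (intro allI impI)
  fix u assume u: "u ~: A"
  show "mu l f u = 0"
  proof (cases "tr t u = l")
   case True
   have "u i = l i" if "i \<in> {1..t}" for i using fun_cong[OF True, of i] that by (simp add: tr_def)
   hence "\<forall>i \<in> {1..t}. colour (u i) = V j" using Icol[OF l] by simp
   thus ?thesis using AB[of u] u f by (simp add: mu_def on_def)
  qed (simp add: mu_def)
  qed
 next
  fix l k and f :: "word => 'k" assume l: "l \<in> I" and k: "k permutes {1..d}" "\<forall>i \<in> {1..t}. k i = i"
  show "nu l (act k f) = act k (nu l f)"
  proof (rule act_local[OF k])
  show "nu l (f + g) = nu l f + nu l g" for f g by (simp add: nu_def fun_eq_iff linD(1)[OF lin])
  show "nu l (der i f) = der i (nu l f)" if i: "i > t" for i f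
  proof
   fix u :: word
   have "(u(i := x)) q = u q" if "q \<in> {1..t}" for q x using that nle[OF i] by (metis fun_upd_other)
   hence "(\<forall>q \<in> {1..t}. (u(i := x)) q = One (e q)) \<longleftrightarrow> (\<forall>q \<in> {1..t}. u q = One (e q))" for x
    by simp
   thus "nu l (der i f) u = der i (nu l f) u"
    unfolding nu_def der[OF i] der_def rpi[OF i] rp_upd[OF nle[OF i]] by (simp split: letter.split)
  qed
  show "nu l (pm k f) = pm k (nu l f)" for f
  proof
   fix u :: word
   have "(\<forall>i \<in> {1..t}. (u o k) i = One (e i)) \<longleftrightarrow> (\<forall>i \<in> {1..t}. u i = One (e i))" using k(2) by simp
   thus "nu l (pm k f) u = pm k (nu l f) u" by (simp only: nu_def pm[OF k] pm_def rp_comp[OF k])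
  qed
  qed
  show "mu l (act k f) = act k (mu l f)"
  proof (rule act_local[OF k])
  show "mu l (f + g) = mu l f + mu l g" for f g by (simp add: mu_def fun_eq_iff)
  show "mu l (der i f) = der i (mu l f)" if i: "i > t" for i f
   unfolding mu_def der_def rpi[OF i] rp_upd[OF nle[OF i]] tr_upd[OF nle[OF i]] by (auto simp: fun_eq_iff split: letter.split)
  show "mu l (pm k f) = pm k (mu l f)" for f
   by (simp only: mu_def fun_eq_iff pm_def rp_comp[OF k] tr_comp[OF k(2)] simp_thms)
  qed
 next
  fix f :: "word => 'k" and g assume f: "on A f" and g: "g permutes {1..d}" and nf: "\<not> (\<forall>i \<in> {1..t}. g i = i)"
  have z: "mu l (act g (nu l f)) = 0" if l: "l \<in> I" for l
  proof
  fix u :: word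
  show "mu l (act g (nu l f)) u = 0 u"
  proof (rule ccontr)
   assume h: "mu l (act g (nu l f)) u ~= 0 u"
   define x where "x = rp t u (One o e)"
   have nz: "act g (nu l f) x ~= 0" using h by (auto simp: mu_def x_def split: if_splits)
   have xB: "x \<in> B" using nz on_act[OF B g onnu[OF l f]] by (auto simp: on_def)
   have "\<forall>i \<in> {1..t}. (x o g) i = One (e i)"
   proof (rule act_supp[OF g _ _ nz])
    fix u v :: word assume c: "colour o u = colour o v"
    have "u i = One a \<longleftrightarrow> v i = One a" for i a
    using colour_comp[OF c, of i] colour_eq_One[of "u i" a] colour_eq_One[of "v i" a] by simp
    thus "(\<forall>i \<in> {1..t}. u i = One (e i)) \<longleftrightarrow> (\<forall>i \<in> {1..t}. v i = One (e i))" by simp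
   qed (auto simp: nu_def split: if_splits)
   moreover have "x i = One (e i)" if "i \<in> {1..t}" for i using that by (simp add: x_def rp_def)
   ultimately have "g i = i" if "i \<in> {1..t}" for i
    using uniq[OF xB that, of "g i" i] that t permutes_in_image[OF g, of i] by auto
   thus False using nf by blast
  qed
  qed
  show "(\<Sum>l \<in> I. mu l (act g (nu l f))) = 0" by (rule sum.neutral) (simp add: z)
 next
  fix f :: "word => 'k" assume f: "on A f"
  have "(\<Sum>l \<in> I. mu l (nu l h)) = E h" for h
  proof
  fix u :: word
  have e: "\<forall>i \<in> {1..t}. rp t u (One o e) i = One (e i)" by (simp add: rp_def)
  have "(\<Sum>l \<in> I. mu l (nu l h)) u = (\<Sum>l \<in> I. if l = tr t u then E h u else 0)"
   unfolding sum_fun_apply by (rule sum.cong[OF refl]) (use e in \<open>auto simp: mu_def nu_def\<close>)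
  also have "... = (if tr t u \<in> I then E h u else 0)" by (rule sum.delta[OF I])
  also have "... = E h u"
  proof (cases "E h u = 0")
   case False
   have "tr t u \<in> I" using supp[OF False] unfolding I_def words_def tr_def colour_iff by auto
   thus ?thesis by simp
  qed simp
  finally show "(\<Sum>l \<in> I. mu l (nu l h)) u = E h u" .
  qed
  thus "(\<Sum>r \<in> R. act r (\<Sum>l \<in> I. mu l (nu l (act (inv' r) f)))) = f" using sumE[OF f] by simp
 qed
qed

end

text \<open>x is a sum of matrix coefficients of S_d on words over L. When x is the delta function
  at \<open>id\<close>, sending a group element g to the vectors g n, and a vector to its
  coefficients at v along the group, shows that the regular representation is a summand of copies of
  the word representation. In this form freeness enters \<open>dominated_block\<close>.\<close>

definition realized :: "nat => letter set => ((nat => nat) => 'k::field) => bool" where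
 "realized d L x \<longleftrightarrow> (EX ps. (\<forall>(n, v) \<in> set ps. on (words d L) n & v \<in> words d L) &
  (ALL tz. tz permutes {1..d} --> x tz = (\<Sum>(n, v)\<leftarrow>ps. act tz n v)))"

definition maplet :: "nat => (nat => nat) => (nat => nat) => word => word" where
 "maplet d g h u = (%i. if i \<in> {1..d} then (case u i of One a => One (g a) | V j => V (h j) | W j => W (h j)) else u i)"

lemma act_maplet:
 assumes s: "sz permutes {1..d::nat}"
 shows "(act sz f) o maplet d g h = act sz (f o maplet d g h)"
proof (rule act_transfer[OF s, where T = "%f. f o maplet d g h" and T' = "%f. f o maplet d g h"])
 show "(f + f') o maplet d g h = (f o maplet d g h) + (f' o maplet d g h)" for f f' :: "word => 'a" by (simp add: fun_eq_iff)
 fix i X and f :: "word => 'a" assume "X \<in> Inv sz" "i \<in> X"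
 hence i: "i \<in> {1..d}" using Inv_subset[OF s] by blast
 show "der i f o maplet d g h = der i (f o maplet d g h)"
 proof
  fix u :: word
  have "maplet d g h (u(i := V j)) = (maplet d g h u)(i := V (h j))" for j
  using i by (auto simp: maplet_def fun_eq_iff)
  moreover have "maplet d g h u i = (case u i of One a => One (g a) | V j => V (h j) | W j => W (h j))"
  using i by (simp only: maplet_def if_True)
  ultimately show "(der i f o maplet d g h) u = der i (f o maplet d g h) u"
  by (simp add: der_def split: letter.split)
 qed
next
 fix f :: "word => 'a"
 have m: "sz i \<in> {1..d} \<longleftrightarrow> i \<in> {1..d}" for i by (rule permutes_in_image[OF s])
 have e: "maplet d g h (u o sz) = maplet d g h u o sz" for u
  by (simp only: maplet_def fun_eq_iff m comp_apply simp_thms)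
 show "pm sz f o maplet d g h = pm sz (f o maplet d g h)"
  by (rule ext) (simp only: comp_apply[of _ "maplet d g h"] pm_def e)
qed

lemma maplet_words:
 assumes "u \<in> words d (letters O1 P1)" "!!a. a \<in> O1 ==> g a \<in> O2" "!!j. j \<in> P1 ==> h j \<in> P2"
 shows "maplet d g h u \<in> words d (letters O2 P2)"
proof -
 have "maplet d g h u i \<in> letters O2 P2" if i: "i \<in> {1..d}" for i
 proof -
  have "u i \<in> letters O1 P1" using assms(1) i by (simp add: words_def)
  hence "(case u i of One a => One (g a) | V j => V (h j) | W j => W (h j)) \<in> letters O2 P2"
  using assms(2,3) by (auto simp: letters_def)
  thus ?thesis using i by (simp only: maplet_def if_True)
 qed
 moreover have "maplet d g h u i = One 0" if "i ~: {1..d}" for i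
  using assms(1) that unfolding words_def maplet_def by (simp only: if_False mem_Collect_eq) blast
 ultimately show ?thesis unfolding words_def by blast
qed

lemma maplet_inverse:
 assumes "u \<in> words d (letters O1 P1)" "!!a. a \<in> O1 ==> g' (g a) = a" "!!j. j \<in> P1 ==> h' (h j) = j"
 shows "maplet d g' h' (maplet d g h u) = u"
proof
 fix i
 show "maplet d g' h' (maplet d g h u) i = u i"
 proof (cases "i \<in> {1..d}")
  case True
  hence "u i \<in> letters O1 P1" using assms(1) by (simp add: words_def)
  thus ?thesis using True assms(2,3) by (auto simp: maplet_def letters_def)
 next
  case False
  thus ?thesis by (simp only: maplet_def if_False)
 qed
qed

text \<open>The factorization in the Young subgroup of the permutations that preserve
  \<open>{1..t}\<close>: \<open>tz\<close> acts on these positions and k on the others.\<close>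

lemma block_split:
 fixes g :: "nat => nat"
 assumes g: "g permutes {1..d}" and t: "t \<le> d" and pres: "\<forall>i \<in> {1..t}. g i \<in> {1..t}"
 defines "tz \<equiv> %i. if i \<in> {1..t} then g i else i"
 shows "tz permutes {1..t} & (EX k. k permutes {1..d} & (\<forall>i \<in> {1..t}. k i = i) & (ALL i. i ~: {1..t} --> k i = g i) & g = tz o k)"
proof -
 have i: "inj_on tz {1..t}" using injD[OF permutes_inj[OF g]] by (simp add: inj_on_def tz_def)
 have im: "tz ` {1..t} \<subseteq> {1..t}" by (rule image_subsetI) (use pres in \<open>simp add: tz_def\<close>)
 have "bij_betw tz {1..t} {1..t}"
  unfolding bij_betw_def using i im card_subset_eq[of "{1..t}" "tz ` {1..t}"] by (simp add: card_image)
 hence tz: "tz permutes {1..t}" by (rule bij_imp_permutes) (simp only: tz_def if_False)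
 have tzd: "tz permutes {1..d}" by (rule permutes_subset[OF tz]) (use t in auto)
 define k where "k = inv' tz o g"
 have k: "k permutes {1..d}" unfolding k_def by (rule permutes_compose[OF g permutes_inv[OF tzd]])
 have kf: "k i = i" if "i \<in> {1..t}" for i
 proof -
  have e: "g i = tz i" using that by (simp only: tz_def if_True)
  show ?thesis unfolding k_def comp_apply e by (rule permutes_inverses(2)[OF tz])
 qed
 have kg: "k i = g i" if h: "i ~: {1..t}" for i
 proof -
  have "g i ~: {1..t}"
  proof
  assume "g i \<in> {1..t}"
  then obtain j where "j \<in> {1..t}" "tz j = g i" using permutes_image[OF tz] by (metis imageE)
  hence "g j = g i" by (simp only: tz_def if_True)
  hence "j = i" by (rule injD[OF permutes_inj[OF g]])
  thus False using h \<open>j \<in> {1..t}\<close> by simp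
  qed
  thus ?thesis using permutes_inv[OF tz] unfolding k_def comp_apply by (metis permutes_not_in)
 qed
 have gk: "g = tz o k" unfolding k_def comp_assoc[symmetric] permutes_inv_o(1)[OF tz] by simp
 show ?thesis using tz k kf kg gk by blast
qed

context char2
begin

lemma dominated_relabel:
 assumes "finite O1" "finite P1" "card O1 = card O2" "card P1 = card P2" "finite O2" "finite P2"
 shows "dominated TYPE('k) d (words d (letters O1 P1)) (words d (letters O2 P2))"
proof -
 let ?A = "words d (letters O1 P1)" and ?B = "words d (letters O2 P2)"
 obtain g where g: "bij_betw g O1 O2" using finite_same_card_bij[OF assms(1,5,3)] by blast
 obtain h where h: "bij_betw h P1 P2" using finite_same_card_bij[OF assms(2,6,4)] by blast
 define g' where "g' = inv_into O1 g"
 define h' where "h' = inv_into P1 h"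
 have gg: "a \<in> O1 ==> g a \<in> O2" "a \<in> O1 ==> g' (g a) = a" "b \<in> O2 ==> g' b \<in> O1" for a b
  using g bij_betw_inv_into[OF g] bij_betw_inv_into_left[OF g] bij_betwE unfolding g'_def by blast+
 have hh: "a \<in> P1 ==> h a \<in> P2" "a \<in> P1 ==> h' (h a) = a" "b \<in> P2 ==> h' b \<in> P1" for a b
  using h bij_betw_inv_into[OF h] bij_betw_inv_into_left[OF h] bij_betwE unfolding h'_def by blast+
 define ind where "ind C f = (%u. if u \<in> C then 1 else 0) * f" for C :: "word set" and f :: "word => 'k"
 have gh: "ghom d C D (%f. ind D (f o maplet d p q))" if D: "stable d D" for C D p q
  unfolding ghom_def
 proof (intro conjI allI impI)
  show "lin (%f. ind D (f o maplet d p q))" by (auto simp: lin_def ind_def fun_eq_iff algebra_simps)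
  show "on D (ind D (f o maplet d p q))" for f by (simp add: on_def ind_def)
  fix sz :: "nat => nat" and f :: "word => 'k" assume s: "sz permutes {1..d}"
  show "ind D (act sz f o maplet d p q) = act sz (ind D (f o maplet d p q))"
  unfolding ind_def act_indicator[OF D s] by (simp only: act_maplet[OF s])
 qed
 define al where "al f = ind ?B (f o maplet d g' h')" for f
 define bt where "bt f = ind ?A (f o maplet d g h)" for f
 have "bt (al f) = f" if f: "on ?A f" for f
 proof
  fix u
  show "bt (al f) u = f u"
  proof (cases "u \<in> words d (letters O1 P1)")
  case True
  have "maplet d g h u \<in> ?B" by (rule maplet_words[OF True]) (auto simp: gg hh)
  moreover have "maplet d g' h' (maplet d g h u) = u" by (rule maplet_inverse[OF True]) (auto simp: gg hh)
  ultimately show ?thesis using True by (simp add: al_def bt_def ind_def)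
  next
  case False
  thus ?thesis using f by (simp add: bt_def ind_def on_def)
  qed
 qed
 moreover have "ghom d ?A ?B al" "ghom d ?B ?A bt" unfolding al_def bt_def by (rule gh[OF stable_words])+
 ultimately show ?thesis unfolding dominated_def by (intro exI[of _ "[(al, bt)]"]) simp
qed

text \<open>Each of the t letters \<open>One (f0 i)\<close> occurs exactly once in a word of A, so A
  is induced from the words that begin with them. These letters are replaced by vectors over the
  alphabet L1 and recovered by reading a coordinate. In the trace, a permutation preserving
  \<open>{1..t}\<close> splits as \<open>tz o k\<close> and contributes the matrix coefficient at
  \<open>tz\<close>, which by \<open>good\<close> vanishes unless \<open>tz\<close> is the identity.
  Any other permutation would bring letters of L1 and L2 together at one position, which is
  impossible as these alphabets are disjoint.\<close>

lemma dominated_block: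
 fixes f0 :: "nat => nat" and d :: nat and O1 P1 O2 P2 O3 P3 :: "nat set"
 defines "L1 \<equiv> letters O1 P1" and "L2 \<equiv> letters O2 P2" and "B \<equiv> words d (letters O3 P3)"
 assumes A: "stable d A" and t: "t \<le> d" and sub: "L1 \<union> L2 \<subseteq> letters O3 P3" and disj: "L1 \<inter> L2 = {}"
  and good: "realized t L1 (%tz. if tz = id then 1 else (0::'k))"
  and rest: "!!u i. u \<in> A ==> (\<forall>i \<in> {1..t}. u i = One (f0 i)) ==> i \<in> {1..d} - {1..t} ==> u i \<in> L2"
  and default: "!!u i. u \<in> A ==> i ~: {1..d} ==> u i = One 0"
  and R: "finite R" "!!r. r \<in> R ==> r permutes {1..d}"
  "!!g. g permutes {1..d} ==> \<exists>!r. r \<in> R & (\<forall>i \<in> {1..t}. r i = g i)"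
  and pos: "!!u. u \<in> A ==> \<exists>!r. r \<in> R & (\<forall>i \<in> {1..t}. u (r i) = One (f0 i))"
 shows "dominated TYPE('k) d A B"
proof -
 obtain ps :: "((word => 'k) \<times> word) list" where
  ps: "!!n v. (n, v) \<in> set ps ==> on (words t L1) n & v \<in> words t L1"
  and psid: "!!tz. tz permutes {1..t} ==> (\<Sum>(n, v)\<leftarrow>ps. act tz n v) = (if tz = id then 1 else 0)"
  using good unfolding realized_def by (metis (mono_tags, lifting) case_prodD)
 define I where "I = {..<length ps}"
 define n where "n x = fst (ps ! x)" for x
 define v where "v x = snd (ps ! x)" for x
 have nv: "on (words t L1) (n x)" "v x \<in> words t L1" if "x \<in> I" for x
  using ps[of "n x" "v x"] that by (simp_all add: I_def n_def v_def)
 have idI: "(\<Sum>x \<in> I. act tz (n x) (v x)) = (if tz = id then 1 else 0)" if "tz permutes {1..t}" for tz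
  using psid[OF that] by (simp add: I_def n_def v_def sum_list_sum_nth case_prod_unfold atLeast0LessThan)
 have I: "finite I" by (simp add: I_def)
 \<comment> \<open>The part of \<open>f\<close> on words beginning with the single letters
   \<open>f0\<close>, regarded as a function of the remaining positions.\<close>
 define F where "F f u = f (rp t u (One o f0))" for u and f :: "word => 'k"
 define is0 where "is0 u \<longleftrightarrow> (\<forall>i \<in> {1..t}. u i = One (f0 i))" for u
 define nu where "nu x f = tens t (n x) (F f)" for x f
 define mu where "mu x f u = (if u \<in> A & is0 u then f (rp t u (v x)) else 0)" for x u and f :: "word => 'k"
 have B: "stable d B" unfolding B_def by (rule stable_words)
 have rpi: "rp t u v i = u i" if "i > t" for u v i using that by (auto simp: rp_def)
 have nle: "i ~: {1..t}" if "i > t" for i using that by auto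
 have nu_nz: "tr t u \<in> words t L1 & rp t u (One o f0) \<in> A" if "nu x f u ~= 0" "x \<in> I" "on A f" for x f u
 proof -
  have "n x (tr t u) ~= 0" "f (rp t u (One o f0)) ~= 0" using that(1) by (auto simp: nu_def tens_def F_def)
  thus ?thesis using nv(1)[OF that(2)] that(3) by (auto simp: on_def)
 qed
 define Q where "Q u \<longleftrightarrow> (\<forall>i \<in> {1..d}. u i \<in> (if i \<in> {1..t} then L1 else L2))" for u :: word
 have Qc: "Q u \<longleftrightarrow> Q w" if c: "colour o u = colour o w" for u w
  unfolding Q_def L1_def L2_def
  by (rule ball_cong[OF refl]) (use colour_letters[OF colour_comp[OF c]] in auto)
 have nuQ: "Q u" if "nu x f u ~= 0" "x \<in> I" "on A f" for x f u
  unfolding Q_def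
 proof
  fix i assume i: "i \<in> {1..d}"
  note nz = nu_nz[OF that]
  show "u i \<in> (if i \<in> {1..t} then L1 else L2)"
  proof (cases "i \<in> {1..t}")
  case True
  hence "tr t u i \<in> L1" using nz unfolding words_def by blast
  thus ?thesis using True by (simp add: tr_def)
  next
  case False
  have "rp t u (One o f0) i \<in> L2"
   by (rule rest[OF conjunct2[OF nz]]) (use i False in \<open>auto simp: rp_def\<close>)
  thus ?thesis using False by (simp only: rp_def if_False)
  qed
 qed
 have onnu: "on B (nu x f)" if x: "x \<in> I" and f: "on A f" for x f
  unfolding on_def
 proof (intro allI impI, rule ccontr)
  fix u assume u: "u ~: B" and nz: "nu x f u ~= 0"
  have "u i \<in> letters O3 P3" if i: "i \<in> {1..d}" for i
  proof -
  have "u i \<in> (if i \<in> {1..t} then L1 else L2)" using nuQ[OF nz x f] i unfolding Q_def by blast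
  thus ?thesis using sub by (auto split: if_splits)
  qed
  moreover have "u i = One 0" if i: "i ~: {1..d}" for i
  proof -
  have "i ~: {1..t}" using i t by auto
  thus ?thesis using default[OF conjunct2[OF nu_nz[OF nz x f]] i] by (simp only: rp_def if_False)
  qed
  ultimately show False using u unfolding B_def words_def by blast
 qed
 have Feqv: "F (act k f) = act k (F f)" if k: "k permutes {1..d}" "\<forall>i \<in> {1..t}. k i = i" for k f
 proof (rule act_local[OF k])
  show "F (f + g) = F f + F g" for f g by (simp add: F_def fun_eq_iff)
  show "F (der i f) = der i (F f)" if i: "i > t" for i f
  unfolding F_def der_def rpi[OF i] rp_upd[OF nle[OF i]] by (auto simp: fun_eq_iff split: letter.split)
  show "F (pm k f) = pm k (F f)" for f by (simp only: F_def fun_eq_iff pm_def rp_comp[OF k] simp_thms)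
 qed
 have is0_upd: "is0 (u(i := y)) \<longleftrightarrow> is0 u" if "i > t" for u i y
  unfolding is0_def by (rule ball_cong[OF refl]) (use that in auto)
 have Aupd: "u(i := V j) \<in> A \<longleftrightarrow> u \<in> A" if "u i = W j" for u i j
  by (rule stable_colour[OF A]) (use that in \<open>auto simp: fun_eq_iff\<close>)
 have linF: "F (f + g) = F f + F g" for f g by (simp add: F_def fun_eq_iff)
 \<comment> \<open>The tensor product structure separates the two factors of the permutation: the
   sum over x is the matrix coefficient at \<open>tz\<close> times the action of \<open>k\<close> on
   the remaining positions.\<close>
 have comb: "(\<Sum>x \<in> I. mu x (act (tz o k) (nu x f))) u =
  (if u \<in> A & is0 u & tz = id then act k (F f) (rp t u (%i. One 0)) else 0)"
  if tz: "tz permutes {1..t}" and k: "k permutes {1..d}" "\<forall>i \<in> {1..t}. k i = i" for tz k f u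
 proof -
  have tzd: "tz permutes {1..d}" by (rule permutes_subset[OF tz]) (use t in auto)
  have "act (tz o k) (nu x f) = tens t (act tz (n x)) (act k (F f))" for x
  unfolding nu_def act_comp[OF tzd k(1)] tens_act_right[OF k, symmetric] tens_act_left[OF tz] ..
  hence "mu x (act (tz o k) (nu x f)) u =
   (if u \<in> A & is0 u then act tz (n x) (v x) * act k (F f) (rp t u (%i. One 0)) else 0)" if "x \<in> I" for x
  proof -
  have "tr t (v x) = v x" using nv(2)[OF that] unfolding words_def tr_def fun_eq_iff by auto
  thus ?thesis using \<open>!!x. act (tz o k) (nu x f) = _ x\<close> by (simp add: mu_def tens_def)
  qed
  hence "(\<Sum>x \<in> I. mu x (act (tz o k) (nu x f))) u =
  (\<Sum>x \<in> I. if u \<in> A & is0 u then act tz (n x) (v x) * act k (F f) (rp t u (%i. One 0)) else 0)"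
  unfolding sum_fun_apply by (intro sum.cong refl)
  also have "... = (if u \<in> A & is0 u then (\<Sum>x \<in> I. act tz (n x) (v x)) * act k (F f) (rp t u (%i. One 0)) else 0)"
  by (cases "u \<in> A & is0 u") (simp_all only: if_True if_False simp_thms sum_distrib_right sum.neutral_const)
  finally show ?thesis unfolding idI[OF tz] by simp
 qed
 show ?thesis
 proof (rule dominated_by_trace[OF A B I R, where nu = nu and mu = mu])
  fix x assume x: "x \<in> I"
  show "lin (nu x)" unfolding lin_def
  by (intro conjI allI ext) (simp_all add: nu_def tens_def F_def algebra_simps)
  show "lin (mu x)" unfolding lin_def by (intro conjI allI ext) (simp_all add: mu_def)
 next
  fix x and f :: "word => 'k" assume "x \<in> I" "on A f"
  thus "on B (nu x f)" by (rule onnu)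
 next
  fix x and f :: "word => 'k"
  show "on A (mu x f)" by (auto simp: mu_def on_def)
 next
  fix x k and f :: "word => 'k" assume x: "x \<in> I" and k: "k permutes {1..d}" "\<forall>i \<in> {1..t}. k i = i"
  show "nu x (act k f) = act k (nu x f)" unfolding nu_def Feqv[OF k] by (rule tens_act_right[OF k])
  show "mu x (act k f) = act k (mu x f)"
  proof (rule act_local[OF k])
  show "mu x (f + g) = mu x f + mu x g" for f g by (simp add: mu_def fun_eq_iff)
  show "mu x (der i f) = der i (mu x f)" if i: "i > t" for i f
  proof
   fix u :: word
   show "mu x (der i f) u = der i (mu x f) u"
   proof (cases "u i")
    case (W j)
    have "u(i := V j) \<in> A & is0 (u(i := V j)) \<longleftrightarrow> u \<in> A & is0 u"
    using Aupd[of u i j, OF W] is0_upd[OF i] by blast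
    thus ?thesis by (simp add: mu_def der_def rpi[OF i] rp_upd[OF nle[OF i]] W)
   qed (simp_all add: mu_def der_def rpi[OF i])
  qed
  show "mu x (pm k f) = pm k (mu x f)" for f
  proof
   fix u
   have "is0 (u o k) \<longleftrightarrow> is0 u" using k(2) by (simp add: is0_def)
   thus "mu x (pm k f) u = pm k (mu x f) u"
    by (simp only: mu_def pm_def rp_comp[OF k] stable_perm[OF A k(1)])
  qed
  qed
 next
  fix f :: "word => 'k" and g assume f: "on A f" and g: "g permutes {1..d}" and nf: "\<not> (\<forall>i \<in> {1..t}. g i = i)"
  show "(\<Sum>x \<in> I. mu x (act g (nu x f))) = 0"
  proof (cases "\<forall>i \<in> {1..t}. g i \<in> {1..t}")
  case True
  define tz where "tz = (%i. if i \<in> {1..t} then g i else i)"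
  obtain k where tz: "tz permutes {1..t}" and k: "k permutes {1..d}" and kf: "\<forall>i \<in> {1..t}. k i = i" and gk: "g = tz o k"
   unfolding tz_def using block_split[OF g t True] by blast
  have nid: "tz ~= id"
  proof
   assume "tz = id"
   have "g i = i" if i: "i \<in> {1..t}" for i
   proof -
    have "tz i = i" using \<open>tz = id\<close> by (simp only: id_apply)
    moreover have "tz i = g i" using i by (simp only: tz_def if_True)
    ultimately show ?thesis by (rule trans[OF sym, rotated])
   qed
   thus False using nf by blast
  qed
  show ?thesis
  proof
   fix u
   show "(\<Sum>x \<in> I. mu x (act g (nu x f))) u = 0 u" unfolding gk comb[OF tz k kf] by (simp only: nid simp_thms if_False zero_fun_apply)
  qed
  next
  case False
  have "mu x (act g (nu x f)) u = 0" if x: "x \<in> I" for x u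
  proof (rule ccontr)
   assume h: "mu x (act g (nu x f)) u ~= 0"
   define y where "y = rp t u (v x)"
   have h': "(if u \<in> A & is0 u then act g (nu x f) y else 0) ~= 0" using h unfolding mu_def y_def .
   have u': "u \<in> A & is0 u"
   proof (rule ccontr)
    assume n: "\<not> (u \<in> A & is0 u)"
    show False using h' unfolding if_not_P[OF n] by blast
   qed
   note u = conjunct1[OF u'] conjunct2[OF u']
   have nz: "act g (nu x f) y ~= 0" using h' unfolding if_P[OF u'] .
   have Qg: "Q (y o g)" by (rule act_supp[OF g Qc nuQ[OF _ x f] nz])
   obtain i where i: "i \<in> {1..t}" "g i ~: {1..t}" using False by blast
   have id: "i \<in> {1..d}" using i(1) t by auto
   hence gi: "g i \<in> {1..d}" using permutes_in_image[OF g] by blast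
   have "(y o g) i \<in> (if i \<in> {1..t} then L1 else L2)" using Qg id unfolding Q_def by blast
   hence "y (g i) \<in> L1" unfolding if_P[OF i(1)] comp_apply .
   moreover have "y (g i) = u (g i)" using i(2) by (simp only: y_def rp_def if_False)
   moreover have "u (g i) \<in> L2" using rest[OF u(1), of "g i"] u(2) gi i(2) unfolding is0_def by blast
   ultimately show False using disj by auto
  qed
  thus ?thesis by (simp add: fun_eq_iff sum_fun_apply)
  qed
 next
  fix f :: "word => 'k" assume f: "on A f"
  define ch where "ch u = (if is0 u then 1 else 0 :: 'k)" for u
  have c: "colour_dep ch" unfolding colour_dep_def
  proof (intro allI impI)
  fix u w :: word assume c: "colour o u = colour o w"
  have "u i = One a \<longleftrightarrow> w i = One a" for i a
   using colour_comp[OF c, of i] colour_eq_One[of "u i" a] colour_eq_One[of "w i" a] by simp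
  thus "ch u = ch w" by (simp add: ch_def is0_def)
  qed
  have tr: "(\<Sum>x \<in> I. mu x (nu x h)) = ch * h" if h: "on A h" for h
  proof
  fix u
  have "rp t (rp t u (%i. One 0)) (One o f0) = u" if "is0 u"
   using that by (auto simp: rp_def is0_def fun_eq_iff)
  moreover have "(\<Sum>x \<in> I. mu x (nu x h)) u = (if u \<in> A & is0 u then F h (rp t u (%i. One 0)) else 0)"
   using comb[OF permutes_id permutes_id, of h u] by (simp add: act_id[unfolded id_def])
  ultimately show "(\<Sum>x \<in> I. mu x (nu x h)) u = (ch * h) u" using h by (auto simp: F_def ch_def on_def)
  qed
  show "(\<Sum>r \<in> R. act r (\<Sum>x \<in> I. mu x (nu x (act (inv' r) f)))) = f"
  proof
  fix u
  have "(\<Sum>r \<in> R. act r (\<Sum>x \<in> I. mu x (nu x (act (inv' r) f)))) u = (\<Sum>r \<in> R. ch (u o r) * f u)"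
   unfolding sum_fun_apply[where A = R]
  proof (rule sum.cong[OF refl])
   fix r assume r: "r \<in> R"
   show "act r (\<Sum>x \<in> I. mu x (nu x (act (inv' r) f))) u = ch (u o r) * f u"
    unfolding tr[OF on_act[OF A permutes_inv[OF R(2)[OF r]] f]] act_mult_colour[OF R(2)[OF r] c] act_inv(1)[OF R(2)[OF r]]
    by simp
  qed
  also have "... = f u"
  proof (cases "u \<in> A")
   case True
   have "\<exists>!r. r \<in> R & is0 (u o r)" using pos[OF True] unfolding is0_def comp_apply .
   then obtain r where r: "r \<in> R" "is0 (u o r)" "!!r'. r' \<in> R ==> is0 (u o r') ==> r' = r" by blast
   have "(\<Sum>r \<in> R. ch (u o r) * f u) = (\<Sum>r' \<in> R. if r' = r then f u else 0)"
   proof (rule sum.cong[OF refl])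
    fix r' assume r': "r' \<in> R"
    show "ch (u o r') * f u = (if r' = r then f u else 0)"
    proof (cases "r' = r")
    case True
    show ?thesis unfolding True ch_def if_P[OF r(2)] by simp
    next
    case False
    hence "\<not> is0 (u o r')" using r(3)[OF r'] by blast
    thus ?thesis using False unfolding ch_def by (simp only: if_False mult_zero_left)
    qed
   qed
   thus ?thesis using r(1) by (simp only: sum.delta[OF R(1)] if_True)
  next
   case False
   thus ?thesis using f by (simp add: on_def)
  qed
  finally show "(\<Sum>r \<in> R. act r (\<Sum>x \<in> I. mu x (nu x (act (inv' r) f)))) u = f u" .
  qed
 qed
qed

end

section \<open>Matrix coefficients: when the delta function is realized over a given
  alphabet\<close>

definition wt :: "nat => word => nat" where
 "wt d u = card {i \<in> {1..d}. EX j. u i = W j}"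

lemma wt_upd: "u i = W a ==> i \<in> {1..d} ==> wt d (u(i := V b)) < wt d u"
 unfolding wt_def by (rule psubset_card_mono) auto

lemma wt_comp:
 assumes s: "sz permutes {1..d}"
 shows "wt d (u o sz) = wt d u"
proof -
 have "sz ` {i \<in> {1..d}. EX j. (u o sz) i = W j} = {i \<in> {1..d}. EX j. u i = W j}" (is "sz ` ?A = ?B")
 proof
  show "sz ` ?A \<subseteq> ?B" using permutes_in_image[OF s] by auto
  show "?B \<subseteq> sz ` ?A"
  proof
  fix i assume i: "i \<in> ?B"
  hence "inv' sz i \<in> {1..d}" using permutes_in_image[OF permutes_inv[OF s], of i] by simp
  hence "inv' sz i \<in> ?A" using i by (simp add: permutes_inverses(1)[OF s])
  thus "i \<in> sz ` ?A" by (rule rev_image_eqI) (simp add: permutes_inverses(1)[OF s])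
  qed
 qed
 thus ?thesis unfolding wt_def using card_image[OF permutes_inj_on[OF s], of ?A] by simp
qed

text \<open>Each delta turns a \<open>V\<close> into a \<open>W\<close>, so the factors
  \<open>hop X\<close> add only terms of larger weight. On the lowest weight of f the braiding is
  invisible and the action just permutes positions.\<close>

lemma act_low:
 fixes f :: "word => 'k::field"
 assumes s: "sz permutes {1..d}" and f: "!!u. f u ~= 0 ==> k \<le> wt d u" and u: "wt d u = k"
 shows "act sz f u = f (u o sz)"
proof -
 have "(ALL u. hops S f u ~= 0 --> k \<le> wt d u) & (ALL u. wt d u \<le> k --> hops S f u = f u)" if "finite S" "S \<subseteq> Inv sz" for S
  using that
 proof (induction S rule: finite_induct)
  case (insert X S)
  obtain i j where X: "X = {i, j}" using insert(4) by (auto simp: Inv_def)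
  have ij: "i \<in> {1..d}" "j \<in> {1..d}" using Inv_subset[OF s, of X] insert(4) X by auto
  have IH: "hops S f w ~= 0 ==> k \<le> wt d w" "wt d w \<le> k ==> hops S f w = f w" for w
  using insert by auto
  have big: "k < wt d w" if nz: "der i (der j (hops S f)) w ~= 0" for w
  proof -
  obtain a where a: "w i = W a" "der j (hops S f) (w(i := V a)) ~= 0"
   using nz by (cases "w i") (auto simp: der_def)
  obtain b where b: "(w(i := V a)) j = W b" "hops S f (w(i := V a, j := V b)) ~= 0"
   using a(2) unfolding der_def[of j] by (cases "(w(i := V a)) j") auto
  show ?thesis using IH(1)[OF b(2)] wt_upd[of "w(i := V a)" j, OF b(1) ij(2), of b] wt_upd[of w i, OF a(1) ij(1), of a] by linarith
  qed
  have e: "hops (insert X S) f w = hops S f w + der i (der j (hops S f)) w" for w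
  using insert(1,2) by (simp add: hops_insert X hop_doubleton)
  show ?case unfolding e
  proof (intro conjI allI impI)
  fix w assume h: "hops S f w + der i (der j (hops S f)) w ~= 0"
  show "k \<le> wt d w"
  proof (cases "hops S f w = 0")
   case True
   hence "der i (der j (hops S f)) w ~= 0" using h by simp
   from big[OF this] show ?thesis by simp
  qed (rule IH(1))
  next
  fix w assume w: "wt d w \<le> k"
  have "der i (der j (hops S f)) w = 0" using big[of w] w by force
  thus "hops S f w + der i (der j (hops S f)) w = f w" using IH(2)[OF w] by simp
  qed
 qed (use f in auto)
 from this[OF finite_Inv[OF s] order_refl] show ?thesis using u wt_comp[OF s, of u] by (simp add: act_def pm_def)
qed

lemma act_unitw_low:
 assumes "sz permutes {1..d}" "wt d w = wt d v"
 shows "act sz (unitw w) v = (if v o sz = w then 1 else 0 :: 'k::field)"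
proof -
 have h: "wt d w \<le> wt d u" if "unitw w u ~= (0::'k)" for u
  using that by (cases "u = w") (simp_all add: unitw_def)
 have "act sz (unitw w) v = (unitw w (v o sz) :: 'k)"
  by (rule act_low[where k = "wt d w", OF assms(1) h assms(2)[symmetric]])
 thus ?thesis by (simp only: unitw_def)
qed

lemma unitw_expand:
 assumes "on A f" "finite A"
 shows "f = (\<Sum>w \<in> A. (%u. f w * unitw w u))"
proof
 fix u
 have "(\<Sum>w \<in> A. (%u. f w * unitw w u)) u = (\<Sum>w \<in> A. if w = u then f u else 0)"
  unfolding sum_fun_apply by (rule sum.cong) (auto simp: unitw_def)
 also have "... = f u" using assms by (simp add: on_def)
 finally show "f u = (\<Sum>w \<in> A. (%u. f w * unitw w u)) u" by simp
qed

lemma realized_zero: "realized d L (%tz. 0)"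
 unfolding realized_def by (intro exI[of _ "[]"]) simp

lemma realized_single: "on (words d L) n ==> v \<in> words d L ==> realized d L (%tz. act tz n v)"
 unfolding realized_def by (intro exI[of _ "[(n, v)]"]) simp

lemma realized_cong: "realized d L x ==> (!!tz. tz permutes {1..d} ==> y tz = x tz) ==> realized d L y"
 unfolding realized_def by metis

lemma realized_add:
 assumes "realized d L x" "realized d L y"
 shows "realized d L (%tz. x tz + y tz :: 'k::field)"
proof -
 obtain ps where ps: "\<forall>(n, v) \<in> set ps. on (words d L) n & v \<in> words d L"
  "ALL tz. tz permutes {1..d} --> x tz = (\<Sum>(n, v)\<leftarrow>ps. act tz n v)" using assms(1) unfolding realized_def by blast
 obtain qs where qs: "\<forall>(n, v) \<in> set qs. on (words d L) n & v \<in> words d L"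
  "ALL tz. tz permutes {1..d} --> y tz = (\<Sum>(n, v)\<leftarrow>qs. act tz n v)" using assms(2) unfolding realized_def by blast
 show ?thesis unfolding realized_def by (rule exI[of _ "ps @ qs"]) (use ps qs in \<open>auto simp: ball_Un\<close>)
qed

lemma realized_sum: "finite S ==> (!!g. g \<in> S ==> realized d L (x g)) ==> realized d L (%tz. \<Sum>g \<in> S. x g tz)"
 by (induction S rule: finite_induct) (simp_all add: realized_zero realized_add)

lemma realized_induct [consumes 1, case_names single zero add cong]:
 assumes "realized d L x"
  and s: "!!n v. on (words d L) n ==> v \<in> words d L ==> P (%tz. act tz n v)"
  and z: "P (%tz. 0)" and a: "!!x y. P x ==> P y ==> P (%tz. x tz + y tz)"
  and c: "!!x y. P x ==> (!!tz. tz permutes {1..d} ==> y tz = x tz) ==> P y"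
 shows "P x"
proof -
 obtain ps where ps: "\<forall>(n, v) \<in> set ps. on (words d L) n & v \<in> words d L"
  "ALL tz. tz permutes {1..d} --> x tz = (\<Sum>(n, v)\<leftarrow>ps. act tz n v)" using assms(1) unfolding realized_def by blast
 have "P (%tz. \<Sum>(n, v)\<leftarrow>ps. act tz n v)" using ps(1)
 proof (induction ps)
  case (Cons p ps)
  have "P (%tz. act tz (fst p) (snd p))" by (rule s) (use Cons(2) in auto)
  from a[OF this Cons(1)] show ?case using Cons(2) by (simp add: case_prod_unfold)
 qed (simp add: z)
 thus ?thesis by (rule c) (use ps(2) in auto)
qed

lemma realized_scale:
 assumes "realized d L x"
 shows "realized d L (%tz. c * x tz :: 'k::field)"
 using assms
proof (induction rule: realized_induct)
 case (single n v)
 have "realized d L (%tz. act tz (%u. c * n u) v)" by (rule realized_single[OF on_scale[OF single(1)] single(2)])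
 thus ?case by (rule realized_cong) (simp add: linD(2)[OF lin_act])
next
 case zero
 show ?case by (simp add: realized_zero)
next
 case (add x y)
 from realized_add[OF add] show ?case by (simp add: distrib_left)
next
 case (cong x y)
 show ?case by (rule realized_cong[OF cong(1)]) (simp add: cong(2))
qed

context char2
begin

text \<open>On the right g is absorbed into the vector n. On the left it is absorbed into the
  coordinate v, which turns into a combination of the coordinates at all words.\<close>

lemma realized_translate:
 fixes x :: "(nat => nat) => 'k"
 assumes x: "realized d (letters O1 P1) x" and fin: "finite O1" "finite P1" and g: "g permutes {1..d}"
 shows realized_right: "realized d (letters O1 P1) (%tz. x (tz o g))"
  and realized_left: "realized d (letters O1 P1) (%tz. x (g o tz))"
proof -
 let ?L = "letters O1 P1"
 have W: "finite (words d ?L)" by (rule card_words(2)) (simp add: letters_def fin)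
 show "realized d ?L (%tz. x (tz o g))" using x
 proof (induction rule: realized_induct)
  case (single n v)
  have "realized d ?L (%tz. act tz (act g n) v)" by (rule realized_single[OF on_act[OF stable_words g single(1)] single(2)])
  thus ?case by (rule realized_cong) (simp only: act_comp[OF _ g])
 next
  case (cong x y)
  show ?case by (rule realized_cong[OF cong(1)]) (rule cong(2)[OF permutes_compose[OF g]])
 qed (simp_all add: realized_zero realized_add)
 show "realized d ?L (%tz. x (g o tz))" using x
 proof (induction rule: realized_induct)
  case (single n v)
  have "realized d ?L (%tz. \<Sum>w \<in> words d ?L. act g (unitw w) v * act tz n w)"
  by (intro realized_sum W realized_scale realized_single single(1))
  thus ?case
  proof (rule realized_cong)
  fix tz :: "nat => nat" assume t: "tz permutes {1..d}"
  define F where "F = act tz n"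
  have F: "on (words d ?L) F" unfolding F_def by (rule on_act[OF stable_words t single(1)])
  have "act (g o tz) n v = act g F v" unfolding act_comp[OF g t] F_def ..
  also have "... = act g (\<Sum>w \<in> words d ?L. (%u. F w * unitw w u)) v" using unitw_expand[OF F W] by simp
  also have "... = (\<Sum>w \<in> words d ?L. act g (unitw w) v * F w)"
   unfolding lin_sum[OF lin_act[OF g]] linD(2)[OF lin_act[OF g]] sum_fun_apply by (simp add: mult.commute)
  finally show "act (g o tz) n v = (\<Sum>w \<in> words d ?L. act g (unitw w) v * act tz n w)" by (simp only: F_def)
  qed
 next
  case (cong x y)
  show ?case by (rule realized_cong[OF cong(1)]) (rule cong(2)[OF permutes_compose[OF _ g]])
 qed (simp_all add: realized_zero realized_add)
qed

definition pt :: "(nat => nat) => (nat => nat) => 'k" where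
 "pt g tz = (if tz = g then 1 else 0)"

lemma card_letters: "finite O1 ==> finite P1 ==> card (letters O1 P1) = card O1 + 2 * card P1"
 unfolding letters_def by (subst card_Un_disjoint, auto simp: card_image inj_on_def)+

lemma distinct_word:
 assumes "finite O1" "finite P1" "b - a \<le> card O1 + 2 * card P1"
 obtains z where "!!i. i \<in> {Suc a..b} ==> z i \<in> letters O1 P1" "!!i. i ~: {Suc a..b} ==> z i = One 0" "inj_on z {Suc a..b}"
proof -
 have "finite (letters O1 P1)" using assms by (simp add: letters_def)
 then obtain f where f: "f ` {Suc a..b} \<subseteq> letters O1 P1" "inj_on f {Suc a..b}"
  using card_le_inj[of "{Suc a..b}" "letters O1 P1"] assms card_letters[OF assms(1,2)] by auto
 show ?thesis
 proof (rule that[of "%i. if i \<in> {Suc a..b} then f i else One 0"])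
  show "inj_on (%i. if i \<in> {Suc a..b} then f i else One 0) {Suc a..b}"
  using f(2) by (simp add: inj_on_def)
  show "(if i \<in> {Suc a..b} then f i else One 0) \<in> letters O1 P1" if i: "i \<in> {Suc a..b}" for i
  unfolding if_P[OF i] using f(1) i by blast
  show "(if i \<in> {Suc a..b} then f i else One 0) = One 0" if i: "i ~: {Suc a..b}" for i
  unfolding if_not_P[OF i] ..
 qed
qed

text \<open>A word z with d distinct letters is moved by every nontrivial permutation. As z has the
  same weight as itself, the braiding does not show, and the coefficient of z at z is the delta
  function.\<close>

lemma realized_few:
 assumes "finite O1" "finite P1" "d \<le> card O1 + 2 * card P1"
 shows "realized d (letters O1 P1) (pt id)"
proof -
 obtain z where z: "!!i. i \<in> {Suc 0..d} ==> z i \<in> letters O1 P1" "!!i. i ~: {Suc 0..d} ==> z i = One 0" "inj_on z {Suc 0..d}"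
  using distinct_word[of O1 P1 d 0] assms by auto
 have zw: "z \<in> words d (letters O1 P1)" using z(1,2) by (simp add: words_def)
 have "realized d (letters O1 P1) (%tz. act tz (unitw z) z :: 'k)" by (rule realized_single[OF on_unitw[OF zw] zw])
 thus ?thesis
 proof (rule realized_cong)
  fix tz :: "nat => nat" assume t: "tz permutes {1..d}"
  have "z o tz = z \<longleftrightarrow> tz = id"
  proof
  assume e: "z o tz = z"
  show "tz = id"
  proof
   fix i show "tz i = id i"
   proof (cases "i \<in> {1..d}")
    case True
    have "z (tz i) = z i" using fun_cong[OF e, of i] by simp
    moreover have "tz i \<in> {1..d}" using permutes_in_image[OF t] True by blast
    ultimately show ?thesis using inj_onD[OF z(3), of "tz i" i] True by simp
   next
    case False
    thus ?thesis using t by (simp add: permutes_not_in)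
   qed
  qed
  qed simp
  thus "pt id tz = act tz (unitw z) z" unfolding act_unitw_low[OF t refl] pt_def by simp
 qed
qed

text \<open>A product of two coefficients: x on the first a positions, and that of z at z on the
  others. Disjointness of the alphabets confines the support to the permutations preserving
  \<open>{1..a}\<close>. If the letters of z are distinct this extends x by zero; if z has two equal
  letters their transposition is added.\<close>

lemma realized_prod:
 fixes x :: "(nat => nat) => 'k"
 assumes x: "realized a (letters O1 P1) x" and ab: "a \<le> b"
  and z: "!!i. i \<in> {Suc a..b} ==> z i \<in> letters O2 P2" "!!i. i ~: {Suc a..b} ==> z i = One 0"
  and disj: "letters O1 P1 \<inter> letters O2 P2 = {}" and sub: "letters O1 P1 \<union> letters O2 P2 \<subseteq> L"
 shows "realized b L (%tz. if (\<forall>i \<in> {1..a}. tz i \<in> {1..a}) & (\<forall>i \<in> {Suc a..b}. z (tz i) = z i)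
  then x (%i. if i \<in> {1..a} then tz i else i) else 0)" (is "realized b L (?y x)")
 using x
proof (induction rule: realized_induct)
 case (single n v)
 define N where "N = tens a n (unitw z :: word => 'k)"
 define vv where "vv = rp a z v"
 define Q where "Q u \<longleftrightarrow> (\<forall>i \<in> {1..b}. u i \<in> (if i \<in> {1..a} then letters O1 P1 else letters O2 P2))" for u :: word
 have Qc: "Q u \<longleftrightarrow> Q w" if c: "colour o u = colour o w" for u w
  unfolding Q_def by (rule ball_cong[OF refl]) (use colour_letters[OF colour_comp[OF c]] in auto)
 have split: "i \<in> {Suc a..b}" if "i \<in> {1..b}" "i ~: {1..a}" for i using that by auto
 have Qz: "Q u" if "tr a u \<in> words a (letters O1 P1)" "rp a u (%i. One 0) = z" for u
  unfolding Q_def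
 proof
  fix i assume i: "i \<in> {1..b}"
  show "u i \<in> (if i \<in> {1..a} then letters O1 P1 else letters O2 P2)"
  proof (cases "i \<in> {1..a}")
  case True
  thus ?thesis using that(1) unfolding words_def tr_def by simp
  next
  case False
  have "u i = z i" using fun_cong[OF that(2), of i] False by (simp only: rp_def if_False)
  thus ?thesis using z(1)[OF split[OF i False]] False by (simp only: if_False)
  qed
 qed
 have Nnz: "tr a u \<in> words a (letters O1 P1) & rp a u (%i. One 0) = z" if "N u ~= 0" for u
  using that single(1) by (auto simp: N_def tens_def on_def unitw_def split: if_splits)
 have Qw: "u \<in> words b L" if "Q u" "!!i. i ~: {1..b} ==> u i = One 0" for u
  unfolding words_def
 proof (intro CollectI allI conjI impI)
  fix i assume "i \<in> {1..b}"
  hence "u i \<in> (if i \<in> {1..a} then letters O1 P1 else letters O2 P2)" using that(1) unfolding Q_def by blast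
  thus "u i \<in> L" using sub by (auto split: if_splits)
 qed (rule that(2))
 have out: "i ~: {1..a} & i ~: {Suc a..b}" if "i ~: {1..b}" for i using that ab by auto
 have onN: "on (words b L) N" unfolding on_def
 proof (intro allI impI, rule ccontr)
  fix u assume u: "u ~: words b L" and nz: "N u ~= 0"
  note nn = Nnz[OF nz]
  have "u i = One 0" if i: "i ~: {1..b}" for i
  proof -
  have "u i = z i" using fun_cong[OF conjunct2[OF nn], of i] unfolding rp_def if_not_P[OF conjunct1[OF out[OF i]]] .
  thus ?thesis using z(2)[OF conjunct2[OF out[OF i]]] by simp
  qed
  thus False using Qw[OF Qz[OF conjunct1[OF nn] conjunct2[OF nn]]] u by blast
 qed
 have trv: "tr a vv = v" using single(2) unfolding vv_def words_def tr_rp by (auto simp: tr_def fun_eq_iff)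
 have rpv: "rp a vv (%i. One 0) = z"
 proof
  fix i show "rp a vv (%i. One 0) i = z i" using z(2)[of i] by (auto simp: vv_def rp_def)
 qed
 have Qv: "Q vv" by (rule Qz) (simp_all only: trv rpv single(2))
 have vw: "vv \<in> words b L"
 proof (rule Qw[OF Qv])
  fix i assume i: "i ~: {1..b}"
  show "vv i = One 0" unfolding vv_def rp_def if_not_P[OF conjunct1[OF out[OF i]]] by (rule z(2)[OF conjunct2[OF out[OF i]]])
 qed
 have "realized b L (%tz. act tz N vv)" by (rule realized_single[OF onN vw])
 thus ?case
 proof (rule realized_cong)
  fix tz :: "nat => nat" assume t: "tz permutes {1..b}"
  show "?y (%tz. act tz n v) tz = act tz N vv"
  proof (cases "\<forall>i \<in> {1..a}. tz i \<in> {1..a}")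
  case True
  define tz1 where "tz1 = (%i. if i \<in> {1..a} then tz i else i)"
  obtain k where t1: "tz1 permutes {1..a}" and k: "k permutes {1..b}" and kf: "\<forall>i \<in> {1..a}. k i = i"
   and kt: "!!i. i ~: {1..a} ==> k i = tz i" and tk: "tz = tz1 o k"
   unfolding tz1_def using block_split[OF t ab True] by blast
  have t1b: "tz1 permutes {1..b}" by (rule permutes_subset[OF t1]) (use ab in auto)
  have "act tz N vv = act tz1 n v * act k (unitw z) z"
   unfolding tk act_comp[OF t1b k] N_def tens_act_right[OF k kf, symmetric] tens_act_left[OF t1, symmetric]
   by (simp only: tens_def trv rpv)
  also have "act k (unitw z) z = (if z o k = z then 1 else 0 :: 'k)" by (rule act_unitw_low[OF k refl])
  also have "z o k = z \<longleftrightarrow> (\<forall>i \<in> {Suc a..b}. z (tz i) = z i)"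
  proof
   assume e: "z o k = z"
   show "\<forall>i \<in> {Suc a..b}. z (tz i) = z i"
   proof
    fix i assume "i \<in> {Suc a..b}"
    hence "k i = tz i" by (intro kt) auto
    thus "z (tz i) = z i" using fun_cong[OF e, of i] by simp
   qed
  next
   assume e: "\<forall>i \<in> {Suc a..b}. z (tz i) = z i"
   show "z o k = z"
   proof
    fix i
    consider "i \<in> {1..a}" | "i ~: {1..a}" "i \<in> {Suc a..b}" | "i ~: {1..b}" by force
    thus "(z o k) i = z i"
    proof cases
    case 1 thus ?thesis using kf by simp
    next
    case 2 thus ?thesis using e kt[of i] by simp
    next
    case 3 thus ?thesis using k by (simp add: permutes_not_in)
    qed
   qed
  qed
  finally show ?thesis using True by (simp add: tz1_def)
  next
  case False
  have "act tz N vv = 0"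
  proof (rule ccontr)
   assume nz: "act tz N vv ~= 0"
   have Qt: "Q (vv o tz)" by (rule act_supp[OF t Qc _ nz]) (use Nnz Qz in blast)+
   obtain i where i: "i \<in> {1..a}" "tz i ~: {1..a}" using False by blast
   have ib: "i \<in> {1..b}" using i(1) ab by auto
   hence tb: "tz i \<in> {1..b}" using permutes_in_image[OF t] by blast
   have "(vv o tz) i \<in> (if i \<in> {1..a} then letters O1 P1 else letters O2 P2)" using Qt ib unfolding Q_def by blast
   hence "vv (tz i) \<in> letters O1 P1" unfolding if_P[OF i(1)] comp_apply .
   moreover have "vv (tz i) \<in> (if tz i \<in> {1..a} then letters O1 P1 else letters O2 P2)" using Qv tb unfolding Q_def by blast
   hence "vv (tz i) \<in> letters O2 P2" using i(2) by (simp only: if_False)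
   ultimately show False using disj by blast
  qed
  thus ?thesis using False by auto
  qed
 qed
next
 case zero
 show ?case by (simp add: realized_zero cong: if_cong)
next
 case (add x y)
 from realized_add[OF add] show ?case by (rule realized_cong) simp
next
 case (cong x y)
 from cong(1) show ?case
 proof (rule realized_cong)
  fix tz :: "nat => nat" assume t: "tz permutes {1..b}"
  show "?y y tz = ?y x tz"
  proof (rule if_cong[OF refl _ refl], elim conjE)
  assume h: "\<forall>i \<in> {1..a}. tz i \<in> {1..a}"
  show "y (%i. if i \<in> {1..a} then tz i else i) = x (%i. if i \<in> {1..a} then tz i else i)"
   by (rule cong(2)[OF conjunct1[OF block_split[OF t ab h]]])
  qed
 qed
qed

end

text \<open>Words over a single copy of P, with \<open>True\<close> standing for \<open>W\<close>;
  the list starts at position 1, whence the index \<open>i - 1\<close>.\<close>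

definition ww :: "nat => bool list => word" where
 "ww p bs = (%i. if i \<in> {1..length bs} then (if bs ! (i - 1) then W p else V p) else One 0)"

lemma act_ww:
 "act (transpose (Suc (length xs)) (Suc (Suc (length xs)))) f (ww p (xs @ a # b # ys)) =
  f (ww p (xs @ b # a # ys)) + (if a & b then f (ww p (xs @ False # False # ys)) else (0::'k::field))"
proof -
 let ?i = "Suc (length xs)"
 have s: "ww p (xs @ a # b # ys) o transpose ?i (Suc ?i) = ww p (xs @ b # a # ys)"
 proof
  fix q
  consider "q = ?i" | "q = Suc ?i" | "q ~= ?i" "q ~= Suc ?i" by blast
  thus "(ww p (xs @ a # b # ys) o transpose ?i (Suc ?i)) q = ww p (xs @ b # a # ys) q"
  proof cases
  case 3
  have "(xs @ a # b # ys) ! (q - 1) = (xs @ b # a # ys) ! (q - 1)" if "1 \<le> q"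
  proof (cases "q - 1 < length xs")
   case False
   hence "q - 1 = length xs + Suc (Suc (q - 3 - length xs))" using 3 that by arith
   then obtain r where "q - 1 = length xs + Suc (Suc r)" by blast
   thus ?thesis by (simp add: nth_append)
  qed (simp add: nth_append)
  thus ?thesis using 3 by (simp add: ww_def)
  qed (simp_all add: ww_def nth_append)
 qed
 have at: "ww p (xs @ b # a # ys) ?i = (if b then W p else V p)" "ww p (xs @ b # a # ys) (Suc ?i) = (if a then W p else V p)"
  by (simp_all add: ww_def nth_append)
 have up: "(ww p (xs @ True # True # ys))(?i := V p, Suc ?i := V p) = ww p (xs @ False # False # ys)"
 proof
  fix q
  consider "q = ?i" | "q = Suc ?i" | "q ~= ?i" "q ~= Suc ?i" by blast
  thus "((ww p (xs @ True # True # ys))(?i := V p, Suc ?i := V p)) q = ww p (xs @ False # False # ys) q"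
  proof cases
  case 3
  have "(xs @ True # True # ys) ! (q - 1) = (xs @ False # False # ys) ! (q - 1)" if "1 \<le> q"
  proof (cases "q - 1 < length xs")
   case False
   hence "q - 1 = length xs + Suc (Suc (q - 3 - length xs))" using 3 that by arith
   then obtain r where "q - 1 = length xs + Suc (Suc r)" by blast
   thus ?thesis by (simp add: nth_append)
  qed (simp add: nth_append)
  thus ?thesis using 3 by (simp add: ww_def)
  qed (simp_all add: ww_def nth_append)
 qed
 show ?thesis unfolding act_adjacent pm_def s using at up
  by (cases a; cases b) (simp_all add: der_def del: length_append)
qed

lemma ww_eq_iff: "length as = length bs ==> ww p as = ww p bs \<longleftrightarrow> as = bs"
proof
 assume l: "length as = length bs" and e: "ww p as = ww p bs"
 show "as = bs"
 proof (rule nth_equalityI[OF l])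
  fix i assume i: "i < length as"
  have "ww p as (Suc i) = ww p bs (Suc i)" using e by simp
  thus "as ! i = bs ! i" using i l by (simp add: ww_def split: if_splits)
 qed
qed simp

lemma ww_words: "ww p bs \<in> words (length bs) (letters {} {p})"
 by (auto simp: words_def ww_def letters_def)

context char2
begin

text \<open>The norm element of S_n. The recursion over cosets below writes it in terms of adjacent
  transpositions, so that it can be evaluated on explicit words.\<close>

definition norm_upto :: "nat => (word => 'k) => word => 'k" where
 "norm_upto n f = (\<Sum>tz \<in> {tz. tz permutes {1..n}}. act tz f)"

lemma norm_upto_0: "norm_upto 0 f = f"
proof -
 have "{tz. tz permutes {1..0::nat}} = {id}" by auto
 thus ?thesis by (simp add: norm_upto_def)
qed

lemma norm_upto_Suc: "norm_upto (Suc n) f = (\<Sum>b \<in> {1..Suc n}. act (transpose (Suc n) b) (norm_upto n f))"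
proof -
 have ins: "{1..Suc n} = insert (Suc n) {1..n}" by auto
 have "norm_upto (Suc n) f = (\<Sum>b \<in> insert (Suc n) {1..n}. \<Sum>q \<in> {q. q permutes {1..n}}. act (transpose (Suc n) b o q) f)"
  unfolding norm_upto_def ins by (rule sum_over_permutations_insert) auto
 also have "... = (\<Sum>b \<in> {1..Suc n}. act (transpose (Suc n) b) (norm_upto n f))"
  unfolding ins[symmetric]
 proof (rule sum.cong[OF refl])
  fix b assume b: "b \<in> {1..Suc n}"
  have t: "transpose (Suc n) b permutes {1..Suc n}" using b by (intro permutes_swap_id) auto
  show "(\<Sum>q \<in> {q. q permutes {1..n}}. act (transpose (Suc n) b o q) f) = act (transpose (Suc n) b) (norm_upto n f)"
  unfolding norm_upto_def lin_sum[OF lin_act[OF t]]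
  proof (rule sum.cong[OF refl])
  fix q assume "q \<in> {q. q permutes {1..n}}"
  hence "q permutes {1..Suc n}" by (auto intro: permutes_subset)
  thus "act (transpose (Suc n) b o q) f = act (transpose (Suc n) b) (act q f)" by (rule act_comp[OF t])
  qed
 qed
 finally show ?thesis .
qed

lemma act_transpose_conj:
 assumes "1 \<le> b" "b < a"
 shows "act (transpose (Suc a) b) f = act (transpose a (Suc a)) (act (transpose a b) (act (transpose a (Suc a)) f :: word => 'k))"
proof -
 have e: "transpose (Suc a) b = transpose a (Suc a) o (transpose a b o transpose a (Suc a))"
  using assms by (auto simp: fun_eq_iff transpose_def)
 have p: "transpose a (Suc a) permutes {1..Suc a}" "transpose a b permutes {1..Suc a}"
  using assms by (auto intro!: permutes_swap_id)
 show ?thesis unfolding e act_comp[OF p(1) permutes_compose[OF p(1) p(2)]] act_comp[OF p(2,1)] ..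
qed

lemma norm_upto_expand:
 shows "norm_upto 2 f = act (transpose 1 2) f + (f :: word => 'k)"
  and "norm_upto 3 f = act (transpose 2 3) (act (transpose 1 2) (act (transpose 2 3) (norm_upto 2 f))) +
  (act (transpose 2 3) (norm_upto 2 f) + norm_upto 2 f)"
  and "norm_upto 4 f = act (transpose 3 4) (act (transpose 2 3) (act (transpose 1 2) (act (transpose 2 3) (act (transpose 3 4) (norm_upto 3 f))))) +
  (act (transpose 3 4) (act (transpose 2 3) (act (transpose 3 4) (norm_upto 3 f))) +
  (act (transpose 3 4) (norm_upto 3 f) + norm_upto 3 f))"
proof -
 have s: "{1..Suc 0} = {1}" "{1..2} = {1, 2::nat}" "{1..3} = {1, 2, 3::nat}" "{1..4} = {1, 2, 3, 4::nat}" by auto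
 have i: "act (transpose a a) g = g" for a and g :: "word => 'k" by (simp add: transpose_eq_id_iff del: id_apply)
 have n1: "norm_upto (Suc 0) f = f" unfolding norm_upto_Suc norm_upto_0 s(1) by (simp add: i)
 have c: "act (transpose 3 1) g = act (transpose 2 3) (act (transpose 2 1) (act (transpose 2 3) g))" for g :: "word => 'k"
  using act_transpose_conj[of 1 2 g] by (simp add: numeral_eq_Suc)
 have c2: "act (transpose 4 b) g = act (transpose 3 4) (act (transpose 3 b) (act (transpose 3 4) g))" if "1 \<le> b" "b < 3" for b and g :: "word => 'k"
  using act_transpose_conj[of b 3 g] that by (simp add: numeral_eq_Suc)
 have tc: "transpose 2 (1::nat) = transpose 1 2" "transpose 3 (2::nat) = transpose 2 3" "transpose 4 (3::nat) = transpose 3 4"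
  by (simp_all add: transpose_commute)
 have S: "2 = Suc (Suc 0)" "3 = Suc 2" "4 = Suc (3::nat)" by simp_all
 show "norm_upto 2 f = act (transpose 1 2) f + f"
  unfolding S(1) norm_upto_Suc[of "Suc 0"] n1 unfolding S(1)[symmetric] s(2) by (simp add: i tc del: One_nat_def)
 show "norm_upto 3 f = act (transpose 2 3) (act (transpose 1 2) (act (transpose 2 3) (norm_upto 2 f))) +
  (act (transpose 2 3) (norm_upto 2 f) + norm_upto 2 f)"
  unfolding S(2) norm_upto_Suc[of 2] unfolding S(2)[symmetric] s(3) by (simp add: i tc c del: One_nat_def)
 show "norm_upto 4 f = act (transpose 3 4) (act (transpose 2 3) (act (transpose 1 2) (act (transpose 2 3) (act (transpose 3 4) (norm_upto 3 f))))) +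
  (act (transpose 3 4) (act (transpose 2 3) (act (transpose 3 4) (norm_upto 3 f))) +
  (act (transpose 3 4) (norm_upto 3 f) + norm_upto 3 f))"
  unfolding S(3) norm_upto_Suc[of 3] unfolding S(3)[symmetric] s(4) by (simp add: i tc c c2 del: One_nat_def)
qed

lemma act_ww_rules:
 fixes f :: "word => 'k"
 shows "act (transpose 1 2) f (ww p (a # b # ys)) = f (ww p (b # a # ys)) + (if a & b then f (ww p (False # False # ys)) else 0)"
  "act (transpose 2 3) f (ww p (x # a # b # ys)) = f (ww p (x # b # a # ys)) + (if a & b then f (ww p (x # False # False # ys)) else 0)"
  "act (transpose 3 4) f (ww p (x # y # a # b # ys)) = f (ww p (x # y # b # a # ys)) + (if a & b then f (ww p (x # y # False # False # ys)) else 0)"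
 using act_ww[of "[]" f p a b ys] act_ww[of "[x]" f p a b ys] act_ww[of "[x, y]" f p a b ys] by (simp_all add: numeral_eq_Suc)

text \<open>Under the plain permutation of positions these norms would vanish, because a word of
  length 3 or 4 over two letters has a repetition. The braiding makes the entry from WVV to WWW, and
  the one from WVVV to WWWV, equal to 1. For this reason a copy of P can serve three or four
  positions although it has only two letters.\<close>

lemma norm_block:
 "norm_upto 3 (unitw (ww p [True, False, False])) (ww p [True, True, True]) = (1::'k)"
 "norm_upto 4 (unitw (ww p [True, False, False, False])) (ww p [True, True, True, False]) = (1::'k)"
 by (simp_all add: norm_upto_expand act_ww_rules unitw_def ww_eq_iff del: One_nat_def)

lemma realized_weight_one:
 assumes k: "k = 3 \<or> k = 4"
 obtains x :: "(nat => nat) => 'k" where "realized k (letters {} {p}) x" "(\<Sum>tz \<in> {tz. tz permutes {1..k}}. x tz) = 1"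
proof -
 have ex: "\<exists>x :: (nat => nat) => 'k. realized k (letters {} {p}) x & (\<Sum>tz \<in> {tz. tz permutes {1..k}}. x tz) = 1"
  if l: "length as = k" "length bs = k" and n: "norm_upto k (unitw (ww p as)) (ww p bs) = (1::'k)" for as bs
 proof (intro exI conjI)
  show "realized k (letters {} {p}) (%tz. act tz (unitw (ww p as)) (ww p bs) :: 'k)"
  using ww_words[of p as] ww_words[of p bs] l by (intro realized_single on_unitw) auto
  show "(\<Sum>tz \<in> {tz. tz permutes {1..k}}. act tz (unitw (ww p as)) (ww p bs)) = (1::'k)"
  using n by (simp only: norm_upto_def sum_fun_apply)
 qed
 from k show ?thesis
 proof
  assume "k = 3"
  thus ?thesis using ex[OF _ _ norm_block(1)[of p, folded \<open>k = 3\<close>]] that by auto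
 next
  assume "k = 4"
  thus ?thesis using ex[OF _ _ norm_block(2)[of p, folded \<open>k = 4\<close>]] that by auto
 qed
qed

text \<open>Add to c the functions \<open>pt id + pt g\<close> with coefficients c(g). The terms
  \<open>pt g\<close> add up to c and cancel it, and the terms \<open>pt id\<close> add up to
  \<open>pt id\<close> since the values of c have sum 1.\<close>

lemma realized_average:
 fixes c :: "(nat => nat) => 'k"
 assumes pair: "!!g. g permutes {1..d} ==> realized d L (%tz. pt id tz + pt g tz)"
  and c: "realized d L c" and sum: "(\<Sum>tz \<in> {tz. tz permutes {1..d}}. c tz) = 1"
 shows "realized d L (pt id)"
proof -
 let ?G = "{tz. tz permutes {1..d}}"
 have fin: "finite ?G" by (simp add: finite_permutations)
 have "realized d L (%tz. (\<Sum>g \<in> ?G. c g * (pt id tz + pt g tz)) + c tz)"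
  by (rule realized_add[OF realized_sum[OF fin] c], rule realized_scale, rule pair) simp
 thus ?thesis
 proof (rule realized_cong)
  fix tz :: "nat => nat" assume t: "tz permutes {1..d}"
  have "(\<Sum>g \<in> ?G. c g * (pt id tz + pt g tz)) = (\<Sum>g \<in> ?G. c g) * pt id tz + (\<Sum>g \<in> ?G. if g = tz then c tz else 0)"
  unfolding sum_distrib_right sum.distrib[symmetric]
  by (rule sum.cong[OF refl]) (auto simp: pt_def distrib_left)
  also have "... = pt id tz + c tz" using t by (simp only: sum mult_1 sum.delta[OF fin] mem_Collect_eq if_True)
  finally show "pt id tz = (\<Sum>g \<in> ?G. c g * (pt id tz + pt g tz)) + c tz" by (simp add: add.assoc)
 qed
qed

text \<open>Put the letter \<open>One e\<close> into the last two positions and use the delta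
  function on the first t - 2. This realizes \<open>pt id + pt s\<close> for the transposition s of
  the last two positions. Conjugation gives every adjacent transposition. For a product,
  \<open>pt id + pt (s' o g)\<close> is the sum of \<open>pt id + pt s'\<close> and the translate of
  \<open>pt id + pt g\<close> by s', because \<open>pt s'\<close> occurs twice.\<close>

lemma realized_pairs:
 assumes fin: "finite O1" "finite P1" and e: "e \<in> O1" and t: "2 \<le> t"
  and good: "realized (t - 2) (letters (O1 - {e}) P1) (pt id)" and g: "g permutes {1..t}"
 shows "realized t (letters O1 P1) (%tz. pt id tz + pt g tz)"
proof -
 let ?L = "letters O1 P1"
 define a where "a = t - 2"
 have ta: "t = Suc (Suc a)" using t by (simp add: a_def)
 define s where "s = transpose (Suc a) t"
 define z where "z = (%i. if i \<in> {Suc a..t} then One e else One 0)"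
 have s: "s permutes {1..t}" unfolding s_def ta by (rule permutes_swap_id) auto
 have z1: "z i \<in> letters {e} {}" if "i \<in> {Suc a..t}" for i using that by (simp only: z_def if_True letters_def) blast
 have z2: "z i = One 0" if "i ~: {Suc a..t}" for i using that by (simp only: z_def if_False)
 have disj: "letters (O1 - {e}) P1 \<inter> letters {e} {} = {}" by (auto simp: letters_def)
 have sub: "letters (O1 - {e}) P1 \<union> letters {e} {} \<subseteq> ?L" using e by (auto simp: letters_def)
 have "realized t ?L (%tz. if (\<forall>i \<in> {1..a}. tz i \<in> {1..a}) & (\<forall>i \<in> {Suc a..t}. z (tz i) = z i)
  then pt id (%i. if i \<in> {1..a} then tz i else i) else (0::'k))"
  by (rule realized_prod[OF good[folded a_def] _ z1 z2 disj sub]) (simp_all add: ta)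
 hence base: "realized t ?L (%tz. pt id tz + pt s tz)"
 proof (rule realized_cong)
  fix tz :: "nat => nat" assume p: "tz permutes {1..t}"
  have ne: "id ~= s"
  proof
  assume "id = s"
  hence "s t = t" by (metis id_apply)
  thus False by (simp add: s_def ta transpose_def)
  qed
  show "pt id tz + pt s tz = (if (\<forall>i \<in> {1..a}. tz i \<in> {1..a}) & (\<forall>i \<in> {Suc a..t}. z (tz i) = z i)
  then pt id (%i. if i \<in> {1..a} then tz i else i) else (0::'k))" (is "_ = ?r")
  proof (cases "\<forall>i \<in> {1..a}. tz i = i")
  case True
  have out: "tz i \<in> {Suc a..t}" if "i \<in> {Suc a..t}" for i
  proof (rule ccontr)
   assume h: "tz i ~: {Suc a..t}"
   have "i \<in> {1..t}" using that by auto
   hence "tz i \<in> {1..t}" using permutes_in_image[OF p] by blast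
   hence "tz i \<in> {1..a}" using h by auto
   hence "tz (tz i) = tz i" using True by blast
   hence "tz i = i" by (rule injD[OF permutes_inj[OF p]])
   thus False using that h by simp
  qed
  have v: "tz (Suc a) \<in> {Suc a, t}" "tz t \<in> {Suc a, t}" using out[of "Suc a"] out[of t] by (auto simp: ta)
  have "tz = id \<or> tz = s"
  proof (cases "tz t = t")
   case tt: True
   have "tz (Suc a) ~= t"
   proof
    assume "tz (Suc a) = t"
    hence "tz (Suc a) = tz t" using tt by simp
    hence "Suc a = t" by (rule injD[OF permutes_inj[OF p]])
    thus False by (simp add: ta)
   qed
   hence "tz (Suc a) = Suc a" using v(1) by simp
   hence "tz i = i" for i
   proof -
    consider "i \<in> {1..a}" | "i = Suc a" | "i = t" | "i ~: {1..t}" unfolding ta by force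
    thus ?thesis using True tt \<open>tz (Suc a) = Suc a\<close> permutes_not_in[OF p] by cases auto
   qed
   thus ?thesis by (auto simp: fun_eq_iff)
  next
   case tt: False
   hence t1: "tz t = Suc a" using v(2) by simp
   have "tz (Suc a) ~= Suc a"
   proof
    assume "tz (Suc a) = Suc a"
    hence "tz (Suc a) = tz t" using t1 by simp
    hence "Suc a = t" by (rule injD[OF permutes_inj[OF p]])
    thus False by (simp add: ta)
   qed
   hence t2: "tz (Suc a) = t" using v(1) by simp
   have "tz i = s i" for i
   proof -
    consider "i \<in> {1..a}" | "i = Suc a" | "i = t" | "i ~: {1..t}" unfolding ta by force
    thus ?thesis
    proof cases
    case 1 thus ?thesis using True by (simp add: s_def ta transpose_def)
    next
    case 2 thus ?thesis using t2 by (simp add: s_def)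
    next
    case 3 thus ?thesis using t1 by (simp add: s_def)
    next
    case 4 thus ?thesis using permutes_not_in[OF p 4] permutes_not_in[OF s 4] by simp
    qed
   qed
   thus ?thesis by (auto simp: fun_eq_iff)
  qed
  hence l: "pt id tz + pt s tz = (1::'k)" using ne by (auto simp: pt_def)
  have "z (tz i) = z i" if "i \<in> {Suc a..t}" for i using out[OF that] that by (simp only: z_def if_True)
  moreover have "(%i. if i \<in> {1..a} then tz i else i) = id" using True by (auto simp: fun_eq_iff)
  ultimately have "?r = 1" using True by (simp add: pt_def)
  thus ?thesis using l by simp
  next
  case False
  have "tz ~= id" using False by auto
  moreover have "tz ~= s" using False by (auto simp: s_def ta transpose_def)
  moreover have "(%i. if i \<in> {1..a} then tz i else i) ~= id"
  proof
   assume h: "(%i. if i \<in> {1..a} then tz i else i) = id"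
   have "tz i = i" if "i \<in> {1..a}" for i using fun_cong[OF h, of i] that by simp
   thus False using False by blast
  qed
  ultimately show ?thesis by (simp add: pt_def)
  qed
 qed
 have conj: "realized t ?L (%tz. pt id tz + pt (h o s o inv' h) tz)" if h: "h permutes {1..t}" for h
 proof -
  have "realized t ?L (%tz. pt id (inv' h o (tz o h)) + pt s (inv' h o (tz o h)))"
  by (rule realized_right[OF realized_left[OF base fin permutes_inv[OF h]] fin h])
  thus ?thesis
  proof (rule realized_cong)
  fix tz
  have "inv' h o (tz o h) = q \<longleftrightarrow> tz = h o q o inv' h" for q
  proof
   assume e: "inv' h o (tz o h) = q"
   have "h o q o inv' h = (h o inv' h) o tz o (h o inv' h)" unfolding e[symmetric] by (simp only: comp_assoc)
   thus "tz = h o q o inv' h" by (simp only: permutes_inv_o[OF h] id_comp comp_id)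
  next
   assume e: "tz = h o q o inv' h"
   have "inv' h o (tz o h) = (inv' h o h) o q o (inv' h o h)" unfolding e by (simp only: comp_assoc)
   thus "inv' h o (tz o h) = q" by (simp only: permutes_inv_o[OF h] id_comp comp_id)
  qed
  thus "pt id tz + pt (h o s o inv' h) tz = pt id (inv' h o (tz o h)) + (pt s (inv' h o (tz o h)) :: 'k)"
   unfolding pt_def by (simp only: comp_id permutes_inv_o[OF h])
  qed
 qed
 have tr: "realized t ?L (%tz. pt id tz + pt (transpose i (Suc i)) tz)" if i: "1 \<le> i" "i < t" for i
 proof -
  have hp: "EX h. h permutes {1..t} & h (Suc a) = i & h t = Suc i"
  proof -
  define h1 where "h1 = transpose (Suc a) i"
  define h2 where "h2 = transpose (h1 t) (Suc i)"
  have r: "Suc a \<in> {1..t}" "t \<in> {1..t}" "i \<in> {1..t}" "Suc i \<in> {1..t}" using i by (auto simp: ta)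
  have p1: "h1 permutes {1..t}" unfolding h1_def by (rule permutes_swap_id[OF r(1,3)])
  hence "h1 t \<in> {1..t}" using permutes_in_image[OF p1] r(2) by blast
  hence p2: "h2 permutes {1..t}" unfolding h2_def by (rule permutes_swap_id[OF _ r(4)])
  have "h1 t ~= i"
  proof
   assume "h1 t = i"
   hence "h1 t = h1 (Suc a)" by (simp add: h1_def)
   hence "t = Suc a" by (rule injD[OF permutes_inj[OF p1]])
   thus False by (simp add: ta)
  qed
  hence h2i: "h2 i = i" unfolding h2_def by (intro transpose_apply_other) auto
  show ?thesis
  proof (intro exI conjI)
   show "h2 o h1 permutes {1..t}" by (rule permutes_compose[OF p1 p2])
   have "h1 (Suc a) = i" by (simp add: h1_def)
   thus "(h2 o h1) (Suc a) = i" using h2i by simp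
   show "(h2 o h1) t = Suc i" by (simp add: h2_def)
  qed
  qed
  then obtain h where h: "h permutes {1..t}" "h (Suc a) = i" "h t = Suc i" by blast
  have "h o s o inv' h = transpose i (Suc i)"
  proof
  fix q
  have e: "inv' h q = x \<longleftrightarrow> q = h x" for x using permutes_inverses[OF h(1)] by metis
  consider "q = i" | "q = Suc i" | "q ~= i" "q ~= Suc i" by blast
  thus "(h o s o inv' h) q = transpose i (Suc i) q"
  proof cases
   case 1
   hence "inv' h q = Suc a" using e h(2) by simp
   thus ?thesis using 1 h(3) by (simp add: s_def)
  next
   case 2
   hence "inv' h q = t" using e h(3) by simp
   thus ?thesis using 2 h(2) by (simp add: s_def)
  next
   case 3
   hence "inv' h q ~= Suc a" "inv' h q ~= t" using e h(2,3) by auto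
   thus ?thesis using 3 by (simp add: s_def transpose_def permutes_inverses(1)[OF h(1)])
  qed
  qed
  thus ?thesis using conj[OF h(1)] by simp
 qed
 show ?thesis using g
 proof (induction rule: adjacent_transpositions_induct)
  case id
  show ?case by (simp add: realized_zero)
 next
  case (step i tz)
  let ?s = "transpose i (Suc i)"
  have s: "?s permutes {1..t}" using step(1,2) by (intro permutes_swap_id) auto
  have ss: "?s o ?s = id" by (rule transpose_comp_involutory)
  have "realized t ?L (%sz. (pt id sz + pt ?s sz) + (pt id (?s o sz) + pt tz (?s o sz)))"
  by (rule realized_add[OF tr[OF step(1,2)] realized_left[OF step(4) fin s]])
  thus ?case
  proof (rule realized_cong)
  fix sz :: "nat => nat"
  have "?s o sz = q \<longleftrightarrow> sz = ?s o q" for q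
   by (metis ss comp_assoc id_comp)
  hence "pt id (?s o sz) = (pt ?s sz :: 'k)" "pt tz (?s o sz) = (pt (?s o tz) sz :: 'k)"
   unfolding pt_def by (simp_all only: comp_id)
  thus "pt id sz + pt (?s o tz) sz = (pt id sz + pt ?s sz) + (pt id (?s o sz) + (pt tz (?s o sz) :: 'k))"
   by (simp add: add.assoc)
  qed
 qed
qed

text \<open>The copy p of P serves k positions, and the other t - k positions get distinct letters.
  The product coefficient is then supported on S_k, so its total sum is the entry of the norm of S_k
  computed before.\<close>

lemma realized_weight:
 assumes fin: "finite O1" "finite P1" and p: "p \<in> P1" and k: "k = 3 \<or> k = 4" and t: "t = card O1 + 2 * (card P1 - 1) + k"
 obtains c :: "(nat => nat) => 'k" where "realized t (letters O1 P1) c" "(\<Sum>tz \<in> {tz. tz permutes {1..t}}. c tz) = 1"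
proof -
 obtain x :: "(nat => nat) => 'k" where x: "realized k (letters {} {p}) x" "(\<Sum>tz \<in> {tz. tz permutes {1..k}}. x tz) = 1"
  using realized_weight_one[OF k] by blast
 have kt: "k \<le> t" using t by simp
 have "t - k \<le> card O1 + 2 * card (P1 - {p})" using t p fin by (simp add: card_Diff_singleton)
 then obtain z where z: "!!i. i \<in> {Suc k..t} ==> z i \<in> letters O1 (P1 - {p})" "!!i. i ~: {Suc k..t} ==> z i = One 0" "inj_on z {Suc k..t}"
  using distinct_word[of O1 "P1 - {p}" t k] fin by auto
 define c where "c tz = (if (\<forall>i \<in> {1..k}. tz i \<in> {1..k}) & (\<forall>i \<in> {Suc k..t}. z (tz i) = z i)
  then x (%i. if i \<in> {1..k} then tz i else i) else 0)" for tz
 have disj: "letters {} {p} \<inter> letters O1 (P1 - {p}) = {}" by (auto simp: letters_def)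
 have sub: "letters {} {p} \<union> letters O1 (P1 - {p}) \<subseteq> letters O1 P1" using p by (auto simp: letters_def)
 have 1: "realized t (letters O1 P1) c" unfolding c_def by (rule realized_prod[OF x(1) kt z(1,2) disj sub])
 have "(\<Sum>tz \<in> {tz. tz permutes {1..t}}. c tz) = (\<Sum>tz \<in> {tz. tz permutes {1..k}}. c tz)"
 proof (rule sum.mono_neutral_right)
  show "{tz. tz permutes {1..k}} \<subseteq> {tz. tz permutes {1..t}}" using kt by (auto intro: permutes_subset)
  show "\<forall>tz \<in> {tz. tz permutes {1..t}} - {tz. tz permutes {1..k}}. c tz = 0"
  proof
  fix tz assume t: "tz \<in> {tz. tz permutes {1..t}} - {tz. tz permutes {1..k}}"
  hence tp: "tz permutes {1..t}" and tk: "\<not> tz permutes {1..k}" by auto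
  show "c tz = 0"
  proof (rule ccontr)
   assume "c tz ~= 0"
   hence h: "\<forall>i \<in> {1..k}. tz i \<in> {1..k}" "\<forall>i \<in> {Suc k..t}. z (tz i) = z i" unfolding c_def by (metis (mono_tags, lifting))+
   have im: "tz ` {1..k} = {1..k}"
    by (rule card_subset_eq) (use h(1) in \<open>auto simp: card_image permutes_inj_on[OF tp]\<close>)
   have "tz i = i" if i: "i \<in> {Suc k..t}" for i
   proof -
    have "tz i ~: {1..k}"
    proof
    assume "tz i \<in> {1..k}"
    then obtain j where "j \<in> {1..k}" "tz j = tz i" using im by (metis imageE)
    hence "j = i" using injD[OF permutes_inj[OF tp]] by blast
    thus False using i \<open>j \<in> {1..k}\<close> by simp
    qed
    moreover have "i \<in> {1..t}" using i by auto
    hence "tz i \<in> {1..t}" using permutes_in_image[OF tp] by blast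
    ultimately have "tz i \<in> {Suc k..t}" by auto
    thus ?thesis using inj_onD[OF z(3) bspec[OF h(2) i]] i by blast
   qed
   hence "tz i = i" if "i ~: {1..k}" for i
    using that permutes_not_in[OF tp, of i] by (cases "i \<in> {Suc k..t}") auto
   hence "tz permutes {1..k}" by (intro permutes_superset[OF tp]) auto
   thus False using tk by blast
  qed
  qed
 qed (simp add: finite_permutations)
 also have "... = (\<Sum>tz \<in> {tz. tz permutes {1..k}}. x tz)"
 proof (rule sum.cong[OF refl])
  fix tz assume "tz \<in> {tz. tz permutes {1..k}}"
  hence tp: "tz permutes {1..k}" by simp
  have e: "(\<forall>i \<in> {1..k}. tz i \<in> {1..k}) & (\<forall>i \<in> {Suc k..t}. z (tz i) = z i)"
  proof (intro conjI ballI)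
  show "tz i \<in> {1..k}" if "i \<in> {1..k}" for i using that permutes_in_image[OF tp] by blast
  fix i assume "i \<in> {Suc k..t}"
  hence "i ~: {1..k}" by auto
  hence "tz i = i" by (rule permutes_not_in[OF tp])
  thus "z (tz i) = z i" by simp
  qed
  have l: "(%i. if i \<in> {1..k} then tz i else i) = tz"
  proof
  fix i show "(if i \<in> {1..k} then tz i else i) = tz i"
   using permutes_not_in[OF tp, of i] by (cases "i \<in> {1..k}") (simp_all only: if_True if_False simp_thms)
  qed
  show "c tz = x tz" unfolding c_def if_P[OF e] l ..
 qed
 finally show ?thesis using that 1 x(2) by simp
qed

text \<open>Let N be the number of letters. Up to N distinct letters suffice. For t = N + 1 and t =
  N + 2 there is a coefficient of total sum 1, by letting one copy of P serve 3 or 4 positions, and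
  \<open>realized_average\<close> asks for the delta function on t - 2 positions with one letter
  \<open>One\<close> removed. For t = N + 1 these are N - 1 positions for N - 1 letters. For t = N +
  2 they are N positions, one more than there are letters, so a second letter \<open>One\<close> is
  called for.\<close>

lemma realized_id:
 assumes fin: "finite O1" "finite P1"
  and t: "t \<le> card O1 + 2 * card P1 \<or> (1 \<le> card O1 & 1 \<le> card P1 & t = card O1 + 2 * card P1 + 1) \<or>
  (2 \<le> card O1 & 1 \<le> card P1 & t = card O1 + 2 * card P1 + 2)"
 shows "realized t (letters O1 P1) (pt id)"
proof -
 have step: "realized t (letters O1 P1) (pt id)"
  if fin: "finite O1" "finite P1" and c: "1 \<le> card O1" "1 \<le> card P1" and k: "k = 3 \<or> k = 4"
  and t: "t = card O1 + 2 * (card P1 - 1) + k"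
  and prev: "!!e. e \<in> O1 ==> realized (t - 2) (letters (O1 - {e}) P1) (pt id)" for O1 P1 k t
 proof -
  obtain e p where ep: "e \<in> O1" "p \<in> P1" using c by (metis card.empty ex_in_conv not_one_le_zero)
  have t2: "2 \<le> t" using t k by auto
  obtain cc :: "(nat => nat) => 'k" where cc: "realized t (letters O1 P1) cc" "(\<Sum>tz \<in> {tz. tz permutes {1..t}}. cc tz) = 1"
  using realized_weight[OF fin ep(2) k t] by blast
  show ?thesis by (rule realized_average[OF realized_pairs[OF fin ep(1) t2 prev[OF ep(1)]] cc])
 qed
 have G1: "realized t (letters O1 P1) (pt id)"
  if fin: "finite O1" "finite P1" and c: "1 \<le> card O1" "1 \<le> card P1" and t: "t = card O1 + 2 * card P1 + 1" for O1 P1 t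
 proof (rule step[OF fin c disjI1[OF refl]])
  show "t = card O1 + 2 * (card P1 - 1) + 3" using t c by simp
  fix e assume e: "e \<in> O1"
  show "realized (t - 2) (letters (O1 - {e}) P1) (pt id)"
  by (rule realized_few) (use fin e t c in \<open>auto simp: card_Diff_singleton\<close>)
 qed
 from t show ?thesis
 proof (elim disjE conjE)
  assume "t \<le> card O1 + 2 * card P1"
  thus ?thesis by (rule realized_few[OF fin])
 next
  assume "1 \<le> card O1" "1 \<le> card P1" "t = card O1 + 2 * card P1 + 1"
  thus ?thesis by (rule G1[OF fin])
 next
  assume c: "2 \<le> card O1" "1 \<le> card P1" and t: "t = card O1 + 2 * card P1 + 2"
  show ?thesis
  proof (rule step[OF fin _ c(2) disjI2[OF refl]])
  show "1 \<le> card O1" "t = card O1 + 2 * (card P1 - 1) + 4" using t c by simp_all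
  fix e assume e: "e \<in> O1"
  show "realized (t - 2) (letters (O1 - {e}) P1) (pt id)"
   by (rule G1) (use fin e t c in \<open>auto simp: card_Diff_singleton\<close>)
  qed
 qed
qed

end

section \<open>Sufficiency: reduction of the multiplicities of the colours\<close>

definition cnt :: "nat => word => letter => nat" where
 "cnt d u c = card {i \<in> {1..d}. colour (u i) = c}"

definition cls :: "nat => (letter => nat) => word set" where
 "cls d ka = {u. (ALL i. i ~: {1..d} --> u i = One 0) & cnt d u = ka}"

lemma cnt_colour: "colour o u = colour o v ==> cnt d u = cnt d v"
 unfolding cnt_def fun_eq_iff by (simp add: comp_def)

lemma cnt_comp:
 assumes s: "sz permutes {1..d}"
 shows "cnt d (u o sz) = cnt d u"
proof
 fix c
 have "sz ` {i \<in> {1..d}. colour ((u o sz) i) = c} = {i \<in> {1..d}. colour (u i) = c}" (is "sz ` ?A = ?B")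
 proof
  show "sz ` ?A \<subseteq> ?B" using permutes_in_image[OF s] by auto
  show "?B \<subseteq> sz ` ?A"
  proof
  fix i assume i: "i \<in> ?B"
  hence "inv' sz i \<in> {1..d}" using permutes_in_image[OF permutes_inv[OF s], of i] by simp
  hence "inv' sz i \<in> ?A" using i by (simp add: permutes_inverses(1)[OF s])
  thus "i \<in> sz ` ?A" by (rule rev_image_eqI) (simp add: permutes_inverses(1)[OF s])
  qed
 qed
 thus "cnt d (u o sz) c = cnt d u c" unfolding cnt_def using card_image[OF permutes_inj_on[OF s], of ?A] by simp
qed

lemma stable_cls: "stable d (cls d ka)"
 unfolding stable_def
proof (intro conjI allI impI)
 fix u v assume u: "u \<in> cls d ka" and c: "colour o u = colour o v"
 have "v i = One 0" if i: "i ~: {1..d}" for i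
 proof -
  have "u i = One 0" using u i unfolding cls_def by blast
  hence "colour (v i) = One 0" using colour_comp[OF c, of i] by simp
  thus ?thesis by (simp only: colour_eq_One)
 qed
 thus "v \<in> cls d ka" using u cnt_colour[OF c, of d] unfolding cls_def by auto
next
 fix sz u assume s: "sz permutes {1..d}" and u: "u \<in> cls d ka"
 have "(u o sz) i = One 0" if i: "i ~: {1..d}" for i
  using u i permutes_not_in[OF s i] unfolding cls_def by auto
 thus "u o sz \<in> cls d ka" using u cnt_comp[OF s, of u] unfolding cls_def by auto
qed

lemma cnt_upd:
 assumes "i \<in> {1..d}" "colour (u i) = c0" "colour x = c1" "c0 ~= c1"
 shows "cnt d (u(i := x)) = (cnt d u)(c0 := cnt d u c0 - 1, c1 := Suc (cnt d u c1))"
proof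
 fix c
 have fin: "finite {q \<in> {1..d}. colour (u q) = c}" for c by simp
 consider "c = c0" | "c = c1" | "c ~= c0" "c ~= c1" by blast
 thus "cnt d (u(i := x)) c = ((cnt d u)(c0 := cnt d u c0 - 1, c1 := Suc (cnt d u c1))) c"
 proof cases
  case 1
  have "{q \<in> {1..d}. colour ((u(i := x)) q) = c} = {q \<in> {1..d}. colour (u q) = c} - {i}"
  using assms 1 by auto
  thus ?thesis using assms 1 by (simp add: cnt_def card_Diff_singleton)
 next
  case 2
  have "{q \<in> {1..d}. colour ((u(i := x)) q) = c} = insert i {q \<in> {1..d}. colour (u q) = c}"
  using assms 2 by auto
  moreover have "i ~: {q \<in> {1..d}. colour (u q) = c}" using assms 2 by auto
  ultimately show ?thesis using 2 by (simp add: cnt_def)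
 next
  case 3
  have "{q \<in> {1..d}. colour ((u(i := x)) q) = c} = {q \<in> {1..d}. colour (u q) = c}" using assms 3 by auto
  thus ?thesis using 3 by (simp add: cnt_def)
 qed
qed

lemma cnt_le: "cnt d u c \<le> d"
proof -
 have "cnt d u c \<le> card {1..d}" unfolding cnt_def by (rule card_mono) auto
 thus ?thesis by simp
qed

lemma cnt_pos: "i \<in> {1..d} ==> cnt d u (colour (u i)) > 0"
 unfolding cnt_def by (subst card_gt_0_iff) auto

lemma cnt_sum:
 assumes "finite C" "!!i. i \<in> {1..d} ==> colour (u i) \<in> C"
 shows "(\<Sum>c \<in> C. cnt d u c) = d"
proof -
 have "(\<Sum>c \<in> C. cnt d u c) = card (\<Union>c \<in> C. {i \<in> {1..d}. colour (u i) = c})"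
  unfolding cnt_def by (rule card_UN_disjoint[symmetric]) (use assms in auto)
 also have "(\<Union>c \<in> C. {i \<in> {1..d}. colour (u i) = c}) = {1..d}" using assms(2) by auto
 finally show ?thesis by simp
qed

context char2
begin

lemma dominated_fresh_cls:
 fixes E :: "(word => 'k) => word => 'k" and w :: word
 assumes w: "w \<in> cls d ka" and t: "t = 1 \<or> t = 2" "t \<le> cnt d w (V j)"
  and R: "finite R" "!!r. r \<in> R ==> r permutes {1..d}"
  "!!g. g permutes {1..d} ==> \<exists>!r. r \<in> R & (\<forall>i \<in> {1..t}. r i = g i)"
  and E: "lin E" "!!f. on (cls d ka) f ==> on (cls d ka) (E f)"
  "!!i f. i > t ==> E (der i f) = der i (E f)"
  "!!k f. k permutes {1..d} ==> (\<forall>i \<in> {1..t}. k i = i) ==> E (pm k f) = pm k (E f)"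
  "!!f u. E f u ~= 0 ==> \<forall>i \<in> {1..t}. colour (u i) = V j"
  "!!f. on (cls d ka) f ==> (\<Sum>r \<in> R. act r (E (act (inv' r) f))) = f"
 obtains ka' where "dominated TYPE('k) d (cls d ka) (cls d ka')" "ka' (V j) = ka (V j) - t" "!!i. i ~= j ==> ka' (V i) = ka (V i)"
proof -
 have fin: "finite {a. \<exists>i \<in> {1..d}. w i = One a}"
  by (rule finite_subset[of _ "(%i. case w i of One a => a | _ => 0) ` {1..d}"]) (force intro: rev_image_eqI)+
 obtain a where a: "!!i. i \<in> {1..d} ==> w i ~= One a" using ex_new_if_finite[OF infinite_UNIV_nat fin] by blast
 obtain b where b: "b ~= a" "!!i. i \<in> {1..d} ==> w i ~= One b"
  using ex_new_if_finite[OF infinite_UNIV_nat finite.insertI[OF fin, of a]] by blast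
 define e where "e i = (if i = 1 then a else b)" for i :: nat
 have ka: "ka = cnt d w" using w by (simp add: cls_def)
 have z: "ka (One a) = 0" "ka (One b) = 0" using a b(2) colour_eq_One unfolding ka cnt_def by auto
 define ka1 where "ka1 = ka(V j := ka (V j) - 1, One a := Suc 0)"
 define ka' where "ka' = (if t = 1 then ka1 else ka1(V j := ka (V j) - 2, One b := Suc 0))"
 have td: "t \<le> d" using t(2) cnt_le[of d w "V j"] by simp
 have cu: "cnt d (rp t u (One o e)) = (if t = 1 then (cnt d u)(V j := cnt d u (V j) - 1, One a := Suc (cnt d u (One a)))
  else (cnt d u)(V j := cnt d u (V j) - 2, One a := Suc (cnt d u (One a)), One b := Suc (cnt d u (One b))))"
  if u: "\<forall>i \<in> {1..t}. colour (u i) = V j" for u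
 proof -
  have c1: "cnt d (u(1 := One a)) = (cnt d u)(V j := cnt d u (V j) - 1, One a := Suc (cnt d u (One a)))"
  by (rule cnt_upd) (use u t td in auto)
  show ?thesis using t(1)
  proof
  assume t: "t = 1"
  have "rp t u (One o e) = u(1 := One a)" by (auto simp: t rp_def e_def)
  thus ?thesis using c1 t by simp
  next
  assume t: "t = 2"
  have r: "rp t u (One o e) = (u(1 := One a))(2 := One b)" by (auto simp: t rp_def e_def fun_eq_iff)
  have "cnt d ((u(1 := One a))(2 := One b)) = (cnt d (u(1 := One a)))(V j := cnt d (u(1 := One a)) (V j) - 1, One b := Suc (cnt d (u(1 := One a)) (One b)))"
   by (rule cnt_upd) (use u t td in auto)
  thus ?thesis unfolding r c1 using t b(1) by (auto simp: fun_eq_iff)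
  qed
 qed
 have AB: "u \<in> cls d ka \<longleftrightarrow> rp t u (One o e) \<in> cls d ka'" if u: "\<forall>i \<in> {1..t}. colour (u i) = V j" for u
 proof -
  have "card {1..t} \<le> card {i \<in> {1..d}. colour (u i) = V j}"
  by (rule card_mono) (use u td in auto)
  hence tu: "t \<le> cnt d u (V j)" by (simp add: cnt_def)
  have tk: "t \<le> ka (V j)" using t(2) ka by simp
  have off: "(ALL i. i ~: {1..d} --> rp t u (One o e) i = One 0) \<longleftrightarrow> (ALL i. i ~: {1..d} --> u i = One 0)"
  proof -
  have "rp t u (One o e) i = u i" if "i ~: {1..d}" for i using that td by (auto simp: rp_def)
  thus ?thesis by simp
  qed
  have "cnt d u = ka \<longleftrightarrow> cnt d (rp t u (One o e)) = ka'"
  proof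
  assume "cnt d u = ka"
  thus "cnt d (rp t u (One o e)) = ka'" unfolding cu[OF u] using t(1) z b(1) by (auto simp: ka'_def ka1_def fun_eq_iff)
  next
  assume h: "cnt d (rp t u (One o e)) = ka'"
  show "cnt d u = ka"
  proof
   fix c
   have hc: "cnt d (rp t u (One o e)) x = ka' x" for x using h by simp
   show "cnt d u c = ka c"
    using t(1) hc[of c] hc[of "V j"] hc[of "One a"] hc[of "One b"] z b(1) tu tk unfolding cu[OF u]
    by (auto simp: ka'_def ka1_def split: if_splits)
  qed
  qed
  thus ?thesis using off unfolding cls_def by blast
 qed
 have uniq: "p = q" if "u \<in> cls d ka'" "i \<in> {1..t}" "p \<in> {1..d}" "q \<in> {1..d}" "u p = One (e i)" "u q = One (e i)" for u p q i
 proof -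
  have "ka' (One (e i)) = 1" using that(2) t(1) b(1) by (auto simp: ka'_def ka1_def e_def)
  hence "card {p \<in> {1..d}. colour (u p) = One (e i)} = 1" using that(1) unfolding cls_def cnt_def by auto
  then obtain x where x: "{p \<in> {1..d}. colour (u p) = One (e i)} = {x}" by (rule card_1_singletonE)
  have "p \<in> {p \<in> {1..d}. colour (u p) = One (e i)}" "q \<in> {p \<in> {1..d}. colour (u p) = One (e i)}" using that by auto
  thus ?thesis unfolding x by simp
 qed
 have "dominated TYPE('k) d (cls d ka) (cls d ka')"
  by (rule dominated_fresh[OF stable_cls stable_cls td R E(1-5) AB uniq E(6)])
 moreover have "ka' (V j) = ka (V j) - t" "ka' (V i) = ka (V i)" if "i ~= j" for i
  using t(1) that by (auto simp: ka'_def ka1_def)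
 moreover have "ka' (V j) = ka (V j) - t" using t(1) by (auto simp: ka'_def ka1_def)
 ultimately show ?thesis using that by blast
qed

text \<open>E cuts out the words whose first position has colour \<open>V j\<close>. Its relative
  trace counts the positions of that colour, so it multiplies by an odd number, which is 1 in the
  field.\<close>

lemma reduce_odd:
 assumes w: "w \<in> cls d ka" and odd: "odd (ka (V j))"
 obtains ka' where "dominated TYPE('k) d (cls d ka) (cls d ka')" "ka' (V j) = ka (V j) - 1" "!!i. i ~= j ==> ka' (V i) = ka (V i)"
proof -
 obtain R where R: "finite R" "!!r. r \<in> R ==> r permutes {1..d}"
  "!!g. g permutes {1..d} ==> \<exists>!r. r \<in> R & (\<forall>i \<in> {1..1}. r i = g i)" using transversal_exists[where d = d and t = 1] by blast
 define ch where "ch u = (if colour (u 1) = V j then 1 else 0 :: 'k)" for u :: word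
 define E where "E f = ch * f" for f
 have c: "colour_dep ch" unfolding colour_dep_def ch_def by (metis colour_comp)
 have ka: "ka = cnt d w" using w by (simp add: cls_def)
 have kpos: "1 \<le> cnt d w (V j)" using odd ka by (metis One_nat_def Suc_leI odd_pos)
 have d1: "1 \<in> {1..d}" 
 proof -
  have "cnt d w (V j) \<le> d" by (rule cnt_le)
  thus ?thesis using kpos by simp
 qed
 \<comment> \<open>A coset of the stabilizer of 1 is given by the image of 1, so the trace turns
   into a sum over positions.\<close>
 have bij: "bij_betw (%r. r 1) R {1..d}"
 proof (rule bij_betwI')
  show "r 1 = r' 1 \<longleftrightarrow> r = r'" if "r \<in> R" "r' \<in> R" for r r'
  using R(3)[OF R(2)[OF that(1)]] that by auto
  show "r 1 \<in> {1..d}" if "r \<in> R" for r using permutes_in_image[OF R(2)[OF that], of 1] d1 by simp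
  fix q assume q: "q \<in> {1..d}"
  have "transpose 1 q permutes {1..d}" by (rule permutes_swap_id[OF d1 q])
  from R(3)[OF this] show "\<exists>r \<in> R. q = r 1" by auto
 qed
 show ?thesis
 proof (rule dominated_fresh_cls[OF w disjI1[OF refl] kpos R, where E = E])
  show "lin E" unfolding E_def[abs_def] by (rule lin_mult)
  show "on (cls d ka) (E f)" if "on (cls d ka) f" for f using that by (simp add: E_def on_def)
  show "E (der i f) = der i (E f)" if "1 < i" for i f
  unfolding E_def by (rule der_mult[symmetric]) (use that in \<open>auto simp: ch_def\<close>)
  show "E (pm k f) = pm k (E f)" if "k permutes {1..d}" "\<forall>i \<in> {1..1}. k i = i" for k f
  using that(2) by (auto simp: E_def pm_def ch_def fun_eq_iff)
  show "\<forall>i \<in> {1..1}. colour (u i) = V j" if "E f u ~= 0" for f u using that by (auto simp: E_def ch_def split: if_splits)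
  fix f :: "word => 'k" assume f: "on (cls d ka) f"
  show "(\<Sum>r \<in> R. act r (E (act (inv' r) f))) = f"
  proof
  fix u
  have "(\<Sum>r \<in> R. act r (E (act (inv' r) f))) u = (\<Sum>r \<in> R. (if colour (u (r 1)) = V j then 1 else 0) * f u)"
   unfolding sum_fun_apply[where A = R]
  proof (rule sum.cong[OF refl])
   fix r assume r: "r \<in> R"
   show "act r (E (act (inv' r) f)) u = (if colour (u (r 1)) = V j then 1 else 0) * f u"
    unfolding E_def act_mult_colour[OF R(2)[OF r] c] act_inv(1)[OF R(2)[OF r]] by (simp add: ch_def)
  qed
  also have "... = (\<Sum>q \<in> {1..d}. (if colour (u q) = V j then 1 else 0) * f u)"
   by (rule sum.reindex_bij_betw[OF bij])
  also have "... = of_nat (cnt d u (V j)) * f u"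
   unfolding sum_distrib_right[symmetric] cnt_def by (simp add: sum.If_cases Int_def)
  also have "... = f u"
  proof (cases "u \<in> cls d ka")
   case True
   hence "odd (cnt d u (V j))" using odd by (simp add: cls_def)
   then obtain q where "cnt d u (V j) = 2 * q + 1" by (rule oddE)
   thus ?thesis by simp
  next
   case False
   thus ?thesis using f by (simp add: on_def)
  qed
  finally show "(\<Sum>r \<in> R. act r (E (act (inv' r) f))) u = f u" .
  qed
 qed (assumption | rule that)+
qed

text \<open>On the tensor square of P the braiding s fixes WW, exchanges VW and WV, and takes VV to
  VV + WW, which is a free module over S_2. The operator T defined here takes VV and WW to VV, fixes
  VW and kills WV; it satisfies T + s T s = 1.\<close>

definition pairop :: "nat => (word => 'k) => word => 'k" where
 "pairop j f u = (if u 1 = V j then (if u 2 = W j then f u else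
  if u 2 = V j then f u + f (u(1 := W j, 2 := W j)) else 0) else 0)"

lemma pairop_sum:
 "pairop j f + act (transpose 1 2) (pairop j (act (transpose 1 2) f)) = (%u. if colour (u 1) = V j & colour (u 2) = V j then 1 else 0) * f"
proof
 fix u :: word
 have a: "act (transpose 1 2) g v = g (v o transpose 1 2) + der 1 (der 2 g) (v o transpose 1 2)" for g :: "word => 'k" and v
  using act_adjacent[of 1 g] by (simp add: pm_def numeral_eq_Suc)
 have tt: "transpose 1 2 1 = (2::nat)" "transpose 1 2 2 = (1::nat)" by (simp_all add: transpose_def)
 have up: "(v o transpose 1 2)(1 := x, 2 := y) = v(1 := x, 2 := y)" "(v o transpose 1 2)(2 := y, 1 := x) = v(1 := x, 2 := y)"
  "(v(1 := x, 2 := y)) o transpose 1 2 = v(1 := y, 2 := x)"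
  "(v o transpose 1 2) o transpose 1 2 = v" for v :: word and x y
  by (auto simp: fun_eq_iff transpose_def)
 have sw: "v 1 = v 2 ==> v o transpose 1 2 = v" for v :: word by (auto simp: fun_eq_iff transpose_def)
 show "(pairop j f + act (transpose 1 2) (pairop j (act (transpose 1 2) f))) u =
  ((%u. if colour (u 1) = V j & colour (u 2) = V j then 1 else 0) * f) u"
  by (cases "u 1"; cases "u 2")
  (auto simp: pairop_def a der_def tt up sw fun_upd_twist fun_upd_idem simp del: One_nat_def split: letter.split)
qed

end

lemma extend_permutation:
 fixes h :: "nat => nat"
 assumes "inj_on h {1..t}" "h ` {1..t} \<subseteq> {1..d}" "t \<le> d"
 shows "EX g. g permutes {1..d} & (\<forall>i \<in> {1..t}. g i = h i)"
 using assms
proof (induction t)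
 case 0
 show ?case
 proof (intro exI conjI)
  show "id permutes {1..d}" by (rule permutes_id)
 qed simp
next
 case (Suc t)
 have "inj_on h {1..t}" by (rule inj_on_subset[OF Suc(2)]) auto
 moreover have "h ` {1..t} \<subseteq> {1..d}" using Suc(3) by auto
 ultimately obtain g where g: "g permutes {1..d}" "!!i. i \<in> {1..t} ==> g i = h i" using Suc(1,4) by auto
 define g' where "g' = transpose (g (Suc t)) (h (Suc t)) o g"
 have S: "Suc t \<in> {1..Suc t}" "Suc t \<in> {1..d}" using Suc(4) by auto
 have "g (Suc t) \<in> {1..d}" using permutes_in_image[OF g(1)] S(2) by blast
 moreover have "h (Suc t) \<in> {1..d}" using Suc(3) S(1) by blast
 ultimately have "g' permutes {1..d}" unfolding g'_def by (intro permutes_compose[OF g(1)] permutes_swap_id)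
 moreover have "g' i = h i" if i: "i \<in> {1..Suc t}" for i
 proof (cases "i = Suc t")
  case True
  thus ?thesis by (simp add: g'_def)
 next
  case False
  hence it: "i \<in> {1..t}" using i by auto
  have "g i ~= g (Suc t)" using False injD[OF permutes_inj[OF g(1)]] by blast
  moreover have "h i ~= h (Suc t)" using inj_onD[OF Suc(2) _ i S(1)] False by blast
  ultimately show ?thesis using g(2)[OF it] by (simp add: g'_def transpose_def)
 qed
 ultimately show ?case by blast
qed

lemma finite_superset:
 fixes A :: "nat set"
 assumes "finite A" "card A \<le> m"
 obtains B where "A \<subseteq> B" "finite B" "card B = m"
proof -
 have "infinite (UNIV - A)" using assms(1) by simp
 then obtain C where C: "finite C" "card C = m - card A" "C \<subseteq> UNIV - A" using infinite_arbitrarily_large by blast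
 have "card (A \<union> C) = m" using C assms by (subst card_Un_disjoint) auto
 thus ?thesis using that[of "A \<union> C"] C(1) assms(1) by blast
qed

text \<open>Here t letters occur once, r letters \<open>One\<close> more often, and s copies of P at
  least four times. The latter two kinds keep letters of their own, and what is left of the alphabet
  must satisfy the hypothesis of \<open>realized_id\<close> for t. The bounds on m and n allow this
  in every residue of d modulo 4.\<close>

lemma size_bounds:
 fixes d m n r s t :: nat
 assumes "d > 0" "t + 2 * r + 4 * s \<le> d"
  "d = 1 --> m >= 1 \<or> n >= 1" "d = 2 --> m + n >= 2 & m >= 1" "d = 3 --> m >= 3 \<or> (n >= 1 & m >= 1)"
  "d >= 4 --> m >= d div 2 & n >= d div 4"
 shows "r \<le> m & s \<le> n & (t \<le> (m - r) + 2 * (n - s) \<or> (1 \<le> m - r & 1 \<le> n - s & t = (m - r) + 2 * (n - s) + 1) \<or>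
  (2 \<le> m - r & 1 \<le> n - s & t = (m - r) + 2 * (n - s) + 2))"
proof -
 consider "d = 1" | "d = 2" | "d = 3" | "d >= 4" using assms(1) by linarith
 thus ?thesis
 proof cases
  case 4
  \<comment> \<open>With d = 4 p + c and c fixed, the divisions disappear and the claim is
    linear.\<close>
  define p where "p = d div 4"
  define c where "c = d mod 4"
  have d: "d = 4 * p + c" "c < 4" by (simp_all add: p_def c_def)
  have n: "p \<le> n" using 4 assms(6) by (simp add: p_def)
  have m2: "d div 2 \<le> m" using 4 assms(6) by simp
  have p1: "1 \<le> p" using 4 by (simp add: p_def)
  from d(2) consider "c = 0" | "c = 1" | "c = 2" | "c = 3" by linarith
  thus ?thesis
  proof cases
  case 1
  have "d div 2 = 2 * p" using d(1) 1 by simp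
  hence "2 * p \<le> m" using m2 by simp
  thus ?thesis using n p1 d(1) 1 assms(2) by arith
  next
  case 2
  have "d div 2 = 2 * p" using d(1) 2 by simp
  hence "2 * p \<le> m" using m2 by simp
  thus ?thesis using n p1 d(1) 2 assms(2) by arith
  next
  case 3
  have "d div 2 = 2 * p + 1" using d(1) 3 by simp
  hence "2 * p + 1 \<le> m" using m2 by simp
  thus ?thesis using n p1 d(1) 3 assms(2) by arith
  next
  case 4
  have "d div 2 = 2 * p + 1" using d(1) 4 by simp
  hence "2 * p + 1 \<le> m" using m2 by simp
  thus ?thesis using n p1 d(1) 4 assms(2) by arith
  qed
 next
  case 1
  hence "m >= 1 \<or> n >= 1" "r = 0" "s = 0" "t \<le> 1" using assms(2,3) by auto
  thus ?thesis by auto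
 next
  case 2
  hence "m + n >= 2" "m >= 1" "s = 0" "t + 2 * r \<le> 2" using assms(2,4) by auto
  thus ?thesis by auto
 next
  case 3
  hence mn: "m >= 3 \<or> (n >= 1 & m >= 1)" and "s = 0" "t + 2 * r \<le> 3" using assms(2,5) by auto
  from mn show ?thesis
  proof
  assume "m >= 3"
  thus ?thesis using \<open>s = 0\<close> \<open>t + 2 * r \<le> 3\<close> by auto
  next
  assume "n >= 1 & m >= 1"
  moreover have "r \<le> 1" using \<open>t + 2 * r \<le> 3\<close> by simp
  ultimately show ?thesis using \<open>s = 0\<close> \<open>t + 2 * r \<le> 3\<close> by auto
  qed
 qed
qed

context char2
begin

lemma lin_pairop: "lin (pairop j)"
 unfolding lin_def by (intro conjI allI ext) (simp_all add: pairop_def algebra_simps)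

lemma on_pairop: "on (cls d ka) f ==> on (cls d ka) (pairop j f)"
 unfolding on_def
proof (intro allI impI)
 fix u assume f: "ALL u. u ~: cls d ka --> f u = 0" and u: "u ~: cls d ka"
 show "pairop j f u = 0"
 proof (cases "u 1 = V j & u 2 = V j")
  case True
  hence "colour o u = colour o u(1 := W j, 2 := W j)" by (auto simp: fun_eq_iff)
  hence "u(1 := W j, 2 := W j) ~: cls d ka" using stable_colour[OF stable_cls] u by blast
  thus ?thesis using f u by (simp add: pairop_def)
 qed (use f u in \<open>auto simp: pairop_def\<close>)
qed

lemma pairop_der:
 assumes i: "2 < i"
 shows "pairop j (der i f) = der i (pairop j f)"
proof
 fix u :: word
 have "(u(i := x))(1 := y, 2 := z) = (u(1 := y, 2 := z))(i := x)" for x y z using i by (auto simp: fun_eq_iff)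
 thus "pairop j (der i f) u = der i (pairop j f) u"
  using i by (cases "u i") (simp_all add: pairop_def der_def)
qed

lemma pairop_pm:
 assumes k: "k permutes {1..d}" "\<forall>i \<in> {1..2}. k i = i"
 shows "pairop j (pm k f) = pm k (pairop j f)"
proof
 fix u :: word
 have k12: "k 1 = 1" "k 2 = 2" using k(2) by auto
 have "(u(1 := y, 2 := z)) o k = (u o k)(1 := y, 2 := z)" for y z
 proof
  fix q
  have "k q = 1 \<longleftrightarrow> q = 1" "k q = 2 \<longleftrightarrow> q = 2" using injD[OF permutes_inj[OF k(1)]] k12 by metis+
  thus "((u(1 := y, 2 := z)) o k) q = ((u o k)(1 := y, 2 := z)) q" by simp
 qed
 thus "pairop j (pm k f) u = pm k (pairop j f) u" using k12 by (simp add: pairop_def pm_def)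
qed

lemma pairop_supp: "pairop j f u ~= 0 ==> colour (u 1) = V j & colour (u 2) = V j"
 by (auto simp: pairop_def split: if_splits)

text \<open>A word of the class has exactly two positions p and q of the colour in question, so only
  the two cosets taking {1, 2} onto {p, q} contribute to the trace. They differ by the transposition
  s of 1 and 2, and together they give T + s T s = 1 for T = \<open>pairop j\<close>.\<close>

lemma reduce_two:
 assumes w: "w \<in> cls d ka" and two: "ka (V j) = 2"
 obtains ka' where "dominated TYPE('k) d (cls d ka) (cls d ka')" "ka' (V j) = ka (V j) - 2" "!!i. i ~= j ==> ka' (V i) = ka (V i)"
proof -
 obtain R where R: "finite R" "!!r. r \<in> R ==> r permutes {1..d}"
  "!!g. g permutes {1..d} ==> \<exists>!r. r \<in> R & (\<forall>i \<in> {1..2}. r i = g i)" using transversal_exists[where d = d and t = 2] by blast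
 have ka: "ka = cnt d w" using w by (simp add: cls_def)
 have k2: "2 \<le> cnt d w (V j)" using two ka by simp
 have d2: "2 \<le> d"
 proof -
  have "cnt d w (V j) \<le> d" by (rule cnt_le)
  thus ?thesis using k2 by simp
 qed
 have i12: "{1..2} = {1, 2::nat}" by auto
 define s where "s = transpose 1 (2::nat)"
 have s: "s permutes {1..d}" unfolding s_def by (rule permutes_swap_id) (use d2 in auto)
 have ss: "s o s = id" unfolding s_def by (rule transpose_comp_involutory)
 have s12: "s 1 = 2" "s 2 = 1" by (simp_all add: s_def)
 have eqv: "pairop j (act k f) = act k (pairop j f)" if "k permutes {1..d}" "\<forall>i \<in> {1..2}. k i = i" for k and f :: "word => 'k"
  by (rule act_local[OF that linD(1)[OF lin_pairop] pairop_der pairop_pm[OF that]])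
 show ?thesis
 proof (rule dominated_fresh_cls[OF w disjI2[OF refl] k2 R, where E = "pairop j"])
  show "\<forall>i \<in> {1..2}. colour (u i) = V j" if "pairop j f u ~= 0" for f u using pairop_supp[OF that] unfolding i12 by blast
  fix f :: "word => 'k" assume f: "on (cls d ka) f"
  define T where "T r = act r (pairop j (act (inv' r) f))" for r
  show "(\<Sum>r \<in> R. act r (pairop j (act (inv' r) f))) = f"
  proof
  fix u
  show "(\<Sum>r \<in> R. act r (pairop j (act (inv' r) f))) u = f u"
  proof (cases "u \<in> cls d ka")
   case False
   have "on (cls d ka) (\<Sum>r \<in> R. act r (pairop j (act (inv' r) f)))"
    by (rule on_sum, rule on_act[OF stable_cls R(2) on_pairop[OF on_act[OF stable_cls permutes_inv[OF R(2)] f]]])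
   thus ?thesis using f False by (simp add: on_def)
  next
   case True
   hence "card {i \<in> {1..d}. colour (u i) = V j} = 2" using two by (auto simp: cls_def cnt_def)
   then obtain p q where pq: "{i \<in> {1..d}. colour (u i) = V j} = {p, q}" "p ~= q" unfolding card_2_iff by blast
   have pqd: "p \<in> {1..d}" "q \<in> {1..d}" using pq(1) by blast+
   define h where "h i = (if i = 1 then p else q)" for i :: nat
   have "EX g. g permutes {1..d} & (\<forall>i \<in> {1..2}. g i = h i)"
   proof (rule extend_permutation[OF _ _ d2])
    show "inj_on h {1..2}" unfolding i12 inj_on_def h_def using pq(2) by auto
    show "h ` {1..2} \<subseteq> {1..d}" unfolding i12 h_def using pqd by auto
   qed
   then obtain g where g: "g permutes {1..d}" "g 1 = p" "g 2 = q" unfolding i12 by (auto simp: h_def)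
   obtain r1 where r1: "r1 \<in> R" "r1 1 = p" "r1 2 = q" using R(3)[OF g(1)] g unfolding i12 by auto
   obtain r2 where r2: "r2 \<in> R" "r2 1 = q" "r2 2 = p" using R(3)[OF permutes_compose[OF s g(1)]] g s12 unfolding i12 by auto
   have uni: "r = r'" if "r \<in> R" "r' \<in> R" "r 1 = r' 1" "r 2 = r' 2" for r r'
    using R(3)[OF R(2)[OF that(1)]] that unfolding i12 by auto
   have ne: "r1 ~= r2" using r1 r2 pq(2) by auto
   have z: "T r u = 0" if r: "r \<in> R - {r1, r2}" for r
   proof (rule ccontr)
    assume nz: "T r u ~= 0"
    have rp: "r permutes {1..d}" using r R(2) by blast
    have "colour ((u o r) 1) = V j & colour ((u o r) 2) = V j"
    by (rule act_supp[OF rp _ pairop_supp nz[unfolded T_def]]) (metis colour_comp)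
    moreover have "r 1 \<in> {1..d}" "r 2 \<in> {1..d}" using permutes_in_image[OF rp] d2 by auto
    ultimately have m: "r 1 \<in> {p, q}" "r 2 \<in> {p, q}" unfolding pq(1)[symmetric] by auto
    have "r 1 ~= r 2" using injD[OF permutes_inj[OF rp], of 1 2] by auto
    hence "(r 1 = p & r 2 = q) \<or> (r 1 = q & r 2 = p)" using m by auto
    hence "r = r1 \<or> r = r2" using uni[of r r1] uni[of r r2] r r1 r2 by auto
    thus False using r by blast
   qed
   have "(\<Sum>r \<in> R. act r (pairop j (act (inv' r) f))) u = (\<Sum>r \<in> R. T r u)" by (simp only: sum_fun_apply T_def)
   also have "... = (\<Sum>r \<in> {r1, r2}. T r u)"
    by (rule sum.mono_neutral_right[OF R(1)]) (use r1 r2 z in auto)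
   also have "... = T r1 u + T r2 u" using ne by simp
   \<comment> \<open>\<open>r2\<close> and \<open>r1 o s\<close> represent the same coset; the
     factor \<open>k\<close> between them fixes 1 and 2 and passes through
     \<open>pairop\<close>.\<close>
   also have "T r2 = act r1 (act s (pairop j (act s (act (inv' r1) f))))"
   proof -
    note p1 = R(2)[OF r1(1)] and p2 = R(2)[OF r2(1)]
    define k where "k = s o (inv' r1 o r2)"
    have k: "k permutes {1..d}" unfolding k_def by (intro permutes_compose permutes_inv p1 p2 s)
    have "inv' r1 q = 2" "inv' r1 p = 1" using permutes_inverses(2)[OF p1] r1 by metis+
    hence kf: "\<forall>i \<in> {1..2}. k i = i" unfolding i12 using r2 s12 by (simp add: k_def)
    have rk: "r2 = r1 o (s o k)"
    unfolding k_def comp_assoc[symmetric] using ss permutes_inv_o(1)[OF p1] by (metis comp_assoc id_comp comp_id)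
    have e: "act s (act (inv' r1) f) = act k (act (inv' r2) f)"
    proof -
    have "k o inv' r2 = s o inv' r1" unfolding k_def comp_assoc permutes_inv_o(1)[OF p2] by simp
    thus ?thesis using act_comp[OF s permutes_inv[OF p1], of f] act_comp[OF k permutes_inv[OF p2], of f] by simp
    qed
    have "act r1 (act s (pairop j (act s (act (inv' r1) f)))) = act r1 (act s (act k (pairop j (act (inv' r2) f))))"
    unfolding e eqv[OF k kf] ..
    also have "... = act r2 (pairop j (act (inv' r2) f))"
    unfolding act_comp[OF s k, symmetric] act_comp[OF p1 permutes_compose[OF k s], symmetric] rk[symmetric] ..
    finally show ?thesis unfolding T_def by (rule sym)
   qed
   also have "T r1 u + act r1 (act s (pairop j (act s (act (inv' r1) f)))) u =
    act r1 (pairop j (act (inv' r1) f) + act s (pairop j (act s (act (inv' r1) f)))) u"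
    unfolding linD(1)[OF lin_act[OF R(2)[OF r1(1)]]] T_def by simp
   also have "... = act r1 ((%u. if colour (u 1) = V j & colour (u 2) = V j then 1 else 0) * act (inv' r1) f) u"
    unfolding s_def pairop_sum ..
   also have "... = f u"
   proof -
    have c: "colour_dep (%u. if colour (u 1) = V j & colour (u 2) = V j then 1 else 0 :: 'k)"
    unfolding colour_dep_def by (metis colour_comp)
    have "colour (u p) = V j" "colour (u q) = V j" using pq(1) by blast+
    thus ?thesis unfolding act_mult_colour[OF R(2)[OF r1(1)] c] act_inv(1)[OF R(2)[OF r1(1)]] by (simp add: r1 del: One_nat_def)
   qed
   finally show ?thesis .
  qed
  qed
 qed (assumption | rule that lin_pairop on_pairop pairop_der pairop_pm)+
qed

lemma dominated_base:
 assumes w: "w \<in> cls d ka" and J: "finite J" "!!j. j ~: J ==> ka (V j) = 0" "!!j. ka (V j) = 0 \<or> 4 \<le> ka (V j)"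
  and d: "d > 0" "d = 1 --> m >= 1 \<or> n >= 1" "d = 2 --> m + n >= 2 & m >= 1" "d = 3 --> m >= 3 \<or> (n >= 1 & m >= 1)"
  "d >= 4 --> m >= d div 2 & n >= d div 4"
 shows "dominated TYPE('k) d (cls d ka) (words d (letters {..<m} {..<n}))"
proof -
 have ka: "cnt d u = ka" if "u \<in> cls d ka" for u using that by (simp add: cls_def)
 define T where "T = {a. ka (One a) = 1}"
 define R1 where "R1 = {a. 2 \<le> ka (One a)}"
 define S where "S = {j. 4 \<le> ka (V j)}"
 have "finite {a. \<exists>i \<in> {1..d}. w i = One a}"
  by (rule finite_subset[of _ "(%i. case w i of One a => a | _ => 0) ` {1..d}"]) (force intro: rev_image_eqI)+
 moreover have "T \<union> R1 \<subseteq> {a. \<exists>i \<in> {1..d}. w i = One a}"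
 proof
  fix a assume "a \<in> T \<union> R1"
  hence "cnt d w (One a) ~= 0" using ka[OF w] by (auto simp: T_def R1_def)
  hence "{i \<in> {1..d}. colour (w i) = One a} ~= {}" unfolding cnt_def by (metis card.empty)
  thus "a \<in> {a. \<exists>i \<in> {1..d}. w i = One a}" using colour_eq_One by blast
 qed
 ultimately have "finite (T \<union> R1)" by (rule rev_finite_subset)
 hence fT: "finite T" and fR: "finite R1" by simp_all
 have "S \<subseteq> J" using J(2) by (force simp: S_def)
 hence fS: "finite S" using J(1) by (rule finite_subset)
 define C where "C = One ` T \<union> One ` R1 \<union> V ` S"
 have inC: "colour (u i) \<in> C" if u: "u \<in> cls d ka" and i: "i \<in> {1..d}" for u i
 proof (cases "u i")
  case (One a)
  hence "ka (One a) > 0" using cnt_pos[OF i, of u] ka[OF u] by simp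
  hence "a \<in> T \<union> R1" by (auto simp: T_def R1_def)
  thus ?thesis using One by (auto simp: C_def)
 next
  case (V a)
  hence "ka (V a) > 0" using cnt_pos[OF i, of u] ka[OF u] by simp
  thus ?thesis using V J(3)[of a] by (auto simp: C_def S_def)
 next
  case (W a)
  hence "ka (V a) > 0" using cnt_pos[OF i, of u] ka[OF u] by simp
  thus ?thesis using W J(3)[of a] by (auto simp: C_def S_def)
 qed
 have TR: "T \<inter> R1 = {}" by (auto simp: T_def R1_def)
 have "(\<Sum>c \<in> C. ka c) = d"
  using cnt_sum[of C d w] inC[OF w] ka[OF w] fT fR fS unfolding C_def by auto
 moreover have "(\<Sum>c \<in> C. ka c) = (\<Sum>c \<in> One ` T. ka c) + (\<Sum>c \<in> One ` R1. ka c) + (\<Sum>c \<in> V ` S. ka c)"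
  unfolding C_def using fT fR fS TR by (subst sum.union_disjoint, auto)+
 moreover have "(\<Sum>c \<in> One ` T. ka c) = card T" by (subst sum.reindex) (auto simp: inj_on_def T_def)
 moreover have "(\<Sum>c \<in> One ` R1. ka c) >= 2 * card R1"
 proof -
  have "(\<Sum>c \<in> One ` R1. ka c) = (\<Sum>a \<in> R1. ka (One a))" by (subst sum.reindex) (auto simp: inj_on_def)
  moreover have "(\<Sum>a \<in> R1. 2) \<le> (\<Sum>a \<in> R1. ka (One a))" by (rule sum_mono) (simp add: R1_def)
  ultimately show ?thesis by simp
 qed
 moreover have "(\<Sum>c \<in> V ` S. ka c) >= 4 * card S"
 proof -
  have "(\<Sum>c \<in> V ` S. ka c) = (\<Sum>a \<in> S. ka (V a))" by (subst sum.reindex) (auto simp: inj_on_def)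
  moreover have "(\<Sum>a \<in> S. 4) \<le> (\<Sum>a \<in> S. ka (V a))" by (rule sum_mono) (simp add: S_def)
  ultimately show ?thesis by simp
 qed
 ultimately have tot: "card T + 2 * card R1 + 4 * card S \<le> d" by linarith
 note sb = size_bounds[OF d(1) tot d(2-5)]
 obtain O3 where O3: "R1 \<subseteq> O3" "finite O3" "card O3 = m" using finite_superset[OF fR] sb by blast
 obtain P3 where P3: "S \<subseteq> P3" "finite P3" "card P3 = n" using finite_superset[OF fS] sb by blast
 define t where "t = card T"
 have td: "t \<le> d" using tot by (simp add: t_def)
 have good: "realized t (letters (O3 - R1) (P3 - S)) (pt id)"
 proof (rule realized_id)
  show "finite (O3 - R1)" "finite (P3 - S)" using O3 P3 by simp_all
  have c: "card (O3 - R1) = m - card R1" "card (P3 - S) = n - card S"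
  using O3 P3 fR fS by (simp_all add: card_Diff_subset)
  show "t \<le> card (O3 - R1) + 2 * card (P3 - S) \<or> (1 \<le> card (O3 - R1) & 1 \<le> card (P3 - S) & t = card (O3 - R1) + 2 * card (P3 - S) + 1) \<or>
  (2 \<le> card (O3 - R1) & 1 \<le> card (P3 - S) & t = card (O3 - R1) + 2 * card (P3 - S) + 2)"
  unfolding c t_def using sb by blast
 qed
 obtain f0 where f0: "bij_betw f0 {1..t} T"
  using finite_same_card_bij[of "{1..t}" T] fT by (auto simp: t_def)
 obtain R where R: "finite R" "!!r. r \<in> R ==> r permutes {1..d}"
  "!!g. g permutes {1..d} ==> \<exists>!r. r \<in> R & (\<forall>i \<in> {1..t}. r i = g i)" using transversal_exists[where d = d and t = t] by blast
 have f0T: "f0 i \<in> T" if "i \<in> {1..t}" for i using f0 that by (rule bij_betw_apply)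
 have one: "EX q. {p \<in> {1..d}. u p = One a} = {q}" if "u \<in> cls d ka" "a \<in> T" for u a
 proof -
  have "card {p \<in> {1..d}. colour (u p) = One a} = 1" using that ka[OF that(1)] by (auto simp: T_def cnt_def)
  thus ?thesis unfolding colour_eq_One by (rule card_1_singletonE) blast
 qed
 have "dominated TYPE('k) d (cls d ka) (words d (letters O3 P3))"
 proof (rule dominated_block[where ?O1.0 = "O3 - R1" and ?P1.0 = "P3 - S" and ?O2.0 = R1 and ?P2.0 = S and ?f0.0 = f0, OF stable_cls td])
  show "letters (O3 - R1) (P3 - S) \<union> letters R1 S \<subseteq> letters O3 P3" using O3 P3 by (auto simp: letters_def)
  show "letters (O3 - R1) (P3 - S) \<inter> letters R1 S = {}" by (auto simp: letters_def)
  show "realized t (letters (O3 - R1) (P3 - S)) (%tz. if tz = id then 1 else (0::'k))"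
  using good unfolding pt_def[abs_def] .
  show "u i = One 0" if "u \<in> cls d ka" "i ~: {1..d}" for u i using that unfolding cls_def by blast
  show "u i \<in> letters R1 S" if u: "u \<in> cls d ka" and o: "\<forall>i \<in> {1..t}. u i = One (f0 i)" and i: "i \<in> {1..d} - {1..t}" for u i
  proof -
  have "u i ~= One a" if a: "a \<in> T" for a
  proof
   assume e: "u i = One a"
   obtain l where l: "l \<in> {1..t}" "f0 l = a" using f0 a unfolding bij_betw_def by blast
   obtain q where q: "{p \<in> {1..d}. u p = One a} = {q}" using one[OF u a] by blast
   have "l \<in> {p \<in> {1..d}. u p = One a}" "i \<in> {p \<in> {1..d}. u p = One a}" using l o e i td by auto
   hence "l = i" unfolding q by simp
   thus False using l i by blast
  qed
  moreover have "colour (u i) \<in> C" using inC[OF u] i by blast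
  ultimately show ?thesis unfolding C_def by (cases "u i") (auto simp: letters_def)
  qed
  show "r \<in> R ==> r permutes {1..d}" for r by (rule R(2))
  show "finite R" by (rule R(1))
  show "g permutes {1..d} ==> \<exists>!r. r \<in> R & (\<forall>i \<in> {1..t}. r i = g i)" for g by (rule R(3))
  show "\<exists>!r. r \<in> R & (\<forall>i \<in> {1..t}. u (r i) = One (f0 i))" if u: "u \<in> cls d ka" for u
  proof -
  \<comment> \<open>The only position of the letter \<open>One (f0 i)\<close>. Any permutation
    extending \<open>pz\<close> determines the coset sought.\<close>
  define pz where "pz i = (SOME q. {p \<in> {1..d}. u p = One (f0 i)} = {q})" for i
  have pz: "{p \<in> {1..d}. u p = One (f0 i)} = {pz i}" if "i \<in> {1..t}" for i
   unfolding pz_def by (rule someI_ex[OF one[OF u f0T[OF that]]])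
  have pzi: "pz i \<in> {1..d}" "u (pz i) = One (f0 i)" if "i \<in> {1..t}" for i using pz[OF that] by blast+
  have "inj_on pz {1..t}"
  proof (rule inj_onI)
   fix x y assume xy: "x \<in> {1..t}" "y \<in> {1..t}" "pz x = pz y"
   hence "f0 x = f0 y" using pzi(2)[OF xy(1)] pzi(2)[OF xy(2)] by simp
   thus "x = y" using f0 xy unfolding bij_betw_def inj_on_def by blast
  qed
  then obtain g where g: "g permutes {1..d}" "\<forall>i \<in> {1..t}. g i = pz i"
   using extend_permutation[OF _ _ td, of pz] pzi(1) by blast
  have "(\<forall>i \<in> {1..t}. u (r i) = One (f0 i)) \<longleftrightarrow> (\<forall>i \<in> {1..t}. r i = g i)" if r: "r \<in> R" for r
  proof (rule ball_cong[OF refl])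
   fix i assume i: "i \<in> {1..t}"
   have "i \<in> {1..d}" using i td by auto
   hence "r i \<in> {1..d}" using permutes_in_image[OF R(2)[OF r]] by blast
   hence "u (r i) = One (f0 i) \<longleftrightarrow> r i = pz i" using pz[OF i] pzi[OF i] by blast
   thus "u (r i) = One (f0 i) \<longleftrightarrow> r i = g i" using g(2) i by simp
  qed
  hence "(r \<in> R & (\<forall>i \<in> {1..t}. u (r i) = One (f0 i))) \<longleftrightarrow> (r \<in> R & (\<forall>i \<in> {1..t}. r i = g i))" for r by blast
  thus ?thesis using R(3)[OF g(1)] by simp
  qed
 qed
 moreover have "dominated TYPE('k) d (words d (letters O3 P3)) (words d (letters {..<m} {..<n}))"
  by (rule dominated_relabel) (use O3 P3 in simp_all)
 ultimately show ?thesis by (rule dominated_trans)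
qed

text \<open>Each reduction lowers the number of positions occupied by copies of P: an odd
  multiplicity drops by 1 and a multiplicity 2 drops to 0. When neither applies, all multiplicities
  are 0 or at least 4.\<close>

lemma dominated_cls:
 assumes J: "finite J"
  and d: "d > 0" "d = 1 --> m >= 1 \<or> n >= 1" "d = 2 --> m + n >= 2 & m >= 1" "d = 3 --> m >= 3 \<or> (n >= 1 & m >= 1)"
  "d >= 4 --> m >= d div 2 & n >= d div 4"
 shows "(!!j. j ~: J ==> ka (V j) = 0) ==> dominated TYPE('k) d (cls d ka) (words d (letters {..<m} {..<n}))"
proof (induction "\<Sum>j \<in> J. ka (V j)" arbitrary: ka rule: less_induct)
 case less
 have red: ?case if k': "dominated TYPE('k) d (cls d ka) (cls d ka')" "ka' (V j) < ka (V j)" "!!i. i ~= j ==> ka' (V i) = ka (V i)" for ka' j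
 proof -
  have j: "j \<in> J" using less(2)[of j] k'(2) by (cases "j \<in> J") auto
  have z: "ka' (V i) = 0" if "i ~: J" for i using less(2)[OF that] k'(3)[of i] that j by metis
  have "(\<Sum>i \<in> J. ka' (V i)) < (\<Sum>i \<in> J. ka (V i))"
  proof (rule sum_strict_mono_ex1[OF J])
  show "\<forall>i \<in> J. ka' (V i) \<le> ka (V i)" using k'(2,3) by (metis less_imp_le order_refl)
  show "\<exists>i \<in> J. ka' (V i) < ka (V i)" using j k'(2) by blast
  qed
  from less(1)[OF this z] show ?thesis using dominated_trans[OF k'(1)] by blast
 qed
 show ?case
 proof (cases "cls d ka = {}")
  case True
  show ?thesis unfolding True by (rule dominated_empty)
 next
  case False
  then obtain w where w: "w \<in> cls d ka" by blast
  show ?thesis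
  proof (cases "EX j. odd (ka (V j))")
  case True
  then obtain j where j: "odd (ka (V j))" by blast
  have "0 < ka (V j)" using j by (rule odd_pos)
  obtain ka' where k': "dominated TYPE('k) d (cls d ka) (cls d ka')" "ka' (V j) = ka (V j) - 1" "!!i. i ~= j ==> ka' (V i) = ka (V i)"
   using reduce_odd[OF w j] by blast
  show ?thesis by (rule red[OF k'(1) _ k'(3)]) (use \<open>0 < ka (V j)\<close> k'(2) in auto)
  next
  case ev: False
  show ?thesis
  proof (cases "EX j. ka (V j) = 2")
   case True
   then obtain j where j: "ka (V j) = 2" by blast
   obtain ka' where k': "dominated TYPE('k) d (cls d ka) (cls d ka')" "ka' (V j) = ka (V j) - 2" "!!i. i ~= j ==> ka' (V i) = ka (V i)"
    using reduce_two[OF w j] by blast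
   show ?thesis by (rule red[OF k'(1) _ k'(3)]) (use j k'(2) in auto)
  next
   case False
   have "ka (V j) = 0 \<or> 4 \<le> ka (V j)" for j
   proof -
    have "even (ka (V j))" "ka (V j) ~= 2" using ev False by blast+
    thus ?thesis by presburger
   qed
   thus ?thesis by (intro dominated_base[OF w J less(2) _ d])
  qed
  qed
 qed
qed

text \<open>The words over a finite alphabet fall into finitely many disjoint classes according to
  the multiplicities of the colours.\<close>

lemma dominated_words:
 assumes d: "d > 0" "d = 1 --> m >= 1 \<or> n >= 1" "d = 2 --> m + n >= 2 & m >= 1" "d = 3 --> m >= 3 \<or> (n >= 1 & m >= 1)"
  "d >= 4 --> m >= d div 2 & n >= d div 4"
 shows "dominated TYPE('k) d (words d (letters {..<m'} {..<n'})) (words d (letters {..<m} {..<n}))"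
proof -
 let ?A = "words d (letters {..<m'} {..<n'})" and ?C = "words d (letters {..<m} {..<n})"
 have fin: "finite (cnt d ` ?A)" by (intro finite_imageI card_words(2)) (simp add: letters_def)
 have eq: "?A = (\<Union>ka \<in> cnt d ` ?A. cls d ka)"
 proof
  show "?A \<subseteq> (\<Union>ka \<in> cnt d ` ?A. cls d ka)" by (auto simp: cls_def words_def)
  show "(\<Union>ka \<in> cnt d ` ?A. cls d ka) \<subseteq> ?A"
  proof
  fix u assume "u \<in> (\<Union>ka \<in> cnt d ` ?A. cls d ka)"
  then obtain w where w: "w \<in> ?A" "u \<in> cls d (cnt d w)" by blast
  have "u i \<in> letters {..<m'} {..<n'}" if i: "i \<in> {1..d}" for i
  proof -
   have "cnt d w (colour (u i)) > 0" using cnt_pos[OF i, of u] w(2) by (simp add: cls_def)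
   hence "{q \<in> {1..d}. colour (w q) = colour (u i)} ~= {}" unfolding cnt_def by (metis card.empty less_irrefl)
   then obtain q where q: "q \<in> {1..d}" "colour (w q) = colour (u i)" by blast
   have "w q \<in> letters {..<m'} {..<n'}" using w(1) q(1) unfolding words_def by blast
   thus ?thesis using colour_letters[OF q(2)] by blast
  qed
  thus "u \<in> ?A" using w(2) unfolding words_def cls_def by blast
  qed
 qed
 have UN: "dominated TYPE('k) d (\<Union>ka \<in> Q. cls d ka) ?C" if "finite Q" "!!ka j. ka \<in> Q ==> j ~: {..<n'} ==> ka (V j) = 0" for Q
  using that
 proof (induction Q rule: finite_induct)
  case empty
  show ?case by (simp add: dominated_empty)
 next
  case (insert ka Q)
  have "dominated TYPE('k) d (cls d ka \<union> (\<Union>ka \<in> Q. cls d ka)) ?C"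
  proof (rule dominated_union)
  show "dominated TYPE('k) d (cls d ka) ?C" by (rule dominated_cls[OF finite_lessThan[of n'] d]) (use insert(4) in blast)
  show "dominated TYPE('k) d (\<Union>ka \<in> Q. cls d ka) ?C" by (rule insert(3)) (use insert(4) in blast)
  show "cls d ka \<inter> (\<Union>ka \<in> Q. cls d ka) = {}" using insert(2) by (auto simp: cls_def)
  show "stable d (cls d ka)" by (rule stable_cls)
  show "stable d (\<Union>ka \<in> Q. cls d ka)" unfolding stable_def
  proof (intro conjI allI impI)
   fix u v assume "u \<in> (\<Union>ka \<in> Q. cls d ka)" and c: "colour o u = colour o v"
   then obtain ka' where k: "ka' \<in> Q" "u \<in> cls d ka'" by blast
   hence "v \<in> cls d ka'" using stable_colour[OF stable_cls c] by blast
   thus "v \<in> (\<Union>ka \<in> Q. cls d ka)" using k(1) by blast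
  next
   fix sz u assume s: "sz permutes {1..d}" and "u \<in> (\<Union>ka \<in> Q. cls d ka)"
   then obtain ka' where k: "ka' \<in> Q" "u \<in> cls d ka'" by blast
   hence "u o sz \<in> cls d ka'" using stable_perm[OF stable_cls s] by blast
   thus "u o sz \<in> (\<Union>ka \<in> Q. cls d ka)" using k(1) by blast
  qed
  qed
  thus ?case by simp
 qed
 have "dominated TYPE('k) d (\<Union>ka \<in> cnt d ` ?A. cls d ka) ?C"
 proof (rule UN[OF fin])
  fix ka j assume k: "ka \<in> cnt d ` ?A" and j: "j ~: {..<n'}"
  then obtain w where w: "w \<in> ?A" "ka = cnt d w" by blast
  have "{i \<in> {1..d}. colour (w i) = V j} = {}"
  proof (rule ccontr)
  assume "{i \<in> {1..d}. colour (w i) = V j} ~= {}"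
  then obtain i where i: "i \<in> {1..d}" "colour (w i) = V j" by blast
  have "w i \<in> letters {..<m'} {..<n'}" using w(1) i(1) unfolding words_def by blast
  thus False using i(2) j by (cases "w i") (auto simp: letters_def)
  qed
  thus "ka (V j) = 0" unfolding w(2) cnt_def by (simp only: card.empty)
 qed
 thus ?thesis unfolding eq[symmetric] .
qed

end

section \<open>Necessity: what domination preserves, and the case without copies of P\<close>

context char2
begin

text \<open>The terms of each pair {g, qf g} are equal and cancel in characteristic 2.\<close>

lemma sum_involution:
 fixes x :: "'b => 'k"
 assumes "finite G" "!!g. g \<in> G ==> qf g \<in> G" "!!g. g \<in> G ==> qf (qf g) = g" "!!g. g \<in> G ==> qf g ~= g" "!!g. g \<in> G ==> x (qf g) = x g"
 shows "(\<Sum>g \<in> G. x g) = 0"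
 using assms
proof (induction "card G" arbitrary: G rule: less_induct)
 case less
 show ?case
 proof (cases "G = {}")
  case False
  then obtain g where g: "g \<in> G" by blast
  note g' = less(3)[OF g]
  let ?H = "G - {g, qf g}"
  have "(\<Sum>h \<in> ?H. x h) = 0"
  proof (rule less(1))
  show "card ?H < card G" by (rule psubset_card_mono[OF less(2)]) (use g in auto)
  show "qf h \<in> ?H" if h: "h \<in> ?H" for h
  proof -
   have "h \<in> G" "h ~= g" "h ~= qf g" using h by blast+
   thus ?thesis using less(3,4)[of h] less(4)[OF g] by force
  qed
  qed (use less in auto)
  moreover have "(\<Sum>h \<in> G. x h) = x g + (x (qf g) + (\<Sum>h \<in> ?H. x h))"
  proof -
  have e: "G = insert g (insert (qf g) ?H)" using g g' by blast
  have "(\<Sum>h \<in> insert g (insert (qf g) ?H). x h) = x g + (x (qf g) + (\<Sum>h \<in> ?H. x h))"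
   using less(2) less(5)[OF g] by (simp add: sum.insert)
  thus ?thesis using e by metis
  qed
  ultimately show ?thesis using less(6)[OF g] by simp
 qed simp
qed

lemma dominatedE:
 assumes "dominated TYPE('k) d A B"
 obtains ps :: "(((word => 'k) => word => 'k) \<times> ((word => 'k) => word => 'k)) list" where
  "!!p. p \<in> set ps ==> ghom d A B (fst p) & ghom d B A (snd p)" "!!f. on A f ==> (\<Sum>p\<leftarrow>ps. snd p (fst p f)) = f"
 using assms unfolding dominated_def case_prod_unfold by blast

text \<open>If \<open>X\<close> is a property of functions preserved by all equivariant maps and a sum of values
 of \<open>Y\<close> is again a value of \<open>Y\<close>, then an implication from \<open>X\<close> to \<open>Y\<close> that holds on \<open>B\<close> also holds on \<open>A\<close>.\<close>

lemma dominated_transfer: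
 fixes X Y :: "word set => (word => 'k) => bool"
 assumes dom: "dominated TYPE('k) d A B" and f: "on A f" "X A f"
  and X: "!!al f. ghom d A B al ==> on A f ==> X A f ==> X B (al f)"
  and XY: "!!f. on B f ==> X B f ==> Y B f"
  and Y: "!!bt f. ghom d B A bt ==> on B f ==> Y B f ==> Y A (bt f)"
  and Y0: "Y A 0" and Yadd: "!!f g. Y A f ==> Y A g ==> Y A (f + g)"
 shows "Y A f"
proof -
 obtain ps :: "(((word => 'k) => word => 'k) \<times> ((word => 'k) => word => 'k)) list" where
  ps: "!!p. p \<in> set ps ==> ghom d A B (fst p) & ghom d B A (snd p)" "!!f. on A f ==> (\<Sum>p\<leftarrow>ps. snd p (fst p f)) = f"
  using dominatedE[OF dom] by blast
 have "Y A (snd p (fst p f))" if p: "p \<in> set ps" for p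
 proof -
  have o: "on B (fst p f)" using ps(1)[OF p] f(1) unfolding ghom_def by blast
  have x: "X B (fst p f)" by (rule X[OF conjunct1[OF ps(1)[OF p]] f])
  have y: "Y B (fst p f)" by (rule XY[OF o x])
  show ?thesis by (rule Y[OF conjunct2[OF ps(1)[OF p]] o y])
 qed
 hence "Y A (\<Sum>p\<leftarrow>qs. snd p (fst p f))" if "set qs \<subseteq> set ps" for qs
  using that by (induction qs) (simp_all add: Y0 Yadd)
 from this[OF order_refl] show ?thesis by (simp only: ps(2)[OF f(1)])
qed

lemma ghomD:
 assumes "ghom d A B al"
 shows "lin al" "on A f ==> on B (al f)" "sz permutes {1..d} ==> on A f ==> al (act sz f) = act sz (al f)"
 using assms unfolding ghom_def by blast+

lemma ghom_sum:
 assumes a: "ghom d A B al" and f: "on A f" and G: "!!g. g \<in> G ==> g permutes {1..d}"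
 shows "al (\<Sum>g \<in> G. act g f) = (\<Sum>g \<in> G. act g (al f))"
 unfolding lin_sum[OF ghomD(1)[OF a]] by (rule sum.cong[OF refl]) (rule ghomD(3)[OF a G f])

text \<open>A word without letters \<open>W\<close> has weight 0, which is the lowest weight
  possible for any function.\<close>

lemma act_weightless:
 assumes s: "sz permutes {1..d}" and u: "!!i j. i \<in> {1..d} ==> u i ~= W j"
 shows "act sz f u = (f (u o sz) :: 'k)"
proof -
 have w0: "wt d u = 0" using u unfolding wt_def by auto
 show ?thesis by (rule act_low[OF s _ w0]) simp
qed

text \<open>A word of length d over fewer than d letters is fixed by a transposition s, and pairing
  g with \<open>s o g\<close> shows that the norm of S_d kills all functions on such words. It does
  not kill the word with d distinct letters, whose coefficient in its own norm comes from
  \<open>id\<close> alone.\<close>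

lemma not_dominated_ones:
 assumes md: "m < d"
 shows "\<not> dominated TYPE('k) d (words d (letters {..<d} {})) (words d (letters {..<m} {}))"
proof
 let ?A = "words d (letters {..<d} {})" and ?B = "words d (letters {..<m} {})"
 let ?G = "{sz. sz permutes {1..d}}"
 assume dom: "dominated TYPE('k) d ?A ?B"
 define N where "N f = (\<Sum>g \<in> ?G. act g f)" for f :: "word => 'k"
 define z where "z i = (if i \<in> {1..d} then One (i - 1) else One 0)" for i :: nat
 have zA: "z \<in> ?A" by (auto simp: words_def z_def letters_def)
 have fin: "finite ?G" by (simp add: finite_permutations)
 have "N (unitw z) = 0"
 proof (rule dominated_transfer[OF dom on_unitw[OF zA], where X = "%A f. True" and Y = "%A f. N f = 0"])
  fix f :: "word => 'k" assume f: "on ?B f"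
  show "N f = 0"
  proof
  fix u
  show "N f u = 0 u"
  proof (cases "u \<in> ?B")
   case False
   have "on ?B (N f)" unfolding N_def by (rule on_sum, rule on_act[OF stable_words _ f]) simp
   thus ?thesis using False by (simp add: on_def)
  next
   case True
   have nw: "u i ~= W j" if "i \<in> {1..d}" for i j using True that unfolding words_def letters_def by fastforce
   have "u ` {1..d} \<subseteq> One ` {..<m}" using True unfolding words_def letters_def by fastforce
   hence "card (u ` {1..d}) \<le> card (One ` {..<m})" by (intro card_mono) auto
   also have "... \<le> m" using card_image_le[of "{..<m}" One] by simp
   finally have "card (u ` {1..d}) < card {1..d}" using md by simp
   hence "\<not> inj_on u {1..d}" using card_image[of u "{1..d}"] by auto
   then obtain p q where pq: "p \<in> {1..d}" "q \<in> {1..d}" "p ~= q" "u p = u q" unfolding inj_on_def by blast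
   define s where "s = transpose p q"
   have s: "s permutes {1..d}" unfolding s_def by (rule permutes_swap_id[OF pq(1,2)])
   have us: "u o s = u" using pq(4) by (auto simp: s_def fun_eq_iff transpose_def)
   have ss: "s o s = id" unfolding s_def by (rule transpose_comp_involutory)
   have "N f u = (\<Sum>g \<in> ?G. f (u o g))"
    unfolding N_def sum_fun_apply by (rule sum.cong[OF refl]) (use act_weightless[OF _ nw] in simp)
   also have "... = 0"
   proof (rule sum_involution[OF fin, where qf = "%g. s o g"])
    fix g assume g: "g \<in> ?G"
    show "s o g \<in> ?G" using permutes_compose[OF _ s] g by simp
    show "s o (s o g) = g" unfolding comp_assoc[symmetric] ss by simp
    show "f (u o (s o g)) = f (u o g)" unfolding comp_assoc[symmetric] us ..
    show "s o g ~= g"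
    proof
    assume h: "s o g = g"
    have "s (g (inv' g p)) = g (inv' g p)" using fun_cong[OF h, of "inv' g p"] by simp
    hence "s p = p" using permutes_inverses(1)[of g "{1..d}" p] g by simp
    thus False using pq(3) by (simp add: s_def)
    qed
   qed
   finally show ?thesis by simp
  qed
  qed
 next
  fix bt :: "(word => 'k) => word => 'k" and f :: "word => 'k" assume b: "ghom d ?B ?A bt" and f: "on ?B f" and z: "N f = 0"
  have "N (bt f) = bt (N f)" unfolding N_def by (rule ghom_sum[OF b f, symmetric]) simp
  thus "N (bt f) = 0" unfolding z by (simp only: lin_zero[OF ghomD(1)[OF b]])
 next
  have "N 0 = (\<Sum>g \<in> ?G. 0)" unfolding N_def by (rule sum.cong[OF refl]) (simp add: lin_zero[OF lin_act])
  thus "N 0 = 0" by simp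
  fix f g assume "N f = 0" "N g = 0"
  moreover have "N (f + g) = N f + N g" unfolding N_def sum.distrib[symmetric]
  by (rule sum.cong[OF refl]) (use linD(1)[OF lin_act] in simp)
  ultimately show "N (f + g) = 0" by simp
 qed simp_all
 moreover have "N (unitw z) z = 1"
 proof -
  have nw: "z i ~= W j" for i j by (simp add: z_def)
  have "N (unitw z) z = (\<Sum>g \<in> ?G. if g = id then 1 else 0)"
  unfolding N_def sum_fun_apply
  proof (rule sum.cong[OF refl])
  fix g assume "g \<in> ?G"
  hence g: "g permutes {1..d}" by simp
  have "z o g = z \<longleftrightarrow> g = id"
  proof
   assume h: "z o g = z"
   show "g = id"
   proof
    fix i show "g i = id i"
    proof (cases "i \<in> {1..d}")
    case True
    hence gi: "g i \<in> {1..d}" using permutes_in_image[OF g] by blast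
    have "z (g i) = z i" using fun_cong[OF h, of i] by simp
    hence "g i - 1 = i - 1" unfolding z_def if_P[OF True] if_P[OF gi] by simp
    thus ?thesis using True gi by auto
    qed (simp add: permutes_not_in[OF g])
   qed
  qed simp
  thus "act g (unitw z) z = (if g = id then 1 else (0::'k))" unfolding act_weightless[OF g nw] unitw_def by simp
  qed
  also have "... = 1" using fin by (simp add: permutes_id)
  finally show ?thesis .
 qed
 ultimately show False by simp
qed

end

section \<open>Blocks of positions and the general obstruction\<close>

definition loc :: "nat => nat => (nat => nat) => nat => nat" where
 "loc b i pj x = (if x \<in> {b * i + 1..b * i + b} then b * i + pj (x - b * i) else x)"

lemma loc_block: "c \<in> {1..b} ==> loc b i pj (b * i + c) = b * i + pj c"
 by (simp add: loc_def)

lemma loc_out: "x ~: {b * i + 1..b * i + b} ==> loc b i pj x = x"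
 by (simp only: loc_def if_False)

lemma block_disjoint:
 assumes "i ~= j" "x \<in> {b * i + 1..b * i + b}"
 shows "x ~: {b * j + 1..b * j + (b::nat)}"
proof
 assume h: "x \<in> {b * j + 1..b * j + b}"
 from assms(1) consider "Suc i \<le> j" | "Suc j \<le> i" by linarith
 thus False
 proof cases
  case 1
  have "b * i + b \<le> b * j" using mult_le_mono2[OF 1, of b] by simp
  thus False using assms(2) h by simp
 next
  case 2
  have "b * j + b \<le> b * i" using mult_le_mono2[OF 2, of b] by simp
  thus False using assms(2) h by simp
 qed
qed

lemma in_block: "x \<in> {b * i + 1..b * i + (b::nat)} ==> \<exists>c \<in> {1..b}. x = b * i + c"
 by (rule bexI[of _ "x - b * i"]) auto

lemma loc_permutes:
 assumes p: "pj permutes {1..b}"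
 shows "loc b i pj permutes {b * i + 1..b * i + b}"
proof (rule bij_imp_permutes)
 let ?D = "{b * i + 1..b * i + b}"
 have r: "pj c \<in> {1..b}" if "c \<in> {1..b}" for c using permutes_in_image[OF p] that by blast
 have "inj_on (loc b i pj) ?D"
 proof (rule inj_onI)
  fix x y assume xy: "x \<in> ?D" "y \<in> ?D" "loc b i pj x = loc b i pj y"
  obtain c where c: "c \<in> {1..b}" "x = b * i + c" using in_block[OF xy(1)] by blast
  obtain e where e: "e \<in> {1..b}" "y = b * i + e" using in_block[OF xy(2)] by blast
  have "pj c = pj e" using xy(3) unfolding c(2) e(2) loc_block[OF c(1)] loc_block[OF e(1)] by simp
  hence "c = e" by (rule injD[OF permutes_inj[OF p]])
  thus "x = y" using c e by simp
 qed
 moreover have "loc b i pj ` ?D \<subseteq> ?D"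
 proof
  fix y assume "y \<in> loc b i pj ` ?D"
  then obtain x where x: "x \<in> ?D" "y = loc b i pj x" by blast
  obtain c where c: "c \<in> {1..b}" "x = b * i + c" using in_block[OF x(1)] by blast
  show "y \<in> ?D" using r[OF c(1)] unfolding x(2) c(2) loc_block[OF c(1)] by simp
 qed
 ultimately show "bij_betw (loc b i pj) ?D ?D"
  unfolding bij_betw_def using card_subset_eq[of ?D "loc b i pj ` ?D"] by (simp add: card_image)
qed (rule loc_out)

lemma loc_commute:
 assumes "pj permutes {1..b}" "pj' permutes {1..b}" "i ~= j"
 shows "loc b i pj o loc b j pj' = loc b j pj' o loc b i pj"
proof
 fix x
 let ?D = "%i. {b * i + 1..b * i + b}"
 have m: "loc b l rh y \<in> ?D l" if "rh permutes {1..b}" "y \<in> ?D l" for l rh y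
  using permutes_in_image[OF loc_permutes[OF that(1)]] that(2) by blast
 consider "x \<in> ?D i" | "x \<in> ?D j" | "x ~: ?D i" "x ~: ?D j" by blast
 thus "(loc b i pj o loc b j pj') x = (loc b j pj' o loc b i pj) x"
 proof cases
  case 1
  show ?thesis unfolding comp_apply loc_out[OF block_disjoint[OF assms(3) 1]] loc_out[OF block_disjoint[OF assms(3) m[OF assms(1) 1]]] ..
 next
  case 2
  show ?thesis unfolding comp_apply loc_out[OF block_disjoint[OF assms(3)[symmetric] 2]]
  loc_out[OF block_disjoint[OF assms(3)[symmetric] m[OF assms(2) 2]]] ..
 next
  case 3
  show ?thesis unfolding comp_apply loc_out[OF 3(1)] loc_out[OF 3(2)] loc_out[OF 3(1)] ..
 qed
qed

text \<open>The list L is an element of the group algebra of S_b, here acting on the positions of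
  the i-th block.\<close>

definition lop :: "nat => ('k \<times> (nat => nat)) list => nat => (word => 'k) => word => 'k::field" where
 "lop b L i f = (\<Sum>(c, pj)\<leftarrow>L. (%u. c * act (loc b i pj) f u))"

primrec iter :: "(nat => (word => 'k) => word => 'k) => nat => (word => 'k) => word => 'k::field" where
 "iter T 0 f = f"
| "iter T (Suc l) f = T l (iter T l f)"

text \<open>\<open>La\<close>, \<open>Lt\<close> and \<open>Lnu\<close> stand for elements alpha,
  tau and nu of the group algebra of S_b, to be applied in each of q blocks of length b. The
  predicate \<open>sp\<close> selects the letters that are to be counted. They are never a
  \<open>V j\<close>, so delta kills the words that consist of them.\<close>

locale blocks = char2 K for K :: "'k::field itself" +
 fixes b q d :: nat and sp :: "letter => bool" and La Lt Lnu :: "('k \<times> (nat => nat)) list"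
 assumes b: "0 < b" and qd: "b * q \<le> d"
  and perms: "!!c pj. (c, pj) \<in> set La \<union> set Lt \<union> set Lnu ==> pj permutes {1..b}"
  and sp: "!!l j. sp l ==> l ~= V j"
begin

abbreviation "blk i \<equiv> {b * i + 1..b * i + b}"
abbreviation "OP L \<equiv> lop b L"

definition special :: "nat => word => bool" where
 "special i u \<longleftrightarrow> (EX l. sp l & (\<forall>c \<in> {1..b}. u (b * i + c) = l))"

text \<open>T involves only the positions of block i, and hence commutes with all group algebra
  elements placed in the other blocks.\<close>

definition local_op :: "nat => ((word => 'k) => word => 'k) => bool" where
 "local_op i T \<longleftrightarrow> lin T & (ALL x f. x ~: blk i --> T (der x f) = der x (T f)) &
  (ALL sz f. sz permutes {1..d} --> (\<forall>x \<in> blk i. sz x = x) --> T (pm sz f) = pm sz (T f))"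

definition good_list :: "('k \<times> (nat => nat)) list => bool" where
 "good_list L \<longleftrightarrow> (\<forall>(c, pj) \<in> set L. pj permutes {1..b})"

lemma good_lists: "good_list La" "good_list Lt" "good_list Lnu"
 using perms by (auto simp: good_list_def)

lemma blk_sub: "i < q ==> blk i \<subseteq> {1..b * q}" "i < q ==> blk i \<subseteq> {1..d}"
proof -
 assume "i < q"
 hence "b * i + b \<le> b * q" using mult_le_mono2[of "Suc i" q b] by simp
 thus "blk i \<subseteq> {1..b * q}" "blk i \<subseteq> {1..d}" using qd by auto
qed

lemma loc_perm: "i < q ==> pj permutes {1..b} ==> loc b i pj permutes {1..d}"
 by (rule permutes_subset[OF loc_permutes blk_sub(2)])

lemma lop_Nil: "OP [] i f = 0" by (simp add: lop_def)

lemma lop_Cons: "OP ((c, pj) # L) i f = (%u. c * act (loc b i pj) f u) + OP L i f" by (simp add: lop_def)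

lemma good_Cons: "good_list ((c, pj) # L) \<longleftrightarrow> pj permutes {1..b} & good_list L" by (auto simp: good_list_def)

lemma lin_scale: "lin T ==> lin (%f u. (c::'k) * T f u)"
 by (auto simp: lin_def fun_eq_iff algebra_simps)

lemma lin_lop: "i < q ==> good_list L ==> lin (OP L i)"
proof (induction L)
 case Nil
 show ?case by (simp add: lop_Nil lin_def fun_eq_iff)
next
 case (Cons p L)
 obtain c pj where p: "p = (c, pj)" by (cases p)
 have g: "pj permutes {1..b}" "good_list L" using Cons(3) good_Cons by (auto simp: p)
 have e: "OP (p # L) i = (%f. (%u. c * act (loc b i pj) f u) + OP L i f)" unfolding p by (rule ext) (rule lop_Cons)
 show ?case unfolding e by (rule lin_add[OF lin_scale[OF lin_act[OF loc_perm[OF Cons(2) g(1)]]] Cons(1)[OF Cons(2) g(2)]])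
qed

lemma lop_transfer:
 assumes T: "lin T" and P: "!!pj. pj permutes {1..b} ==> T (act (loc b i pj) f) = act (loc b j pj) (T f)"
  and L: "good_list L"
 shows "T (OP L i f) = OP L j (T f)"
 using L
proof (induction L)
 case Nil
 show ?case unfolding lop_Nil by (rule lin_zero[OF T])
next
 case (Cons p L)
 obtain c pj where p: "p = (c, pj)" by (cases p)
 have g: "pj permutes {1..b}" "good_list L" using Cons(2) good_Cons by (auto simp: p)
 show ?case unfolding p lop_Cons linD[OF T] P[OF g(1)] Cons(1)[OF g(2)] ..
qed

lemma on_lop: "i < q ==> good_list L ==> stable d A ==> on A f ==> on A (OP L i f)"
proof (induction L)
 case Nil
 show ?case unfolding lop_Nil by (rule on_zero)
next
 case (Cons p L)
 obtain c pj where p: "p = (c, pj)" by (cases p)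
 have g: "pj permutes {1..b}" "good_list L" using Cons(3) good_Cons by (auto simp: p)
 show ?case unfolding p lop_Cons
  by (rule on_add[OF on_scale[OF on_act[OF Cons(4) loc_perm[OF Cons(2) g(1)] Cons(5)]] Cons(1)[OF Cons(2) g(2) Cons(4,5)]])
qed

lemma ghom_lop:
 assumes a: "ghom d A B al" and i: "i < q" and L: "good_list L" and f: "on A f"
 shows "al (OP L i f) = OP L i (al f)"
 by (rule lop_transfer[OF ghomD(1)[OF a] _ L]) (rule ghomD(3)[OF a loc_perm[OF i] f])

lemma local_lop:
 assumes T: "local_op i T" and ij: "i ~= j" "j < q" and L: "good_list L"
 shows "T (OP L j f) = OP L j (T f)"
proof -
 have l: "lin T" using T unfolding local_op_def by blast
 show ?thesis
 proof (rule lop_transfer[OF l _ L])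
 fix pj assume p: "pj permutes {1..b}"
 show "T (act (loc b j pj) f) = act (loc b j pj) (T f)"
 proof (rule act_transfer[OF loc_perm[OF ij(2) p] linD(1)[OF l]])
  fix x X and f :: "word => 'k" assume "X \<in> Inv (loc b j pj)" "x \<in> X"
  hence "x \<in> blk j" using Inv_subset[OF loc_permutes[OF p]] by blast
  hence "x ~: blk i" by (rule block_disjoint[OF ij(1)[symmetric]])
  thus "T (der x f) = der x (T f)" using T unfolding local_op_def by blast
 next
  fix f :: "word => 'k"
  have "\<forall>x \<in> blk i. loc b j pj x = x" using loc_out[OF block_disjoint[OF ij(1)]] by blast
  thus "T (pm (loc b j pj) f) = pm (loc b j pj) (T f)" using T loc_perm[OF ij(2) p] unfolding local_op_def by blast
 qed
 qed
qed

lemma lop_lop: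
 assumes ij: "i ~= j" "i < q" "j < q" and L: "good_list L" "good_list L'"
 shows "OP L i (OP L' j f) = OP L' j (OP L i f)"
proof (rule lop_transfer[OF lin_lop[OF ij(2) L(1)] _ L(2)])
 fix pj assume p: "pj permutes {1..b}"
 show "OP L i (act (loc b j pj) f) = act (loc b j pj) (OP L i f)"
 proof (rule lop_transfer[OF lin_act[OF loc_perm[OF ij(3) p]] _ L(1), symmetric])
  fix pj' assume p': "pj' permutes {1..b}"
  show "act (loc b j pj) (act (loc b i pj') f) = act (loc b i pj') (act (loc b j pj) f)"
  unfolding act_comp[OF loc_perm[OF ij(3) p] loc_perm[OF ij(2) p'], symmetric]
   act_comp[OF loc_perm[OF ij(2) p'] loc_perm[OF ij(3) p], symmetric] loc_commute[OF p p' ij(1)[symmetric]] ..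
 qed
qed

text \<open>A copy of S_q: the permutations of the blocks that keep the order inside each
  block.\<close>

definition Grp :: "(nat => nat) set" where
 "Grp = {g. g permutes {1..b * q} & (\<forall>i < q. \<exists>j < q. \<forall>c \<in> {1..b}. g (b * i + c) = b * j + c)}"

definition N :: "(word => 'k) => word => 'k" where
 "N f = (\<Sum>g \<in> Grp. act g f)"

text \<open>The span, in the functions supported in A, of the images of tau in the various
  blocks.\<close>

definition Y :: "word set => (word => 'k) => bool" where
 "Y A F \<longleftrightarrow> (EX h. (\<forall>i < q. on A (h i)) & F = (\<Sum>i<q. OP Lt i (h i)))"

lemma finite_Grp: "finite Grp"
 by (rule finite_subset[OF _ finite_permutations[of "{1..b * q}"]]) (auto simp: Grp_def)

lemma Grp_perm: "g \<in> Grp ==> g permutes {1..d}"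
 using qd by (auto simp: Grp_def intro: permutes_subset)

lemma Y_zero: "Y A 0"
 unfolding Y_def
proof (intro exI[of _ "%i. 0"] conjI allI impI on_zero)
 show "0 = (\<Sum>i<q. OP Lt i 0)" by (rule sum.neutral[symmetric]) (simp add: lin_zero[OF lin_lop] good_lists)
qed

lemma Y_add:
 assumes "Y A F" "Y A F'"
 shows "Y A (F + F')"
proof -
 obtain h h' where h: "\<forall>i < q. on A (h i)" "F = (\<Sum>i<q. OP Lt i (h i))" "\<forall>i < q. on A (h' i)" "F' = (\<Sum>i<q. OP Lt i (h' i))"
  using assms unfolding Y_def by blast
 show ?thesis unfolding Y_def
 proof (intro exI[of _ "%i. h i + h' i"] conjI allI impI)
  show "on A (h i + h' i)" if "i < q" for i using h that by (intro on_add) blast+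
  show "F + F' = (\<Sum>i<q. OP Lt i (h i + h' i))" unfolding h(2,4) sum.distrib[symmetric]
  by (rule sum.cong[OF refl]) (simp add: linD(1)[OF lin_lop] good_lists)
 qed
qed

lemma Y_single:
 assumes i: "i < q" and h: "on A h"
 shows "Y A (OP Lt i h)"
 unfolding Y_def
proof (intro exI[of _ "%j. if j = i then h else 0"] conjI allI impI)
 show "on A (if j = i then h else 0)" for j by (cases "j = i") (simp_all only: if_True if_False simp_thms h on_zero)
 have "(\<Sum>j<q. OP Lt j (if j = i then h else 0)) = (\<Sum>j<q. if j = i then OP Lt i h else 0)"
  by (rule sum.cong[OF refl]) (simp add: lin_zero[OF lin_lop] good_lists)
 also have "... = OP Lt i h" using i by simp
 finally show "OP Lt i h = (\<Sum>j<q. OP Lt j (if j = i then h else 0))" by (rule sym)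
qed

lemma Y_sum: "(!!x. x \<in> S ==> Y A (F x)) ==> Y A (sum F S)"
 by (induction S rule: infinite_finite_induct) (simp_all add: Y_zero Y_add)

lemma Y_lop:
 assumes A: "stable d A" and L: "good_list L" and j: "j < q" and c: "!!h. OP L j (OP Lt j h) = OP Lt j (OP L j h)" and F: "Y A F"
 shows "Y A (OP L j F)"
proof -
 obtain h where h: "\<forall>i < q. on A (h i)" "F = (\<Sum>i<q. OP Lt i (h i))" using F unfolding Y_def by blast
 have e: "OP L j F = (\<Sum>i<q. OP L j (OP Lt i (h i)))" unfolding h(2) by (rule lin_sum[OF lin_lop[OF j L]])
 have y: "Y A (OP L j (OP Lt i (h i)))" if i: "i < q" for i
 proof -
  have "OP L j (OP Lt i (h i)) = OP Lt i (OP L j (h i))"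
  proof (cases "j = i")
  case True
  thus ?thesis using c by simp
  next
  case False
  show ?thesis by (rule lop_lop[OF False j i L good_lists(2)])
  qed
  thus ?thesis using Y_single[OF i on_lop[OF j L A, of "h i"]] h(1) i by simp
 qed
 show ?thesis unfolding e by (rule Y_sum, rule y) simp
qed

lemma Grp_lop:
 assumes g: "g \<in> Grp" and i: "i < q" and L: "good_list L"
 obtains j where "j < q" "!!f. act g (OP L i f) = OP L j (act g f)"
proof -
 obtain j where j: "j < q" "\<forall>c \<in> {1..b}. g (b * i + c) = b * j + c" using g i unfolding Grp_def by blast
 have gp: "g permutes {1..d}" by (rule Grp_perm[OF g])
 have e: "g o loc b i pj = loc b j pj o g" if p: "pj permutes {1..b}" for pj
 proof
  fix x
  show "(g o loc b i pj) x = (loc b j pj o g) x"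
  proof (cases "x \<in> blk i")
  case True
  then obtain c where c: "c \<in> {1..b}" "x = b * i + c" using in_block by blast
  have "pj c \<in> {1..b}" using permutes_in_image[OF p] c(1) by blast
  thus ?thesis unfolding comp_apply c(2) loc_block[OF c(1)] using j(2) c(1) loc_block[OF c(1)] by simp
  next
  case False
  have "g x ~: blk j"
  proof
   assume "g x \<in> blk j"
   then obtain c where c: "c \<in> {1..b}" "g x = b * j + c" using in_block by blast
   hence "g x = g (b * i + c)" using j(2) by simp
   hence "x = b * i + c" by (rule injD[OF permutes_inj[OF gp]])
   thus False using False c(1) by simp
  qed
  thus ?thesis using loc_out[OF False] loc_out by simp
  qed
 qed
 show ?thesis
 proof (rule that[OF j(1)])
  fix f
  show "act g (OP L i f) = OP L j (act g f)"
  proof (rule lop_transfer[OF lin_act[OF gp] _ L])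
  fix pj assume p: "pj permutes {1..b}"
  show "act g (act (loc b i pj) f) = act (loc b j pj) (act g f)"
   unfolding act_comp[OF gp loc_perm[OF i p], symmetric] act_comp[OF loc_perm[OF j(1) p] gp, symmetric] e[OF p] ..
  qed
 qed
qed

lemma Y_N:
 assumes A: "stable d A" and F: "Y A F"
 shows "Y A (N F)"
proof -
 obtain h where h: "\<forall>i < q. on A (h i)" "F = (\<Sum>i<q. OP Lt i (h i))" using F unfolding Y_def by blast
 show ?thesis unfolding N_def
 proof (rule Y_sum)
  fix g assume g: "g \<in> Grp"
  have e: "act g F = (\<Sum>i<q. act g (OP Lt i (h i)))" unfolding h(2) by (rule lin_sum[OF lin_act[OF Grp_perm[OF g]]])
  have y: "Y A (act g (OP Lt i (h i)))" if i: "i < q" for i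
  proof -
  obtain j where j: "j < q" "!!f. act g (OP Lt i f) = OP Lt j (act g f)" using Grp_lop[OF g i good_lists(2)] by blast
  show ?thesis unfolding j(2) by (rule Y_single[OF j(1) on_act[OF A Grp_perm[OF g]]]) (use h(1) i in blast)
  qed
  show "Y A (act g F)" unfolding e by (rule Y_sum, rule y) simp
 qed
qed

lemma iter_on: "(!!i f. i < q ==> on A f ==> on A (T i f)) ==> l \<le> q ==> on A f ==> on A (iter T l f)"
 by (induction l) simp_all

lemma iter_lin: "(!!i. i < q ==> lin (T i :: (word => 'k) => word => 'k)) ==> l \<le> q ==> lin (iter T l)"
proof (induction l)
 case 0
 have "iter T 0 = (%f. f)" by (rule ext) simp
 thus ?case using lin_id by simp
next
 case (Suc l)
 have "iter T (Suc l) = (%f. T l (iter T l f))" by (rule ext) simp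
 thus ?case using lin_comp[OF Suc(2)[of l] Suc(1)] Suc(2,3) by simp
qed

lemma iter_lop_commute:
 assumes T: "!!i. i < q ==> local_op i (T i)" and L: "good_list L" and j: "j < q"
 shows "l \<le> j ==> iter T l (OP L j f) = OP L j (iter T l f)"
 by (induction l) (use local_lop[OF T _ j L] j in auto)

lemma block_decomp:
 assumes "x \<in> {1..b * q}"
 obtains i c where "i < q" "c \<in> {1..b}" "x = b * i + c"
proof -
 have "1 \<le> x" "x \<le> b * q" using assms by auto
 hence "x - 1 < b * q" by linarith
 hence "x - 1 < q * b" by (subst mult.commute)
 hence "(x - 1) div b < q" by (rule less_mult_imp_div_less)
 moreover have "(x - 1) mod b + 1 \<in> {1..b}" using mod_less_divisor[OF b, of "x - 1"] by simp
 moreover have "x = b * ((x - 1) div b) + ((x - 1) mod b + 1)" using mult_div_mod_eq[of b "x - 1"] assms by simp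
 ultimately show ?thesis by (rule that)
qed

lemma Grp_image:
 assumes g: "g \<in> Grp" and j: "j < q"
 shows "\<exists>i < q. \<forall>c \<in> {1..b}. g (b * i + c) = b * j + c"
proof -
 have gp: "g permutes {1..b * q}" using g by (simp add: Grp_def)
 have j1: "b * j + 1 \<in> blk j" using b by simp
 hence "b * j + 1 \<in> {1..b * q}" using blk_sub(1)[OF j] by blast
 hence "inv' g (b * j + 1) \<in> {1..b * q}" using permutes_in_image[OF permutes_inv[OF gp]] by blast
 then obtain i c where i: "i < q" "c \<in> {1..b}" "inv' g (b * j + 1) = b * i + c" by (rule block_decomp)
 obtain l where l: "l < q" "\<forall>c \<in> {1..b}. g (b * i + c) = b * l + c" using g i(1) unfolding Grp_def by blast
 have "b * j + 1 = g (b * i + c)" using permutes_inverses(1)[OF gp, of "b * j + 1"] i(3) by simp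
 hence e: "b * j + 1 = b * l + c" using l(2) i(2) by simp
 have "b * l + c \<in> blk l" using i(2) by auto
 hence "b * j + 1 \<in> blk l" using e by simp
 hence "l = j" using block_disjoint[of j l "b * j + 1" b] j1 by blast
 thus ?thesis using i(1) l(2) by blast
qed

text \<open>On words all of whose blocks are special, delta vanishes at every position that a
  permutation of the blocks can move. The factors \<open>hop X\<close> then act as the
  identity.\<close>

lemma act_special:
 assumes F: "!!u i. F u ~= 0 ==> i < q ==> special i u" and g: "g \<in> Grp"
 shows "act g F = pm g F"
proof -
 have gp: "g permutes {1..b * q}" using g by (simp add: Grp_def)
 have dz: "der x F = 0" if x: "x \<in> {1..b * q}" for x
 proof
  fix u
  show "der x F u = 0 u"
  proof (cases "u x")
  case (W a)
  obtain i c where iq: "i < q" and c: "c \<in> {1..b}" and xc: "x = b * i + c" by (rule block_decomp[OF x])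
  have "F (u(x := V a)) = 0"
  proof (rule ccontr)
   assume "F (u(x := V a)) ~= 0"
   then obtain l where l: "sp l" "\<forall>c \<in> {1..b}. (u(x := V a)) (b * i + c) = l" using F[OF _ iq] unfolding special_def by blast
   have "(u(x := V a)) (b * i + c) = l" using l(2) c by blast
   hence "V a = l" using xc by simp
   thus False using sp[OF l(1)] by blast
  qed
  thus ?thesis by (simp add: der_def W)
  qed (simp_all add: der_def)
 qed
 have "hops S F = F" if "finite S" "S \<subseteq> Inv g" for S
  using that
 proof (induction S rule: finite_induct)
  case (insert X S)
  obtain x y where X: "X = {x, y}" using insert(4) by (auto simp: Inv_def)
  have "y \<in> {1..b * q}" using Inv_subset[OF gp, of X] insert(4) X by auto
  thus ?case using insert by (simp add: hops_insert X hop_doubleton dz)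
 qed simp
 from this[OF finite_Inv[OF gp] order_refl] show ?thesis by (simp add: act_def)
qed

definition bswap :: "nat => nat => nat => nat" where
 "bswap i j x = (if x \<in> blk i then x - b * i + b * j else if x \<in> blk j then x - b * j + b * i else x)"

lemma bswap_block: "i ~= j ==> c \<in> {1..b} ==> bswap i j (b * l + c) = b * (if l = i then j else if l = j then i else l) + c"
proof -
 assume ij: "i ~= j" and c: "c \<in> {1..b}"
 have l: "b * l + c \<in> blk l" using c by auto
 consider "l = i" | "l = j" "l ~= i" | "l ~= i" "l ~= j" by blast
 thus ?thesis
 proof cases
  case 1
  thus ?thesis using l by (simp add: bswap_def)
 next
  case 2
  have "b * l + c ~: blk i" using block_disjoint[OF 2(2) l] .
  thus ?thesis unfolding bswap_def if_not_P[OF \<open>b * l + c ~: blk i\<close>] using 2 l by simp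
 next
  case 3
  have n: "b * l + c ~: blk i" "b * l + c ~: blk j" using block_disjoint[OF _ l] 3 by blast+
  thus ?thesis unfolding bswap_def if_not_P[OF n(1)] if_not_P[OF n(2)] using 3 by simp
 qed
qed

lemma bswap_out: "x ~: blk i ==> x ~: blk j ==> bswap i j x = x"
 by (simp only: bswap_def if_False)

lemma bswap_bswap:
 assumes "i ~= j"
 shows "bswap i j (bswap i j x) = x"
proof (cases "x \<in> blk i \<or> x \<in> blk j")
 case True
 then obtain l c where c: "c \<in> {1..b}" "x = b * l + c" "l = i \<or> l = j" using in_block by blast
 show ?thesis unfolding c(2) bswap_block[OF assms c(1)] using c(3) assms by auto
next
 case False
 hence n: "x ~: blk i" "x ~: blk j" by blast+
 show ?thesis by (simp only: bswap_out[OF n])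
qed

lemma bswap_Grp:
 assumes ij: "i ~= j" "i < q" "j < q"
 shows "bswap i j \<in> Grp"
proof -
 have "bij (bswap i j)" by (rule o_bij[of "bswap i j"]) (auto simp: fun_eq_iff bswap_bswap[OF ij(1)])
 moreover have "bswap i j x = x" if "x ~: {1..b * q}" for x
  by (rule bswap_out) (use that blk_sub(1)[OF ij(2)] blk_sub(1)[OF ij(3)] in blast)+
 ultimately have "bswap i j permutes {1..b * q}" unfolding permutes_def by (metis bij_pointE)
 moreover have "\<exists>l' < q. \<forall>c \<in> {1..b}. bswap i j (b * l + c) = b * l' + c" if "l < q" for l
  by (rule exI[of _ "if l = i then j else if l = j then i else l"]) (use bswap_block[OF ij(1)] ij that in auto)
 ultimately show ?thesis by (simp add: Grp_def)
qed

lemma Grp_comp: "g \<in> Grp ==> h \<in> Grp ==> g o h \<in> Grp"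
proof -
 assume g: "g \<in> Grp" and h: "h \<in> Grp"
 have "\<exists>l < q. \<forall>c \<in> {1..b}. (g o h) (b * i + c) = b * l + c" if i: "i < q" for i
 proof -
  obtain j where j: "j < q" "\<forall>c \<in> {1..b}. h (b * i + c) = b * j + c" using h i unfolding Grp_def by blast
  obtain l where l: "l < q" "\<forall>c \<in> {1..b}. g (b * j + c) = b * l + c" using g j(1) unfolding Grp_def by blast
  show ?thesis using j(2) l by auto
 qed
 thus ?thesis using g h by (auto simp: Grp_def intro: permutes_compose)
qed

text \<open>With fewer than q letters at hand, two of the q special blocks of a word carry the same
  letter. Exchanging these two blocks fixes the word and pairs off the terms of the norm.\<close>

lemma N_special:
 assumes F: "!!u i. F u ~= 0 ==> i < q ==> special i u"
  and S: "finite S" "card S < q" "!!u x. F u ~= 0 ==> x \<in> {1..b * q} ==> u x \<in> S"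
 shows "N F = 0"
proof
 fix u
 have e: "act g F = pm g F" if g: "g \<in> Grp" for g
 proof (rule act_special[OF _ g])
  fix u i assume "F u ~= 0" "i < q"
  thus "special i u" by (rule F)
 qed
 have Nu: "N F u = (\<Sum>g \<in> Grp. F (u o g))"
  unfolding N_def sum_fun_apply
 proof (rule sum.cong[OF refl])
  fix g assume g: "g \<in> Grp"
  show "act g F u = F (u o g)" using fun_cong[OF e[OF g], of u] by (simp only: pm_def)
 qed
 show "N F u = 0 u"
 proof (cases "\<exists>g \<in> Grp. F (u o g) ~= 0")
  case False
  thus ?thesis using Nu by simp
 next
  case True
  then obtain g where g: "g \<in> Grp" "F (u o g) ~= 0" by blast
  define v where "v = u o g"
  have c1: "1 \<in> {1..b}" using b by simp
  have sub: "(%i. v (b * i + 1)) ` {..<q} \<subseteq> S"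
  using S(3)[OF g(2)[folded v_def]] blk_sub(1) c1 by fastforce
  have "card ((%i. v (b * i + 1)) ` {..<q}) < card {..<q}" using card_mono[OF S(1) sub] S(2) by simp
  hence "\<not> inj_on (%i. v (b * i + 1)) {..<q}" using card_image by fastforce
  then obtain i j where ij: "i < q" "j < q" "i ~= j" "v (b * i + 1) = v (b * j + 1)" unfolding inj_on_def by blast
  obtain l where l: "\<forall>c \<in> {1..b}. v (b * i + c) = l" using F[OF g(2)[folded v_def] ij(1)] unfolding special_def by blast
  obtain l' where l': "\<forall>c \<in> {1..b}. v (b * j + c) = l'" using F[OF g(2)[folded v_def] ij(2)] unfolding special_def by blast
  have ll: "l' = l" using l l' ij(4) c1 by metis
  have vs: "v o bswap i j = v"
  proof
  fix x
  show "(v o bswap i j) x = v x"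
  proof (cases "x \<in> blk i \<or> x \<in> blk j")
   case True
   then obtain m c where c: "c \<in> {1..b}" "x = b * m + c" "m = i \<or> m = j" using in_block by blast
   show ?thesis unfolding comp_apply c(2) bswap_block[OF ij(3) c(1)] using c(1,3) l l' ll ij(3) by auto
  next
   case False
   hence n: "x ~: blk i" "x ~: blk j" by blast+
   show ?thesis by (simp only: comp_apply bswap_out[OF n])
  qed
  qed
  define s where "s = g o (bswap i j o inv' g)"
  have gp: "g permutes {1..b * q}" using g(1) by (simp add: Grp_def)
  have us: "u o s = u"
  proof -
  have "u o s = (v o bswap i j) o inv' g" unfolding s_def v_def by (simp only: comp_assoc)
  also have "... = u o (g o inv' g)" unfolding vs unfolding v_def by (simp only: comp_assoc)
  finally show ?thesis by (simp only: permutes_inv_o(1)[OF gp] comp_id)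
  qed
  \<comment> \<open>The equal blocks belong to v = u o g, where F does not vanish; translating the
    sum by g puts v in the place of u.\<close>
  have "(\<Sum>h \<in> Grp. F (u o h)) = (\<Sum>h \<in> Grp. F (u o (g o h)))"
  proof (rule sum.reindex_bij_witness[where i = "%h. g o h" and j = "%h. inv' g o h"])
  have gi: "inv' g \<in> Grp"
  proof -
   have "\<exists>i < q. \<forall>c \<in> {1..b}. inv' g (b * j + c) = b * i + c" if j: "j < q" for j
   proof -
    obtain i where i: "i < q" "\<forall>c \<in> {1..b}. g (b * i + c) = b * j + c" using Grp_image[OF g(1) j] by blast
    have "inv' g (b * j + c) = b * i + c" if "c \<in> {1..b}" for c
    using permutes_inverses(2)[OF gp, of "b * i + c"] bspec[OF i(2) that] by simp
    thus ?thesis using i(1) by blast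
   qed
   thus ?thesis using permutes_inv[OF gp] by (simp add: Grp_def)
  qed
  fix h :: "nat => nat"
  show "g o (inv' g o h) = h" unfolding comp_assoc[symmetric] permutes_inv_o(1)[OF gp] by simp
  show "inv' g o (g o h) = h" unfolding comp_assoc[symmetric] permutes_inv_o(2)[OF gp] by simp
  show "F (u o (g o (inv' g o h))) = F (u o h)" unfolding comp_assoc[symmetric, of g] permutes_inv_o(1)[OF gp] by simp
  show "h \<in> Grp ==> inv' g o h \<in> Grp" by (rule Grp_comp[OF gi])
  show "h \<in> Grp ==> g o h \<in> Grp" by (rule Grp_comp[OF g(1)])
  qed
  also have "... = (\<Sum>h \<in> Grp. F (v o h))" unfolding v_def by (simp only: comp_assoc)
  also have "... = 0"
  proof (rule sum_involution[OF finite_Grp, where qf = "%h. bswap i j o h"])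
  fix h assume h: "h \<in> Grp"
  show "bswap i j o h \<in> Grp" by (rule Grp_comp[OF bswap_Grp[OF ij(3,1,2)] h])
  show "bswap i j o (bswap i j o h) = h" by (simp add: fun_eq_iff bswap_bswap[OF ij(3)])
  show "F (v o (bswap i j o h)) = F (v o h)" unfolding comp_assoc[symmetric] vs ..
  show "bswap i j o h ~= h"
  proof
   assume e: "bswap i j o h = h"
   have hp: "h permutes {1..b * q}" using h by (simp add: Grp_def)
   have "bswap i j (b * i + 1) = b * i + 1"
    using fun_cong[OF e, of "inv' h (b * i + 1)"] permutes_inverses(1)[OF hp] by simp
   thus False using bswap_block[OF ij(3) c1, of i] ij(3) b by simp
  qed
  qed
  finally show ?thesis using Nu by simp
 qed
qed

text \<open>On functions killed by nu, \<open>ez\<close> is a normal form of alpha modulo the image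
  of tau. Applied in all blocks, the product of the alphas takes such a function on B, modulo
  \<open>Y\<close>, to one supported on words with all blocks special, and this is killed by
  \<open>N\<close> for lack of letters. So on B, being killed by nu implies that \<open>N\<close> of
  the product of the alphas lies in \<open>Y\<close>, and \<open>dominated_transfer\<close> carries
  this implication to A. There it fails for f0, whose product of alphas is a word w with q different
  special letters: the product of the \<open>\<eta> i\<close> kills \<open>Y\<close> but fixes the
  norm of w, in which w has coefficient 1.\<close>

theorem obstruction:
 fixes ez \<eta> :: "nat => (word => 'k) => word => 'k"
 assumes A: "stable d A" and B: "stable d B" and f0: "on A f0" "!!i. i < q ==> OP Lnu i f0 = 0" "iter (OP La) q f0 = unitw w"
  and w: "!!i c. i < q ==> c \<in> {1..b} ==> w (b * i + c) = l i" "!!i. i < q ==> sp (l i)" "inj_on l {..<q}"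
  and at: "!!i h. i < q ==> OP La i (OP Lt i h) = OP Lt i (OP La i h)"
  and \<eta>: "!!i. i < q ==> local_op i (\<eta> i)" "!!i h. i < q ==> \<eta> i (OP Lt i h) = 0"
  "!!i F. i < q ==> (!!u. F u ~= 0 ==> special i u) ==> \<eta> i F = F"
  and ez: "!!i. i < q ==> local_op i (ez i)" "!!i f. i < q ==> on B f ==> on B (ez i f)"
  "!!i f u. i < q ==> ez i f u ~= 0 ==> special i u"
  "!!i f. i < q ==> on B f ==> OP Lnu i f = 0 ==> EX h. on B h & OP La i f = ez i f + OP Lt i h"
  "!!i j f u. i < q ==> j < q ==> (!!u. f u ~= 0 ==> special i u) ==> j ~= i ==> ez j f u ~= 0 ==> special i u"
  and S: "finite S" "card S < q" "!!u x l. u \<in> B ==> x \<in> {1..d} ==> sp (u x) ==> u x \<in> S"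
 shows "\<not> dominated TYPE('k) d A B"
proof
 assume dom: "dominated TYPE('k) d A B"
 have "Y A (N (iter (OP La) q f0))"
 proof (rule dominated_transfer[OF dom f0(1), where X = "%A f. \<forall>i < q. OP Lnu i f = 0" and Y = "%A f. Y A (N (iter (OP La) q f))"])
  show "\<forall>i < q. OP Lnu i f0 = 0" using f0(2) by blast
  fix al :: "(word => 'k) => word => 'k" and f :: "word => 'k" assume a: "ghom d A B al" "on A f" "\<forall>i < q. OP Lnu i f = 0"
  show "\<forall>i < q. OP Lnu i (al f) = 0"
  using ghom_lop[OF a(1) _ good_lists(3) a(2)] a(3) lin_zero[OF ghomD(1)[OF a(1)]] by metis
 next
  fix f :: "word => 'k" assume f: "on B f" "\<forall>i < q. OP Lnu i f = 0"
  have onez: "on B (iter ez l f)" if "l \<le> q" for l by (rule iter_on[OF ez(2) that f(1)])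
  \<comment> \<open>One block after another: errors from earlier blocks stay in \<open>Y\<close>,
    because alpha commutes with tau in its own block by \<open>at\<close> and with everything placed
    in other blocks.\<close>
  have "Y B (iter (OP La) l f + iter ez l f)" if "l \<le> q" for l
  using that
  proof (induction l)
  case 0
  show ?case unfolding iter.simps add_self_fun by (rule Y_zero)
  next
  case (Suc l)
  have l: "l < q" using Suc(2) by simp
  have "OP Lnu l (iter ez l f) = iter ez l (OP Lnu l f)"
   by (rule iter_lop_commute[OF ez(1) good_lists(3) l order_refl, symmetric])
  also have "... = iter ez l 0" using f(2) l by simp
  also have "... = 0"
   by (rule lin_zero[OF iter_lin]) (use ez(1) l in \<open>auto simp: local_op_def\<close>)
  finally have n0: "OP Lnu l (iter ez l f) = 0" .
  obtain h where h: "on B h" "OP La l (iter ez l f) = ez l (iter ez l f) + OP Lt l h"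
   using ez(4)[OF l onez[OF less_imp_le[OF l]] n0] by blast
  have "Y B (OP La l (iter (OP La) l f + iter ez l f) + OP Lt l h)"
   by (rule Y_add[OF Y_lop[OF B good_lists(1) l at[OF l] Suc(1)] Y_single[OF l h(1)]]) (use l in simp)
  moreover have "OP La l (iter (OP La) l f + iter ez l f) + OP Lt l h = iter (OP La) (Suc l) f + iter ez (Suc l) f"
   unfolding linD(1)[OF lin_lop[OF l good_lists(1)]] h(2) iter.simps
   by (simp only: add.assoc add_self_fun add_0_right)
  ultimately show ?case by (simp only:)
  qed
  hence y: "Y B (N (iter (OP La) q f + iter ez q f))" by (intro Y_N[OF B]) simp
  have spez: "special i u" if "k \<le> q" "i < k" "iter ez k f u ~= 0" for k i u
  using that
  proof (induction k arbitrary: u)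
  case (Suc k)
  show ?case
  proof (cases "i = k")
   case True
   thus ?thesis using ez(3)[of k "iter ez k f" u] Suc(2,4) by simp
  next
   case False
   have ik: "i < k" using False Suc(3) by simp
   show ?thesis
    by (rule ez(5)[of i k "iter ez k f" u]) (use Suc ik in auto)
  qed
  qed simp
  have spq: "special i u" if "iter ez q f u ~= 0" "i < q" for i u by (rule spez[OF order_refl that(2,1)])
  have "N (iter ez q f) = 0"
  proof (rule N_special[OF spq S(1,2)])
  fix u x assume nz: "iter ez q f u ~= 0" and x: "x \<in> {1..b * q}"
  obtain i c where iq: "i < q" and c: "c \<in> {1..b}" and xc: "x = b * i + c" by (rule block_decomp[OF x])
  have "special i u" by (rule spq[OF nz iq])
  then obtain l' where l: "sp l'" "\<forall>c \<in> {1..b}. u (b * i + c) = l'" unfolding special_def by blast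
  have "u x = l'" using bspec[OF l(2) c] xc by simp
  moreover have "u \<in> B" using onez[OF order_refl] nz by (auto simp: on_def)
  ultimately show "u x \<in> S" using S(3)[of u x] l(1) x qd by auto
  qed
  moreover have "N (f1 + f2) = N f1 + N f2" for f1 f2 unfolding N_def sum.distrib[symmetric]
  by (rule sum.cong[OF refl]) (rule linD(1)[OF lin_act[OF Grp_perm]])
  ultimately show "Y B (N (iter (OP La) q f))" using y by simp
 next
  fix bt :: "(word => 'k) => word => 'k" and f :: "word => 'k"
  assume be: "ghom d B A bt" and f: "on B f" and y: "Y B (N (iter (OP La) q f))"
  have onI: "on B (iter (OP La) k f)" if "k \<le> q" for k by (rule iter_on[OF on_lop[OF _ good_lists(1) B] that f])
  have "iter (OP La) k (bt f) = bt (iter (OP La) k f)" if "k \<le> q" for k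
  using that by (induction k) (use ghom_lop[OF be _ good_lists(1) onI] in auto)
  hence "N (iter (OP La) q (bt f)) = N (bt (iter (OP La) q f))" by simp
  also have "... = bt (N (iter (OP La) q f))" unfolding N_def by (rule ghom_sum[OF be onI[OF order_refl] Grp_perm, symmetric])
  finally have e: "N (iter (OP La) q (bt f)) = bt (N (iter (OP La) q f))" .
  obtain h where h: "\<forall>i < q. on B (h i)" "N (iter (OP La) q f) = (\<Sum>i<q. OP Lt i (h i))" using y unfolding Y_def by blast
  have "bt (N (iter (OP La) q f)) = (\<Sum>i<q. OP Lt i (bt (h i)))"
  unfolding h(2) lin_sum[OF ghomD(1)[OF be]] by (rule sum.cong[OF refl]) (use ghom_lop[OF be _ good_lists(2)] h(1) in simp)
  hence e': "N (iter (OP La) q (bt f)) = (\<Sum>i<q. OP Lt i (bt (h i)))" using e by (rule trans[rotated])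
  show "Y A (N (iter (OP La) q (bt f)))" unfolding Y_def
  proof (intro exI[of _ "%i. bt (h i)"] conjI allI impI)
  show "on A (bt (h i))" if "i < q" for i by (rule ghomD(2)[OF be]) (use h(1) that in blast)
  qed (rule e')
 next
  have linq: "lin (iter (OP La) q)" by (rule iter_lin[OF lin_lop[OF _ good_lists(1)] order_refl])
  have "iter (OP La) q 0 = 0" by (rule lin_zero[OF linq])
  moreover have "N 0 = 0" unfolding N_def by (rule sum.neutral) (use lin_zero[OF lin_act[OF Grp_perm]] in blast)
  ultimately show "Y A (N (iter (OP La) q 0))" by (simp add: Y_zero)
  fix f g assume y: "Y A (N (iter (OP La) q f))" "Y A (N (iter (OP La) q g))"
  have "iter (OP La) q (f + g) = iter (OP La) q f + iter (OP La) q g" by (rule linD(1)[OF linq])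
  moreover have "N (f1 + f2) = N f1 + N f2" for f1 f2 unfolding N_def sum.distrib[symmetric]
  by (rule sum.cong[OF refl]) (rule linD(1)[OF lin_act[OF Grp_perm]])
  ultimately show "Y A (N (iter (OP La) q (f + g)))" using Y_add[OF y] by simp
 qed
 then obtain h where h: "N (unitw w) = (\<Sum>i<q. OP Lt i (h i))" unfolding f0(3) Y_def by blast
 have lin\<eta>: "lin (\<eta> i)" if "i < q" for i using \<eta>(1)[OF that] unfolding local_op_def by blast
 have linI: "lin (iter \<eta> k)" if "k \<le> q" for k by (rule iter_lin[OF lin\<eta> that])
 \<comment> \<open>\<open>\<eta>\<close> for another block commutes with tau in block i, and
   \<open>\<eta>\<close> for block i kills it.\<close>
 have z: "iter \<eta> k (OP Lt i h) = 0" if "i < k" "k \<le> q" for i k h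
  using that
 proof (induction k)
  case (Suc k)
  show ?case
  proof (cases "i = k")
  case True
  have "iter \<eta> k (OP Lt i h) = OP Lt i (iter \<eta> k h)"
   by (rule iter_lop_commute[OF \<eta>(1) good_lists(2)]) (use True Suc(3) in auto)
  thus ?thesis using \<eta>(2)[of i] True Suc(3) by simp
  next
  case False
  have kq: "k < q" using Suc(3) by simp
  have e: "iter \<eta> k (OP Lt i h) = 0" by (rule Suc(1)) (use False Suc(2,3) in auto)
  show ?thesis unfolding iter.simps e by (rule lin_zero[OF lin\<eta>[OF kq]])
  qed
 qed simp
 have spw: "special i w" if "i < q" for i unfolding special_def using w(1,2)[OF that] by blast
 have pmw: "act g (unitw w) = (pm g (unitw w) :: word => 'k)" if g: "g \<in> Grp" for g
  by (rule act_special[OF _ g]) (use spw in \<open>auto simp: unitw_def split: if_splits\<close>)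
 have Nsp: "special i u" if nz: "N (unitw w) u ~= 0" and i: "i < q" for i u
 proof -
  obtain g where g: "g \<in> Grp" "act g (unitw w) u ~= (0::'k)" using nz unfolding N_def sum_fun_apply by (meson sum.neutral)
  have ug: "u o g = w" using g(2) unfolding pmw[OF g(1)] by (auto simp: pm_def unitw_def split: if_splits)
  obtain j where j: "j < q" "\<forall>c \<in> {1..b}. g (b * j + c) = b * i + c" using Grp_image[OF g(1) i] by blast
  have "u (b * i + c) = l j" if c: "c \<in> {1..b}" for c
  using bspec[OF j(2) c] fun_cong[OF ug, of "b * j + c"] w(1)[OF j(1) c] by simp
  thus ?thesis unfolding special_def using w(2)[OF j(1)] by blast
 qed
 have "iter \<eta> k (N (unitw w)) = N (unitw w)" if "k \<le> q" for k using that
 proof (induction k)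
  case (Suc k)
  have "\<eta> k (N (unitw w)) = N (unitw w)" by (rule \<eta>(3)) (use Suc(2) Nsp in auto)
  thus ?case using Suc by simp
 qed simp
 hence "N (unitw w) = iter \<eta> q (N (unitw w))" by simp
 also have "... = (\<Sum>i<q. iter \<eta> q (OP Lt i (h i)))" unfolding h by (rule lin_sum[OF linI[OF order_refl]])
 also have "... = 0" by (rule sum.neutral) (use z in auto)
 finally have N0: "N (unitw w) w = 0" by simp
 have "N (unitw w) w = (\<Sum>g \<in> Grp. if g = id then 1 else 0)"
  unfolding N_def sum_fun_apply
 proof (rule sum.cong[OF refl])
  fix g assume g: "g \<in> Grp"
  have gp: "g permutes {1..b * q}" using g by (simp add: Grp_def)
  have "w o g = w \<longleftrightarrow> g = id"
  proof
  assume e: "w o g = w"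
  show "g = id"
  proof
   fix x show "g x = id x"
   proof (cases "x \<in> {1..b * q}")
    case True
    obtain i c where iq: "i < q" and c: "c \<in> {1..b}" and xc1: "x = b * i + c" by (rule block_decomp[OF True])
    note xc = xc1 c
    obtain j where j: "j < q" "g (b * i + c) = b * j + c" using g iq xc(2) unfolding Grp_def by blast
    have "w (b * j + c) = w (b * i + c)" using fun_cong[OF e, of "b * i + c"] j(2) by simp
    hence "l j = l i" using w(1)[OF j(1) xc(2)] w(1)[OF iq xc(2)] by simp
    hence "j = i" using w(3) j(1) iq by (simp add: inj_on_def)
    thus ?thesis unfolding xc1 id_apply using j(2) by simp
   qed (simp add: permutes_not_in[OF gp])
  qed
  qed simp
  thus "act g (unitw w) w = (if g = id then 1 else (0::'k))" unfolding pmw[OF g] by (simp add: pm_def unitw_def)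
 qed
 also have "... = 1"
 proof -
  have "id \<in> Grp" unfolding Grp_def
  proof (intro CollectI conjI allI impI permutes_id)
  show "\<exists>j < q. \<forall>c \<in> {1..b}. id (b * i + c) = b * j + c" if "i < q" for i using that by auto
  qed
  thus ?thesis by (simp only: sum.delta[OF finite_Grp] if_True)
 qed
 finally show False using N0 by simp
qed

end

section \<open>Blocks of length 2: counting the letters One\<close>

fun key :: "letter => nat" where
 "key (One a) = 2 * a" | "key (V j) = 2 * j + 1" | "key (W j) = 2 * j + 1"

text \<open>Colours are numbered injectively, even for \<open>One\<close> and odd for copies of P.
  Comparing these numbers is what breaks the symmetry inside a block.\<close>

lemma key_eq: "key l = key l' \<longleftrightarrow> colour l = colour l'"
 by (cases l; cases l') (auto simp: double_not_eq_Suc_double Suc_double_not_eq_double)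

context char2
begin

definition ones :: "nat => word => bool" where
 "ones i u \<longleftrightarrow> (EX a. u (Suc (2 * i)) = One a & u (Suc (Suc (2 * i))) = One a)"

definition const_one :: "nat => (word => 'k) => word => 'k" where
 "const_one i f u = (if ones i u then f u else 0)"

text \<open>Half of a function that is invariant under the transposition s. Of two different colours
  the increasing order is kept. For two letters of one copy of P, VW is kept, and the value at WW is
  stored at VV, from where s brings it back, since s takes VV to VV + WW.\<close>

definition pairhom :: "nat => (word => 'k) => word => 'k" where
 "pairhom p f u = (if key (u p) < key (u (Suc p)) then f u else
  (case u p of V j => (if u (Suc p) = W j then f u else if u (Suc p) = V j then f (u(p := W j, Suc p := W j)) else 0) | _ => 0))"

lemma act_swap:
 "act (transpose p (Suc p)) g u = g (u o transpose p (Suc p)) +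
  (case u p of W a => (case u (Suc p) of W c => g ((u o transpose p (Suc p))(p := V c, Suc p := V a)) | _ => 0) | _ => (0::'k))"
 unfolding act_adjacent pm_def by (simp add: der_def split: letter.split)

text \<open>Away from two equal letters \<open>One\<close> the block is free over S_2, so an
  invariant is a trace. For two letters of one copy of P, invariance at WW says that the value there
  equals itself plus the value at VV, whence f vanishes at VV.\<close>

lemma pairhom_homotopy:
 assumes f: "act (transpose p (Suc p)) f = f" and u: "\<not> (EX a. u p = One a & u (Suc p) = One a)"
 shows "f u = pairhom p f u + act (transpose p (Suc p)) (pairhom p f) u"
proof -
 let ?s = "transpose p (Suc p)"
 have us: "(u o ?s) p = u (Suc p)" "(u o ?s) (Suc p) = u p" by simp_all
 have rel: "f v = f (v o ?s) + (case v p of W a => (case v (Suc p) of W c => f ((v o ?s)(p := V c, Suc p := V a)) | _ => 0) | _ => 0)" for v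
  using act_swap[of p f v] unfolding f .
 consider "key (u p) < key (u (Suc p))" | "key (u (Suc p)) < key (u p)" | "key (u p) = key (u (Suc p))" by linarith
 thus ?thesis
 proof cases
  case 1
  have "act ?s (pairhom p f) u = 0" unfolding act_swap
  using 1 by (cases "u p"; cases "u (Suc p)") (auto simp: pairhom_def us)
  thus ?thesis using 1 by (simp add: pairhom_def)
 next
  case 2
  have "pairhom p f u = 0" using 2 by (cases "u p"; cases "u (Suc p)") (auto simp: pairhom_def)
  moreover have "act ?s (pairhom p f) u = act ?s f u" unfolding act_swap
  using 2 by (cases "u p"; cases "u (Suc p)") (auto simp: pairhom_def us)
  ultimately show ?thesis unfolding f by simp
 next
  case 3
  hence c: "colour (u p) = colour (u (Suc p))" by (simp only: key_eq)
  then obtain j where j: "u p = V j \<or> u p = W j" "u (Suc p) = V j \<or> u (Suc p) = W j"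
  using u by (cases "u p"; cases "u (Suc p)") auto
  have sw: "v o ?s = v" if "v p = v (Suc p)" for v :: word using that by (auto simp: fun_eq_iff transpose_def)
  have vv0: "f v = 0" if "v p = V j" "v (Suc p) = V j" for v
  proof -
  define w where "w = v(p := W j, Suc p := W j)"
  have "w o ?s = w" by (rule sw) (simp add: w_def)
  moreover have "w(p := V j, Suc p := V j) = v" using that by (auto simp: w_def fun_eq_iff)
  moreover have "w p = W j" "w (Suc p) = W j" by (simp_all add: w_def)
  ultimately show ?thesis using rel[of w] by simp
  qed
  have ups: "((u o ?s)(p := x, Suc p := y)) = u(p := x, Suc p := y)" for x y by (auto simp: fun_eq_iff transpose_def)
  from j show ?thesis
  proof (elim disjE)
  assume h: "u p = V j" "u (Suc p) = V j"
  have e: "u o ?s = u" by (rule sw) (simp add: h)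
  show ?thesis unfolding act_swap using h vv0[OF h] by (simp add: e)
  next
  assume h: "u p = V j" "u (Suc p) = W j"
  show ?thesis unfolding act_swap using h by (simp add: pairhom_def us)
  next
  assume h: "u p = W j" "u (Suc p) = V j"
  show ?thesis unfolding act_swap using h rel[of u] by (simp add: pairhom_def us)
  next
  assume h: "u p = W j" "u (Suc p) = W j"
  have e: "u o ?s = u" by (rule sw) (simp add: h)
  have e2: "u(p := W j, Suc p := W j) = u" using h by (auto simp: fun_eq_iff)
  show ?thesis unfolding act_swap ups using h by (simp add: e pairhom_def e2)
  qed
 qed
qed

text \<open>Here alpha = 1 and tau = nu = 1 + s. In one block, invariants modulo traces are
  represented by the words with twice the same letter \<open>One\<close>, so
  \<open>const_one\<close> serves both as normal form and as detector. The test word has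
  \<open>One i\<close> twice in block i.\<close>

lemma not_dominated_pairs:
 assumes mq: "m < q" and qd: "2 * q \<le> d"
 shows "\<not> dominated TYPE('k) d (words d (letters {..<q} {})) (words d (letters {..<m} {..<n}))"
proof -
 define Lt :: "('k \<times> (nat => nat)) list" where "Lt = [(1, id), (1, transpose 1 2)]"
 define La :: "('k \<times> (nat => nat)) list" where "La = [(1, id)]"
 define sp where "sp l \<longleftrightarrow> (EX a. l = One a)" for l
 have t12: "transpose 1 2 permutes {1..2::nat}" by (rule permutes_swap_id) auto
 interpret blocks K 2 q d sp La Lt Lt
 proof unfold_locales
  show "pj permutes {1..2}" if "(c, pj) \<in> set La \<union> set Lt \<union> set Lt" for c pj
  using that t12 permutes_id unfolding La_def Lt_def by auto
 qed (use qd in \<open>auto simp: sp_def\<close>)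
 have l0: "loc 2 i id = id" for i by (auto simp: loc_def fun_eq_iff)
 have l1: "loc 2 i (transpose 1 2) = transpose (Suc (2 * i)) (Suc (Suc (2 * i)))" for i
  by (auto simp: loc_def fun_eq_iff transpose_def)
 have La: "OP La i f = f" for i f by (simp add: La_def lop_def l0 act_id[unfolded id_def] del: id_apply)
 have Lt: "OP Lt i f = f + act (transpose (Suc (2 * i)) (Suc (Suc (2 * i)))) f" for i f
  unfolding Lt_def lop_Cons lop_Nil l0 l1 by (simp only: act_id mult_1 add_0_right)
 have blk: "Suc (2 * i) \<in> blk i" "Suc (Suc (2 * i)) \<in> blk i" for i by simp_all
 have b12: "{1..2} = {1, 2::nat}" by auto
 have spec: "special i u \<longleftrightarrow> (ones i u)" for i u
  unfolding special_def sp_def b12 ones_def by auto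
 have loc1: "local_op i (const_one i)" for i
  unfolding local_op_def
 proof (intro conjI allI impI)
  show "lin (const_one i)" unfolding lin_def by (intro conjI allI ext) (simp_all add: const_one_def)
  fix x and f :: "word => 'k" assume x: "x ~: blk i"
  hence ne: "x ~= Suc (2 * i)" "x ~= Suc (Suc (2 * i))" using blk by blast+
  have "ones i (u(x := y)) \<longleftrightarrow> ones i u" for u y using ne by (simp add: ones_def)
  thus "const_one i (der x f) = der x (const_one i f)"
  by (simp add: const_one_def der_def fun_eq_iff split: letter.split)
 next
  fix sz and f :: "word => 'k" assume "sz permutes {1..d}" and s: "\<forall>x \<in> blk i. sz x = x"
  have "sz (Suc (2 * i)) = Suc (2 * i)" "sz (Suc (Suc (2 * i))) = Suc (Suc (2 * i))" using s blk by blast+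
  hence "ones i (u o sz) \<longleftrightarrow> ones i u" for u by (simp add: ones_def)
  hence "const_one i (pm sz f) u = pm sz (const_one i f) u" for u by (simp only: const_one_def pm_def)
  thus "const_one i (pm sz f) = pm sz (const_one i f)" by (rule ext)
 qed
 \<comment> \<open>\<open>(x - 1) div 2\<close> is the number of the block of x. Beyond the blocks
   stands \<open>One 0\<close>, a letter of the larger alphabet because q > m.\<close>
 define w where "w x = (if x \<in> {1..2 * q} then One ((x - 1) div 2) else One 0)" for x :: nat
 have ww: "w (2 * i + c) = One i" if "i < q" "c \<in> {1..2}" for i c
 proof -
  have "2 * i + c \<in> {1..2 * q}" "(2 * i + c - 1) div 2 = i" using that by auto
  thus ?thesis by (simp only: w_def if_True)
 qed
 have wA: "w \<in> words d (letters {..<q} {})"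
  unfolding words_def
 proof (intro CollectI allI conjI impI)
  fix x assume "x \<in> {1..d}"
  have "w x = One ((x - 1) div 2) & (x - 1) div 2 < q \<or> w x = One 0" by (auto simp: w_def)
  thus "w x \<in> letters {..<q} {}" using mq by (auto simp: letters_def)
 qed (use qd in \<open>auto simp: w_def\<close>)
 have wone: "EX a. w x = One a" for x by (auto simp: w_def)
 have ds: "der x (unitw w) = (0 :: word => 'k)" for x
 proof
  fix u
  show "der x (unitw w) u = 0 u"
  proof (cases "u x")
  case (W j)
  have "u(x := V j) ~= w" using wone[of x] by (metis fun_upd_same letter.distinct(1))
  thus ?thesis by (simp add: der_def W unitw_def)
  qed (simp_all add: der_def)
 qed
 have inv: "act (transpose (Suc (2 * i)) (Suc (Suc (2 * i)))) (unitw w) = (unitw w :: word => 'k)" if i: "i < q" for i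
 proof -
  let ?s = "transpose (Suc (2 * i)) (Suc (Suc (2 * i)))"
  have "w (Suc (2 * i)) = w (Suc (Suc (2 * i)))" using ww[OF i, of 1] ww[OF i, of 2] by simp
  hence ws: "w o ?s = w" by (auto simp: fun_eq_iff transpose_def)
  have "u o ?s = w \<longleftrightarrow> u = w" for u
  proof
  assume "u o ?s = w"
  hence "(u o ?s) o ?s = w o ?s" by simp
  thus "u = w" unfolding ws comp_assoc transpose_comp_involutory comp_id .
  qed (simp only: ws)
  thus ?thesis unfolding act_adjacent ds der_zero add_0_right by (simp add: pm_def unitw_def fun_eq_iff)
 qed
 show ?thesis
 proof (rule obstruction[where ?f0.0 = "unitw w" and w = w and l = One and \<eta> = const_one and ez = const_one and S = "One ` {..<m}"])
  show "stable d (words d (letters {..<q} {}))" "stable d (words d (letters {..<m} {..<n}))" by (rule stable_words)+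
  show "on (words d (letters {..<q} {})) (unitw w)" by (rule on_unitw[OF wA])
  show "OP Lt i (unitw w) = 0" if "i < q" for i unfolding Lt inv[OF that] by (rule add_self_fun)
  have "iter (OP La) k (unitw w) = unitw w" for k by (induction k) (simp_all add: La)
  thus "iter (OP La) q (unitw w) = unitw w" .
  show "w (2 * i + c) = One i" if "i < q" "c \<in> {1..2}" for i c by (rule ww[OF that])
  show "sp (One i)" for i by (simp add: sp_def)
  show "inj_on One {..<q}" by (simp add: inj_on_def)
  show "OP La i (OP Lt i h) = OP Lt i (OP La i h)" for i h by (simp only: La)
  show "local_op i (const_one i)" for i by (rule loc1)
  thus "local_op i (const_one i)" for i .
  show "const_one i (OP Lt i h) = 0" for i h
  proof
  fix u :: word
  show "const_one i (OP Lt i h) u = 0 u"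
  proof (cases "ones i u")
   case True
   then obtain a where a: "u (Suc (2 * i)) = One a" "u (Suc (Suc (2 * i))) = One a" unfolding ones_def by blast
   hence e: "u o transpose (Suc (2 * i)) (Suc (Suc (2 * i))) = u" by (auto simp: fun_eq_iff transpose_def)
   show ?thesis using True unfolding Lt const_one_def plus_fun_apply act_swap e by (simp add: a)
  qed (simp add: const_one_def)
  qed
  show "const_one i F = F" if "!!u. F u ~= 0 ==> special i u" for i F
  using that unfolding spec by (auto simp: const_one_def fun_eq_iff)
  show "on (words d (letters {..<m} {..<n})) (const_one i f)" if "on (words d (letters {..<m} {..<n})) f" for i f
  using that by (simp add: const_one_def on_def)
  show "special i u" if "const_one i f u ~= 0" for i f u using that unfolding spec by (simp add: const_one_def split: if_splits)
  show "special i u" if "!!u. f u ~= 0 ==> special i u" "const_one j f u ~= 0" for i j f u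
  using that by (simp add: const_one_def split: if_splits)
  show "finite (One ` {..<m})" by simp
  show "card (One ` {..<m}) < q" using mq by (simp add: card_image inj_on_def)
  show "u x \<in> One ` {..<m}" if "u \<in> words d (letters {..<m} {..<n})" "x \<in> {1..d}" "sp (u x)" for u x
  using that unfolding words_def letters_def sp_def by auto
  fix i and f :: "word => 'k" assume i: "i < q" and f: "on (words d (letters {..<m} {..<n})) f" "OP Lt i f = 0"
  let ?s = "transpose (Suc (2 * i)) (Suc (Suc (2 * i)))"
  have "f + act ?s f = 0" using f(2) unfolding Lt .
  hence "f + (f + act ?s f) = f" by simp
  hence sf: "act ?s f = f" by (simp only: add_self_left_fun)
  \<comment> \<open>At words with two equal letters \<open>One\<close> in the block, s acts
    trivially and the trace of g vanishes; there \<open>const_one\<close> alone accounts for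
    f.\<close>
  define g where "g u = (if ones i u then 0 else pairhom (Suc (2 * i)) f u)" for u
  have "on (words d (letters {..<m} {..<n})) g" unfolding on_def
  proof (intro allI impI)
  fix u assume u: "u ~: words d (letters {..<m} {..<n})"
  have fz: "f u = 0" using f(1) u by (simp add: on_def)
  have fz2: "f (u(Suc (2 * i) := W j, Suc (Suc (2 * i)) := W j)) = 0" if "u (Suc (2 * i)) = V j" "u (Suc (Suc (2 * i))) = V j" for j
  proof -
   have "colour o u = colour o u(Suc (2 * i) := W j, Suc (Suc (2 * i)) := W j)" using that by (auto simp: fun_eq_iff)
   hence "u(Suc (2 * i) := W j, Suc (Suc (2 * i)) := W j) ~: words d (letters {..<m} {..<n})"
    using stable_colour[OF stable_words] u by blast
   thus ?thesis using f(1) by (simp add: on_def)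
  qed
  show "g u = 0" using fz fz2 by (auto simp: g_def pairhom_def split: letter.split)
  qed
  moreover have "OP La i f = const_one i f + OP Lt i g"
  proof
  fix u
  show "OP La i f u = (const_one i f + OP Lt i g) u"
  proof (cases "ones i u")
   case True
   then obtain a where a: "u (Suc (2 * i)) = One a" "u (Suc (Suc (2 * i))) = One a" unfolding ones_def by blast
   hence e: "u o ?s = u" by (auto simp: fun_eq_iff transpose_def)
   have "act ?s g u = g u" unfolding act_swap e by (simp add: a)
   thus ?thesis using True unfolding La Lt plus_fun_apply by (simp add: const_one_def)
  next
   case False
   have o: "\<not> ones i (u o ?s)" using False by (auto simp: ones_def)
   have g: "g v = pairhom (Suc (2 * i)) f v" if "\<not> ones i v" for v using that by (simp add: g_def)
   have "act ?s g u = act ?s (pairhom (Suc (2 * i)) f) u" unfolding act_swap g[OF o]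
    by (auto simp: ones_def intro!: g split: letter.split)
   thus ?thesis using False pairhom_homotopy[OF sf False[unfolded ones_def]] g[OF False] unfolding La Lt plus_fun_apply
    by (simp add: const_one_def)
  qed
  qed
  ultimately show "EX h. on (words d (letters {..<m} {..<n})) h & OP La i f = const_one i f + OP Lt i h" by blast
 qed
qed

end

section \<open>Blocks of length 4: counting the copies of P\<close>

definition px :: "nat => nat => nat" where
 "px q = transpose (Suc q) (Suc (Suc q)) o transpose (q + 3) (q + 4)"

text \<open>With the positions of the block numbered from 1 to 4, \<open>px\<close> is x = (12)(34)
  and \<open>py\<close> is y = (13)(24); they generate the Klein four-group. They are written as
  products of adjacent transpositions because for these the action is explicit.\<close>

definition py :: "nat => nat => nat" where
 "py q = transpose (Suc (Suc q)) (q + 3) o (transpose (Suc q) (Suc (Suc q)) o (transpose (q + 3) (q + 4) o transpose (Suc (Suc q)) (q + 3)))"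

definition sb :: "nat => nat => bool => bool => bool => bool => word => word" where
 "sb q j a b c e u = u(Suc q := if a then W j else V j, Suc (Suc q) := if b then W j else V j,
  q + 3 := if c then W j else V j, q + 4 := if e then W j else V j)"

lemma px_simps: "px q (Suc q) = Suc (Suc q)" "px q (Suc (Suc q)) = Suc q" "px q (q + 3) = q + 4" "px q (q + 4) = q + 3"
 by (simp_all add: px_def transpose_def)

lemma py_simps: "py q (Suc q) = q + 3" "py q (Suc (Suc q)) = q + 4" "py q (q + 3) = Suc q" "py q (q + 4) = Suc (Suc q)"
 by (simp_all add: py_def transpose_def)

lemma pxy_out:
 assumes "x ~= Suc q" "x ~= Suc (Suc q)" "x ~= q + 3" "x ~= q + (4::nat)"
 shows "px q x = x" "py q x = x"
 using assms by (simp_all add: px_def py_def transpose_def)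

lemma block4_cases:
 obtains "x = Suc q" | "x = Suc (Suc q)" | "x = q + 3" | "x = q + 4" | "x ~= Suc q" "x ~= Suc (Suc q)" "x ~= q + 3" "x ~= q + (4::nat)"
 by blast

lemma pxy_relations: "px q o px q = id" "py q o py q = id" "px q o py q = py q o px q"
proof -
 have "(px q o px q) x = id x & (py q o py q) x = id x & (px q o py q) x = (py q o px q) x" for x
  by (rule block4_cases[of x q]) (simp_all only: comp_apply id_apply px_simps py_simps pxy_out simp_thms not_False_eq_True)
 thus "px q o px q = id" "py q o py q = id" "px q o py q = py q o px q" unfolding fun_eq_iff by blast+
qed

lemma adjacent_permutes: "transpose (Suc q) (Suc (Suc q)) permutes {1..q + 4}" "transpose (Suc (Suc q)) (q + 3) permutes {1..q + 4}"
  "transpose (q + 3) (q + 4) permutes {1..q + (4::nat)}"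
 by (rule permutes_swap_id; simp)+

lemma pxy_permutes: "px q permutes {1..q + 4}" "py q permutes {1..q + 4}"
 unfolding px_def py_def by (intro permutes_compose adjacent_permutes)+

lemma sb_at: "sb q j a b c e u (Suc q) = (if a then W j else V j)" "sb q j a b c e u (Suc (Suc q)) = (if b then W j else V j)"
  "sb q j a b c e u (q + 3) = (if c then W j else V j)" "sb q j a b c e u (q + 4) = (if e then W j else V j)"
 by (simp_all add: sb_def)

lemma sb_out: "x ~= Suc q ==> x ~= Suc (Suc q) ==> x ~= q + 3 ==> x ~= q + 4 ==> sb q j a b c e u x = u x"
 by (simp add: sb_def)

lemma sb_sb: "sb q j a b c e (sb q j' a' b' c' e' u) = sb q j a b c e u"
proof
 fix x show "sb q j a b c e (sb q j' a' b' c' e' u) x = sb q j a b c e u x"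
  by (rule block4_cases[of x q]) (simp_all only: sb_at sb_out simp_thms not_False_eq_True)
qed

context char2
begin

lemma act_pxy:
 "act (px q) f = act (transpose (Suc q) (Suc (Suc q))) (act (transpose (q + 3) (q + 4)) f :: word => 'k)"
 "act (py q) f = act (transpose (Suc (Suc q)) (q + 3)) (act (transpose (Suc q) (Suc (Suc q))) (act (transpose (q + 3) (q + 4)) (act (transpose (Suc (Suc q)) (q + 3)) f :: word => 'k)))"
proof -
 note p = adjacent_permutes[of q]
 show "act (px q) f = act (transpose (Suc q) (Suc (Suc q))) (act (transpose (q + 3) (q + 4)) f)"
  unfolding px_def by (rule act_comp[OF p(1) p(3)])
 show "act (py q) f = act (transpose (Suc (Suc q)) (q + 3)) (act (transpose (Suc q) (Suc (Suc q))) (act (transpose (q + 3) (q + 4)) (act (transpose (Suc (Suc q)) (q + 3)) f)))"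
  unfolding py_def act_comp[OF p(2) permutes_compose[OF permutes_compose[OF p(2) p(3)] p(1)]]
  act_comp[OF p(1) permutes_compose[OF p(2) p(3)]] act_comp[OF p(3) p(2)] ..
qed

abbreviation "XX q \<equiv> act (px q)"
abbreviation "YY q \<equiv> act (py q)"

lemma XY_relations: "XX q (XX q f) = (f :: word => 'k)" "YY q (YY q f) = f" "YY q (XX q f) = XX q (YY q f)"
 using act_comp[OF pxy_permutes(1)[of q] pxy_permutes(1), of f] act_comp[OF pxy_permutes(2)[of q] pxy_permutes(2), of f]
  act_comp[OF pxy_permutes(2)[of q] pxy_permutes(1), of f] act_comp[OF pxy_permutes(1)[of q] pxy_permutes(2), of f]
 unfolding pxy_relations by (simp_all only: act_id)

lemma lin_XY: "lin (XX q)" "lin (YY q)"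
 by (rule lin_act[OF pxy_permutes(1)], rule lin_act[OF pxy_permutes(2)])

lemma sb_adjacent:
 "act (transpose (Suc q) (Suc (Suc q))) f (sb q j a b c e u) = f (sb q j b a c e u) + (if a & b then f (sb q j False False c e u) else (0::'k))"
 "act (transpose (Suc (Suc q)) (q + 3)) f (sb q j a b c e u) = f (sb q j a c b e u) + (if b & c then f (sb q j a False False e u) else (0::'k))"
 "act (transpose (q + 3) (q + 4)) f (sb q j a b c e u) = f (sb q j a b e c u) + (if c & e then f (sb q j a b False False u) else (0::'k))"
proof -
 have o: "sb q j a b c e u o transpose (Suc q) (Suc (Suc q)) = sb q j b a c e u"
  "sb q j a b c e u o transpose (Suc (Suc q)) (q + 3) = sb q j a c b e u"
  "sb q j a b c e u o transpose (q + 3) (q + 4) = sb q j a b e c u" for a b c e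
  by (auto simp: fun_eq_iff sb_def transpose_def)
 have up: "(sb q j a b c e u)(Suc q := V j, Suc (Suc q) := V j) = sb q j False False c e u"
  "(sb q j a b c e u)(Suc (Suc q) := V j, q + 3 := V j) = sb q j a False False e u"
  "(sb q j a b c e u)(q + 3 := V j, q + 4 := V j) = sb q j a b False False u" for a b c e
  by (auto simp: fun_eq_iff sb_def)
 have S: "q + 3 = Suc (Suc (Suc q))" "q + 4 = Suc (q + 3)" by simp_all
 show "act (transpose (Suc q) (Suc (Suc q))) f (sb q j a b c e u) = f (sb q j b a c e u) + (if a & b then f (sb q j False False c e u) else 0)"
  using act_swap[of "Suc q" f "sb q j a b c e u"] unfolding o(1) sb_at by (auto simp: up split: if_splits)
 show "act (transpose (Suc (Suc q)) (q + 3)) f (sb q j a b c e u) = f (sb q j a c b e u) + (if b & c then f (sb q j a False False e u) else 0)"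
  using act_swap[of "Suc (Suc q)" f "sb q j a b c e u"] unfolding S(1)[symmetric] o(2) sb_at by (auto simp: up split: if_splits)
 show "act (transpose (q + 3) (q + 4)) f (sb q j a b c e u) = f (sb q j a b e c u) + (if c & e then f (sb q j a b False False u) else 0)"
  using act_swap[of "q + 3" f "sb q j a b c e u"] unfolding S(2)[symmetric] o(3) sb_at by (auto simp: up split: if_splits)
qed

text \<open>Applying delta to both factors takes VV to WW and kills WW.\<close>

lemma act_unitw_pair:
 assumes u: "u p = u (Suc p)"
 shows "u p = V j ==> act (transpose p (Suc p)) (unitw u) = (unitw u + unitw (u(p := W j, Suc p := W j)) :: word => 'k)"
  and "u p = W j ==> act (transpose p (Suc p)) (unitw u) = (unitw u :: word => 'k)"
proof -
 let ?s = "transpose p (Suc p)"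
 have sw: "v o ?s = v" if "v p = v (Suc p)" for v :: word using that by (auto simp: fun_eq_iff transpose_def)
 have inv: "v o ?s = z \<longleftrightarrow> v = z" if "z p = z (Suc p)" for v z :: word
 proof
  assume "v o ?s = z"
  hence "(v o ?s) o ?s = z o ?s" by simp
  thus "v = z" unfolding sw[OF that] comp_assoc transpose_comp_involutory comp_id .
 qed (use sw[OF that] in simp)
 have pmu: "pm ?s (unitw z) = (unitw z :: word => 'k)" if "z p = z (Suc p)" for z
  by (rule ext) (simp only: pm_def unitw_def inv[OF that])
 have d: "der x (unitw z) = (unitw (z(x := W j)) :: word => 'k)" if "z x = V j" for x z j
 proof
  fix v
  show "der x (unitw z) v = (unitw (z(x := W j)) v :: 'k)"
  using that by (cases "v x") (auto simp: der_def unitw_def fun_eq_iff split: if_splits)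
 qed
 have d0: "der x (unitw z) = (0 :: word => 'k)" if "z x = W j" for x z j
 proof
  fix v
  show "der x (unitw z) v = (0 :: word => 'k) v"
  using that by (cases "v x") (auto simp: der_def unitw_def fun_eq_iff split: if_splits)
 qed
 show "act ?s (unitw u) = (unitw u + unitw (u(p := W j, Suc p := W j)) :: word => 'k)" if j: "u p = V j"
 proof -
  define z where "z = u(p := W j, Suc p := W j)"
  have z: "z p = z (Suc p)" by (simp add: z_def)
  have "(u(Suc p := W j)) p = V j" "u (Suc p) = V j" using j u by simp_all
  hence e: "der p (der (Suc p) (unitw u)) = (unitw z :: word => 'k)"
  using d[of u "Suc p" j] d[of "u(Suc p := W j)" p j] by (simp add: z_def fun_upd_twist)
  show ?thesis unfolding act_adjacent e linD(1)[OF lin_pm] pmu[OF u] pmu[OF z] unfolding z_def ..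
 qed
 show "act ?s (unitw u) = (unitw u :: word => 'k)" if j: "u p = W j"
 proof -
  have "u (Suc p) = W j" using j u by simp
  from d0[of u "Suc p" j, OF this] show ?thesis unfolding act_adjacent by (simp only: der_zero add_0_right pmu[OF u])
 qed
qed

definition const_at :: "nat => word => bool" where
 "const_at q u \<longleftrightarrow> key (u (Suc q)) = key (u (Suc (Suc q))) & key (u (Suc (Suc q))) = key (u (q + 3)) & key (u (q + 3)) = key (u (q + 4))"

definition col :: "nat => word => nat" where
 "col q u = (case u (Suc q) of One a => a | V j => j | W j => j)"

definition isP :: "nat => word => bool" where
 "isP q u \<longleftrightarrow> const_at q u & (EX j. u (Suc q) = V j \<or> u (Suc q) = W j)"

lemma isP_sb:
 assumes "isP q u"
 obtains a b c e where "u = sb q (col q u) a b c e u"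
proof -
 obtain j where j: "u (Suc q) = V j \<or> u (Suc q) = W j" using assms unfolding isP_def by blast
 have k: "key (u (Suc q)) = 2 * j + 1" using j by auto
 have l: "l = V j \<or> l = W j" if "key l = 2 * j + 1" for l
  using that by (cases l) (auto simp: double_not_eq_Suc_double)
 have "u (Suc (Suc q)) = V j \<or> u (Suc (Suc q)) = W j" "u (q + 3) = V j \<or> u (q + 3) = W j" "u (q + 4) = V j \<or> u (q + 4) = W j"
  using assms k l unfolding isP_def const_at_def by metis+
 moreover have c: "col q u = j" using j by (auto simp: col_def)
 ultimately have "u = sb q (col q u) (u (Suc q) = W j) (u (Suc (Suc q)) = W j) (u (q + 3) = W j) (u (q + 4) = W j) u"
  using j unfolding c by (auto simp: sb_def fun_eq_iff)
 thus ?thesis by (rule that)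
qed

lemma sb_isP: "isP q (sb q j a b c e u)" "col q (sb q j a b c e u) = j"
 by (auto simp: isP_def const_at_def col_def sb_at)

text \<open>The value of \<open>f\<close> at the word obtained from \<open>u\<close> by refilling the block with the given pattern.\<close>

definition atv :: "nat => (word => 'k) => word => bool => bool => bool => bool => 'k" where
 "atv q f u a b c e = f (sb q (col q u) a b c e u)"

definition allW :: "nat => word => bool" where
 "allW q u \<longleftrightarrow> (EX j. u (Suc q) = W j & u (Suc (Suc q)) = W j & u (q + 3) = W j & u (q + 4) = W j)"

definition pat :: "nat => word => bool \<times> bool \<times> bool \<times> bool" where
 "pat q u = ((EX j. u (Suc q) = W j), (EX j. u (Suc (Suc q)) = W j), (EX j. u (q + 3) = W j), (EX j. u (q + 4) = W j))"

lemma pat_sb: "pat q (sb q j a b c e u) = (a, b, c, e)"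
 by (simp add: atv_def pat_def sb_at)

lemma atv_sb: "atv q f (sb q j a b c e u) a' b' c' e' = f (sb q j a' b' c' e' u)"
 by (simp add: atv_def sb_isP sb_sb)

lemma allW_sb: "allW q (sb q j a b c e u) \<longleftrightarrow> a & b & c & e"
 by (auto simp: allW_def sb_at)

end

text \<open>\<open>om\<close> is a primitive cube root of unity, and \<open>om + 1\<close> is its
  square.\<close>

locale cube_root = char2 K for K :: "'k::field itself" +
 fixes om :: 'k
 assumes om: "om * om = om + 1"
begin

lemma om_simps: "om * (om * x) = om * x + x" "(om + 1) * x = om * x + x" "(1 + om) * x = om * x + x"
 using om by (simp_all add: mult.assoc[symmetric] distrib_right)

text \<open>tau = x + om y + om^2 xy in the group algebra of the Klein four-group. Its coefficients
  have sum 0, so tau squares to 0. With alpha = 1 + x one computes tau alpha = 1 + x + y + xy = nu,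
  so on functions killed by nu the values of alpha are cycles for tau. Permuting x, y, xy cyclically
  multiplies tau by a cube root of unity.\<close>

definition TT :: "nat => (word => 'k) => word => 'k" where
 "TT q f u = XX q f u + om * YY q f u + (om + 1) * XX q (YY q f) u"

text \<open>On a block over one copy of P the action preserves the parity of the number of letters
  \<open>W\<close>. On the odd part \<open>oddhom\<close> is a contracting homotopy for tau. On the
  even part alpha f is a multiple of WWWW up to tau of \<open>evenhom\<close>, and
  \<open>evenproj\<close> gives this multiple.\<close>

definition evenhom :: "nat => (word => 'k) => word => 'k" where
 "evenhom q f u = (if isP q u then (if pat q u = (True, True, False, False) then atv q f u False False False False
  else if pat q u = (True, False, True, False) then (om + 1) * (atv q f u True False True False + atv q f u False True False True)
  else if pat q u = (True, False, False, True) then om * (atv q f u True False False True + atv q f u False True True False) else 0) else 0)"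

definition evenproj :: "nat => (word => 'k) => word => 'k" where
 "evenproj q f u = (if allW q u then (om + 1) * atv q f u False False False False + atv q f u True True False False + atv q f u False False True True
  + (om + 1) * (atv q f u True False True False + atv q f u False True False True)
  + om * (atv q f u True False False True + atv q f u False True True False) else 0)"

definition oddproj :: "nat => (word => 'k) => word => 'k" where
 "oddproj q f u = (if isP q u then (if pat q u = (True, False, False, False) then f u
  else if pat q u = (False, True, False, False) then f u
  else if pat q u = (False, True, True, True) \<or> pat q u = (True, False, True, True) then f u + atv q f u False False True False + atv q f u False False False True
  else 0) else 0)"

definition oddhom :: "nat => (word => 'k) => word => 'k" where
 "oddhom q f = oddproj q (%u. om * YY q f u + (om + 1) * XX q (YY q f) u)"

text \<open>A functional on blocks over one copy of P that vanishes on the image of tau and is 1 at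
  WWWW; it shows that WWWW is not a boundary.\<close>

definition detect :: "nat => (word => 'k) => word => 'k" where
 "detect q f u = (if allW q u then atv q f u True True True True + om * atv q f u True True False False
  + (om + 1) * atv q f u True False True False + om * atv q f u True False False True else 0)"

lemmas eval_simps = act_pxy sb_adjacent pat_sb atv_sb sb_isP allW_sb

lemma even_identity:
 assumes "even (of_bool a + of_bool b + of_bool c + of_bool e :: nat)"
 shows "f (sb q j a b c e u) + XX q f (sb q j a b c e u) =
  evenproj q f (sb q j a b c e u) + TT q (evenhom q f) (sb q j a b c e u)"
 using assms by (cases a; cases b; cases c; cases e)
  (simp_all add: TT_def evenproj_def evenhom_def eval_simps om_simps distrib_left add_ac)

lemma odd_identity:
 assumes "odd (of_bool a + of_bool b + of_bool c + of_bool e :: nat)"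
 shows "TT q (oddhom q f) (sb q j a b c e u) + oddhom q (TT q f) (sb q j a b c e u) = f (sb q j a b c e u)"
 using assms by (cases a; cases b; cases c; cases e)
  (simp_all add: TT_def[abs_def] oddhom_def oddproj_def eval_simps om om_simps distrib_left add_ac)

lemma parity_zero:
 "even (of_bool a + of_bool b + of_bool c + of_bool e :: nat) ==> TT q (oddhom q f) (sb q j a b c e u) = 0"
 "odd (of_bool a + of_bool b + of_bool c + of_bool e :: nat) ==> TT q (evenhom q f) (sb q j a b c e u) = 0"
 by (cases a; cases b; cases c; cases e; simp add: TT_def[abs_def] oddhom_def oddproj_def evenhom_def eval_simps)+

lemma detect_TT: "detect q (TT q f) = 0"
proof
 fix u
 show "detect q (TT q f) u = 0 u"
  by (simp add: detect_def atv_def TT_def[abs_def] eval_simps om om_simps distrib_left add_ac)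
qed

end

context char2
begin

text \<open>Let tau = al G + bt G' + ga G G' for commuting involutions, and S = bt G' F + ga G G' F.
  Then tau F = 0 reads S = al G F. The multiplier ch passes through G, while G' turns it into ch'.
  So in tau h, with h = ka ch S, the term al G yields ch F and the other two yield ch' F, because
  the square of bt G' + ga G G' is bt^2 + ga^2. This contracts tau where the group exchanges two
  sets of colour patterns.\<close>

lemma shift_homotopy:
 fixes G G' :: "(word => 'k) => word => 'k"
 assumes l: "lin G" "lin G'" and GG: "!!f. G (G f) = f" "!!f. G' (G' f) = f" "!!f. G' (G f) = G (G' f)"
  and F: "!!u. al * G F u + (bt * G' F u + ga * G (G' F) u) = 0"
  and ch: "!!f. G (ch * f) = ch * G f" "!!f. G' (ch * f) = ch' * G' f" "!!f. G (ch' * f) = ch' * G f"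
  and ka: "ka * (bt * bt + ga * ga) = 1"
 defines "h \<equiv> (%u. ka * (ch * (%u. bt * G' F u + ga * G (G' F) u)) u)"
 shows "al * G h u + (bt * G' h u + ga * G (G' h) u) = (ch u + ch' u) * F u"
proof -
 define S where "S = (%u. bt * G' F u) + (%u. ga * G (G' F) u)"
 have hS: "h = (%u. ka * (ch * S) u)" unfolding h_def S_def by (simp add: fun_eq_iff)
 have aS: "(%u. al * G F u) = S"
 proof
  fix u
  have "al * G F u + (al * G F u + (bt * G' F u + ga * G (G' F) u)) = al * G F u" using F[of u] by simp
  thus "al * G F u = S u" unfolding add_self_left S_def by simp
 qed
 have GS: "G S = (%u. bt * G (G' F) u) + (%u. ga * G' F u)" unfolding S_def linD[OF l(1)] GG(1) ..
 have G'S: "G' S = (%u. bt * F u) + (%u. ga * G F u)" unfolding S_def linD[OF l(2)] GG(2) GG(3) ..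
 have GG'S: "G (G' S) = (%u. bt * G F u) + (%u. ga * F u)" unfolding G'S linD[OF l(1)] GG(1) ..
 have a1: "(%u. al * G (G' F) u) = G' S" unfolding aS[symmetric] linD[OF l(2)] GG(3) ..
 have "G S = (%u. al * F u)" unfolding aS[symmetric] linD[OF l(1)] GG(1) ..
 hence a2: "(%u. al * G' F u) = G (G' S)" using linD(2)[OF l(2), of al F] GG(3)[of S] by simp
 have "al * G h u = ka * (ch u * (al * G S u))" unfolding hS linD[OF l(1)] ch(1) by (simp add: algebra_simps)
 also have "al * G S u = bt * (al * G (G' F) u) + ga * (al * G' F u)" unfolding GS by (simp add: algebra_simps)
 also have "... = bt * G' S u + ga * G (G' S) u" using fun_cong[OF a1, of u] fun_cong[OF a2, of u] by simp
 also have "... = (bt * bt + ga * ga) * F u" unfolding G'S unfolding GG'S[unfolded G'S] by (simp add: algebra_simps)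
 also have "ka * (ch u * ((bt * bt + ga * ga) * F u)) = (ka * (bt * bt + ga * ga)) * (ch u * F u)"
  by (simp only: mult_ac)
 finally have 1: "al * G h u = ch u * F u" unfolding ka by simp
 have "bt * G' h u + ga * G (G' h) u = ka * (ch' u * (bt * G' S u + ga * G (G' S) u))"
  unfolding hS linD[OF l(2)] ch(2) linD[OF l(1)] ch(3) by (simp add: algebra_simps)
 also have "bt * G' S u + ga * G (G' S) u = (bt * bt + ga * ga) * F u" unfolding G'S unfolding GG'S[unfolded G'S] by (simp add: algebra_simps)
 also have "ka * (ch' u * ((bt * bt + ga * ga) * F u)) = (ka * (bt * bt + ga * ga)) * (ch' u * F u)"
  by (simp only: mult_ac)
 finally show ?thesis unfolding 1 ka by (simp add: distrib_right)
qed

lemma isP_colour: "colour o u = colour o v ==> isP q u \<longleftrightarrow> isP q v"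
proof -
 assume c: "colour o u = colour o v"
 have k: "key (u x) = key (v x)" for x unfolding key_eq by (rule colour_comp[OF c])
 have o: "(EX j. l = V j \<or> l = W j) \<longleftrightarrow> odd (key l)" for l by (cases l) auto
 show ?thesis by (simp only: isP_def const_at_def o k)
qed

lemma allW_isP: "allW q u ==> isP q u"
 unfolding allW_def isP_def const_at_def by (elim exE conjE) simp

lemma isP_px: "isP q (u o px q) \<longleftrightarrow> isP q u" "isP q (u o py q) \<longleftrightarrow> isP q u"
proof -
 have o: "(EX j. l = V j \<or> l = W j) \<longleftrightarrow> odd (key l)" for l by (cases l) auto
 show "isP q (u o px q) \<longleftrightarrow> isP q u" "isP q (u o py q) \<longleftrightarrow> isP q u"
  unfolding isP_def const_at_def comp_apply px_simps py_simps o by auto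
qed

end

context cube_root
begin

lemma TT_supp:
 assumes g: "!!u. g u ~= 0 ==> isP q u" and nz: "TT q g u ~= 0"
 shows "isP q u"
proof -
 have "XX q g u ~= 0 \<or> YY q g u ~= 0 \<or> XX q (YY q g) u ~= 0"
 proof (rule ccontr)
  assume "\<not> (XX q g u ~= 0 \<or> YY q g u ~= 0 \<or> XX q (YY q g) u ~= 0)"
  hence "TT q g u = 0" by (simp add: TT_def)
  thus False using nz by simp
 qed
 then consider "XX q g u ~= 0" | "YY q g u ~= 0" | "XX q (YY q g) u ~= 0" by blast
 thus ?thesis
 proof cases
  case 1
  show ?thesis using act_supp[where Q = "isP q", OF pxy_permutes(1) isP_colour g 1] unfolding isP_px .
 next
  case 2
  show ?thesis using act_supp[where Q = "isP q", OF pxy_permutes(2) isP_colour g 2] unfolding isP_px .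
 next
  case 3
  have f: "isP q v" if nz: "YY q g v ~= 0" for v using act_supp[where Q = "isP q", OF pxy_permutes(2) isP_colour g nz] unfolding isP_px .
  show ?thesis using act_supp[where Q = "isP q", OF pxy_permutes(1) isP_colour f 3] unfolding isP_px .
 qed
qed

lemma TT_add: "TT q (f + g) u = TT q f u + TT q g u"
 unfolding TT_def linD(1)[OF lin_XY(1)] linD(1)[OF lin_XY(2)] by (simp add: algebra_simps)

text \<open>That nu kills f means that F = f + x f is a cycle for tau. Three comparisons of sums of
  keys, each fixed by one of x, y, xy and reversed by the other two, take apart the blocks that are
  not constant, and \<open>shift_homotopy\<close> makes F a boundary on each piece. Three ties force
  all four keys to agree. For a constant block of letters \<open>One\<close> then x f = f, so F
  vanishes; for a block over one copy of P the even and the odd patterns are treated by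
  \<open>evenhom\<close> and \<open>oddhom\<close>.\<close>

lemma block_homotopy:
 assumes qd: "q + 4 \<le> d" and B: "stable d B" and f: "on B f"
  and nu: "!!u. f u + XX q f u + YY q f u + XX q (YY q f) u = 0"
 shows "EX h. on B h & (ALL u. f u + XX q f u = evenproj q f u + TT q h u)"
proof -
 define F where "F = f + XX q f"
 have pd: "px q permutes {1..d}" "py q permutes {1..d}" using pxy_permutes[of q] qd by (auto intro: permutes_subset)
 have onXY: "on B (XX q g)" "on B (YY q g)" if "on B g" for g by (rule on_act[OF B pd(1) that], rule on_act[OF B pd(2) that])
 have onF: "on B F" unfolding F_def by (intro on_add f onXY)
 have TF: "TT q F = (%u. 0)"
 proof
  fix u
  have "TT q F u = f u + XX q f u + YY q f u + XX q (YY q f) u"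
  unfolding TT_def F_def linD(1)[OF lin_XY(1)] linD(1)[OF lin_XY(2)] XY_relations plus_fun_apply
  by (simp add: distrib_left distrib_right add_ac)
  thus "TT q F u = 0" using nu by simp
 qed
 let ?k1 = "%u. key (u (Suc q))" and ?k2 = "%u. key (u (Suc (Suc q)))" and ?k3 = "%u. key (u (q + 3))" and ?k4 = "%u. key (u (q + 4))"
 define ind where "ind P u = (if P u then 1 else 0 :: 'k)" for P :: "word => bool" and u
 \<comment> \<open>x preserves this comparison, while y and xy reverse it. In the same way
   \<open>a2\<close>, \<open>b2\<close> belong to y and \<open>a3\<close>, \<open>b3\<close> to xy,
   each being consulted when the previous comparisons are ties.\<close>
 define a1 where "a1 u \<longleftrightarrow> ?k1 u + ?k2 u < ?k3 u + ?k4 u" for u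
 define b1 where "b1 u \<longleftrightarrow> ?k3 u + ?k4 u < ?k1 u + ?k2 u" for u
 define a2 where "a2 u \<longleftrightarrow> ?k1 u + ?k2 u = ?k3 u + ?k4 u & ?k1 u + ?k3 u < ?k2 u + ?k4 u" for u
 define b2 where "b2 u \<longleftrightarrow> ?k1 u + ?k2 u = ?k3 u + ?k4 u & ?k2 u + ?k4 u < ?k1 u + ?k3 u" for u
 define a3 where "a3 u \<longleftrightarrow> ?k1 u + ?k2 u = ?k3 u + ?k4 u & ?k1 u + ?k3 u = ?k2 u + ?k4 u & ?k1 u + ?k4 u < ?k2 u + ?k3 u" for u
 define b3 where "b3 u \<longleftrightarrow> ?k1 u + ?k2 u = ?k3 u + ?k4 u & ?k1 u + ?k3 u = ?k2 u + ?k4 u & ?k2 u + ?k3 u < ?k1 u + ?k4 u" for u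
 have cd: "colour_dep (ind P)" if "!!u v. (!!x. key (u x) = key (v x)) ==> P u \<longleftrightarrow> P v" for P
  unfolding colour_dep_def
 proof (intro allI impI)
  fix u v :: word assume c: "colour o u = colour o v"
  have "key (u x) = key (v x)" for x unfolding key_eq by (rule colour_comp[OF c])
  hence "P u \<longleftrightarrow> P v" by (rule that)
  thus "ind P u = ind P v" by (simp add: ind_def)
 qed
 have mX: "XX q (ind P * g) = ind P' * XX q g" if "colour_dep (ind P)" "!!u. P (u o px q) = P' u" for P P' g
  unfolding act_mult_colour[OF pd(1) that(1)] by (simp add: fun_eq_iff ind_def that(2))
 have mY: "YY q (ind P * g) = ind P' * YY q g" if "colour_dep (ind P)" "!!u. P (u o py q) = P' u" for P P' g
  unfolding act_mult_colour[OF pd(2) that(1)] by (simp add: fun_eq_iff ind_def that(2))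
 have cda: "colour_dep (ind a1)" "colour_dep (ind b1)" "colour_dep (ind a2)" "colour_dep (ind b2)" "colour_dep (ind a3)" "colour_dep (ind b3)"
  by (rule cd, simp add: a1_def b1_def a2_def b2_def a3_def b3_def)+
 have ax: "a1 (u o px q) = a1 u" "b1 (u o px q) = b1 u" "a1 (u o py q) = b1 u" "a2 (u o py q) = a2 u" "b2 (u o py q) = b2 u"
  "a2 (u o px q) = b2 u" "a3 (u o px q) = b3 u" "a3 (u o py q) = b3 u" "b3 (u o px q) = a3 u" "b3 (u o py q) = a3 u" for u
  unfolding a1_def b1_def a2_def b2_def a3_def b3_def comp_apply px_simps py_simps by auto
 \<comment> \<open>In the three applications of \<open>shift_homotopy\<close> the number bt^2 + ga^2
   is 1, om^2 and om, with inverses 1, om and om + 1.\<close>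
 have omi: "om * om + (om + 1) * (om + 1) = 1" "om * (1 * 1 + (om + 1) * (om + 1)) = 1" "(om + 1) * (1 * 1 + om * om) = 1"
  by (simp_all add: om distrib_left distrib_right add_ac)
 have TFu: "XX q F u + om * YY q F u + (om + 1) * XX q (YY q F) u = 0" for u using fun_cong[OF TF, of u] by (simp add: TT_def)
 define h1 where "h1 = (%u. 1 * (ind a1 * (%u. om * YY q F u + (om + 1) * XX q (YY q F) u)) u)"
 have H1: "TT q h1 u = (ind a1 u + ind b1 u) * F u" for u
 proof -
  have "1 * XX q h1 u + (om * YY q h1 u + (om + 1) * XX q (YY q h1) u) = (ind a1 u + ind b1 u) * F u"
  unfolding h1_def
  proof (rule shift_homotopy[OF lin_XY])
  show "1 * XX q F u + (om * YY q F u + (om + 1) * XX q (YY q F) u) = 0" for u using TFu[of u] by (simp add: add.assoc)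
  show "1 * (om * om + (om + 1) * (om + 1)) = 1" using omi(1) by simp
  qed (rule XY_relations mX[OF cda(1) ax(1)] mX[OF cda(2) ax(2)] mY[OF cda(1) ax(3)])+
  thus ?thesis by (simp add: TT_def add.assoc)
 qed
 define h2 where "h2 = (%u. om * (ind a2 * (%u. 1 * XX q F u + (om + 1) * YY q (XX q F) u)) u)"
 have H2: "TT q h2 u = (ind a2 u + ind b2 u) * F u" for u
 proof -
  have "om * YY q h2 u + (1 * XX q h2 u + (om + 1) * YY q (XX q h2) u) = (ind a2 u + ind b2 u) * F u"
  unfolding h2_def
  proof (rule shift_homotopy[OF lin_XY(2,1)])
  show "om * YY q F u + (1 * XX q F u + (om + 1) * YY q (XX q F) u) = 0" for u
   using TFu[of u] unfolding XY_relations(3) by (simp add: add_ac)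
  show "om * (1 * 1 + (om + 1) * (om + 1)) = 1" by (rule omi(2))
  qed (rule XY_relations XY_relations(3)[symmetric] mY[OF cda(3) ax(4)] mY[OF cda(4) ax(5)] mX[OF cda(3) ax(6)])+
  thus ?thesis unfolding TT_def XY_relations(3) by (simp add: add_ac)
 qed
 define h3 where "h3 = (%u. (om + 1) * (ind a3 * (%u. 1 * XX q F u + om * XX q (YY q (XX q F)) u)) u)"
 have H3: "TT q h3 u = (ind a3 u + ind b3 u) * F u" for u
 proof -
  have "(om + 1) * XX q (YY q h3) u + (1 * XX q h3 u + om * XX q (YY q (XX q h3)) u) = (ind a3 u + ind b3 u) * F u"
  unfolding h3_def
  proof (rule shift_homotopy[where G = "%f. XX q (YY q f)" and G' = "XX q", OF lin_comp[OF lin_XY] lin_XY(1)])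
  show "(om + 1) * XX q (YY q F) u + (1 * XX q F u + om * XX q (YY q (XX q F)) u) = 0" for u
   using TFu[of u] unfolding XY_relations by (simp add: add_ac)
  show "(om + 1) * (1 * 1 + om * om) = 1" by (rule omi(3))
  show "XX q (YY q (XX q (YY q f))) = f" for f :: "word => 'k" by (simp only: XY_relations)
  show "XX q (XX q (YY q f)) = XX q (YY q (XX q f))" for f :: "word => 'k" by (simp only: XY_relations)
  show "XX q (YY q (ind a3 * g)) = ind a3 * XX q (YY q g)" for g unfolding mY[OF cda(5) ax(8)] mX[OF cda(6) ax(9)] ..
  show "XX q (YY q (ind b3 * g)) = ind b3 * XX q (YY q g)" for g unfolding mY[OF cda(6) ax(10)] mX[OF cda(5) ax(7)] ..
  qed (rule XY_relations mX[OF cda(5) ax(7)])+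
  thus ?thesis unfolding TT_def XY_relations by (simp add: add_ac)
 qed
 define ho where "ho = oddhom q F"
 define he where "he = evenhom q f"
 define h where "h = h1 + (h2 + (h3 + (ho + he)))"
 have sho: "ho u ~= 0 ==> isP q u" for u by (simp add: ho_def oddhom_def oddproj_def split: if_splits)
 have she: "he u ~= 0 ==> isP q u" for u by (simp add: he_def evenhom_def split: if_splits)
 have onat: "atv q g u a b c e = 0" if og: "on B g" and ou: "u ~: B" and oP: "isP q u" for g u a b c e
 proof -
  obtain a' b' c' e' where u: "u = sb q (col q u) a' b' c' e' u" using isP_sb[OF oP] by blast
  define v where "v = sb q (col q u) a b c e u"
  have cs: "colour o sb q j a b c e w = (colour o w)(Suc q := V j, Suc (Suc q) := V j, q + 3 := V j, q + 4 := V j)" for j a b c e w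
  by (rule ext) (simp only: sb_def comp_apply fun_upd_apply if_distrib[of colour] colour.simps if_cancel)
  have "colour o sb q (col q u) a' b' c' e' u = colour o v" by (simp only: v_def cs)
  hence "colour o u = colour o v" by (rule trans[OF arg_cong[where f = "(o) colour", OF u]])
  hence "v ~: B" using stable_colour[OF B] ou by blast
  hence "g v = 0" using og by (simp add: on_def)
  thus ?thesis by (simp only: atv_def v_def)
 qed
 have onm: "on B (%u. c * (P * (%u. a * g u + b * g' u)) u)" if "on B g" "on B g'" for c P a b g g'
  using that by (simp add: on_def)
 have onho: "on B ho" unfolding on_def
 proof (intro allI impI)
  fix u assume u: "u ~: B"
  define g where "g = (%u. om * YY q F u + (om + 1) * XX q (YY q F) u)"
  have og: "on B g" using onXY(1)[OF onXY(2)[OF onF]] onXY(2)[OF onF] by (simp add: g_def on_def)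
  have "g u = 0" using og u by (simp add: on_def)
  thus "ho u = 0" unfolding ho_def oddhom_def g_def[symmetric] oddproj_def using onat[OF og u] by simp
 qed
 have onhe: "on B he" unfolding on_def he_def evenhom_def using onat[OF f] by simp
 have onh: "on B h" unfolding h_def
  by (intro on_add onho onhe) (unfold h1_def h2_def h3_def, (intro onm onXY onF)+)
 have "F u = evenproj q f u + TT q h u" for u
 proof -
  have T: "TT q h u = (ind a1 u + ind b1 u) * F u + ((ind a2 u + ind b2 u) * F u + ((ind a3 u + ind b3 u) * F u + (TT q ho u + TT q he u)))"
  unfolding h_def TT_add H1 H2 H3 ..
  show ?thesis
  proof (cases "const_at q u")
  case False
  have nP: "\<not> isP q u" using False by (simp add: isP_def)
  have z: "TT q ho u = 0" "TT q he u = 0"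
   by (rule ccontr, use TT_supp[of ho q u, OF sho] nP in blast) (rule ccontr, use TT_supp[of he q u, OF she] nP in blast)
  have "\<not> allW q u" using allW_isP nP by blast
  moreover have "(ind a1 u + ind b1 u) + (ind a2 u + ind b2 u) + (ind a3 u + ind b3 u) = 1"
  proof -
   have "a1 u \<or> b1 u \<or> a2 u \<or> b2 u \<or> a3 u \<or> b3 u"
    using False unfolding const_at_def a1_def b1_def a2_def b2_def a3_def b3_def by linarith
   moreover have "\<not> (a1 u & b1 u)" "\<not> (a2 u & b2 u)" "\<not> (a3 u & b3 u)" "\<not> ((a1 u \<or> b1 u) & (a2 u \<or> b2 u))"
    "\<not> ((a1 u \<or> b1 u) & (a3 u \<or> b3 u))" "\<not> ((a2 u \<or> b2 u) & (a3 u \<or> b3 u))"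
    unfolding a1_def b1_def a2_def b2_def a3_def b3_def by linarith+
   ultimately show ?thesis unfolding ind_def by (elim disjE) simp_all
  qed
  hence "(ind a1 u + ind b1 u) * F u + ((ind a2 u + ind b2 u) * F u + (ind a3 u + ind b3 u) * F u) = F u"
   by (metis add.assoc distrib_right mult_1)
  ultimately show ?thesis unfolding T z by (simp add: evenproj_def)
  next
  case True
  have i0: "ind a1 u = 0" "ind b1 u = 0" "ind a2 u = 0" "ind b2 u = 0" "ind a3 u = 0" "ind b3 u = 0"
   using True unfolding const_at_def ind_def a1_def b1_def a2_def b2_def a3_def b3_def by simp_all
  have T': "TT q h u = TT q ho u + TT q he u" unfolding T i0 by simp
  show ?thesis
  proof (cases "isP q u")
   case True
   obtain a b c e where u: "u = sb q (col q u) a b c e u" using isP_sb[OF True] by blast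
   define j where "j = col q u"
   have uj: "sb q j a b c e u = u" using u by (simp add: j_def)
   show ?thesis
   proof (cases "even (of_bool a + of_bool b + of_bool c + of_bool e :: nat)")
    case True
    show ?thesis using even_identity[OF True, of f q j u] parity_zero(1)[OF True, of q F j u]
    unfolding uj T' by (simp add: F_def ho_def he_def)
   next
    case False
    have "\<not> allW q u" using allW_sb[of q j a b c e u] False unfolding uj by auto
    moreover have "oddhom q (%u. 0) u = (0::'k)"
    proof -
    have "YY q (%u. 0) = (0 :: word => 'k)" using lin_zero[OF lin_XY(2)] by (simp add: zero_fun_def)
    moreover have "XX q 0 = (0 :: word => 'k)" by (rule lin_zero[OF lin_XY(1)])
    ultimately show ?thesis by (simp add: oddhom_def oddproj_def atv_def)
    qed
    ultimately show ?thesis using odd_identity[OF False, of q F j u] parity_zero(2)[OF False, of q f j u]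
    unfolding uj T' TF by (simp add: evenproj_def ho_def he_def)
   qed
  next
   case nP: False
   have z: "TT q ho u = 0" "TT q he u = 0"
   by (rule ccontr, use TT_supp[of ho q u, OF sho] nP in blast) (rule ccontr, use TT_supp[of he q u, OF she] nP in blast)
   have "\<not> allW q u" using allW_isP nP by blast
   \<comment> \<open>All four letters are the same \<open>One a\<close>: the transpositions fix the
     word, and delta contributes nothing.\<close>
   moreover have "XX q f u = f u"
   proof -
    obtain a where a: "u (Suc q) = One a" using True nP unfolding isP_def by (cases "u (Suc q)") auto
    have L: "l = One a" if "key l = 2 * a" for l using that by (cases l) (auto simp: double_not_eq_Suc_double Suc_double_not_eq_double)
    have "key (u (Suc q)) = 2 * a" using a by simp
    hence k: "key (u (Suc (Suc q))) = 2 * a" "key (u (q + 3)) = 2 * a" "key (u (q + 4)) = 2 * a"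
    using True unfolding const_at_def by linarith+
    note o = L[OF k(1)] L[OF k(2)] L[OF k(3)]
    have S: "q + 4 = Suc (q + 3)" by simp
    have e: "u o transpose (Suc q) (Suc (Suc q)) = u" "u o transpose (q + 3) (q + 4) = u" using a o by (auto simp: fun_eq_iff transpose_def)
    have "act (transpose (Suc q) (Suc (Suc q))) g u = g u" "act (transpose (q + 3) (q + 4)) g u = g u" for g :: "word => 'k"
    using act_swap[of "Suc q" g u] act_swap[of "q + 3" g u] unfolding S[symmetric] e by (simp_all add: a o)
    thus ?thesis unfolding act_pxy by simp
   qed
   ultimately show ?thesis unfolding T' z F_def by (simp add: evenproj_def)
  qed
  qed
 qed
 hence "ALL u. f u + XX q f u = evenproj q f u + TT q h u" by (simp add: F_def)
 thus ?thesis using onh by blast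
qed

end

context cube_root
begin

lemma local_frame:
 assumes x: "x ~: {q + 1..q + (4::nat)}"
 shows "col q (u(x := y)) = col q u" "allW q (u(x := y)) \<longleftrightarrow> allW q u" "sb q j a b c e (u(x := y)) = (sb q j a b c e u)(x := y)"
proof -
 have ne: "x ~= Suc q" "x ~= Suc (Suc q)" "x ~= q + 3" "x ~= q + 4" using x by auto
 show "col q (u(x := y)) = col q u" using ne by (simp add: col_def)
 show "allW q (u(x := y)) \<longleftrightarrow> allW q u" using ne by (simp add: allW_def)
 show "sb q j a b c e (u(x := y)) = (sb q j a b c e u)(x := y)" using ne by (auto simp: sb_def fun_eq_iff)
qed

lemma local_perm:
 assumes s: "inj sz" "\<forall>x \<in> {q + 1..q + (4::nat)}. sz x = x"
 shows "col q (u o sz) = col q u" "allW q (u o sz) \<longleftrightarrow> allW q u" "sb q j a b c e (u o sz) = sb q j a b c e u o sz"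
proof -
 have e: "sz (Suc q) = Suc q" "sz (Suc (Suc q)) = Suc (Suc q)" "sz (q + 3) = q + 3" "sz (q + 4) = q + 4" using s(2) by auto
 show "col q (u o sz) = col q u" using e by (simp add: col_def)
 show "allW q (u o sz) \<longleftrightarrow> allW q u" using e by (simp add: allW_def)
 have i: "sz x = sz y \<longleftrightarrow> x = y" for x y using s(1) by (simp add: inj_eq)
 show "sb q j a b c e (u o sz) = sb q j a b c e u o sz"
 proof
  fix x
  show "sb q j a b c e (u o sz) x = (sb q j a b c e u o sz) x"
  using i[of x "Suc q"] i[of x "Suc (Suc q)"] i[of x "q + 3"] i[of x "q + 4"] unfolding e by (simp add: sb_def)
 qed
qed

text \<open>Operators that combine, with constant coefficients, the values at refillings of a block
  of letters \<open>W\<close> do not see the other positions. Both \<open>evenproj\<close> and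
  \<open>detect\<close> have this shape.\<close>

lemma local_functional:
 fixes T :: "(word => 'k) => word => 'k"
 assumes T: "!!f u. T f u = (if allW q u then (\<Sum>(k, a, b, c, e)\<leftarrow>L. k * atv q f u a b c e) else 0)"
 shows "lin T" "x ~: {q + 1..q + 4} ==> T (der x f) = der x (T f)"
  "sz permutes {1..d} ==> \<forall>x \<in> {q + 1..q + 4}. sz x = x ==> T (pm sz f) = pm sz (T f)"
proof -
 have s: "(\<Sum>(k, a, b, c, e)\<leftarrow>L. k * atv q (f + g) u a b c e) = (\<Sum>(k, a, b, c, e)\<leftarrow>L. k * atv q f u a b c e) + (\<Sum>(k, a, b, c, e)\<leftarrow>L. k * atv q g u a b c e)" for f g u
  by (induction L) (auto simp: atv_def algebra_simps)
 have m: "(\<Sum>(k, a, b, c, e)\<leftarrow>L. k * atv q (%u. r * f u) u a b c e) = r * (\<Sum>(k, a, b, c, e)\<leftarrow>L. k * atv q f u a b c e)" for r f u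
  by (induction L) (auto simp: atv_def algebra_simps)
 show "lin T" unfolding lin_def by (intro conjI allI ext) (simp_all only: T s m plus_fun_apply split: if_split, simp_all)
 show "T (der x f) = der x (T f)" if x: "x ~: {q + 1..q + 4}"
 proof
  fix u
  have xs: "sb q j a b c e u x = u x" for j a b c e by (rule sb_out) (use x in auto)
  show "T (der x f) u = der x (T f) u"
  proof (cases "u x")
  case (W i)
  have "atv q (der x f) u a b c e = atv q f (u(x := V i)) a b c e" for a b c e
   unfolding atv_def local_frame[OF x] by (simp add: der_def xs W)
  thus ?thesis by (simp add: T der_def W local_frame[OF x])
  next
  case (One i)
  have "atv q (der x f) u a b c e = 0" for a b c e unfolding atv_def by (simp add: der_def xs One)
  thus ?thesis by (simp add: T der_def One case_prod_unfold)
  next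
  case (V i)
  have "atv q (der x f) u a b c e = 0" for a b c e unfolding atv_def by (simp add: der_def xs V)
  thus ?thesis by (simp add: T der_def V case_prod_unfold)
  qed
 qed
 show "T (pm sz f) = pm sz (T f)" if s: "sz permutes {1..d}" "\<forall>x \<in> {q + 1..q + 4}. sz x = x"
 proof
  fix u
  note p = local_perm[OF permutes_inj[OF s(1)] s(2)]
  show "T (pm sz f) u = pm sz (T f) u" by (simp only: T pm_def p atv_def)
 qed
qed

lemma evenproj_sum: "evenproj q f u = (if allW q u then (\<Sum>(k, a, b, c, e)\<leftarrow>[(om + 1, False, False, False, False), (1, True, True, False, False),
  (1, False, False, True, True), (om + 1, True, False, True, False), (om + 1, False, True, False, True), (om, True, False, False, True),
  (om, False, True, True, False)]. k * atv q f u a b c e) else 0)"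
 by (simp add: evenproj_def algebra_simps)

lemma detect_sum: "detect q f u = (if allW q u then (\<Sum>(k, a, b, c, e)\<leftarrow>[(1, True, True, True, True), (om, True, True, False, False),
  (om + 1, True, False, True, False), (om, True, False, False, True)]. k * atv q f u a b c e) else 0)"
 by (simp add: detect_def algebra_simps)

text \<open>The braiding fixes WW and takes VV to VV + WW, so x = (12)(34) takes WWVV to WWVV +
  WWWW. All adjacent transpositions of the block fix WWWW.\<close>

lemma XX_unitw:
 fixes u :: word
 assumes u: "u (Suc q) = W j" "u (Suc (Suc q)) = W j" "u (q + 3) = V j" "u (q + 4) = V j"
 defines "v \<equiv> u(q + 3 := W j, q + 4 := W j)"
 shows "XX q (unitw u) = unitw u + (unitw v :: word => 'k)" "YY q (unitw v) = (unitw v :: word => 'k)"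
proof -
 have S: "q + 4 = Suc (q + 3)" "Suc (Suc (Suc q)) = q + 3" by simp_all
 have v: "v (Suc q) = W j" "v (Suc (Suc q)) = W j" "v (q + 3) = W j" "v (q + 4) = W j" using u by (simp_all add: v_def)
 have 1: "act (transpose (q + 3) (q + 4)) (unitw u) = (unitw u + unitw v :: word => 'k)"
  using act_unitw_pair(1)[of u "q + 3" j] u unfolding S(1)[symmetric] v_def by simp
 have 2: "act (transpose (Suc q) (Suc (Suc q))) (unitw u) = (unitw u :: word => 'k)" by (rule act_unitw_pair(2)) (simp_all add: u)
 have 3: "act (transpose (Suc q) (Suc (Suc q))) (unitw v) = (unitw v :: word => 'k)" by (rule act_unitw_pair(2)) (simp_all add: v)
 have 4: "act (transpose (q + 3) (q + 4)) (unitw v) = (unitw v :: word => 'k)"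
  using act_unitw_pair(2)[of v "q + 3" j] v unfolding S(1)[symmetric] by simp
 have 5: "act (transpose (Suc (Suc q)) (q + 3)) (unitw v) = (unitw v :: word => 'k)"
  using act_unitw_pair(2)[of v "Suc (Suc q)" j] v unfolding S(2) by simp
 show "XX q (unitw u) = unitw u + (unitw v :: word => 'k)"
  unfolding act_pxy 1 linD(1)[OF lin_act[OF adjacent_permutes(1)]] 2 3 ..
 show "YY q (unitw v) = (unitw v :: word => 'k)" unfolding act_pxy 5 4 3 5 ..
qed

lemma loc_pxy: "loc 4 i (px 0) = px (4 * i)" "loc 4 i (py 0) = py (4 * i)" "loc 4 i (px 0 o py 0) = px (4 * i) o py (4 * i)"
proof -
 let ?q = "4 * i"
 have "loc 4 i (px 0) x = px ?q x & loc 4 i (py 0) x = py ?q x & loc 4 i (px 0 o py 0) x = (px ?q o py ?q) x" for x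
 proof (rule block4_cases[of x ?q])
  assume x: "x = Suc ?q"
  show ?thesis unfolding x by (simp add: loc_def px_def py_def transpose_def)
 next
  assume x: "x = Suc (Suc ?q)"
  show ?thesis unfolding x by (simp add: loc_def px_def py_def transpose_def)
 next
  assume x: "x = ?q + 3"
  show ?thesis unfolding x by (simp add: loc_def px_def py_def transpose_def)
 next
  assume x: "x = ?q + 4"
  show ?thesis unfolding x by (simp add: loc_def px_def py_def transpose_def)
 next
  assume x: "x ~= Suc ?q" "x ~= Suc (Suc ?q)" "x ~= ?q + 3" "x ~= ?q + 4"
  hence "x ~: {4 * i + 1..4 * i + 4}" by auto
  thus ?thesis unfolding comp_apply pxy_out[OF x] by (intro conjI loc_out)
 qed
 thus "loc 4 i (px 0) = px ?q" "loc 4 i (py 0) = py ?q" "loc 4 i (px 0 o py 0) = px ?q o py ?q" unfolding fun_eq_iff by blast+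
qed

text \<open>The starting word has the pattern WWVV over the i-th copy of P in block i. There alpha =
  1 + x gives WWWW, and nu = (1 + y)(1 + x) gives 0 because y fixes WWWW. In the normal form a
  special block is WWWW over a single copy, so fewer than p copies force a repetition among p
  blocks.\<close>

lemma not_dominated_quadruples:
 assumes np: "n < p" and pd: "4 * p \<le> d"
 shows "\<not> dominated TYPE('k) d (words d (letters {..<1} {..<p})) (words d (letters {..<m} {..<n}))"
proof -
 define La :: "('k \<times> (nat => nat)) list" where "La = [(1, id), (1, px 0)]"
 define Lt :: "('k \<times> (nat => nat)) list" where "Lt = [(1, px 0), (om, py 0), (om + 1, px 0 o py 0)]"
 define Lnu :: "('k \<times> (nat => nat)) list" where "Lnu = [(1, id), (1, px 0), (1, py 0), (1, px 0 o py 0)]"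
 define sp where "sp l \<longleftrightarrow> (EX j. l = W j)" for l
 have perm0: "px 0 permutes {1..4}" "py 0 permutes {1..4}" using pxy_permutes[of 0] by simp_all
 interpret blocks K 4 p d sp La Lt Lnu
 proof unfold_locales
  show "pj permutes {1..4}" if "(c, pj) \<in> set La \<union> set Lt \<union> set Lnu" for c pj
  using that perm0 permutes_id permutes_compose[OF perm0(2,1)] unfolding La_def Lt_def Lnu_def by auto
 qed (use pd in \<open>auto simp: sp_def\<close>)
 have l0: "loc 4 i id = id" for i by (auto simp: loc_def fun_eq_iff)
 have XY: "act (px q o py q) f = XX q (YY q f)" for q and f :: "word => 'k" by (rule act_comp[OF pxy_permutes])
 have La: "OP La i f u = f u + XX (4 * i) f u" for i f u
  unfolding La_def lop_Cons lop_Nil l0 loc_pxy act_id plus_fun_apply by simp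
 have Lt: "OP Lt i f u = TT (4 * i) f u" for i f u
  unfolding Lt_def lop_Cons lop_Nil loc_pxy XY plus_fun_apply TT_def by (simp add: add.assoc)
 have Lnu: "OP Lnu i f u = f u + XX (4 * i) f u + YY (4 * i) f u + XX (4 * i) (YY (4 * i) f) u" for i f u
  unfolding Lnu_def lop_Cons lop_Nil l0 loc_pxy XY act_id plus_fun_apply by (simp add: add.assoc)
 have b4: "{1..4} = {1, 2, 3, 4::nat}" by auto
 have spec: "special i u \<longleftrightarrow> allW (4 * i) u" for i u
  unfolding special_def sp_def b4 allW_def by auto
 \<comment> \<open>In \<open>v k\<close> the blocks with number less than \<open>k\<close> already
   read WWWW and the others WWVV. The one letter \<open>One 0\<close> of the alphabet fills the
   positions beyond the blocks.\<close>
 define v where "v k x = (if x \<in> {1..4 * p} then (if (x - 1) mod 4 < 2 \<or> (x - 1) div 4 < k then W ((x - 1) div 4) else V ((x - 1) div 4)) else One 0)" for k x :: nat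
 have vb: "v k (Suc (4 * i)) = W i" "v k (Suc (Suc (4 * i))) = W i" "v k (4 * i + 3) = (if i < k then W i else V i)"
  "v k (4 * i + 4) = (if i < k then W i else V i)" if "i < p" for i k
 proof -
  have m: "Suc (4 * i) \<in> {1..4 * p}" "Suc (Suc (4 * i)) \<in> {1..4 * p}" "4 * i + 3 \<in> {1..4 * p}" "4 * i + 4 \<in> {1..4 * p}" using that by auto
  have S: "Suc (4 * i) - 1 = 4 * i + 0" "Suc (Suc (4 * i)) - 1 = 4 * i + 1" "4 * i + 3 - 1 = 4 * i + 2" "4 * i + 4 - 1 = 4 * i + 3" by simp_all
  have D: "(4 * i + r) div 4 = i" "(4 * i + r) mod 4 = r" if "r < 4" for r :: nat using that by simp_all
  have r4: "(0 :: nat) < 4" "(1 :: nat) < 4" "(2 :: nat) < 4" "(3 :: nat) < 4" by simp_all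
  have a: "(Suc (4 * i) - 1) div 4 = i" "(Suc (4 * i) - 1) mod 4 = 0" "(Suc (Suc (4 * i)) - 1) div 4 = i" "(Suc (Suc (4 * i)) - 1) mod 4 = 1"
  "(4 * i + 3 - 1) div 4 = i" "(4 * i + 3 - 1) mod 4 = 2" "(4 * i + 4 - 1) div 4 = i" "(4 * i + 4 - 1) mod 4 = 3"
  by (simp_all only: S D[OF r4(1)] D[OF r4(2)] D[OF r4(3)] D[OF r4(4)])
  show "v k (Suc (4 * i)) = W i" unfolding v_def if_P[OF m(1)] a by simp
  show "v k (Suc (Suc (4 * i))) = W i" unfolding v_def if_P[OF m(2)] a by simp
  show "v k (4 * i + 3) = (if i < k then W i else V i)" unfolding v_def if_P[OF m(3)] a by simp
  show "v k (4 * i + 4) = (if i < k then W i else V i)" unfolding v_def if_P[OF m(4)] a by simp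
 qed
 have vS: "(v k)(4 * k + 3 := W k, 4 * k + 4 := W k) = v (Suc k)" if "k < p" for k
 proof
  fix x
  consider "x = 4 * k + 3" | "x = 4 * k + 4" | "x ~= 4 * k + 3" "x ~= 4 * k + 4" by blast
  thus "((v k)(4 * k + 3 := W k, 4 * k + 4 := W k)) x = v (Suc k) x"
  proof cases
  case 3
  have "(x - 1) mod 4 < 2 \<or> (x - 1) div 4 < k \<longleftrightarrow> (x - 1) mod 4 < 2 \<or> (x - 1) div 4 < Suc k" if "x \<in> {1..4 * p}"
  proof -
   define y where "y = x - 1"
   have x: "x = Suc y" using that by (simp add: y_def)
   have md: "y mod 4 < 2" if yk: "y div 4 = k"
   proof (rule ccontr)
    assume nl: "\<not> y mod 4 < 2"
    have eq: "k * 4 + y mod 4 = y" using div_mult_mod_eq[of y 4] unfolding yk .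
    have lt: "y mod 4 < 4" by simp
    have "r = 2 \<or> r = 3" if "r < 4" "\<not> r < 2" for r :: nat using that by arith
    from this[OF lt nl] show False
    proof
    assume h: "y mod 4 = 2"
    have "x = 4 * k + 3" using eq unfolding h x by simp
    thus False using 3 by blast
    next
    assume h: "y mod 4 = 3"
    have "x = 4 * k + 4" using eq unfolding h x by simp
    thus False using 3 by blast
    qed
   qed
   show ?thesis unfolding y_def[symmetric]
   proof (cases "y div 4 = k")
    case True
    show "y mod 4 < 2 \<or> y div 4 < k \<longleftrightarrow> y mod 4 < 2 \<or> y div 4 < Suc k" using md[OF True] by blast
   next
    case False
    show "y mod 4 < 2 \<or> y div 4 < k \<longleftrightarrow> y mod 4 < 2 \<or> y div 4 < Suc k" unfolding less_Suc_eq[of "y div 4" k] using False by blast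
   qed
  qed
  thus ?thesis using 3 by (simp only: v_def fun_upd_apply if_False split: if_split) auto
  qed (use vb[OF that, of "Suc k"] in simp_all)
 qed
 have v0A: "v k \<in> words d (letters {..<1} {..<p})" for k
  unfolding words_def
 proof (intro CollectI allI conjI impI)
  fix x assume "x \<in> {1..d}"
  show "v k x \<in> letters {..<1} {..<p}"
  proof (cases "x \<in> {1..4 * p}")
  case True
  hence "(x - 1) div 4 < p" by auto
  thus ?thesis unfolding v_def if_P[OF True] by (simp add: letters_def)
  next
  case False
  show ?thesis unfolding v_def if_not_P[OF False] by (simp add: letters_def)
  qed
 next
  fix x assume "x ~: {1..d}"
  hence "x ~: {1..4 * p}" using pd by auto
  thus "v k x = One 0" by (simp only: v_def if_False)
 qed
 have La_v: "OP La k (unitw (v k)) = unitw (v (Suc k))" if k: "k < p" for k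
 proof
  fix u
  have b: "v k (4 * k + 3) = V k" "v k (4 * k + 4) = V k" using vb(3,4)[OF k, of k] by simp_all
  have "XX (4 * k) (unitw (v k)) = unitw (v k) + (unitw (v (Suc k)) :: word => 'k)"
  using XX_unitw(1)[OF vb(1)[OF k, of k] vb(2)[OF k, of k] b] unfolding vS[OF k] .
  thus "OP La k (unitw (v k)) u = unitw (v (Suc k)) u" unfolding La by simp
 qed
 have nu0: "OP Lnu i (unitw (v 0)) = 0" if i: "i < p" for i
 proof
  fix u
  define w' where "w' = (v 0)(4 * i + 3 := W i, 4 * i + 4 := W i)"
  have b: "v 0 (4 * i + 3) = V i" "v 0 (4 * i + 4) = V i" using vb(3,4)[OF i, of 0] by simp_all
  note x = XX_unitw[OF vb(1)[OF i, of 0] vb(2)[OF i, of 0] b, folded w'_def]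
  have y: "YY (4 * i) (XX (4 * i) (unitw (v 0))) = YY (4 * i) (unitw (v 0)) + (unitw w' :: word => 'k)"
  unfolding x(1) linD(1)[OF lin_XY(2)] x(2) ..
  show "OP Lnu i (unitw (v 0)) u = 0 u" unfolding Lnu XY_relations(3)[symmetric] y unfolding x(1) by (simp add: add_ac)
 qed
 have loc_even: "local_op i (evenproj (4 * i))" for i
  unfolding local_op_def using local_functional[OF evenproj_sum[of "4 * i"]] by blast
 have loc_det: "local_op i (detect (4 * i))" for i
  unfolding local_op_def using local_functional[OF detect_sum[of "4 * i"]] by blast
 show ?thesis
 proof (rule obstruction[where ?f0.0 = "unitw (v 0)" and w = "v p" and l = W and \<eta> = "%i. detect (4 * i)" and ez = "%i. evenproj (4 * i)" and S = "W ` {..<n}"])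
  show "stable d (words d (letters {..<1} {..<p}))" "stable d (words d (letters {..<m} {..<n}))" by (rule stable_words)+
  show "on (words d (letters {..<1} {..<p})) (unitw (v 0))" by (rule on_unitw[OF v0A])
  show "OP Lnu i (unitw (v 0)) = 0" if "i < p" for i by (rule nu0[OF that])
  have "iter (OP La) k (unitw (v 0)) = unitw (v k)" if "k \<le> p" for k
  using that by (induction k) (simp_all add: La_v)
  thus "iter (OP La) p (unitw (v 0)) = unitw (v p)" by simp
  show "v p (4 * i + c) = W i" if i: "i < p" and c: "c \<in> {1..4}" for i c
  proof -
  have "c = 1 \<or> c = 2 \<or> c = 3 \<or> c = 4" using c unfolding b4 by blast
  thus ?thesis using vb[OF i, of p] i by auto
  qed
  show "sp (W i)" for i by (simp add: sp_def)
  show "inj_on W {..<p}" by (simp add: inj_on_def)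
  show "OP La i (OP Lt i h) = OP Lt i (OP La i h)" for i h
  proof
  fix u
  have a: "OP La i g = g + XX (4 * i) g" for g by (rule ext) (simp add: La)
  have t: "OP Lt i g = TT (4 * i) g" for g by (rule ext) (simp add: Lt)
  have "XX (4 * i) (TT (4 * i) h) = TT (4 * i) (XX (4 * i) h)"
  proof -
   have e: "TT (4 * i) g = XX (4 * i) g + ((%u. om * YY (4 * i) g u) + (%u. (om + 1) * XX (4 * i) (YY (4 * i) g) u))" for g
    by (rule ext) (simp add: TT_def add.assoc)
   show ?thesis unfolding e linD[OF lin_XY(1)] XY_relations ..
  qed
  thus "OP La i (OP Lt i h) u = OP Lt i (OP La i h) u" unfolding a t plus_fun_apply TT_add by simp
  qed
  show "local_op i (detect (4 * i))" for i by (rule loc_det)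
  show "local_op i (evenproj (4 * i))" for i by (rule loc_even)
  show "detect (4 * i) (OP Lt i h) = 0" for i h
  proof -
  have "OP Lt i h = TT (4 * i) h" by (rule ext) (rule Lt)
  thus ?thesis by (simp only: detect_TT)
  qed
  show "detect (4 * i) F = F" if F: "!!u. F u ~= 0 ==> special i u" for i F
  proof
  fix u
  have z: "F (sb (4 * i) j a b c e u) = 0" if "\<not> (a & b & c & e)" for j a b c e
   using F[of "sb (4 * i) j a b c e u"] that unfolding spec allW_sb by blast
  show "detect (4 * i) F u = F u"
  proof (cases "allW (4 * i) u")
   case True
   then obtain j where j: "u (Suc (4 * i)) = W j" "u (Suc (Suc (4 * i))) = W j" "u (4 * i + 3) = W j" "u (4 * i + 4) = W j" unfolding allW_def by blast
   have "sb (4 * i) (col (4 * i) u) True True True True u = u" using j by (auto simp: sb_def col_def fun_eq_iff)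
   thus ?thesis using True by (simp add: detect_def atv_def z)
  next
   case False
   hence "F u = 0" using F[of u] unfolding spec by blast
   thus ?thesis using False by (simp add: detect_def)
  qed
  qed
  show "special i u" if "evenproj (4 * i) f u ~= 0" for i f u
  using that unfolding spec by (simp add: evenproj_def split: if_splits)
  show "on (words d (letters {..<m} {..<n})) (evenproj (4 * i) f)" if f: "on (words d (letters {..<m} {..<n})) f" for i f
  unfolding on_def
  proof (intro allI impI)
  fix u assume u: "u ~: words d (letters {..<m} {..<n})"
  show "evenproj (4 * i) f u = 0"
  proof (cases "allW (4 * i) u")
   case True
   then obtain j where j: "u (Suc (4 * i)) = W j" "u (Suc (Suc (4 * i))) = W j" "u (4 * i + 3) = W j" "u (4 * i + 4) = W j" unfolding allW_def by blast
   have "atv (4 * i) f u a b c e = 0" for a b c e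
   proof -
    have "colour o u = colour o sb (4 * i) (col (4 * i) u) a b c e u" using j by (auto simp: sb_def col_def fun_eq_iff)
    hence "sb (4 * i) (col (4 * i) u) a b c e u ~: words d (letters {..<m} {..<n})" using stable_colour[OF stable_words] u by blast
    thus ?thesis using f by (simp add: atv_def on_def)
   qed
   thus ?thesis by (simp add: evenproj_def)
  qed (simp add: evenproj_def)
  qed
  show "special i u" if f: "!!u. f u ~= 0 ==> special i u" and ij: "j ~= i" and nz: "evenproj (4 * j) f u ~= 0" for i j f u
  proof -
  have "EX a b c e. atv (4 * j) f u a b c e ~= 0"
  proof (rule ccontr)
   assume "\<not> (EX a b c e. atv (4 * j) f u a b c e ~= 0)"
   thus False using nz by (simp add: evenproj_def split: if_splits)
  qed
  then obtain a b c e where "f (sb (4 * j) (col (4 * j) u) a b c e u) ~= 0" unfolding atv_def by blast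
  hence s: "allW (4 * i) (sb (4 * j) (col (4 * j) u) a b c e u)" using f unfolding spec by blast
  have "sb (4 * j) (col (4 * j) u) a b c e u x = u x" if "x \<in> {4 * i + 1..4 * i + 4}" for x
   by (rule sb_out) (use block_disjoint[OF ij[symmetric] that] in auto)
  thus ?thesis using s unfolding spec allW_def by simp
  qed
  show "finite (W ` {..<n})" by simp
  show "card (W ` {..<n}) < p" using np by (simp add: card_image inj_on_def)
  show "u x \<in> W ` {..<n}" if "u \<in> words d (letters {..<m} {..<n})" "x \<in> {1..d}" "sp (u x)" for u x
  using that unfolding words_def letters_def sp_def by auto
  fix i and f :: "word => 'k" assume i: "i < p" and f: "on (words d (letters {..<m} {..<n})) f" "OP Lnu i f = 0"
  have id: "4 * i + 4 \<le> d" using i pd by simp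
  obtain h where h: "on (words d (letters {..<m} {..<n})) h" "ALL u. f u + XX (4 * i) f u = evenproj (4 * i) f u + TT (4 * i) h u"
  using block_homotopy[OF id stable_words f(1)] fun_cong[OF f(2)] unfolding Lnu zero_fun_apply by blast
  have "OP La i f = evenproj (4 * i) f + OP Lt i h" by (rule ext) (use h(2) in \<open>simp add: La Lt\<close>)
  thus "EX h. on (words d (letters {..<m} {..<n})) h & OP La i f = evenproj (4 * i) f + OP Lt i h" using h(1) by blast
 qed
qed

end

theorem proposition4p41:
  fixes m n d :: nat
  assumes "CHAR('k::alg_closed_field) = 2"
    and "d > 0"
  shows "relatively_discerning d (mn_obj m n :: 'k mat) \<longleftrightarrow>
    (d = 1 \<longrightarrow> m \<ge> 1 \<or> n \<ge> 1) \<and>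
    (d = 2 \<longrightarrow> m + n \<ge> 2 \<and> m \<ge> 1) \<and>
    (d = 3 \<longrightarrow> m \<ge> 3 \<or> (n \<ge> 1 \<and> m \<ge> 1)) \<and>
    (d \<ge> 4 \<longrightarrow> m \<ge> d div 2 \<and> n \<ge> d div 4)"
proof -
 have two: "(1::'k) + 1 = 0"
  using of_nat_CHAR[where 'a = 'k] unfolding assms(1) by simp
 interpret char2 "TYPE('k)" by standard (rule two)
 \<comment> \<open>A root of 1 + X + X^2, rewritten with signs dropped in characteristic 2.\<close>
 have "\<exists>om :: 'k. om * om = om + 1"
 proof -
  have "degree [:1, 1, 1 :: 'k:] > 0" by simp
  then obtain om :: 'k where om: "poly [:1, 1, 1:] om = 0" using alg_closed_imp_poly_has_root by blast
  hence "1 + (om + om * om) = 0" by (simp add: algebra_simps)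
  hence "(om + 1) + ((om + 1) + om * om) = om + 1" by (metis add.commute add.assoc add_0_right)
  hence "om * om = om + 1" by simp
  thus ?thesis by blast
 qed
 then obtain om :: 'k where om: "om * om = om + 1" by blast
 interpret cube_root "TYPE('k)" om by standard (rule om)
 have red: "relatively_discerning d (mn_obj m n :: 'k mat) \<longleftrightarrow>
  (ALL m' n'. dominated TYPE('k) d (words d (letters {..<m'} {..<n'})) (words d (letters {..<m} {..<n})))"
  by (rule relatively_discerning_iff_dominated)
 have e: "{..<0} = ({} :: nat set)" by simp
 show ?thesis
 proof
  assume h: "relatively_discerning d (mn_obj m n :: 'k mat)"
  have dom: "dominated TYPE('k) d (words d (letters {..<m'} {..<n'})) (words d (letters {..<m} {..<n}))" for m' n'
  using h red by blast
  \<comment> \<open>Tested on a sum of d div 2 unit objects.\<close>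
  have m: "d div 2 \<le> m"
  proof (rule ccontr)
  assume "\<not> d div 2 \<le> m"
  hence "m < d div 2" by simp
  from not_dominated_pairs[OF this, of d n] show False using dom[of "d div 2" 0] by (simp add: e)
  qed
  \<comment> \<open>Tested on d div 4 copies of P together with one unit object, which supplies the
    letter for the remaining positions.\<close>
  have n: "d div 4 \<le> n"
  proof (rule ccontr)
  assume "\<not> d div 4 \<le> n"
  hence "n < d div 4" by simp
  from not_dominated_quadruples[OF this, of d m] show False using dom[of 1 "d div 4"] by simp
  qed
  \<comment> \<open>Without copies of P the objects are trivial modules, and d units are tested.
    This sharpens the bound on m precisely where small d calls for it.\<close>
  have mn: "n = 0 ==> d \<le> m"
  proof (rule ccontr)
  assume n0: "n = 0" and "\<not> d \<le> m"
  hence "m < d" by simp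
  from not_dominated_ones[OF this] show False using dom[of d 0] n0 by (simp add: e)
  qed
  \<comment> \<open>For d at most 3 the claims follow by distinguishing n = 0, where m is at least
    d, from n > 0, where m is at least d div 2.\<close>
  show "(d = 1 --> m >= 1 \<or> n >= 1) & (d = 2 --> m + n >= 2 & m >= 1) &
  (d = 3 --> m >= 3 \<or> (n >= 1 & m >= 1)) & (d >= 4 --> m >= d div 2 & n >= d div 4)"
  proof (intro conjI impI)
  show "m >= 1 \<or> n >= 1" if "d = 1" using mn that by (cases "n = 0") auto
  show "m + n >= 2" if "d = 2" using mn m that by (cases "n = 0") auto
  show "m >= 1" if "d = 2" using m that by simp
  show "m >= 3 \<or> (n >= 1 & m >= 1)" if "d = 3" using mn m that by (cases "n = 0") auto
  show "m >= d div 2" "n >= d div 4" by (rule m, rule n)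
  qed
 next
  assume h: "(d = 1 --> m >= 1 \<or> n >= 1) & (d = 2 --> m + n >= 2 & m >= 1) &
  (d = 3 --> m >= 3 \<or> (n >= 1 & m >= 1)) & (d >= 4 --> m >= d div 2 & n >= d div 4)"
  have "dominated TYPE('k) d (words d (letters {..<m'} {..<n'})) (words d (letters {..<m} {..<n}))" for m' n'
  by (rule dominated_words[OF assms(2)]) (use h in blast)+
  thus "relatively_discerning d (mn_obj m n :: 'k mat)" using red by blast
 qed
qed

end
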